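(* Let $(X,\omega)$ be a compact Kähler manifold of complex dimension $n$, equipped with a Kähler metric $\omega$. Let $V\subset X$ be a (closed) complex submanifold of complex dimension $k>0$. Let $\varphi$ be a quasi-psh function on $V$, with arbitrary singularities, such that $\omega|_V+\sqrt{-1}\partial\bar\partial\varphi>\epsilon\,\omega|_V$ on $V$ for some $\epsilon>0$. Suppose that there are an open neighborhood $U$ of $V$ in $X$ and a holomorphic retraction $\pi:U\to V$. Then there is a quasi-psh function $\Phi$ on $X$ such that $\Phi|_V=\varphi$ and $\omega+\sqrt{-1}\partial\bar\partial\Phi>\epsilon'\omega$ on $X$ for some $\epsilon'>0$.
   Context: A quasi-plurisubharmonic (quasi-psh) function on a complex manifold is a function with values in $[-\infty,+\infty)$, not identically $-\infty$ (on any connected component), which is locally the sum of a plurisubharmonic function and a smooth function. The Kähler metric $\omega$ is identified with its associated Kähler form, and $\omega|_V$ is the restriction (pull-back) of this form to $V$. Inequalities between $(1,1)$-forms/currents are understood in the sense of positive currents: $T>\epsilon\omega$ (for some $\epsilon>0$) means that $T-\epsilon\omega$ is a positive $(1,1)$-current; since $\epsilon$ and $\epsilon'$ are only required to exist, strict and non-strict inequalities give equivalent statements. A holomorphic retraction $\pi:U\to V$ of an open neighborhood $U$ of $V$ in $X$ is a holomorphic map such that $\pi|_V:V\to V$ is the identity map. The equality $\Phi|_V=\varphi$ is pointwise equality on $V$. *)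

theory Defs
  imports "HOL-Analysis.Analysis"
begin

section \<open>Smooth and holomorphic maps between complex coordinate spaces\<close>

fun Ck_on :: "nat \<Rightarrow> ('a::real_normed_vector \<Rightarrow> 'b::real_normed_vector) \<Rightarrow> 'a set \<Rightarrow> bool" where
  "Ck_on 0 f S \<longleftrightarrow> continuous_on S f"
| "Ck_on (Suc m) f S \<longleftrightarrow>
     (\<forall>x\<in>S. f differentiable (at x)) \<and> (\<forall>v. Ck_on m (\<lambda>x. frechet_derivative f (at x) v) S)"

text \<open>Smoothness over the reals; only used for open \<open>S\<close>.\<close>

definition smooth_on :: "('a::real_normed_vector \<Rightarrow> 'b::real_normed_vector) \<Rightarrow> 'a set \<Rightarrow> bool" where
  "smooth_on f S \<longleftrightarrow> (\<forall>m. Ck_on m f S)"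

text \<open>Holomorphic maps of several variables: complex-linear total derivative at each point of the
  open set \<open>S\<close>.\<close>

definition holo_on :: "(complex^'n \<Rightarrow> complex^'m) \<Rightarrow> (complex^'n) set \<Rightarrow> bool" where
  "holo_on f S \<longleftrightarrow>
     (\<forall>x\<in>S. \<exists>D. (f has_derivative D) (at x) \<and> (\<forall>c v. D (c *s v) = c *s D v))"

text \<open>The Wirtinger derivatives \<open>\<partial>/\<partial>z\<^sub>j\<close> and \<open>\<partial>/\<partial>\<bar>z\<^sub>j\<close>.\<close>

definition wirtinger :: "'n \<Rightarrow> (complex^'n \<Rightarrow> complex) \<Rightarrow> complex^'n \<Rightarrow> complex" where
  "wirtinger j f z = (frechet_derivative f (at z) (axis j 1)
                       - \<i> * frechet_derivative f (at z) (axis j \<i>)) / 2"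

definition wirtinger_bar :: "'n \<Rightarrow> (complex^'n \<Rightarrow> complex) \<Rightarrow> complex^'n \<Rightarrow> complex" where
  "wirtinger_bar j f z = (frechet_derivative f (at z) (axis j 1)
                       + \<i> * frechet_derivative f (at z) (axis j \<i>)) / 2"


section \<open>Complex manifolds\<close>

text \<open>A chart is a pair of its domain and its coordinate map; the values of the coordinate map
  outside the domain are irrelevant.\<close>

type_synonym ('a, 'n) chart = "'a set \<times> ('a \<Rightarrow> complex^'n)"

abbreviation chart_image :: "('a, 'n::finite) chart \<Rightarrow> (complex^'n) set" where
  "chart_image c \<equiv> snd c ` fst c"

abbreviation chart_inv :: "('a, 'n::finite) chart \<Rightarrow> complex^'n \<Rightarrow> 'a" where
  "chart_inv c \<equiv> inv_into (fst c) (snd c)"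

definition is_chart :: "'a topology \<Rightarrow> ('a, 'n::finite) chart \<Rightarrow> bool" where
  "is_chart X c \<longleftrightarrow> openin X (fst c) \<and> open (chart_image c) \<and>
     homeomorphic_map (subtopology X (fst c)) (top_of_set (chart_image c)) (snd c)"

definition holo_transition :: "('a, 'n::finite) chart \<Rightarrow> ('a, 'n) chart \<Rightarrow> bool" where
  "holo_transition c d \<longleftrightarrow> holo_on (snd d \<circ> chart_inv c) (snd c ` (fst c \<inter> fst d))"

text \<open>\<open>(X, A)\<close> is a complex manifold of pure dimension \<open>CARD('n)\<close>, not necessarily connected.
  The holomorphic atlas \<open>A\<close> is not required to be maximal.\<close>

definition complex_manifold :: "'a topology \<Rightarrow> ('a, 'n::finite) chart set \<Rightarrow> bool" where
  "complex_manifold X A \<longleftrightarrow> Hausdorff_space X \<and> second_countable X \<and>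
     (\<forall>c\<in>A. is_chart X c) \<and> \<Union> (fst ` A) = topspace X \<and>
     (\<forall>c\<in>A. \<forall>d\<in>A. holo_transition c d)"

definition compatible_chart ::
  "'a topology \<Rightarrow> ('a, 'n::finite) chart set \<Rightarrow> ('a, 'n) chart \<Rightarrow> bool" where
  "compatible_chart X A c \<longleftrightarrow>
     is_chart X c \<and> (\<forall>d\<in>A. holo_transition c d \<and> holo_transition d c)"

definition holomorphic_map ::
  "'a topology \<Rightarrow> ('a, 'n::finite) chart set \<Rightarrow> 'b topology \<Rightarrow> ('b, 'm::finite) chart set
     \<Rightarrow> ('a \<Rightarrow> 'b) \<Rightarrow> bool" where
  "holomorphic_map X A Y B f \<longleftrightarrow> continuous_map X Y f \<and>
     (\<forall>c\<in>A. \<forall>d\<in>B. holo_on (snd d \<circ> f \<circ> chart_inv c) (snd c ` {x \<in> fst c. f x \<in> fst d}))"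

definition open_atlas :: "('a, 'n::finite) chart set \<Rightarrow> 'a set \<Rightarrow> ('a, 'n) chart set" where
  "open_atlas A U = (\<lambda>c. (fst c \<inter> U, snd c)) ` A"

text \<open>A chart \<open>c\<close> of \<open>X\<close> is adapted to \<open>V\<close> if it is compatible with the complex structure of \<open>X\<close>
  and \<open>V\<close> is given in it by the vanishing of the coordinates outside the range of the
  injection \<open>\<iota>\<close>; the remaining coordinates then give a chart of \<open>V\<close>.\<close>

definition adapted_chart ::
  "'a topology \<Rightarrow> ('a, 'n::finite) chart set \<Rightarrow> 'a set \<Rightarrow> ('k::finite \<Rightarrow> 'n) \<Rightarrow> ('a, 'n) chart
     \<Rightarrow> bool" where
  "adapted_chart X A V \<iota> c \<longleftrightarrow> inj \<iota> \<and> compatible_chart X A c \<and>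
     snd c ` (fst c \<inter> V) = {z \<in> chart_image c. \<forall>i. i \<notin> range \<iota> \<longrightarrow> z $ i = 0}"

definition submanifold_atlas ::
  "'a topology \<Rightarrow> ('a, 'n::finite) chart set \<Rightarrow> 'a set \<Rightarrow> ('a, 'k::finite) chart set" where
  "submanifold_atlas X A V =
     {(fst c \<inter> V, \<lambda>x. \<chi> j. snd c x $ \<iota> j) | c \<iota>. adapted_chart X A V \<iota> c}"

text \<open>Closed complex submanifolds of dimension \<open>CARD('k)\<close>.\<close>

definition closed_submanifold ::
  "'k::finite itself \<Rightarrow> 'a topology \<Rightarrow> ('a, 'n::finite) chart set \<Rightarrow> 'a set \<Rightarrow> bool" where
  "closed_submanifold _ X A V \<longleftrightarrow> closedin X V \<and>
     (\<forall>p\<in>V. \<exists>(\<iota> :: 'k \<Rightarrow> 'n) c. adapted_chart X A V \<iota> c \<and> p \<in> fst c)"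

definition holomorphic_retraction ::
  "'k::finite itself \<Rightarrow> 'a topology \<Rightarrow> ('a, 'n::finite) chart set \<Rightarrow> 'a set \<Rightarrow> 'a set
     \<Rightarrow> ('a \<Rightarrow> 'a) \<Rightarrow> bool" where
  "holomorphic_retraction _ X A U V \<pi> \<longleftrightarrow>
     holomorphic_map (subtopology X U) (open_atlas A U) (subtopology X V)
       (submanifold_atlas X A V :: ('a, 'k) chart set) \<pi> \<and>
     (\<forall>x\<in>V. \<pi> x = x)"


section \<open>Forms of bidegree (1,1) and Kaehler metrics\<close>

text \<open>A (1,1)-form is given by its coefficient matrix \<open>g\<^sub>j\<^sub>k\<close> in each chart of the atlas, the form
  being \<open>\<i> \<Sum> g\<^sub>j\<^sub>k dz\<^sub>j \<and> d\<bar>z\<^sub>k\<close>. The charts are tied together by the transformation law.\<close>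

type_synonym ('a, 'n) form11 = "('a, 'n) chart \<Rightarrow> 'a \<Rightarrow> complex^'n^'n"

definition jacobian ::
  "('b, 'm::finite) chart \<Rightarrow> ('b \<Rightarrow> 'a) \<Rightarrow> ('a, 'n::finite) chart \<Rightarrow> 'b \<Rightarrow> complex^'m^'n" where
  "jacobian c f d p =
     (\<chi> l j. frechet_derivative (snd d \<circ> f \<circ> chart_inv c) (at (snd c p)) (axis j 1) $ l)"

definition pullback_matrix :: "complex^'m^'n \<Rightarrow> complex^'n^'n \<Rightarrow> complex^'m^'m" where
  "pullback_matrix J g = (\<chi> j k. \<Sum>l\<in>UNIV. \<Sum>m\<in>UNIV. J $ l $ j * g $ l $ m * cnj (J $ m $ k))"

definition smooth_form11 :: "('a, 'n::finite) chart set \<Rightarrow> ('a, 'n) form11 \<Rightarrow> bool" where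
  "smooth_form11 A \<omega> \<longleftrightarrow>
     (\<forall>c\<in>A. \<forall>d\<in>A. \<forall>p\<in>fst c \<inter> fst d.
        \<omega> c p = pullback_matrix (jacobian c (\<lambda>x. x) d p) (\<omega> d p)) \<and>
     (\<forall>c\<in>A. \<forall>j k. smooth_on (\<lambda>z. \<omega> c (chart_inv c z) $ j $ k) (chart_image c))"

text \<open>Pull-back under a holomorphic map into the manifold with atlas \<open>A\<close>. By the transformation law
  the result does not depend on the chart chosen around \<open>f p\<close>.\<close>

definition pullback_form ::
  "('a, 'n::finite) chart set \<Rightarrow> ('b \<Rightarrow> 'a) \<Rightarrow> ('a, 'n) form11 \<Rightarrow> ('b, 'm::finite) form11" where
  "pullback_form A f \<omega> = (\<lambda>c p.
     let d = (SOME d. d \<in> A \<and> f p \<in> fst d) in pullback_matrix (jacobian c f d p) (\<omega> d (f p)))"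

text \<open>The value of \<open>\<i> \<Sum> g\<^sub>j\<^sub>k dz\<^sub>j \<and> d\<bar>z\<^sub>k\<close> on a pair of tangent vectors.\<close>

definition form_value :: "complex^'n^'n \<Rightarrow> complex^'n \<Rightarrow> complex^'n \<Rightarrow> complex" where
  "form_value g u v =
     \<i> * (\<Sum>j\<in>UNIV. \<Sum>k\<in>UNIV. g $ j $ k * (u $ j * cnj (v $ k) - v $ j * cnj (u $ k)))"

text \<open>\<open>d\<omega> = 0\<close>: the exterior derivative of a 2-form, evaluated on constant vector fields
  \<open>u, v, w\<close> in a chart.\<close>

definition closed_form11 :: "('a, 'n::finite) chart set \<Rightarrow> ('a, 'n) form11 \<Rightarrow> bool" where
  "closed_form11 A \<omega> \<longleftrightarrow>
     (\<forall>c\<in>A. \<forall>z\<in>chart_image c. \<forall>u v w.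
        frechet_derivative (\<lambda>y. form_value (\<omega> c (chart_inv c y)) v w) (at z) u
      + frechet_derivative (\<lambda>y. form_value (\<omega> c (chart_inv c y)) w u) (at z) v
      + frechet_derivative (\<lambda>y. form_value (\<omega> c (chart_inv c y)) u v) (at z) w = 0)"

definition hermitian_posdef :: "complex^'n^'n \<Rightarrow> bool" where
  "hermitian_posdef g \<longleftrightarrow> (\<forall>j k. g $ k $ j = cnj (g $ j $ k)) \<and>
     (\<forall>v. v \<noteq> 0 \<longrightarrow> Re (\<Sum>j\<in>UNIV. \<Sum>k\<in>UNIV. g $ j $ k * v $ j * cnj (v $ k)) > 0)"

definition kaehler_form :: "('a, 'n::finite) chart set \<Rightarrow> ('a, 'n) form11 \<Rightarrow> bool" where
  "kaehler_form A \<omega> \<longleftrightarrow> smooth_form11 A \<omega> \<and> closed_form11 A \<omega> \<and>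
     (\<forall>c\<in>A. \<forall>p\<in>fst c. hermitian_posdef (\<omega> c p))"

definition compact_kaehler_manifold ::
  "'a topology \<Rightarrow> ('a, 'n::finite) chart set \<Rightarrow> ('a, 'n) form11 \<Rightarrow> bool" where
  "compact_kaehler_manifold X A \<omega> \<longleftrightarrow>
     complex_manifold X A \<and> compact_space X \<and> kaehler_form A \<omega>"


section \<open>Plurisubharmonic and quasi-plurisubharmonic functions\<close>

text \<open>The mean of \<open>u\<close> over the circle \<open>a + e\<^sup>i\<^sup>\<theta> w\<close>, as integral of the positive part minus integral
  of the negative part (\<open>e2ennreal\<close> truncates at 0). For upper semicontinuous \<open>u < \<infinity>\<close> the first
  integral is finite, so the difference is the Lebesgue integral with values in \<open>[-\<infinity>, \<infinity>)\<close>.\<close>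

definition circle_mean ::
  "(complex^'n \<Rightarrow> ereal) \<Rightarrow> complex^'n \<Rightarrow> complex^'n \<Rightarrow> ereal" where
  "circle_mean u a w =
     (enn2ereal (\<integral>\<^sup>+\<theta>. e2ennreal (u (a + cis \<theta> *s w)) * indicator {0..2*pi} \<theta> \<partial>lborel)
    - enn2ereal (\<integral>\<^sup>+\<theta>. e2ennreal (- u (a + cis \<theta> *s w)) * indicator {0..2*pi} \<theta> \<partial>lborel))
      / ereal (2 * pi)"

text \<open>Upper semicontinuity together with the sub-mean-value property on all closed discs contained
  in complex lines; the constant \<open>-\<infinity>\<close> is allowed.\<close>

definition psh_coord :: "(complex^'n::finite) set \<Rightarrow> (complex^'n \<Rightarrow> ereal) \<Rightarrow> bool" where
  "psh_coord S u \<longleftrightarrow> (\<forall>z\<in>S. u z < \<infinity>) \<and>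
     (\<forall>t. openin (top_of_set S) {z \<in> S. u z < t}) \<and>
     (\<forall>a w. {a + \<zeta> *s w | \<zeta>. cmod \<zeta> \<le> 1} \<subseteq> S \<longrightarrow> u a \<le> circle_mean u a w)"

definition psh_on :: "('a, 'n::finite) chart set \<Rightarrow> 'a set \<Rightarrow> ('a \<Rightarrow> ereal) \<Rightarrow> bool" where
  "psh_on A W u \<longleftrightarrow> (\<forall>c\<in>A. psh_coord (snd c ` (fst c \<inter> W)) (u \<circ> chart_inv c))"

definition smooth_function_on :: "('a, 'n::finite) chart set \<Rightarrow> 'a set \<Rightarrow> ('a \<Rightarrow> real) \<Rightarrow> bool" where
  "smooth_function_on A W f \<longleftrightarrow> (\<forall>c\<in>A. smooth_on (f \<circ> chart_inv c) (snd c ` (fst c \<inter> W)))"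

definition quasi_psh ::
  "'a topology \<Rightarrow> ('a, 'n::finite) chart set \<Rightarrow> ('a \<Rightarrow> ereal) \<Rightarrow> bool" where
  "quasi_psh X A \<phi> \<longleftrightarrow>
     (\<forall>x\<in>topspace X. \<phi> x < \<infinity>) \<and>
     (\<forall>C\<in>connected_components_of X. \<exists>x\<in>C. \<phi> x \<noteq> -\<infinity>) \<and>
     (\<forall>p\<in>topspace X. \<exists>W u f. openin X W \<and> p \<in> W \<and> psh_on A W u \<and> smooth_function_on A W f \<and>
        (\<forall>x\<in>W. \<phi> x = u x + ereal (f x)))"


section \<open>Currents of bidegree (1,1)\<close>

definition test_function :: "(complex^'n::finite) set \<Rightarrow> (complex^'n \<Rightarrow> complex) \<Rightarrow> bool" where
  "test_function S h \<longleftrightarrow> smooth_on h UNIV \<and> (\<exists>K. compact K \<and> K \<subseteq> S \<and> (\<forall>z. z \<notin> K \<longrightarrow> h z = 0))"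

text \<open>In each chart a (1,1)-current is \<open>\<i> \<Sum> T\<^sub>j\<^sub>k dz\<^sub>j \<and> d\<bar>z\<^sub>k\<close> with distributions \<open>T\<^sub>j\<^sub>k\<close> as coefficients,
  that is, \<open>T c j k h\<close> is the value of \<open>T\<^sub>j\<^sub>k\<close> at the test function \<open>h\<close>.\<close>

type_synonym ('a, 'n) current11 =
  "('a, 'n) chart \<Rightarrow> 'n \<Rightarrow> 'n \<Rightarrow> (complex^'n \<Rightarrow> complex) \<Rightarrow> complex"

definition current_of_form :: "('a, 'n::finite) form11 \<Rightarrow> ('a, 'n) current11" where
  "current_of_form \<omega> = (\<lambda>c j k h.
     (LINT z:chart_image c|lborel. \<omega> c (chart_inv c z) $ j $ k * h z))"

text \<open>\<open>\<i>\<partial>\<bar>\<partial>\<phi>\<close> in the sense of distributions. A quasi-psh function is locally integrable, so its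
  \<open>-\<infinity>\<close>-set (which \<open>real_of_ereal\<close> sends to 0) has measure zero.\<close>

definition i_ddbar :: "('a \<Rightarrow> ereal) \<Rightarrow> ('a, 'n::finite) current11" where
  "i_ddbar \<phi> = (\<lambda>c j k h.
     (LINT z:chart_image c|lborel.
        of_real (real_of_ereal (\<phi> (chart_inv c z))) * wirtinger j (wirtinger_bar k h) z))"

definition current_add ::
  "('a, 'n) current11 \<Rightarrow> ('a, 'n) current11 \<Rightarrow> ('a, 'n) current11" where
  "current_add S T = (\<lambda>c j k h. S c j k h + T c j k h)"

definition current_scale :: "real \<Rightarrow> ('a, 'n) current11 \<Rightarrow> ('a, 'n) current11" where
  "current_scale r T = (\<lambda>c j k h. of_real r * T c j k h)"

text \<open>Positivity of a (1,1)-current: for each constant vector \<open>\<xi>\<close> the distribution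
  \<open>\<Sum> T\<^sub>j\<^sub>k \<xi>\<^sub>j \<bar>\<xi>\<^sub>k\<close> is nonnegative. This is \<open>T \<and> \<i>\<alpha>\<^sub>1 \<and> \<bar>\<alpha>\<^sub>1 \<and> \<dots> \<and> \<i>\<alpha>\<^sub>m \<and> \<bar>\<alpha>\<^sub>m \<ge> 0\<close>, with \<open>m = n - 1\<close>, for
  constant (1,0)-forms \<open>\<alpha>\<^sub>i\<close> in the chart: if they are linearly independent, \<open>\<xi>\<close> spans their common
  kernel.\<close>

definition positive_current :: "('a, 'n::finite) chart set \<Rightarrow> ('a, 'n) current11 \<Rightarrow> bool" where
  "positive_current A T \<longleftrightarrow>
     (\<forall>c\<in>A. \<forall>h. test_function (chart_image c) h \<and> (\<forall>z. h z \<in> \<real>\<^sub>\<ge>\<^sub>0) \<longrightarrow>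
        (\<forall>\<xi> :: complex^'n. (\<Sum>j\<in>UNIV. \<Sum>k\<in>UNIV. T c j k h * \<xi> $ j * cnj (\<xi> $ k)) \<in> \<real>\<^sub>\<ge>\<^sub>0))"

definition current_ge ::
  "('a, 'n::finite) chart set \<Rightarrow> ('a, 'n) current11 \<Rightarrow> ('a, 'n) current11 \<Rightarrow> bool" where
  "current_ge A T S \<longleftrightarrow> positive_current A (current_add T (current_scale (-1) S))"

end

theory Submission
  imports Defs "HOL-Complex_Analysis.Cauchy_Integral_Formula"
begin

text \<open>
Put \<open>t < 1\<close> slightly larger than \<open>s > 1 - \<epsilon>\<close>. Cover \<open>X\<close> by finitely many coordinate balls \<open>W\<^sub>g\<close>, on which \<open>E\<^sub>g\<close> is the squared
norm of the normal coordinates of \<open>V\<close> (near points of \<open>V\<close>) or the constant 1 (away from \<open>V\<close>), multiplied by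
\<open>exp (- m\<^sub>g |z - z\<^sub>g|\<^sup>2)\<close>. The weight makes the pieces that are about to leave their ball smaller than the maximum, so
\<open>E = max E\<^sub>g\<close> is continuous with zero set \<open>V\<close>. Each \<open>ln E\<^sub>g\<close> is quasi-psh with bounded negative part of its
Levi form, whence \<open>t \<omega> + \<i>\<partial>\<partial>\<bar>(\<delta> ln E) \<ge> 0\<close> for small \<open>\<delta>\<close>. Near \<open>V\<close> the function \<open>\<phi> \<circ> \<pi> + C E\<close> satisfies the same
inequality for large \<open>C\<close>: the pull-back of \<open>\<omega>\<close> by \<open>\<pi>\<close> differs from \<open>\<omega>\<close> at \<open>V\<close> only in directions in which \<open>C E\<^sub>g\<close> is as
convex as one likes. For a suitable constant \<open>B\<close> the function \<open>\<Phi> = max (\<phi> \<circ> \<pi> + C E) (\<delta> ln E + B)\<close> near \<open>V\<close>,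
\<open>\<Phi> = \<delta> ln E + B\<close> elsewhere, solves the problem, since \<open>\<delta> ln E = -\<infinity>\<close> on \<open>V\<close>.

The maximum of two functions is handled by the pointwise form of the inequalities: \<open>v\<close> plus any
sufficiently positive quadratic form is plurisubharmonic near the point. Currents are translated to and from this form
by convolution with rotation invariant bumps.
\<close>

section \<open>Circle means in one variable\<close>

text \<open>The obstacle is that \<phi> has arbitrary singularities: \<phi> composed with \<pi> is
  unbounded below and lives only near \<open>V\<close>, so it cannot be cut off. The maximum leaves
  \<phi> untouched on \<open>V\<close> because the logarithm is -\<infinity> there. The constants
  are fixed in the order \<delta>, \<open>C\<close>, \<open>e1\<close>, \<open>B\<close>; the last
  one makes the logarithm win before the first branch stops being defined. \<open>E\<close> is not
  smooth, but r \<mapsto> max (\<phi> (\<pi> x) + C r) (\<delta> ln r + B) is increasing, so near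
  each point \<Phi> is a finite maximum of expressions that involve a single piece each. The levels
  1 - \<epsilon> < s < t < 1 leave room for freezing the coefficients of \<omega> on
  \<open>V\<close>, for the penalty term \<open>C E\<close>, and for the final \<epsilon>' = 1 - t.
  Comparison with constant quadratic forms replaces local potentials of \<omega>. The analytic core
  is one form of Jensen's formula on discs, for functions given with a complex gradient and the
  antilinear part of its derivative; singular functions enter through nonnegative integrals
  only.\<close>

lemma has_vector_derivative_cis: "((\<lambda>t. cis t) has_vector_derivative (\<i> * cis t)) (at t within S)"
proof -
 have "((\<lambda>t. Complex (cos t) (sin t)) has_vector_derivative Complex (- sin t) (cos t)) (at t within S)"
  unfolding has_vector_derivative_complex_iff by (auto intro!: derivative_eq_intros)
 moreover have "Complex (- sin t) (cos t) = \<i> * cis t" by (simp add: complex_eq_iff)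
 ultimately show ?thesis by (simp add: cis.ctr)
qed

lemma integral_periodic_derivative:
 fixes f :: "real \<Rightarrow> 'b::banach"
 assumes "\<And>t. (f has_vector_derivative f' t) (at t within {0..2*pi})" "f (2*pi) = f 0"
 shows "(f' has_integral 0) {0..2*pi}"
 using fundamental_theorem_of_calculus[of 0 "2*pi" f f'] assms by (auto simp: pi_ge_zero)

lemma mono_from_vector_derivative:
 fixes f f' :: "real \<Rightarrow> real"
 assumes "0 < R" and d: "\<And>r. r \<in> {0..R} \<Longrightarrow> (f has_vector_derivative f' r) (at r within {0..R})"
  and nn: "\<And>r. 0 < r \<Longrightarrow> r < R \<Longrightarrow> f' r \<ge> 0" and "a \<in> {0..R}"
 shows "f 0 \<le> f a"
proof (cases "a = 0")
 case False
 have "\<exists>x\<in>{0<..<a}. f a - f 0 = (\<lambda>x h. h * f' x) x (a - 0)"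
 proof (rule mvt_simple)
  show "0 < a" using False assms by auto
  fix x assume "0 \<le> x" "x \<le> a"
  then show "(f has_derivative (\<lambda>h. h * f' x)) (at x within {0..a})"
   using d[of x] assms(4) unfolding has_vector_derivative_def
   by (auto intro: has_derivative_subset[where s="{0..R}"])
 qed
 then obtain x where x: "0 < x" "x < a" "f a - f 0 = a * f' x" by auto
 have "0 \<le> f' x" using nn[of x] x assms(4) by auto
 then show ?thesis using x by (smt (verit) mult_nonneg_nonneg)
qed simp

text \<open>Green's formula in polar coordinates; \<open>p\<close> is the complex gradient of
  \<open>g\<close> and \<open>L\<close> a quarter of its Laplacian. Let m(r) and N(r) be the circle
  integrals of \<open>g\<close> and \<open>L\<close>, and q(r) that of p(z) z. Then m' = (2/r) Re q
  and q' = 2 r N, and two integrations of the lower bound for Re N give the first claim. As 2 Re (i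
  p z) is the derivative of \<open>g\<close> along the circle, Im q vanishes, hence also Im N; this
  contradicts c > 0 in the second claim, which is the substitute for the symmetry of second
  derivatives.\<close>

lemma disc_mean_aux:
 fixes g :: "complex \<Rightarrow> real" and p A L :: "complex \<Rightarrow> complex"
 assumes R: "R > 0"
  and dg: "\<And>s. s \<in> cball 0 R \<Longrightarrow> (g has_derivative (\<lambda>h. 2 * Re (p s * h))) (at s)"
  and dp: "\<And>s. s \<in> cball 0 R \<Longrightarrow> (p has_derivative (\<lambda>h. A s * h + L s * cnj h)) (at s)"
  and cA: "continuous_on (cball 0 R) A" and cL: "continuous_on (cball 0 R) L"
 shows "(\<forall>s\<in>cball 0 R. c \<le> Re (L s)) \<Longrightarrow>
   2*pi*(g 0 + c*R^2) \<le> integral {0..2*pi} (\<lambda>t. g (of_real R * cis t))"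
  and "(\<forall>s\<in>cball 0 R. c \<le> Im (L s)) \<Longrightarrow> c \<le> 0"
proof -
 let ?z = "\<lambda>r t. of_real r * cis t :: complex"
 have zin: "?z r t \<in> cball 0 R" if "r \<in> {0..R}" for r t using that by (auto simp: norm_mult)
 have cp: "continuous_on (cball 0 R) p"
  using dp by (meson continuous_at_imp_continuous_on has_derivative_continuous)
 have cg: "continuous_on (cball 0 R) g"
  using dg by (meson continuous_at_imp_continuous_on has_derivative_continuous)
 have czz: "continuous_on ({0..R} \<times> {0..2*pi}) (\<lambda>(r,t). ?z r t)"
  by (auto simp: case_prod_unfold intro!: continuous_intros)
 have cc: "continuous_on ({0..R} \<times> {0..2*pi}) (\<lambda>(r,t). f (?z r t))"
  if "continuous_on (cball 0 R) f" for f :: "complex \<Rightarrow> 'b::topological_space"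
  using continuous_on_compose2[OF that czz] zin by (force simp: case_prod_unfold)
 have c1: "continuous_on {0..2*pi} (\<lambda>t. f (?z r t))"
  if "continuous_on (cball 0 R) f" "r \<in> {0..R}" for f :: "complex \<Rightarrow> 'b::topological_space" and r
  by (rule continuous_on_compose2[OF that(1)]) (use zin that(2) in \<open>auto intro!: continuous_intros\<close>)
 have dzr: "((\<lambda>r. ?z r t) has_vector_derivative cis t) (at r within T)" for r t T
  by (auto intro!: derivative_eq_intros simp: has_vector_derivative_def scaleR_conv_of_real)
 have dzt: "((\<lambda>t. ?z r t) has_vector_derivative \<i> * ?z r t) (at t within T)" for r t T
  using has_vector_derivative_mult_right[OF has_vector_derivative_cis, of "of_real r" t T]
  by (simp add: mult.left_commute)
 have dgr: "((\<lambda>r. g (?z r t)) has_vector_derivative 2 * Re (p (?z r t) * cis t)) (at r within {0..R})"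
  if "r \<in> {0..R}" for r t
  using vector_derivative_diff_chain_within[OF dzr has_derivative_at_withinI[OF dg[OF zin[OF that]]]]
  by (simp add: o_def)
 have dgt: "((\<lambda>t. g (?z r t)) has_vector_derivative 2 * Re (p (?z r t) * (\<i> * ?z r t))) (at t within T)"
  if "r \<in> {0..R}" for r t T
  using vector_derivative_diff_chain_within[OF dzt has_derivative_at_withinI[OF dg[OF zin[OF that]]]]
  by (simp add: o_def)
 have dpr: "((\<lambda>r. p (?z r t)) has_vector_derivative A (?z r t) * cis t + L (?z r t) * cnj (cis t)) (at r within {0..R})"
  if "r \<in> {0..R}" for r t
  using vector_derivative_diff_chain_within[OF dzr has_derivative_at_withinI[OF dp[OF zin[OF that]]]]
  by (simp add: o_def)
 have dpt: "((\<lambda>t. p (?z r t)) has_vector_derivative A (?z r t) * (\<i> * ?z r t) + L (?z r t) * cnj (\<i> * ?z r t)) (at t within T)"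
  if "r \<in> {0..R}" for r t T
  using vector_derivative_diff_chain_within[OF dzt has_derivative_at_withinI[OF dp[OF zin[OF that]]]]
  by (simp add: o_def)
 define m where "m = (\<lambda>r. integral {0..2*pi} (\<lambda>t. g (?z r t)))"
 define q where "q = (\<lambda>r. integral {0..2*pi} (\<lambda>t. p (?z r t) * ?z r t))"
 define N where "N = (\<lambda>r. integral {0..2*pi} (\<lambda>t. L (?z r t)))"
 have m': "(m has_vector_derivative integral {0..2*pi} (\<lambda>t. 2 * Re (p (?z r t) * cis t))) (at r within {0..R})"
  if "r \<in> {0..R}" for r
 proof -
  have "continuous_on ({0..R} \<times> {0..2*pi}) (\<lambda>(r,t). 2 * Re (p (?z r t) * cis t))"
   using cc[OF cp] by (auto simp: case_prod_unfold intro!: continuous_intros)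
  then show ?thesis unfolding m_def
   using leibniz_rule_vector_derivative[of "{0..R}" 0 "2*pi" "\<lambda>r t. g (?z r t)" "\<lambda>r t. 2 * Re (p (?z r t) * cis t)" r]
    dgr that integrable_continuous_interval[OF c1[OF cg]] by auto
 qed
 \<comment> \<open>Integrating the derivative of p(z) cis t over a full turn trades the term with
   \<open>A\<close>, about which nothing is known, for the one with \<open>L\<close>.\<close>
 have rot0: "((\<lambda>t. \<i> * (p (?z r t) * cis t + A (?z r t) * of_real r * (cis t)^2 - of_real r * L (?z r t))) has_integral 0) {0..2*pi}"
  if r: "r \<in> {0..R}" for r
 proof (rule integral_periodic_derivative[where f="\<lambda>t. p (?z r t) * cis t"])
  fix t
  have e: "cis t * cnj (cis t) = 1" by (simp add: cis_cnj cis_mult)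
  have "((\<lambda>t. p (?z r t) * cis t) has_vector_derivative p (?z r t) * (\<i> * cis t) + (A (?z r t) * (\<i> * ?z r t) + L (?z r t) * cnj (\<i> * ?z r t)) * cis t) (at t within {0..2*pi})"
   by (rule has_vector_derivative_mult[OF dpt[OF r] has_vector_derivative_cis])
  moreover have "L (?z r t) * cnj (\<i> * ?z r t) * cis t = - \<i> * of_real r * L (?z r t) * (cis t * cnj (cis t))"
   by (simp add: algebra_simps)
  then have "p (?z r t) * (\<i> * cis t) + (A (?z r t) * (\<i> * ?z r t) + L (?z r t) * cnj (\<i> * ?z r t)) * cis t
   = \<i> * (p (?z r t) * cis t + A (?z r t) * of_real r * (cis t)^2 - of_real r * L (?z r t))"
   unfolding e distrib_right by (simp add: algebra_simps power2_eq_square)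
  ultimately show "((\<lambda>t. p (?z r t) * cis t) has_vector_derivative \<i> * (p (?z r t) * cis t + A (?z r t) * of_real r * (cis t)^2 - of_real r * L (?z r t))) (at t within {0..2*pi})"
   by (rule has_vector_derivative_eq_rhs)
 qed simp
 have q': "(q has_vector_derivative 2 * of_real r * N r) (at r within {0..R})" if r: "r \<in> {0..R}" for r
 proof -
  let ?fx = "\<lambda>r t. p (?z r t) * cis t + A (?z r t) * of_real r * (cis t)^2 + of_real r * L (?z r t)"
  have d: "((\<lambda>r. p (?z r t) * ?z r t) has_vector_derivative ?fx r t) (at r within {0..R})" if "r \<in> {0..R}" for r t
  proof -
   have e: "cis t * cnj (cis t) = 1" by (simp add: cis_cnj cis_mult)
   have "((\<lambda>r. p (?z r t) * ?z r t) has_vector_derivative p (?z r t) * cis t + (A (?z r t) * cis t + L (?z r t) * cnj (cis t)) * ?z r t) (at r within {0..R})"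
    by (rule has_vector_derivative_mult[OF dpr[OF that] dzr])
   moreover have "L (?z r t) * cnj (cis t) * ?z r t = of_real r * L (?z r t) * (cis t * cnj (cis t))"
    by (simp add: algebra_simps)
   then have "p (?z r t) * cis t + (A (?z r t) * cis t + L (?z r t) * cnj (cis t)) * ?z r t = ?fx r t"
    unfolding e distrib_right by (simp add: algebra_simps power2_eq_square)
   ultimately show ?thesis by (rule has_vector_derivative_eq_rhs)
  qed
  have "continuous_on ({0..R} \<times> {0..2*pi}) (\<lambda>(r,t). ?fx r t)"
   using cc[OF cp] cc[OF cA] cc[OF cL] by (auto simp: case_prod_unfold intro!: continuous_intros)
  moreover have "(\<lambda>t. p (?z r t) * ?z r t) integrable_on {0..2*pi}" if "r \<in> {0..R}" for r
   by (intro integrable_continuous_interval continuous_intros c1[OF cp that])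
  ultimately have "(q has_vector_derivative integral {0..2*pi} (?fx r)) (at r within {0..R})" unfolding q_def
   using leibniz_rule_vector_derivative[of "{0..R}" 0 "2*pi" "\<lambda>r t. p (?z r t) * ?z r t" ?fx r] d r by auto
  moreover have "integral {0..2*pi} (?fx r) = 2 * of_real r * N r"
  proof -
   have "((\<lambda>t. of_real r * L (?z r t)) has_integral of_real r * N r) {0..2*pi}" unfolding N_def
    by (intro has_integral_mult_right integrable_integral integrable_continuous_interval c1[OF cL r])
   from has_integral_add[OF has_integral_mult_right[OF rot0[OF r], of "-\<i>"] has_integral_mult_right[OF this, of 2]]
   have "(?fx r has_integral 2 * of_real r * N r) {0..2*pi}" by (simp add: algebra_simps)
   then show ?thesis by (rule integral_unique)
  qed
  ultimately show ?thesis by simp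
 qed
 have q0: "q 0 = 0" by (simp add: q_def)
 have iL: "(\<lambda>t. L (?z r t)) integrable_on {0..2*pi}" if "r \<in> {0..R}" for r
  by (intro integrable_continuous_interval c1[OF cL that])
 { assume c: "\<forall>s\<in>cball 0 R. c \<le> Re (L s)"
  have ReL: "Re (N r) \<ge> 2*pi*c" if r: "r \<in> {0..R}" for r
  proof -
   have "((\<lambda>t. Re (L (?z r t))) has_integral Re (N r)) {0..2*pi}"
    unfolding N_def by (intro has_integral_Re integrable_integral iL r)
   from has_integral_le[OF has_integral_const_real this, of c] c zin[OF r] show ?thesis by (simp add: pi_ge_zero mult.commute)
  qed
  have Req: "Re (q r) \<ge> 2*pi*c*r^2" if "r \<in> {0..R}" for r
  proof -
   have "(\<lambda>r. Re (q r) - 2*pi*c*r^2) 0 \<le> (\<lambda>r. Re (q r) - 2*pi*c*r^2) r"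
   proof (rule mono_from_vector_derivative[OF R _ _ that])
    fix r assume "r \<in> {0..R}"
    from q'[OF this] have "((\<lambda>r. Re (q r)) has_vector_derivative Re (2 * of_real r * N r)) (at r within {0..R})"
     unfolding has_vector_derivative_complex_iff by (simp add: has_real_derivative_iff_has_vector_derivative)
    moreover have "((\<lambda>r. 2*pi*c*r^2) has_real_derivative 2*pi*c*(2*r)) (at r within {0..R})"
     by (auto intro!: derivative_eq_intros)
    ultimately show "((\<lambda>r. Re (q r) - 2*pi*c*r^2) has_vector_derivative Re (2 * of_real r * N r) - 2*pi*c*(2*r)) (at r within {0..R})"
     unfolding has_real_derivative_iff_has_vector_derivative[symmetric] by (rule DERIV_diff)
   next
    fix r assume "0 < r" "r < R"
    then have "0 \<le> 2 * r * (Re (N r) - 2*pi*c)" using ReL[of r] by auto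
    then show "0 \<le> Re (2 * of_real r * N r) - 2*pi*c*(2*r)" by (simp add: algebra_simps)
   qed
   then show ?thesis by (simp add: q0)
  qed
  have "(\<lambda>r. m r - 2*pi*c*r^2) 0 \<le> (\<lambda>r. m r - 2*pi*c*r^2) R"
  proof (rule mono_from_vector_derivative[OF R])
   fix r assume "r \<in> {0..R}"
   from m'[OF this] show "((\<lambda>r. m r - 2*pi*c*r^2) has_vector_derivative integral {0..2*pi} (\<lambda>t. 2 * Re (p (?z r t) * cis t)) - 2*pi*c*(2*r)) (at r within {0..R})"
    unfolding has_real_derivative_iff_has_vector_derivative[symmetric] by (auto intro!: derivative_eq_intros)
  next
   fix r assume r: "0 < r" "r < R"
   have i: "((\<lambda>t. p (?z r t) * ?z r t) has_integral q r) {0..2*pi}" unfolding q_def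
    by (intro integrable_integral integrable_continuous_interval continuous_intros c1[OF cp]) (use r in auto)
   have "((\<lambda>t. 2 / r * Re (p (?z r t) * ?z r t)) has_integral 2 / r * Re (q r)) {0..2*pi}"
    by (intro has_integral_mult_right has_integral_Re i)
   moreover have "2 / r * Re (p (?z r t) * ?z r t) = 2 * Re (p (?z r t) * cis t)" for t using r by (simp add: field_simps)
   ultimately have "integral {0..2*pi} (\<lambda>t. 2 * Re (p (?z r t) * cis t)) = 2 / r * Re (q r)" by (simp add: integral_unique)
   moreover have "2 / r * Re (q r) \<ge> 2 / r * (2*pi*c*r^2)" using Req[of r] r by (intro mult_left_mono) auto
   ultimately show "0 \<le> integral {0..2*pi} (\<lambda>t. 2 * Re (p (?z r t) * cis t)) - 2*pi*c*(2*r)" using r by (simp add: power2_eq_square)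
  qed (use R in auto)
  then show "2*pi*(g 0 + c*R^2) \<le> integral {0..2*pi} (\<lambda>t. g (of_real R * cis t))"
   by (simp add: m_def algebra_simps pi_ge_zero)
 }
 { assume c: "\<forall>s\<in>cball 0 R. c \<le> Im (L s)"
  have Imq: "Im (q r) = 0" if r: "r \<in> {0..R}" for r
  proof -
   have "((\<lambda>t. 2 * Re (p (?z r t) * (\<i> * ?z r t))) has_integral 0) {0..2*pi}"
    by (rule integral_periodic_derivative[OF dgt[OF r]]) simp
   from has_integral_mult_right[OF this, of "-1/2"]
   have "((\<lambda>t. Im (p (?z r t) * ?z r t)) has_integral 0) {0..2*pi}" by (simp add: algebra_simps)
   moreover have "((\<lambda>t. Im (p (?z r t) * ?z r t)) has_integral Im (q r)) {0..2*pi}" unfolding q_def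
    by (intro has_integral_Im integrable_integral integrable_continuous_interval continuous_intros c1[OF cp r])
   ultimately show ?thesis by (rule has_integral_unique[symmetric])
  qed
  have RR: "R \<in> {0..R}" using R by auto
  have "((\<lambda>r. Im (q r)) has_vector_derivative Im (2 * of_real R * N R)) (at R within {0..R})"
   using q'[OF RR] unfolding has_vector_derivative_complex_iff by (simp add: has_real_derivative_iff_has_vector_derivative)
  moreover have "((\<lambda>r. Im (q r)) has_vector_derivative 0) (at R within {0..R})"
   using Imq by (intro has_vector_derivative_transform[OF RR _ has_vector_derivative_const[of 0]]) auto
  ultimately have "Im (2 * of_real R * N R) = 0"
   by (rule vector_derivative_unique_within[rotated]) (use R in \<open>simp add: trivial_limit_within islimpt_Icc\<close>)
  then have "Im (N R) = 0" using R by simp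
  moreover have "((\<lambda>t. Im (L (?z R t))) has_integral Im (N R)) {0..2*pi}"
   unfolding N_def by (intro has_integral_Im integrable_integral iL RR)
  from has_integral_le[OF has_integral_const_real this, of c] c zin[OF RR]
  have "2*pi*c \<le> Im (N R)" by (simp add: pi_ge_zero mult.commute)
  ultimately show "c \<le> 0" using mult_pos_pos[of "2*pi" c] by fastforce
 }
qed

section \<open>Holomorphic functions of several variables\<close>

text \<open>The scalar analogue of \<open>holo_on\<close>: Cauchy's formula is applied to scalar
  functions, and maps are reduced to their components by \<open>holo_on_iff\<close>.\<close>

definition hol_fun :: "(complex^'n::finite \<Rightarrow> complex) \<Rightarrow> (complex^'n) set \<Rightarrow> bool" where
 "hol_fun g S \<longleftrightarrow> (\<forall>x\<in>S. \<exists>D. (g has_derivative D) (at x) \<and> (\<forall>c v. D (c *s v) = c * D v))"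

lemma hol_funD:
 assumes "hol_fun g S" "x \<in> S"
 shows "(g has_derivative frechet_derivative g (at x)) (at x)"
  "frechet_derivative g (at x) (c *s v) = c * frechet_derivative g (at x) v"
proof -
 obtain D where D: "(g has_derivative D) (at x)" "\<And>c v. D (c *s v) = c * D v"
  using assms unfolding hol_fun_def by blast
 have "D = frechet_derivative g (at x)" by (rule frechet_derivative_at[OF D(1)])
 with D show "(g has_derivative frechet_derivative g (at x)) (at x)"
  "frechet_derivative g (at x) (c *s v) = c * frechet_derivative g (at x) v" by auto
qed

lemma hol_fun_continuous: "hol_fun g S \<Longrightarrow> continuous_on S g"
 using hol_funD(1) by (meson continuous_at_imp_continuous_on has_derivative_continuous)

lemma bounded_linear_scalar_left: "bounded_linear (\<lambda>c::complex. c *s (v::complex^'n::finite))"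
proof (rule bounded_linear_intro[where K="norm v"])
 fix x :: complex and r :: real
 show "r *\<^sub>R x *s v = r *\<^sub>R (x *s v)" by (simp add: vec_eq_iff)
 show "norm (x *s v) \<le> norm x * norm v"
  by (simp add: norm_vec_def norm_mult L2_set_right_distrib[symmetric])
qed (simp add: vec.scale_left_distrib)

lemma norm_scalar_mult: "norm (c *s (v::complex^'n::finite)) = cmod c * norm v"
 by (simp add: norm_vec_def norm_mult L2_set_right_distrib)

lemmas continuous_on_scalar_left [continuous_intros] =
 bounded_linear.continuous_on[OF bounded_linear_scalar_left]

lemma has_derivative_scalar_left:
 "((\<lambda>c. a + c *s (v::complex^'n::finite)) has_derivative (\<lambda>h. h *s v)) (at c within S)"
 by (rule has_derivative_eq_rhs[OF has_derivative_add[OF has_derivative_const bounded_linear_imp_has_derivative[OF bounded_linear_scalar_left]]]) simp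

text \<open>Cauchy's formula for the derivative of b \<mapsto> g (x + b v) at 0. The velocity of the
  circle is 2 pi i times its position, which cancels one power of the denominator. No derivative of
  \<open>g\<close> occurs under the integral, so regularity in \<open>x\<close> can be read off from
  it.\<close>

lemma hol_fun_derivative_integral:
 fixes g :: "complex^'n::finite \<Rightarrow> complex"
 assumes h: "hol_fun g S" and S: "\<And>b. cmod b \<le> r \<Longrightarrow> x + b *s v \<in> S" and r: "r > 0"
 shows "((\<lambda>t. inverse (circlepath 0 r t) * g (x + circlepath 0 r t *s v)) has_integral
  frechet_derivative g (at x) v) {0..1}"
proof -
 let ?f = "\<lambda>b. g (x + b *s v)"
 have d: "(?f has_field_derivative frechet_derivative g (at (x + b *s v)) v) (at b)" if "cmod b \<le> r" for b
 proof -
  have "(?f has_derivative (\<lambda>h. frechet_derivative g (at (x + b *s v)) (h *s v))) (at b)"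
   using has_derivative_compose[OF has_derivative_scalar_left hol_funD(1)[OF h S[OF that]]] by simp
  then show ?thesis unfolding has_field_derivative_def
   by (simp add: hol_funD(2)[OF h S[OF that]] mult_commute_abs)
 qed
 have c: "continuous_on (cball 0 r) ?f"
  using d by (intro DERIV_continuous_on[where D="\<lambda>b. frechet_derivative g (at (x + b *s v)) v"]) (auto intro: has_field_derivative_at_within)
 have hol: "?f holomorphic_on ball 0 r"
  unfolding holomorphic_on_def field_differentiable_def
  using d has_field_derivative_at_within by (metis less_imp_le mem_ball_0)
 have "((\<lambda>u. ?f u / (u - 0)^2) has_contour_integral (2 * pi * \<i>) * deriv ?f 0) (circlepath 0 r)"
  using Cauchy_has_contour_integral_higher_derivative_circlepath[OF c hol, of 0 1] r by (simp add: power2_eq_square)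
 moreover have "deriv ?f 0 = frechet_derivative g (at x) v"
  using DERIV_imp_deriv[OF d[of 0]] r by simp
 ultimately have "((\<lambda>t. ?f (circlepath 0 r t) / (circlepath 0 r t)^2 * vector_derivative (circlepath 0 r) (at t within {0..1})) has_integral
   (2 * pi * \<i>) * frechet_derivative g (at x) v) {0..1}"
  by (simp add: has_contour_integral_def)
 from has_integral_mult_right[OF this, of "inverse (2*pi*\<i>)"]
 have "((\<lambda>t. inverse (2*pi*\<i>) * (?f (circlepath 0 r t) / (circlepath 0 r t)^2 * vector_derivative (circlepath 0 r) (at t within {0..1}))) has_integral
   frechet_derivative g (at x) v) {0..1}" by (simp add: field_simps)
 then show ?thesis
 proof (rule has_integral_eq[rotated])
  fix t :: real assume "t \<in> {0..1}"
  then have "vector_derivative (circlepath 0 r) (at t within {0..1}) = 2 * pi * \<i> * circlepath 0 r t"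
   using vector_derivative_circlepath01[of t 0 r] by (simp add: circlepath algebra_simps)
  moreover have "circlepath 0 r t \<noteq> 0" using r by (simp add: circlepath)
  ultimately show "inverse (2*pi*\<i>) * (?f (circlepath 0 r t) / (circlepath 0 r t)^2 * vector_derivative (circlepath 0 r) (at t within {0..1}))
    = inverse (circlepath 0 r t) * g (x + circlepath 0 r t *s v)"
   by (simp add: field_simps power2_eq_square)
 qed
qed

lemma circlepath_continuous_snd: "continuous_on S (\<lambda>p. circlepath 0 r (snd p))"
 by (simp add: circlepath) (intro continuous_intros)

text \<open>\<open>hol_fun\<close> says nothing about how the derivative depends on the point. Near
  a given point one radius serves for all centres, and the Cauchy integral can be differentiated
  under the integral sign. Continuity comes first, for all directions, because the Leibniz rule asks
  for it in the differentiated integrand; complex linearity then passes through the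
  integral.\<close>

lemma hol_fun_derivative:
 fixes g :: "complex^'n::finite \<Rightarrow> complex"
 assumes h: "hol_fun g S" and S: "open S"
 shows "continuous_on S (\<lambda>z. frechet_derivative g (at z) v)"
  "hol_fun (\<lambda>z. frechet_derivative g (at z) v) S"
proof -
 have ex: "\<exists>e r. e > 0 \<and> r > 0 \<and> (\<forall>x\<in>ball z0 e. \<forall>b. cmod b \<le> r \<longrightarrow> x + b *s v \<in> S)" if z0: "z0 \<in> S" for z0 v
 proof -
  obtain e where e: "e > 0" "ball z0 e \<subseteq> S" using S z0 unfolding open_contains_ball by blast
  \<comment> \<open>The 1 in \<open>1 + norm v\<close> covers the direction
    \<open>v = 0\<close>.\<close>
  have "x + b *s v \<in> S" if x: "x \<in> ball z0 (e/2)" and b: "cmod b \<le> e / (2 * (1 + norm v))" for x b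
  proof -
   have "norm (b *s v) \<le> e / (2 * (1 + norm v)) * norm v"
    unfolding norm_scalar_mult using b by (rule mult_right_mono) simp
   also have "\<dots> = e / 2 * (norm v / (1 + norm v))" by simp
   also have "\<dots> \<le> e / 2 * 1" using e(1) by (intro mult_left_mono) (simp_all add: divide_le_eq add_pos_nonneg)
   finally have "dist z0 (x + b *s v) < e"
    using x dist_triangle[of z0 "x + b *s v" x] by (simp add: dist_norm)
   then show ?thesis using e by auto
  qed
  moreover have "e / (2 * (1 + norm v)) > 0" using e(1) by (auto intro!: divide_pos_pos add_pos_nonneg)
  ultimately show ?thesis using e(1) by (intro exI[of _ "e/2"] exI[of _ "e / (2 * (1 + norm v))"]) auto
 qed
 have cont: "continuous_on S (\<lambda>z. frechet_derivative g (at z) v)" for v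
 proof (rule continuous_at_imp_continuous_on, rule ballI)
  fix z0 assume "z0 \<in> S"
  then obtain e r where er: "e > 0" "r > 0" "\<And>x b. x \<in> ball z0 e \<Longrightarrow> cmod b \<le> r \<Longrightarrow> x + b *s v \<in> S"
   using ex by meson
  have "continuous_on (ball z0 e \<times> cbox 0 1) (\<lambda>(x,t). inverse (circlepath 0 r t) * g (x + circlepath 0 r t *s v))"
   unfolding case_prod_unfold
   by (intro continuous_on_mult continuous_on_inverse continuous_on_compose2[OF hol_fun_continuous[OF h]] continuous_on_add
     continuous_on_fst continuous_on_id continuous_on_scalar_left circlepath_continuous_snd)
     (use er in \<open>auto simp: circlepath norm_mult\<close>)
  from integral_continuous_on_param[OF this]
  have "continuous_on (ball z0 e) (\<lambda>z. frechet_derivative g (at z) v)"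
   by (rule continuous_on_eq) (use hol_fun_derivative_integral[OF h er(3,2)] in \<open>auto intro: integral_unique\<close>)
  then show "isCont (\<lambda>z. frechet_derivative g (at z) v) z0"
   using er(1) by (simp add: continuous_on_eq_continuous_at)
 qed
 show "continuous_on S (\<lambda>z. frechet_derivative g (at z) v)" by (rule cont)
 \<comment> \<open>The Leibniz rule expects derivatives in the space of bounded linear maps;
   continuity there is checked on basis vectors in \<open>cfx\<close>.\<close>
 define G where "G z = Blinfun (frechet_derivative g (at z))" for z
 have G: "blinfun_apply (G z) = frechet_derivative g (at z)" if "z \<in> S" for z
  unfolding G_def using hol_funD(1)[OF h that] by (simp add: bounded_linear_Blinfun_apply has_derivative_bounded_linear)
 show "hol_fun (\<lambda>z. frechet_derivative g (at z) v) S" unfolding hol_fun_def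
 proof
  fix z0 assume z0: "z0 \<in> S"
  then obtain e r where er: "e > 0" "r > 0" "\<And>x b. x \<in> ball z0 e \<Longrightarrow> cmod b \<le> r \<Longrightarrow> x + b *s v \<in> S"
   using ex by meson
  let ?c = "circlepath 0 r"
  let ?f = "\<lambda>x t. inverse (?c t) * g (x + ?c t *s v)"
  let ?fx = "\<lambda>x t. blinfun_compose (blinfun_mult_right (inverse (?c t))) (G (x + ?c t *s v))"
  have in_S: "x + ?c t *s v \<in> S" if "x \<in> ball z0 e" for x t
   using er(3)[OF that, of "?c t"] er(2) by (simp add: circlepath norm_mult)
  have d: "((\<lambda>x. ?f x t) has_derivative blinfun_apply (?fx x t)) (at x within ball z0 e)" if "x \<in> ball z0 e" for x t
  proof -
   have "((\<lambda>x. g (x + ?c t *s v)) has_derivative (\<lambda>h. frechet_derivative g (at (x + ?c t *s v)) h)) (at x within ball z0 e)"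
    using has_derivative_compose[of "\<lambda>x. x + ?c t *s v" "\<lambda>h. h" x "ball z0 e", OF _ hol_funD(1)[OF h in_S[OF that, of t]]]
    has_derivative_add[OF has_derivative_ident[of "at x within ball z0 e"] has_derivative_const[of "?c t *s v"]]
    by simp
   note D = has_derivative_mult_right[OF this, of "inverse (?c t)"]
   have "(\<lambda>h. inverse (?c t) * frechet_derivative g (at (x + ?c t *s v)) h) = blinfun_apply (?fx x t)"
    by (rule ext) (simp add: G[OF in_S[OF that]] blinfun_mult_right.rep_eq)
   with D show ?thesis by simp
  qed
  have cfx: "continuous_on (ball z0 e \<times> cbox 0 1) (\<lambda>(x,t). ?fx x t)"
  proof (rule continuous_on_blinfun_componentwise)
   fix i :: "complex^'n" assume "i \<in> Basis"
   have "continuous_on (ball z0 e \<times> cbox 0 1) (\<lambda>(x,t). inverse (?c t) * (\<lambda>z. frechet_derivative g (at z) i) (x + ?c t *s v))"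
    unfolding case_prod_unfold
    by (intro continuous_on_mult continuous_on_inverse continuous_on_compose2[OF cont[of i]] continuous_on_add
     continuous_on_fst continuous_on_id continuous_on_scalar_left circlepath_continuous_snd)
      (use er in \<open>auto simp: circlepath norm_mult\<close>)
   then show "continuous_on (ball z0 e \<times> cbox 0 1) (\<lambda>y. blinfun_apply (case y of (x,t) \<Rightarrow> ?fx x t) i)"
    by (rule continuous_on_eq) (auto simp: G[OF in_S] blinfun_mult_right.rep_eq)
  qed
  have int: "?f x integrable_on cbox 0 1" if "x \<in> ball z0 e" for x
   using hol_fun_derivative_integral[OF h er(3)[OF that] er(2)] by (auto simp: integrable_on_def)
  have z0b: "z0 \<in> ball z0 e" using er by simp
  have L: "((\<lambda>x. integral (cbox 0 1) (?f x)) has_derivative blinfun_apply (integral (cbox 0 1) (?fx z0))) (at z0 within ball z0 e)"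
   by (rule leibniz_rule[OF d int cfx z0b]) auto
  have "((\<lambda>z. frechet_derivative g (at z) v) has_derivative blinfun_apply (integral (cbox 0 1) (?fx z0))) (at z0 within ball z0 e)"
   by (rule has_derivative_transform[OF z0b _ L])
     (use hol_fun_derivative_integral[OF h er(3,2)] in \<open>auto intro: integral_unique[symmetric]\<close>)
  then have D: "((\<lambda>z. frechet_derivative g (at z) v) has_derivative blinfun_apply (integral (cbox 0 1) (?fx z0))) (at z0)"
   using er(1) by (simp add: at_within_open[OF z0b])
  have cfz: "continuous_on (cbox 0 1) (?fx z0)"
   using continuous_on_compose2[OF cfx, of "cbox 0 1" "\<lambda>t. (z0,t)", OF continuous_on_Pair[OF continuous_on_const continuous_on_id]] z0b
   by force
  have "blinfun_apply (integral (cbox 0 1) (?fx z0)) (c *s w) = c * blinfun_apply (integral (cbox 0 1) (?fx z0)) w" for c w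
  proof -
   have "blinfun_apply (integral (cbox 0 1) (?fx z0)) (c *s w) = integral (cbox 0 1) (\<lambda>t. c * blinfun_apply (?fx z0 t) w)"
    by (subst blinfun_apply_integral[OF integrable_continuous[OF cfz]], rule integral_cong)
      (simp add: G[OF in_S[OF z0b]] hol_funD(2)[OF h in_S[OF z0b]] blinfun_mult_right.rep_eq)
   also have "\<dots> = c * integral (cbox 0 1) (\<lambda>t. blinfun_apply (?fx z0 t) w)" by (rule integral_mult_right)
   finally show ?thesis unfolding blinfun_apply_integral[OF integrable_continuous[OF cfz], of w] .
  qed
  with D show "\<exists>D. ((\<lambda>z. frechet_derivative g (at z) v) has_derivative D) (at z0) \<and> (\<forall>c w. D (c *s w) = c * D w)" by blast
 qed
qed

lemma hol_fun_Ck: "open S \<Longrightarrow> hol_fun g S \<Longrightarrow> Ck_on m g S"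
proof (induction m arbitrary: g)
 case (Suc m)
 then show ?case using hol_fun_derivative(2)[OF Suc.prems(2,1)] hol_funD(1)[OF Suc.prems(2)]
  by (auto simp: differentiable_def)
qed (simp add: hol_fun_continuous)

lemma vec_sum_axis: "(x::complex^'n::finite) = (\<Sum>l\<in>UNIV. (x $ l) *s axis l 1)"
 by (simp add: vec_eq_iff axis_def if_distrib cong: if_cong)

lemma has_derivative_vec_componentwise:
 fixes F :: "'a::real_normed_vector \<Rightarrow> complex^'m::finite"
 assumes "\<And>l. ((\<lambda>z. F z $ l) has_derivative (\<lambda>h. D h $ l)) (at x within S)"
 shows "(F has_derivative D) (at x within S)"
proof -
 have "((\<lambda>z. \<Sum>l\<in>UNIV. (F z $ l) *s axis l 1) has_derivative (\<lambda>h. \<Sum>l\<in>UNIV. (D h $ l) *s axis l (1::complex))) (at x within S)"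
  by (intro has_derivative_sum bounded_linear.has_derivative[OF bounded_linear_scalar_left] assms)
 then show ?thesis unfolding vec_sum_axis[symmetric] by (simp add: fun_eq_iff[symmetric])
qed

lemma holo_on_iff: "holo_on F S \<longleftrightarrow> (\<forall>l. hol_fun (\<lambda>z. F z $ l) S)"
proof
 assume F: "holo_on F S"
 show "\<forall>l. hol_fun (\<lambda>z. F z $ l) S" unfolding hol_fun_def
 proof (intro allI ballI)
  fix l x assume "x \<in> S"
  then obtain D where "(F has_derivative D) (at x)" "\<And>c v. D (c *s v) = c *s D v"
   using F unfolding holo_on_def by blast
  then show "\<exists>D. ((\<lambda>z. F z $ l) has_derivative D) (at x) \<and> (\<forall>c v. D (c *s v) = c * D v)"
   by (intro exI[of _ "\<lambda>h. D h $ l"]) (auto intro!: bounded_linear.has_derivative[OF bounded_linear_vec_nth])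
 qed
next
 assume F: "\<forall>l. hol_fun (\<lambda>z. F z $ l) S"
 show "holo_on F S" unfolding holo_on_def
 proof
  fix x assume x: "x \<in> S"
  let ?D = "\<lambda>h. \<chi> l. frechet_derivative (\<lambda>z. F z $ l) (at x) h"
  have "(F has_derivative ?D) (at x)"
   by (rule has_derivative_vec_componentwise) (use F hol_funD(1) x in auto)
  moreover have "?D (c *s v) = c *s ?D v" for c v
   using F hol_funD(2)[OF _ x] by (simp add: vec_eq_iff)
  ultimately show "\<exists>D. (F has_derivative D) (at x) \<and> (\<forall>c v. D (c *s v) = c *s D v)" by blast
 qed
qed

lemma matrix_vector_mult_axis: "(M *v axis j (1::complex)) $ l = M $ l $ j"
 by (simp add: matrix_vector_mult_def axis_def if_distrib cong: if_cong)

definition Jac :: "(complex^'n::finite \<Rightarrow> complex^'m::finite) \<Rightarrow> complex^'n \<Rightarrow> complex^'n^'m" where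
 "Jac F z = (\<chi> l j. frechet_derivative F (at z) (axis j 1) $ l)"

lemma holo_on_continuous: "holo_on F S \<Longrightarrow> continuous_on S F"
 unfolding holo_on_def by (meson continuous_at_imp_continuous_on has_derivative_continuous)

lemma holo_on_Jac:
 assumes "holo_on F S" "x \<in> S"
 shows "(F has_derivative (\<lambda>h. Jac F x *v h)) (at x)"
proof -
 obtain D where D: "(F has_derivative D) (at x)" "\<And>c v. D (c *s v) = c *s D v"
  using assms unfolding holo_on_def by blast
 have fD: "frechet_derivative F (at x) = D" by (rule frechet_derivative_at[OF D(1), symmetric])
 have "linear D" using D(1) has_derivative_linear by blast
 have "D h = Jac F x *v h" for h
 proof -
  have "D h = D (\<Sum>l\<in>UNIV. (h $ l) *s axis l 1)" by (rule arg_cong[OF vec_sum_axis])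
  also have "\<dots> = (\<Sum>l\<in>UNIV. (h $ l) *s D (axis l 1))" by (simp add: linear_sum[OF \<open>linear D\<close>] D(2))
  finally show ?thesis by (simp add: Jac_def fD vec_eq_iff matrix_vector_mult_def mult.commute)
 qed
 then have "D = (\<lambda>h. Jac F x *v h)" by blast
 with D(1) show ?thesis by simp
qed

lemma Jac_unique:
 assumes "(F has_derivative (\<lambda>h. M *v h)) (at x)"
 shows "Jac F x = M"
 using frechet_derivative_at[OF assms, symmetric] by (simp add: Jac_def vec_eq_iff matrix_vector_mult_axis)

lemma Jac_hol:
 assumes "holo_on F S" "open S"
 shows "hol_fun (\<lambda>z. Jac F z $ l $ j) S"
proof -
 have F: "hol_fun (\<lambda>z. F z $ l) S" using assms(1) holo_on_iff by blast
 have eq: "Jac F z $ l $ j = frechet_derivative (\<lambda>z. F z $ l) (at z) (axis j 1)" if "z \<in> S" for z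
 proof -
  have "((\<lambda>z. F z $ l) has_derivative (\<lambda>h. (Jac F z *v h) $ l)) (at z)"
   by (rule bounded_linear.has_derivative[OF bounded_linear_vec_nth holo_on_Jac[OF assms(1) that]])
  from frechet_derivative_at[OF this, symmetric] show ?thesis by (simp add: matrix_vector_mult_axis)
 qed
 show ?thesis unfolding hol_fun_def
 proof
  fix x assume x: "x \<in> S"
  obtain D where D: "((\<lambda>z. frechet_derivative (\<lambda>z. F z $ l) (at z) (axis j 1)) has_derivative D) (at x)" "\<forall>c v. D (c *s v) = c * D v"
   using hol_fun_derivative(2)[OF F assms(2)] x unfolding hol_fun_def by blast
  have "((\<lambda>z. Jac F z $ l $ j) has_derivative D) (at x)"
   by (rule has_derivative_transform_within_open[OF D(1) assms(2) x]) (simp add: eq)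
  with D(2) show "\<exists>D. ((\<lambda>z. Jac F z $ l $ j) has_derivative D) (at x) \<and> (\<forall>c v. D (c *s v) = c * D v)" by blast
 qed
qed

lemma Jac_continuous: "holo_on F S \<Longrightarrow> open S \<Longrightarrow> continuous_on S (Jac F)"
 using hol_fun_continuous[OF Jac_hol]
 by (auto intro!: continuous_on_vec_lambda[where f="\<lambda>l z. Jac F z $ l", unfolded vec_nth_inverse]
    continuous_on_vec_lambda[where f="\<lambda>j z. Jac F z $ l $ j" for l, unfolded vec_nth_inverse])

lemma holo_on_compose:
 assumes "holo_on F S" "holo_on G T" "F ` S \<subseteq> T"
 shows "holo_on (G \<circ> F) S" "x \<in> S \<Longrightarrow> Jac (G \<circ> F) x = Jac G (F x) ** Jac F x"
proof -
 have d: "((G \<circ> F) has_derivative (\<lambda>h. (Jac G (F x) ** Jac F x) *v h)) (at x)" if "x \<in> S" for x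
  using diff_chain_at[OF holo_on_Jac[OF assms(1) that] holo_on_Jac[OF assms(2)]] assms(3) that
  by (auto simp: o_def matrix_vector_mul_assoc)
 have "(M *v (c *s v)) = c *s (M *v v)" for M :: "complex^'a^'c" and c v
  by (simp add: vec_eq_iff matrix_vector_mult_def sum_distrib_left algebra_simps)
 with d show "holo_on (G \<circ> F) S" unfolding holo_on_def by blast
 show "x \<in> S \<Longrightarrow> Jac (G \<circ> F) x = Jac G (F x) ** Jac F x" using Jac_unique[OF d] .
qed

lemma holo_on_subset: "holo_on F S \<Longrightarrow> T \<subseteq> S \<Longrightarrow> holo_on F T"
 unfolding holo_on_def by blast

lemma holo_on_cong_open:
 assumes "holo_on F S" "open S" "\<And>x. x \<in> S \<Longrightarrow> F x = G x"
 shows "holo_on G S"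
 unfolding holo_on_def
proof
 fix x assume x: "x \<in> S"
 then obtain D where D: "(F has_derivative D) (at x)" "\<forall>c v. D (c *s v) = c *s D v"
  using assms(1) unfolding holo_on_def by blast
 from has_derivative_transform_within_open[OF D(1) assms(2) x assms(3)] D(2)
 show "\<exists>D. (G has_derivative D) (at x) \<and> (\<forall>c v. D (c *s v) = c *s D v)" by blast
qed

section \<open>Hermitian forms and Levi forms\<close>

definition hform :: "complex^'n^'n \<Rightarrow> complex^'n \<Rightarrow> complex" where
 "hform L w = (\<Sum>j\<in>UNIV. \<Sum>k\<in>UNIV. L $ j $ k * w $ j * cnj (w $ k))"

abbreviation qf :: "complex^'n^'n \<Rightarrow> complex^'n \<Rightarrow> real" where "qf L w \<equiv> Re (hform L w)"

definition cnjv :: "complex^'n \<Rightarrow> complex^'n" where "cnjv h = (\<chi> k. cnj (h $ k))"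

definition hermitian :: "complex^'n^'n \<Rightarrow> bool" where
 "hermitian g \<longleftrightarrow> (\<forall>j k. g $ k $ j = cnj (g $ j $ k))"

definition outer :: "complex^'n \<Rightarrow> complex^'n \<Rightarrow> complex^'n^'n" where
 "outer p q = (\<chi> j k. p $ j * cnj (q $ k))"

definition dotp :: "complex^'n \<Rightarrow> complex^'n \<Rightarrow> complex" where
 "dotp p h = (\<Sum>j\<in>UNIV. p $ j * h $ j)"

lemma dotp_simps:
 "dotp (p + q) h = dotp p h + dotp q h" "dotp (- p) h = - dotp p h" "dotp (r *\<^sub>R p) h = of_real r * dotp p h"
 "dotp p (c *s h) = c * dotp p h" "dotp 0 h = 0"
 by (simp_all add: dotp_def sum.distrib sum_negf scaleR_conv_of_real[where 'a=complex] sum_distrib_left algebra_simps)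

lemma dotp_transpose: "dotp (transpose J *v p) h = dotp p (J *v h)"
 unfolding dotp_def matrix_vector_mult_def vec_lambda_beta transpose_def sum_distrib_left sum_distrib_right
 by (subst sum.swap) (simp add: mult_ac)

lemma dotp_bounded_linear: "bounded_linear (\<lambda>p. dotp p w)"
 unfolding dotp_def by (intro bounded_linear_sum bounded_linear_mult_left[THEN bounded_linear_compose] bounded_linear_vec_nth)

lemma outer_mult: "outer p q *v cnjv h = cnj (dotp q h) *s p"
 by (simp add: outer_def cnjv_def dotp_def matrix_vector_mult_def vec_eq_iff sum_distrib_left sum_distrib_right mult_ac)

lemma outerl_mult: "(\<chi> i j. p $ i * q $ j) *v h = dotp q h *s (p :: complex^'n)"
 by (simp add: dotp_def matrix_vector_mult_def vec_eq_iff sum_distrib_left sum_distrib_right mult_ac)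

lemma transpose_mult_nth: "(transpose J *v p) $ j = (\<Sum>l\<in>UNIV. J $ l $ j * p $ l)"
 unfolding matrix_vector_mult_def transpose_def vec_lambda_beta ..

lemma two_Re_scaleR: "(2 * Re d) *\<^sub>R p = d *s p + cnj d *s (p :: complex^'n)"
 by (simp add: vec_eq_iff complex_eq_iff algebra_simps)

lemma scaleR_matrix_vector: "(c *\<^sub>R A) *v h = c *\<^sub>R (A *v (h :: complex^'n))"
 by (simp add: matrix_vector_mult_def vec_eq_iff scaleR_right.sum)

lemma matrix_vector_scalar: "(M :: complex^'n^'m) *v (c *s v) = c *s (M *v v)"
 by (simp add: vec_eq_iff matrix_vector_mult_def sum_distrib_left algebra_simps)

text \<open>\<open>dG = 2 Re (p dz)\<close> at \<open>z\<close>, and \<open>dP = A dz + L d\<close>conj\<open>(z)\<close>: when \<open>P\<close> is the complex gradient of \<open>G\<close>, its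
 second coefficient \<open>L\<close> is the Levi form of \<open>G\<close>.\<close>

abbreviation wder :: "(complex^'n::finite \<Rightarrow> real) \<Rightarrow> complex^'n \<Rightarrow> complex^'n \<Rightarrow> bool" where
 "wder G p z \<equiv> (G has_derivative (\<lambda>h. 2 * Re (dotp p h))) (at z)"

abbreviation lder :: "(complex^'n::finite \<Rightarrow> complex^'n) \<Rightarrow> complex^'n^'n \<Rightarrow> complex^'n^'n \<Rightarrow> complex^'n \<Rightarrow> bool" where
 "lder P A L z \<equiv> (P has_derivative (\<lambda>h. A *v h + L *v cnjv h)) (at z)"

definition has_levi :: "(complex^'n::finite) set \<Rightarrow> (complex^'n \<Rightarrow> real) \<Rightarrow> (complex^'n \<Rightarrow> complex^'n) \<Rightarrow>
  (complex^'n \<Rightarrow> complex^'n^'n) \<Rightarrow> bool" where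
 "has_levi S G P L \<longleftrightarrow>
   (\<forall>z\<in>S. wder G (P z) z) \<and> continuous_on S L \<and>
   (\<exists>A. continuous_on S A \<and> (\<forall>z\<in>S. lder P (A z) (L z) z))"

lemma hform_add: "hform (A + B) w = hform A w + hform B w"
 by (simp add: hform_def sum.distrib algebra_simps)

lemma hform_scaleR: "hform (c *\<^sub>R A) w = of_real c * hform A w"
 by (simp add: hform_def sum_distrib_left scaleR_conv_of_real[where 'a=complex] algebra_simps)

lemma hform_minus: "hform (- A) w = - hform A w"
 by (simp add: hform_def sum_negf)

lemma hform_diff: "hform (A - B) w = hform A w - hform B w"
 by (simp add: hform_def sum_subtractf algebra_simps)

lemma hform_zero [simp]: "hform 0 w = 0" "hform A 0 = 0"
 by (simp_all add: hform_def)

lemma hform_scale: "hform L (c *s w) = (cmod c)^2 * hform L w"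
proof -
 have "L $ j $ k * (c * w $ j) * (cnj c * cnj (w $ k)) = (cmod c)^2 * (L $ j $ k * w $ j * cnj (w $ k))" for j k
 proof -
  have "L $ j $ k * (c * w $ j) * (cnj c * cnj (w $ k)) = (c * cnj c) * (L $ j $ k * w $ j * cnj (w $ k))" by (simp add: algebra_simps)
  then show ?thesis by (simp add: complex_norm_square[symmetric])
 qed
 then show ?thesis by (simp only: hform_def sum_distrib_left vector_smult_component complex_cnj_mult)
qed

lemma hform_alt: "hform L w = dotp (L *v cnjv w) w"
 by (simp add: hform_def cnjv_def dotp_def matrix_vector_mult_def sum_distrib_right sum_distrib_left mult_ac)

lemma hform_outer: "hform (outer p q) w = dotp p w * cnj (dotp q w)"
 by (simp add: hform_def outer_def dotp_def sum_product mult_ac)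

lemma pullback_matrix_alt: "pullback_matrix J g = transpose J ** (g ** (\<chi> m k. cnj (J $ m $ k)))"
 by (simp add: pullback_matrix_def matrix_matrix_mult_def transpose_def sum_distrib_left mult.assoc vec_eq_iff)

lemma cnjv_mult: "cnjv (J *v w) = (\<chi> m k. cnj (J $ m $ k)) *v cnjv w"
 by (simp add: cnjv_def matrix_vector_mult_def vec_eq_iff)

lemma hform_pullback: "hform (pullback_matrix J g) w = hform g (J *v w)"
proof -
 have "hform (pullback_matrix J g) w = dotp (transpose J *v (g *v cnjv (J *v w))) w"
  by (simp add: hform_alt pullback_matrix_alt cnjv_mult matrix_vector_mul_assoc matrix_mul_assoc)
 also have "\<dots> = hform g (J *v w)" unfolding hform_alt dotp_transpose ..
 finally show ?thesis .
qed

lemma hermitian_pullback: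
 assumes "hermitian g" shows "hermitian (pullback_matrix J g)"
proof -
 have g: "cnj (g $ l $ m) = g $ m $ l" for l m using assms unfolding hermitian_def by metis
 show ?thesis unfolding hermitian_def pullback_matrix_def
  by (simp add: g mult_ac) (intro allI sum.swap)
qed

lemma hform_continuous: "continuous_on UNIV (\<lambda>p. hform (fst p) (snd p))"
 unfolding hform_def by (intro continuous_intros)

lemma hform_continuous_on [continuous_intros]:
 "continuous_on S f \<Longrightarrow> continuous_on S g \<Longrightarrow> continuous_on S (\<lambda>x. hform (f x) (g x))"
 using continuous_on_compose2[OF hform_continuous continuous_on_Pair] by fastforce

lemma hermitian_hform_real: "hermitian H \<Longrightarrow> Im (hform H w) = 0"
proof -
 assume H: "hermitian H"
 have H': "cnj (H $ j $ k) = H $ k $ j" for j k using H unfolding hermitian_def by metis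
 have "cnj (hform H w) = (\<Sum>j\<in>UNIV. \<Sum>k\<in>UNIV. H $ k $ j * w $ k * cnj (w $ j))"
  unfolding hform_def by (simp add: H' mult_ac)
 also have "\<dots> = hform H w" unfolding hform_def by (rule sum.swap)
 finally show ?thesis by (simp add: complex_eq_iff)
qed

text \<open>A complex line is a holomorphic map of one variable, so gradient and Levi form restrict
  to \<open>dotp P w\<close> and \<open>hform L w\<close>. These are exactly the data that
  \<open>disc_mean_aux\<close> consumes.\<close>

lemma has_levi_line:
 assumes L: "has_levi S G P L"
 shows "\<exists>A. (\<forall>t. a + t *s w \<in> S \<longrightarrow> ((\<lambda>t. G (a + t *s w)) has_derivative (\<lambda>h. 2 * Re (dotp (P (a + t *s w)) w * h))) (at t) \<and>
   ((\<lambda>t. dotp (P (a + t *s w)) w) has_derivative (\<lambda>h. A t * h + hform (L (a + t *s w)) w * cnj h)) (at t)) \<and>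
   continuous_on {t. a + t *s w \<in> S} A \<and> continuous_on {t. a + t *s w \<in> S} (\<lambda>t. hform (L (a + t *s w)) w)"
proof -
 obtain A where A: "continuous_on S A" "\<And>z. z \<in> S \<Longrightarrow> lder P (A z) (L z) z"
  and G: "\<And>z. z \<in> S \<Longrightarrow> wder G (P z) z"
  and cL: "continuous_on S L"
  using L unfolding has_levi_def by blast
 let ?A = "\<lambda>t. \<Sum>j\<in>UNIV. (\<Sum>k\<in>UNIV. A (a + t *s w) $ j $ k * w $ k) * w $ j"
 have 1: "((\<lambda>t. G (a + t *s w)) has_derivative (\<lambda>h. 2 * Re (dotp (P (a + t *s w)) w * h))) (at t)"
  if "a + t *s w \<in> S" for t
  by (rule has_derivative_eq_rhs[OF has_derivative_compose[OF has_derivative_scalar_left G[OF that]]])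
    (simp add: fun_eq_iff dotp_simps mult.commute)
 have 2: "((\<lambda>t. dotp (P (a + t *s w)) w) has_derivative (\<lambda>h. ?A t * h + hform (L (a + t *s w)) w * cnj h)) (at t)"
  if "a + t *s w \<in> S" for t
 proof (rule has_derivative_eq_rhs[OF bounded_linear.has_derivative[OF dotp_bounded_linear has_derivative_compose[OF has_derivative_scalar_left A(2)[OF that]]]])
  have "cnjv (h *s w) = cnj h *s cnjv w" for h by (simp add: cnjv_def vec_eq_iff)
  moreover have "dotp (c *s p) w = c * dotp p w" for c p by (simp add: dotp_def sum_distrib_left mult_ac)
  moreover have "dotp (A (a + t *s w) *v w) w = ?A t" for t by (simp add: dotp_def matrix_vector_mult_def)
  ultimately show "(\<lambda>h. dotp (A (a + t *s w) *v (h *s w) + L (a + t *s w) *v cnjv (h *s w)) w) =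
   (\<lambda>h. ?A t * h + hform (L (a + t *s w)) w * cnj h)"
   by (simp add: fun_eq_iff hform_alt matrix_vector_scalar dotp_simps mult.commute)
 qed
 have sub: "continuous_on {t. a + t *s w \<in> S} (\<lambda>t. f (a + t *s w))" if "continuous_on S f" for f :: "_ \<Rightarrow> complex^_^_"
  by (rule continuous_on_compose2[OF that]) (auto intro!: continuous_intros)
 show ?thesis
  by (intro exI[of _ ?A] conjI allI impI 1 2) (auto intro!: continuous_intros sub A(1) cL)
qed

text \<open>Jensen's inequality on a disc. The constant \<open>c\<close> is kept because it gives
  the exact circle mean of a quadratic form, and because a strict gain is what makes a negative Levi
  form contradictory in \<open>has_levi_nonneg\<close>.\<close>

lemma has_levi_mean:
 assumes L: "has_levi S G P L" and S: "\<And>b. cmod b \<le> 1 \<Longrightarrow> a + b *s w \<in> S"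
  and c: "\<And>b. cmod b \<le> 1 \<Longrightarrow> c \<le> qf (L (a + b *s w)) w"
 shows "2*pi*(G a + c) \<le> integral {0..2*pi} (\<lambda>t. G (a + cis t *s w))"
proof -
 obtain A where A: "\<And>b. a + b *s w \<in> S \<Longrightarrow> ((\<lambda>b. G (a + b *s w)) has_derivative (\<lambda>h. 2 * Re (dotp (P (a + b *s w)) w * h))) (at b)"
   "\<And>b. a + b *s w \<in> S \<Longrightarrow> ((\<lambda>b. dotp (P (a + b *s w)) w) has_derivative (\<lambda>h. A b * h + hform (L (a + b *s w)) w * cnj h)) (at b)"
   "continuous_on {b. a + b *s w \<in> S} A" "continuous_on {b. a + b *s w \<in> S} (\<lambda>b. hform (L (a + b *s w)) w)"
  using has_levi_line[OF L, of a w] by meson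
 have sub: "cball 0 1 \<subseteq> {b. a + b *s w \<in> S}" using S by auto
 have "2*pi*(G (a + 0 *s w) + c*1^2) \<le> integral {0..2*pi} (\<lambda>t. G (a + (of_real 1 * cis t) *s w))"
  by (rule disc_mean_aux(1)[where g="\<lambda>b. G (a + b *s w)" and A=A])
    (use A(1,2) c S in \<open>auto intro: continuous_on_subset[OF A(3) sub] continuous_on_subset[OF A(4) sub]\<close>)
 then show ?thesis by simp
qed

lemma has_levi_uminus: "has_levi S G P L \<Longrightarrow> has_levi S (\<lambda>z. - G z) (\<lambda>z. - P z) (\<lambda>z. - L z)"
 unfolding has_levi_def
proof (elim conjE exE, intro conjI ballI exI)
 fix A z assume P: "\<forall>z\<in>S. lder P (A z) (L z) z" and z: "z \<in> S"
 have "(\<lambda>h. - (A z *v h + L z *v cnjv h)) = (\<lambda>h. - A z *v h + - L z *v cnjv h)"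
  by (simp add: fun_eq_iff vec_eq_iff matrix_vector_mult_def sum_negf)
 then show "((\<lambda>z. - P z) has_derivative (\<lambda>h. - A z *v h + - L z *v cnjv h)) (at z)"
  using has_derivative_minus[OF P[rule_format, OF z]] by simp
next
 fix z assume P: "\<forall>z\<in>S. wder G (P z) z" and z: "z \<in> S"
 show "wder (\<lambda>z. - G z) (- P z) z"
  by (rule has_derivative_eq_rhs[OF has_derivative_minus[OF P[rule_format, OF z]]]) (simp add: fun_eq_iff dotp_simps)
qed (auto intro: continuous_intros)

lemma has_levi_add:
 assumes "has_levi S G P L" "has_levi S G' P' L'"
 shows "has_levi S (\<lambda>z. G z + G' z) (\<lambda>z. P z + P' z) (\<lambda>z. L z + L' z)"
proof -
 obtain A A' where A: "continuous_on S A" "\<And>z. z \<in> S \<Longrightarrow> lder P (A z) (L z) z"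
   "continuous_on S A'" "\<And>z. z \<in> S \<Longrightarrow> lder P' (A' z) (L' z) z"
  using assms unfolding has_levi_def by blast
 show ?thesis unfolding has_levi_def
 proof (intro conjI ballI exI[of _ "\<lambda>z. A z + A' z"])
  fix z assume z: "z \<in> S"
  show "lder (\<lambda>z. P z + P' z) (A z + A' z) (L z + L' z) z"
   by (rule has_derivative_eq_rhs[OF has_derivative_add[OF A(2)[OF z] A(4)[OF z]]])
     (simp add: fun_eq_iff matrix_vector_mult_add_rdistrib)
  have "wder G (P z) z" "wder G' (P' z) z"
   using assms z unfolding has_levi_def by auto
  from has_derivative_add[OF this]
  show "wder (\<lambda>z. G z + G' z) (P z + P' z) z"
   by (rule has_derivative_eq_rhs) (simp add: fun_eq_iff dotp_simps algebra_simps)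
 qed (use assms A in \<open>auto simp: has_levi_def intro!: continuous_intros\<close>)
qed

lemma has_levi_const: "has_levi S (\<lambda>z. c) (\<lambda>z. 0) (\<lambda>z. 0)"
 unfolding has_levi_def by (auto intro!: exI[of _ "\<lambda>z. 0"] continuous_intros simp: dotp_simps matrix_vector_mult_def zero_vec_def[symmetric])

lemma has_levi_quad:
 assumes H: "hermitian H"
 shows "has_levi S (\<lambda>z. qf H z) (\<lambda>z. H *v cnjv z) (\<lambda>z. H)"
 unfolding has_levi_def
proof (intro conjI ballI exI[of _ "\<lambda>z. 0"])
 fix z :: "complex^'a"
 have H': "cnj (H $ j $ k) = H $ k $ j" for j k using H unfolding hermitian_def by metis
 have "((\<lambda>z. H *v cnjv z) has_derivative (\<lambda>h. H *v cnjv h)) (at z)"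
 proof (rule has_derivative_vec_componentwise)
  show "((\<lambda>z. (H *v cnjv z) $ l) has_derivative (\<lambda>h. (H *v cnjv h) $ l)) (at z)" for l
   unfolding matrix_vector_mult_def vec_lambda_beta cnjv_def
   by (intro has_derivative_sum has_derivative_mult_right bounded_linear.has_derivative[OF bounded_linear_cnj] bounded_linear_imp_has_derivative bounded_linear_vec_nth)
 qed
 then show "lder (\<lambda>z. H *v cnjv z) 0 H z" by simp
 have "((\<lambda>z. hform H z) has_derivative (\<lambda>h. \<Sum>j\<in>UNIV. \<Sum>k\<in>UNIV. (H $ j $ k * z $ j) * cnj (h $ k) + (H $ j $ k * h $ j) * cnj (z $ k))) (at z)"
  unfolding hform_def
  by (intro has_derivative_sum has_derivative_mult has_derivative_mult_right bounded_linear.has_derivative[OF bounded_linear_cnj] bounded_linear_imp_has_derivative bounded_linear_vec_nth)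
 from bounded_linear.has_derivative[OF bounded_linear_Re this]
 show "wder (\<lambda>z. qf H z) (H *v cnjv z) z"
 proof (rule has_derivative_eq_rhs, intro ext)
  fix h
  have 1: "(\<Sum>j\<in>UNIV. \<Sum>k\<in>UNIV. (H $ j $ k * h $ j) * cnj (z $ k)) = dotp (H *v cnjv z) h"
   by (simp add: dotp_def matrix_vector_mult_def cnjv_def sum_distrib_right sum_distrib_left mult_ac)
  have "(\<Sum>j\<in>UNIV. \<Sum>k\<in>UNIV. (H $ j $ k * z $ j) * cnj (h $ k)) = (\<Sum>j\<in>UNIV. \<Sum>k\<in>UNIV. (H $ k $ j * z $ k) * cnj (h $ j))"
   by (rule sum.swap)
  also have "\<dots> = cnj (dotp (H *v cnjv z) h)"
   by (simp add: dotp_def H' matrix_vector_mult_def cnjv_def sum_distrib_right sum_distrib_left mult_ac)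
  finally show "Re (\<Sum>j\<in>UNIV. \<Sum>k\<in>UNIV. (H $ j $ k * z $ j) * cnj (h $ k) + (H $ j $ k * h $ j) * cnj (z $ k)) = 2 * Re (dotp (H *v cnjv z) h)"
   unfolding sum.distrib 1 by simp
 qed
qed (auto intro: continuous_intros)

lemma has_levi_scale:
 assumes "has_levi S G P L"
 shows "has_levi S (\<lambda>z. c * G z) (\<lambda>z. c *\<^sub>R P z) (\<lambda>z. c *\<^sub>R L z)"
proof -
 obtain A where A: "continuous_on S A" "\<And>z. z \<in> S \<Longrightarrow> lder P (A z) (L z) z"
  using assms unfolding has_levi_def by blast
 show ?thesis unfolding has_levi_def
 proof (intro conjI ballI exI[of _ "\<lambda>z. c *\<^sub>R A z"])
  fix z assume z: "z \<in> S"
  show "lder (\<lambda>z. c *\<^sub>R P z) (c *\<^sub>R A z) (c *\<^sub>R L z) z"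
   by (rule has_derivative_eq_rhs[OF has_derivative_scaleR_right[OF A(2)[OF z]]])
     (simp add: fun_eq_iff vec_eq_iff matrix_vector_mult_def scaleR_right.sum algebra_simps)
  have "wder G (P z) z"
   using assms z unfolding has_levi_def by auto
  from has_derivative_mult_right[OF this, of c]
  show "wder (\<lambda>z. c * G z) (c *\<^sub>R P z) z"
   by (rule has_derivative_eq_rhs) (simp add: fun_eq_iff dotp_simps)
 qed (use assms A in \<open>auto simp: has_levi_def intro!: continuous_intros\<close>)
qed

lemma has_levi_subset: "has_levi S G P L \<Longrightarrow> T \<subseteq> S \<Longrightarrow> has_levi T G P L"
 unfolding has_levi_def using continuous_on_subset by blast

lemma has_levi_chain:
 fixes k k' k'' :: "real \<Rightarrow> real"
 assumes L: "has_levi S G P L" and GI: "\<And>z. z \<in> S \<Longrightarrow> G z \<in> I"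
  and k: "\<And>x. x \<in> I \<Longrightarrow> (k has_real_derivative k' x) (at x)" "\<And>x. x \<in> I \<Longrightarrow> (k' has_real_derivative k'' x) (at x)"
  and ck: "continuous_on I k''"
 shows "has_levi S (\<lambda>z. k (G z)) (\<lambda>z. k' (G z) *\<^sub>R P z) (\<lambda>z. k' (G z) *\<^sub>R L z + k'' (G z) *\<^sub>R outer (P z) (P z))"
proof -
 obtain A where A: "continuous_on S A" "\<And>z. z \<in> S \<Longrightarrow> lder P (A z) (L z) z"
  and G: "\<And>z. z \<in> S \<Longrightarrow> wder G (P z) z"
  and cL: "continuous_on S L"
  using L unfolding has_levi_def by blast
 have cP: "continuous_on S P" "continuous_on S G" using has_derivative_continuous[OF A(2)] has_derivative_continuous[OF G]
  by (auto intro!: continuous_at_imp_continuous_on)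
 have ck': "continuous_on I k'"
  using k(2) by (intro DERIV_continuous_on[of I k' k'']) (auto intro: has_field_derivative_at_within)
 have c: "continuous_on S (\<lambda>z. f (G z))" if "continuous_on I f" for f :: "real \<Rightarrow> real"
  by (rule continuous_on_compose2[OF that cP(2)]) (use GI in auto)
 show ?thesis unfolding has_levi_def
 proof (intro conjI ballI exI[of _ "\<lambda>z. k' (G z) *\<^sub>R A z + k'' (G z) *\<^sub>R (\<chi> i j. P z $ i * P z $ j)"])
  fix z assume z: "z \<in> S"
  show "wder (\<lambda>z. k (G z)) (k' (G z) *\<^sub>R P z) z"
   by (rule has_derivative_eq_rhs[OF has_derivative_compose[OF G[OF z] k(1)[OF GI[OF z], unfolded has_field_derivative_def]]])
     (simp add: fun_eq_iff dotp_simps)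
  have kd: "((\<lambda>z. k' (G z)) has_derivative (\<lambda>h. k'' (G z) * (2 * Re (dotp (P z) h)))) (at z)"
   by (rule has_derivative_compose[OF G[OF z] k(2)[OF GI[OF z], unfolded has_field_derivative_def]])
  show "lder (\<lambda>z. k' (G z) *\<^sub>R P z) (k' (G z) *\<^sub>R A z + k'' (G z) *\<^sub>R (\<chi> i j. P z $ i * P z $ j)) (k' (G z) *\<^sub>R L z + k'' (G z) *\<^sub>R outer (P z) (P z)) z"
  proof (rule has_derivative_eq_rhs[OF has_derivative_scaleR[OF kd A(2)[OF z]]], intro ext)
   fix h
   have "((k'' (G z) * (2 * Re (dotp (P z) h))) *\<^sub>R P z) =
     (k'' (G z) *\<^sub>R (\<chi> i j. P z $ i * P z $ j)) *v h + (k'' (G z) *\<^sub>R outer (P z) (P z)) *v cnjv h"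
    unfolding scaleR_matrix_vector outer_mult outerl_mult scaleR_right_distrib[symmetric] two_Re_scaleR[symmetric] scaleR_scaleR ..
   moreover have "k' (G z) *\<^sub>R (A z *v h + L z *v cnjv h) = (k' (G z) *\<^sub>R A z) *v h + (k' (G z) *\<^sub>R L z) *v cnjv h"
    by (simp add: scaleR_matrix_vector scaleR_right_distrib)
   ultimately show "k' (G z) *\<^sub>R (A z *v h + L z *v cnjv h) + (k'' (G z) * (2 * Re (dotp (P z) h))) *\<^sub>R P z =
    (k' (G z) *\<^sub>R A z + k'' (G z) *\<^sub>R (\<chi> i j. P z $ i * P z $ j)) *v h + (k' (G z) *\<^sub>R L z + k'' (G z) *\<^sub>R outer (P z) (P z)) *v cnjv h"
    by (simp add: matrix_vector_mult_add_rdistrib)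
  qed
 qed (use A(1) cL cP in \<open>auto simp: outer_def intro!: continuous_intros c[OF ck] c[OF ck']\<close>)
qed

lemma has_levi_mult:
 assumes L1: "has_levi S G1 P1 L1" and L2: "has_levi S G2 P2 L2"
 shows "has_levi S (\<lambda>z. G1 z * G2 z) (\<lambda>z. G1 z *\<^sub>R P2 z + G2 z *\<^sub>R P1 z)
  (\<lambda>z. (G1 z *\<^sub>R L2 z + outer (P2 z) (P1 z)) + (G2 z *\<^sub>R L1 z + outer (P1 z) (P2 z)))"
proof -
 have half: "\<exists>A. continuous_on S A \<and> (\<forall>z\<in>S. lder (\<lambda>z. G1 z *\<^sub>R P2 z) (A z) (G1 z *\<^sub>R L2 z + outer (P2 z) (P1 z)) z)
   \<and> continuous_on S (\<lambda>z. G1 z *\<^sub>R L2 z + outer (P2 z) (P1 z))"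
  if L1: "has_levi S G1 P1 L1" and L2: "has_levi S G2 P2 L2" for G1 P1 L1 G2 P2 L2
 proof -
  obtain A1 where A1: "\<And>z. z \<in> S \<Longrightarrow> lder P1 (A1 z) (L1 z) z"
   and G1: "\<And>z. z \<in> S \<Longrightarrow> wder G1 (P1 z) z"
   using L1 unfolding has_levi_def by blast
  obtain A2 where A2: "continuous_on S A2" "\<And>z. z \<in> S \<Longrightarrow> lder P2 (A2 z) (L2 z) z"
   and cL: "continuous_on S L2"
   using L2 unfolding has_levi_def by blast
  have cP: "continuous_on S P1" "continuous_on S G1" "continuous_on S P2"
   using has_derivative_continuous[OF A1] has_derivative_continuous[OF A2(2)] has_derivative_continuous[OF G1]
   by (auto intro!: continuous_at_imp_continuous_on)
  let ?A = "\<lambda>z. G1 z *\<^sub>R A2 z + (\<chi> i j. P2 z $ i * P1 z $ j)"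
  have "lder (\<lambda>z. G1 z *\<^sub>R P2 z) (?A z) (G1 z *\<^sub>R L2 z + outer (P2 z) (P1 z)) z" if z: "z \<in> S" for z
  proof (rule has_derivative_eq_rhs[OF has_derivative_scaleR[OF G1[OF z] A2(2)[OF z]]], intro ext)
   fix h
   have "(2 * Re (dotp (P1 z) h)) *\<^sub>R P2 z = (\<chi> i j. P2 z $ i * P1 z $ j) *v h + outer (P2 z) (P1 z) *v cnjv h"
    by (simp add: outer_mult outerl_mult two_Re_scaleR)
   moreover have "G1 z *\<^sub>R (A2 z *v h + L2 z *v cnjv h) = (G1 z *\<^sub>R A2 z) *v h + (G1 z *\<^sub>R L2 z) *v cnjv h"
    by (simp add: scaleR_matrix_vector scaleR_right_distrib)
   ultimately show "G1 z *\<^sub>R (A2 z *v h + L2 z *v cnjv h) + (2 * Re (dotp (P1 z) h)) *\<^sub>R P2 z =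
    ?A z *v h + (G1 z *\<^sub>R L2 z + outer (P2 z) (P1 z)) *v cnjv h"
    by (simp add: matrix_vector_mult_add_rdistrib)
  qed
  moreover have "continuous_on S ?A" "continuous_on S (\<lambda>z. G1 z *\<^sub>R L2 z + outer (P2 z) (P1 z))"
   unfolding outer_def using A2(1) cL cP by (auto intro!: continuous_intros)
  ultimately show ?thesis by blast
 qed
 obtain A where A: "continuous_on S A" "\<And>z. z \<in> S \<Longrightarrow> lder (\<lambda>z. G1 z *\<^sub>R P2 z) (A z) (G1 z *\<^sub>R L2 z + outer (P2 z) (P1 z)) z"
  "continuous_on S (\<lambda>z. G1 z *\<^sub>R L2 z + outer (P2 z) (P1 z))" using half[OF L1 L2] by blast
 obtain B where B: "continuous_on S B" "\<And>z. z \<in> S \<Longrightarrow> lder (\<lambda>z. G2 z *\<^sub>R P1 z) (B z) (G2 z *\<^sub>R L1 z + outer (P1 z) (P2 z)) z"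
  "continuous_on S (\<lambda>z. G2 z *\<^sub>R L1 z + outer (P1 z) (P2 z))" using half[OF L2 L1] by blast
 show ?thesis unfolding has_levi_def
 proof (intro conjI ballI exI[of _ "\<lambda>z. A z + B z"])
  fix z assume z: "z \<in> S"
  show "lder (\<lambda>z. G1 z *\<^sub>R P2 z + G2 z *\<^sub>R P1 z) (A z + B z) ((G1 z *\<^sub>R L2 z + outer (P2 z) (P1 z)) + (G2 z *\<^sub>R L1 z + outer (P1 z) (P2 z))) z"
   by (rule has_derivative_eq_rhs[OF has_derivative_add[OF A(2)[OF z] B(2)[OF z]]])
     (simp add: fun_eq_iff matrix_vector_mult_add_rdistrib)
  have "wder G1 (P1 z) z" "wder G2 (P2 z) z"
   using L1 L2 z unfolding has_levi_def by auto
  from has_derivative_mult[OF this]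
  show "wder (\<lambda>z. G1 z * G2 z) (G1 z *\<^sub>R P2 z + G2 z *\<^sub>R P1 z) z"
   by (rule has_derivative_eq_rhs) (simp add: fun_eq_iff dotp_simps algebra_simps)
 qed (use A B in \<open>auto intro!: continuous_intros\<close>)
qed

text \<open>For holomorphic \<open>F\<close> the second derivatives \<open>Q\<close> are complex
  linear and land in the hidden coefficient \<open>A\<close>; the antilinear part is the pull-back
  of \<open>L\<close> alone. This is why \<open>has_levi\<close> leaves \<open>A\<close>
  existentially quantified.\<close>

lemma has_levi_compose:
 assumes L: "has_levi S G P L" and F: "holo_on F T" "open T" "F ` T \<subseteq> S"
 shows "has_levi T (\<lambda>z. G (F z)) (\<lambda>z. transpose (Jac F z) *v P (F z)) (\<lambda>z. pullback_matrix (Jac F z) (L (F z)))"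
proof -
 obtain A where A: "continuous_on S A" "\<And>z. z \<in> S \<Longrightarrow> lder P (A z) (L z) z"
  and G: "\<And>z. z \<in> S \<Longrightarrow> wder G (P z) z"
  and cL: "continuous_on S L"
  using L unfolding has_levi_def by blast
 have cP: "continuous_on S P" using A(2)
  by (meson continuous_at_imp_continuous_on has_derivative_continuous)
 have cF: "continuous_on T F" by (rule holo_on_continuous[OF F(1)])
 have comp: "continuous_on T (\<lambda>z. f (F z))" if "continuous_on S f" for f :: "_ \<Rightarrow> 'z::topological_space"
  by (rule continuous_on_compose2[OF that cF F(3)])
 define Q where "Q z l j i = frechet_derivative (\<lambda>z. Jac F z $ l $ j) (at z) (axis i 1)" for z l j i
 have dJ: "((\<lambda>z. Jac F z $ l $ j) has_derivative (\<lambda>h. \<Sum>i\<in>UNIV. Q z l j i * h $ i)) (at z)" if z: "z \<in> T" for z l j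
 proof -
  have h: "hol_fun (\<lambda>z. Jac F z $ l $ j) T" by (rule Jac_hol[OF F(1,2)])
  have "linear (frechet_derivative (\<lambda>z. Jac F z $ l $ j) (at z))"
   using hol_funD(1)[OF h z] has_derivative_linear by blast
  then have "frechet_derivative (\<lambda>z. Jac F z $ l $ j) (at z) h = (\<Sum>i\<in>UNIV. Q z l j i * h $ i)" for h
   using arg_cong[OF vec_sum_axis[of h], of "frechet_derivative (\<lambda>z. Jac F z $ l $ j) (at z)"]
   by (simp add: linear_sum hol_funD(2)[OF h z] Q_def mult.commute)
  then have "frechet_derivative (\<lambda>z. Jac F z $ l $ j) (at z) = (\<lambda>h. \<Sum>i\<in>UNIV. Q z l j i * h $ i)" by blast
  with hol_funD(1)[OF h z] show ?thesis by simp
 qed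
 have cQ: "continuous_on T (\<lambda>z. Q z l j i)" for l j i
  unfolding Q_def by (rule hol_fun_derivative(1)[OF Jac_hol[OF F(1,2)] F(2)])
 let ?B = "\<lambda>z. \<chi> j i. \<Sum>l\<in>UNIV. Q z l j i * P (F z) $ l"
 let ?A = "\<lambda>z. transpose (Jac F z) ** (A (F z) ** Jac F z) + ?B z"
 have cJ: "continuous_on T (Jac F)" by (rule Jac_continuous[OF F(1,2)])
 show ?thesis unfolding has_levi_def
 proof (intro conjI ballI exI[of _ ?A])
  show "continuous_on T (\<lambda>z. pullback_matrix (Jac F z) (L (F z)))"
   unfolding pullback_matrix_def by (intro continuous_intros cJ comp[OF cL])
  show "continuous_on T ?A"
   unfolding matrix_matrix_mult_def transpose_def vec_lambda_beta by (intro continuous_intros cJ comp[OF cP] comp[OF A(1)] cQ)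
  fix z assume z: "z \<in> T"
  then have Fz: "F z \<in> S" using F by auto
  have dF: "(F has_derivative (\<lambda>h. Jac F z *v h)) (at z)" by (rule holo_on_Jac[OF F(1) z])
  show "wder (\<lambda>z. G (F z)) (transpose (Jac F z) *v P (F z)) z"
   by (rule has_derivative_eq_rhs[OF has_derivative_compose[OF dF G[OF Fz]]]) (simp only: dotp_transpose)
  show "lder (\<lambda>z. transpose (Jac F z) *v P (F z)) (?A z) (pullback_matrix (Jac F z) (L (F z))) z"
  proof (rule has_derivative_vec_componentwise)
   fix j
   let ?X = "\<lambda>h. A (F z) *v (Jac F z *v h) + L (F z) *v cnjv (Jac F z *v h)"
   have "((\<lambda>z. \<Sum>l\<in>UNIV. Jac F z $ l $ j * P (F z) $ l) has_derivative
     (\<lambda>h. \<Sum>l\<in>UNIV. Jac F z $ l $ j * ?X h $ l + (\<Sum>i\<in>UNIV. Q z l j i * h $ i) * P (F z) $ l)) (at z)"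
    by (intro has_derivative_sum has_derivative_mult dJ[OF z] bounded_linear.has_derivative[OF bounded_linear_vec_nth]
      has_derivative_compose[OF dF A(2)[OF Fz]])
   moreover have "(\<Sum>l\<in>UNIV. Jac F z $ l $ j * ?X h $ l + (\<Sum>i\<in>UNIV. Q z l j i * h $ i) * P (F z) $ l) =
     (?A z *v h + pullback_matrix (Jac F z) (L (F z)) *v cnjv h) $ j" for h
   proof -
    have "(\<Sum>l\<in>UNIV. (\<Sum>i\<in>UNIV. Q z l j i * h $ i) * P (F z) $ l) = (\<Sum>l\<in>UNIV. \<Sum>i\<in>UNIV. Q z l j i * P (F z) $ l * h $ i)"
     by (simp add: sum_distrib_right sum_distrib_left mult_ac)
    also have "\<dots> = (?B z *v h) $ j"
     by (subst sum.swap) (simp add: matrix_vector_mult_def sum_distrib_right)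
    finally have 1: "(\<Sum>l\<in>UNIV. (\<Sum>i\<in>UNIV. Q z l j i * h $ i) * P (F z) $ l) = (?B z *v h) $ j" .
    have "(\<Sum>l\<in>UNIV. Jac F z $ l $ j * ?X h $ l) = (transpose (Jac F z) *v ?X h) $ j"
     by (simp only: transpose_mult_nth)
    also have "transpose (Jac F z) *v ?X h = (transpose (Jac F z) ** (A (F z) ** Jac F z)) *v h + pullback_matrix (Jac F z) (L (F z)) *v cnjv h"
     by (simp add: matrix_vector_right_distrib pullback_matrix_alt cnjv_mult matrix_vector_mul_assoc matrix_mul_assoc)
    finally show ?thesis using 1 by (simp add: sum.distrib matrix_vector_mult_add_rdistrib)
   qed
   ultimately show "((\<lambda>z. (transpose (Jac F z) *v P (F z)) $ j) has_derivative (\<lambda>h. (?A z *v h + pullback_matrix (Jac F z) (L (F z)) *v cnjv h) $ j)) (at z)"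
    by (simp only: transpose_mult_nth)
  qed
 qed
qed

text \<open>If the imaginary part had a sign at \<open>a\<close>, continuity would bound it away
  from 0 on a small disc, against the second half of \<open>disc_mean_aux\<close> applied to
  \<open>s * G\<close> with s = 1 or s = -1.\<close>

lemma has_levi_real:
 assumes L: "has_levi S G P L" and S: "open S" "a \<in> S"
 shows "Im (hform (L a) w) = 0"
proof -
 obtain A where A: "\<And>t. a + t *s w \<in> S \<Longrightarrow> ((\<lambda>t. G (a + t *s w)) has_derivative (\<lambda>h. 2 * Re (dotp (P (a + t *s w)) w * h))) (at t)"
   "\<And>t. a + t *s w \<in> S \<Longrightarrow> ((\<lambda>t. dotp (P (a + t *s w)) w) has_derivative (\<lambda>h. A t * h + hform (L (a + t *s w)) w * cnj h)) (at t)"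
   "continuous_on {t. a + t *s w \<in> S} A" "continuous_on {t. a + t *s w \<in> S} (\<lambda>t. hform (L (a + t *s w)) w)"
  using has_levi_line[OF L, of a w] by meson
 let ?l = "\<lambda>t::complex. hform (L (a + t *s w)) w"
 let ?D = "{t::complex. a + t *s w \<in> S}"
 have oD: "open ?D"
  using open_vimage[OF S(1), of "\<lambda>t. a + t *s w"] continuous_on_add[OF continuous_on_const continuous_on_scalar_left[OF continuous_on_id], of UNIV a w]
  by (simp add: vimage_def)
 have D0: "0 \<in> ?D" using S by simp
 have *: "s * Im (?l 0) \<le> 0" if s: "s = 1 \<or> s = -1" for s
 proof (rule ccontr)
  assume "\<not> ?thesis"
  then have pos: "s * Im (?l 0) > 0" by simp
  have "continuous_on ?D (\<lambda>t. s * Im (?l t))" by (intro continuous_intros A(4))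
  then have "open {t\<in>?D. s * Im (?l 0) / 2 < s * Im (?l t)}"
   using continuous_open_preimage[OF _ oD, of "\<lambda>t. s * Im (?l t)" "{s * Im (?l 0) / 2<..}"]
   by (simp add: vimage_def Int_def)
  moreover have "0 \<in> {t\<in>?D. s * Im (?l 0) / 2 < s * Im (?l t)}" using D0 pos by simp
  ultimately obtain R where R: "R > 0" "cball (0::complex) R \<subseteq> {t\<in>?D. s * Im (?l 0) / 2 < s * Im (?l t)}"
   using open_contains_cball by blast
  then have sub: "cball 0 R \<subseteq> ?D" by auto
  have c: "continuous_on (cball (0::complex) R) (\<lambda>t::complex. of_real s * A t :: complex)" "continuous_on (cball (0::complex) R) (\<lambda>t::complex. of_real s * ?l t)"
   by (rule continuous_on_mult[OF continuous_on_const continuous_on_subset[OF A(3) sub]],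
     rule continuous_on_mult[OF continuous_on_const continuous_on_subset[OF A(4) sub]])
  have "s * Im (?l 0) / 2 \<le> 0"
  proof (rule disc_mean_aux(2)[OF R(1) _ _ c])
   fix t :: complex assume "t \<in> cball 0 R"
   then have z: "a + t *s w \<in> S" using sub by auto
   show "((\<lambda>t::complex. s * G (a + t *s w)) has_derivative (\<lambda>h. 2 * Re ((of_real s * dotp (P (a + t *s w)) w) * h))) (at t)"
    by (rule has_derivative_eq_rhs[OF has_derivative_mult_right[OF A(1)[OF z]]]) (simp add: fun_eq_iff algebra_simps)
   show "((\<lambda>t. of_real s * dotp (P (a + t *s w)) w) has_derivative (\<lambda>h. of_real s * A t * h + of_real s * ?l t * cnj h)) (at t)"
    by (rule has_derivative_eq_rhs[OF has_derivative_mult_right[OF A(2)[OF z]]]) (simp add: fun_eq_iff algebra_simps)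
  qed (use R in auto)
  with pos show False by simp
 qed
 from *[of 1] *[of "-1"] show ?thesis by simp
qed

section \<open>Plurisubharmonic functions in coordinates\<close>

text \<open>The sub-mean-value property of \<open>u \<le> B\<close> is restated for the nonnegative function \<open>B - u\<close>, so
 that Tonelli and Fatou apply without integrability conditions.\<close>

definition gap :: "real \<Rightarrow> ('a \<Rightarrow> ereal) \<Rightarrow> 'a \<Rightarrow> ennreal" where
 "gap B u z = e2ennreal (ereal B - u z)"

abbreviation lborel_nn_integral :: "('a::euclidean_space \<Rightarrow> ennreal) \<Rightarrow> ennreal" (binder "\<integral>\<^sub>+" 10)
 where "lborel_nn_integral f \<equiv> nn_integral lborel f"

abbreviation lborel_integral :: "('a::euclidean_space \<Rightarrow> 'b::{banach, second_countable_topology}) \<Rightarrow> 'b" (binder "\<integral>\<^sub>L" 10)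
 where "lborel_integral f \<equiv> integral\<^sup>L lborel f"

text \<open>Not divided by the length of the circle: the factor 2 pi is carried on the other side of
  all inequalities.\<close>

definition cint :: "(complex^'n::finite \<Rightarrow> ennreal) \<Rightarrow> complex^'n \<Rightarrow> complex^'n \<Rightarrow> ennreal" where
 "cint k a w = (\<integral>\<^sub>+t. k (a + cis t *s w) * indicator {0..2*pi} t)"

lemma gap_simps [simp]: "u z = ereal r \<Longrightarrow> gap B u z = ennreal (B - r)" "u z = -\<infinity> \<Longrightarrow> gap B u z = top"
 by (simp_all add: gap_def)

lemma nn_integral_circle_const: "(\<integral>\<^sub>+t. c * indicator {0..2*pi} t) = c * ennreal (2*pi)"
 by (simp add: nn_integral_cmult_indicator pi_ge_zero)

text \<open>Formally the integral of B - u is 2 pi B minus that of \<open>u\<close>. Since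
  subtraction of extended nonnegative numbers loses information, \<open>pt\<close> states this with
  the negative terms moved across; both \<open>ennreal B\<close> and \<open>ennreal (- B)\<close>
  occur, so \<open>B\<close> may have either sign. Only the integral of the negative part can be
  infinite, and then either side of the equivalence means u a = -\<infinity>.\<close>

lemma circle_mean_iff:
 assumes B: "\<And>t. u (a + cis t *s w) \<le> ereal B" "u a < \<infinity>" "u a \<le> ereal B"
  and m[measurable]: "(\<lambda>t. u (a + cis t *s w)) \<in> borel_measurable borel"
 shows "u a \<le> circle_mean u a w \<longleftrightarrow> cint (gap B u) a w \<le> ennreal (2*pi) * gap B u a"
proof -
 let ?v = "\<lambda>t. u (a + cis t *s w)" and ?I = "indicator {0..2*pi} :: real \<Rightarrow> ennreal"
 define Pp where "Pp = (\<integral>\<^sub>+t. e2ennreal (?v t) * ?I t)"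
 define N where "N = (\<integral>\<^sub>+t. e2ennreal (- ?v t) * ?I t)"
 define K where "K = cint (gap B u) a w"
 have mean: "circle_mean u a w = (enn2ereal Pp - enn2ereal N) / ereal (2*pi)"
  by (simp add: circle_mean_def Pp_def N_def)
 have pt: "gap B u (a + cis t *s w) + e2ennreal (?v t) + ennreal (- B) = e2ennreal (- ?v t) + ennreal B" for t
  using B(1)[of t]
  by (cases "?v t"; cases "real_of_ereal (?v t) \<ge> 0"; cases "B \<ge> 0")
    (auto simp: ennreal_neg ennreal_plus[symmetric] simp del: ennreal_plus)
 have meas [measurable]: "(\<lambda>t. gap B u (a + cis t *s w)) \<in> borel_measurable borel"
  unfolding gap_def by measurable
 have meas1: "(\<lambda>t. gap B u (a + cis t *s w) * ?I t) \<in> borel_measurable lborel" by measurable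
 have meas2: "(\<lambda>t. e2ennreal (?v t) * ?I t) \<in> borel_measurable lborel" by measurable
 have meas3: "(\<lambda>t. c * ?I t) \<in> borel_measurable lborel" for c by measurable
 have "K + Pp + ennreal (-B) * ennreal (2*pi) = N + ennreal B * ennreal (2*pi)"
 proof -
  have "K + Pp + ennreal (-B) * ennreal (2*pi) = (\<integral>\<^sub>+t. (gap B u (a + cis t *s w) + e2ennreal (?v t) + ennreal (- B)) * ?I t)"
   unfolding K_def Pp_def cint_def nn_integral_circle_const[symmetric] distrib_right
   by (simp only: nn_integral_add[symmetric] meas1 meas2 meas3 borel_measurable_add)
  also have "\<dots> = (\<integral>\<^sub>+t. (e2ennreal (- ?v t) + ennreal B) * ?I t)" unfolding pt ..
  also have "\<dots> = N + ennreal B * ennreal (2*pi)"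
   unfolding N_def nn_integral_circle_const[symmetric] distrib_right by (subst nn_integral_add; simp)
  finally show ?thesis .
 qed
 then have sumK: "K + Pp + ennreal (-B * (2*pi)) = N + ennreal (B * (2*pi))"
  by (simp add: ennreal_mult''[symmetric] pi_ge_zero)
 have "Pp \<le> (\<integral>\<^sub>+t. ennreal B * ?I t)" unfolding Pp_def
  using B(1) e2ennreal_mono by (intro nn_integral_mono mult_right_mono) (fastforce, simp)
 then have "Pp < top" unfolding nn_integral_circle_const by (simp add: ennreal_mult_less_top order_le_less_trans)
 then obtain p where p: "Pp = ennreal p" "p \<ge> 0" by (cases Pp) auto
 show ?thesis
 proof (cases N)
  case top
  then have "K = top" using sumK p by (auto simp: ennreal_plus[symmetric] simp del: ennreal_plus)
  moreover have "circle_mean u a w = -\<infinity>" using top p by (simp add: mean)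
  ultimately show ?thesis
   using B(2) by (cases "u a") (auto simp: K_def[symmetric] ennreal_mult_eq_top_iff top_unique ennreal_mult_top pi_ge_zero)
 next
  case (real n)
  then have "K < top" using sumK p
   by (metis add_top ennreal_add_eq_top ennreal_neq_top infinity_ennreal_def less_top)
  then obtain b where k: "K = ennreal b" "b \<ge> 0" by (cases K) auto
  have eq: "b + p - n = B * (2*pi)"
  proof (cases "B \<ge> 0")
   case True
   then have "ennreal (b + p) = ennreal (n + B * (2*pi))" "n + B * (2*pi) \<ge> 0"
    using sumK k p real by (simp_all add: ennreal_neg pi_ge_zero)
   then show ?thesis using k p by (simp del: ennreal_plus)
  next
   case False
   then have nn: "0 \<le> - B * (2*pi)" by (intro mult_nonneg_nonneg) (auto simp: pi_ge_zero)
   then have z: "ennreal (B * (2*pi)) = 0" by (intro ennreal_neg) auto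
   have "ennreal (b + p + - B * (2*pi)) = ennreal n"
    using sumK k p real nn z by (simp only: ennreal_plus add_nonneg_nonneg) simp
   then have "b + p + - B * (2*pi) = n" using real k p nn by (subst (asm) ennreal_inj) auto
   then show ?thesis by simp
  qed
  have cm: "circle_mean u a w = ereal ((p - n) / (2*pi))" using real p by (simp add: mean)
  show ?thesis
  proof (cases "u a")
   case (real r)
   have rB: "r \<le> B" using B(3) real by simp
   then have "ennreal (2*pi) * ennreal (B - r) = ennreal (2*pi*(B - r))" using ennreal_mult''[of "B - r" "2*pi"] by simp
   moreover have "r \<le> (p - n) / (2*pi) \<longleftrightarrow> r * (2*pi) \<le> p - n" by (simp add: pos_le_divide_eq)
   then have "r \<le> (p - n) / (2*pi) \<longleftrightarrow> b \<le> 2*pi*(B - r)" using eq by (auto simp: algebra_simps)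
   moreover have "0 \<le> 2*pi*(B - r)" using rB by (simp add: pi_ge_zero)
   ultimately show ?thesis using k real by (simp add: cm K_def[symmetric])
  qed (use B(2) cm K_def k in \<open>auto simp: ennreal_mult_top pi_ge_zero\<close>)
 qed
qed

lemma psh_coord_usc: "psh_coord S u \<Longrightarrow> open S \<Longrightarrow> open {z\<in>S. u z < t}"
 unfolding psh_coord_def using openin_open_trans by blast

lemma psh_coord_less_top: "psh_coord S u \<Longrightarrow> z \<in> S \<Longrightarrow> u z < \<infinity>"
 unfolding psh_coord_def by blast

lemma usc_measurable_comp:
 assumes "\<And>t::ereal. open {z\<in>S. u z < t}" "continuous_on UNIV f" "\<And>x::real. f x \<in> S"
 shows "(\<lambda>x. u (f x) :: ereal) \<in> borel_measurable borel"
proof (rule borel_measurableI_less)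
 fix t
 have "{x. u (f x) < t} = f -` {z\<in>S. u z < t}" using assms(3) by auto
 then show "{x \<in> space borel. u (f x) < t} \<in> sets borel"
  using open_vimage[OF assms(1) assms(2)] by simp
qed

lemma circle_continuous: "continuous_on T (\<lambda>t. a + cis t *s w)"
 by (intro continuous_intros)

text \<open>Extending \<open>u\<close> by \<infinity> off \<open>S\<close> keeps the sublevel sets
  open, and the gap of the value \<infinity> is 0.\<close>

lemma usc_measurable:
 assumes "\<And>t::ereal. open {z\<in>S. u z < t}" "open S"
 shows "(\<lambda>z. if z \<in> S then gap B u z else 0) \<in> borel_measurable (borel :: 'a::topological_space measure)"
proof -
 have "(\<lambda>z. if z \<in> S then u z else \<infinity>) \<in> borel_measurable borel"
 proof (rule borel_measurableI_less)
  fix t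
  have "{x. (if x \<in> S then u x else \<infinity>) < t} = {z\<in>S. u z < t}" by auto
  then show "{x \<in> space borel. (if x \<in> S then u x else \<infinity>) < t} \<in> sets borel" using assms(1) by simp
 qed
 then have "(\<lambda>z. gap B (\<lambda>z. if z \<in> S then u z else \<infinity>) z) \<in> borel_measurable borel" unfolding gap_def by measurable
 moreover have "(\<lambda>z. gap B (\<lambda>z. if z \<in> S then u z else \<infinity>) z) = (\<lambda>z. if z \<in> S then gap B u z else 0)"
  by (auto simp: gap_def e2ennreal_neg)
 ultimately show ?thesis by simp
qed

lemma usc_bounded_above:
 assumes usc: "\<And>t::ereal. open {z\<in>S. u z < t}" and "\<And>z. z \<in> S \<Longrightarrow> u z < \<infinity>" "compact K" "K \<subseteq> S"
 shows "\<exists>B::real. \<forall>z\<in>K. u z < ereal B"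
proof -
 have cov: "K \<subseteq> (\<Union>n::nat. {z\<in>S. u z < ereal (real n)})"
 proof
  fix z assume "z \<in> K"
  then have "u z < \<infinity>" "z \<in> S" using assms by auto
  then obtain n :: nat where "u z < ereal (real n)" using less_PInf_Ex_of_nat by auto
  with \<open>z \<in> S\<close> show "z \<in> (\<Union>n::nat. {z\<in>S. u z < ereal (real n)})" by auto
 qed
 obtain D where D: "finite D" "K \<subseteq> (\<Union>n\<in>D. {z\<in>S. u z < ereal (real n)})"
  by (rule compactE_image[OF assms(3), of UNIV "\<lambda>n::nat. {z\<in>S. u z < ereal (real n)}", OF usc cov]) (rule that)
 have "u z < ereal (Max (insert 0 (real ` D)))" if zK: "z \<in> K" for z
 proof -
  obtain n where "n \<in> D" "u z < ereal (real n)" using subsetD[OF D(2) zK] by auto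
  moreover have "real n \<le> Max (insert 0 (real ` D))" using D(1) \<open>n \<in> D\<close> by auto
  ultimately show ?thesis by (metis ereal_less_eq(3) order_less_le_trans)
 qed
 then show ?thesis by blast
qed

abbreviation cdisc :: "complex^'n::finite \<Rightarrow> complex^'n \<Rightarrow> (complex^'n) set" where
 "cdisc a w \<equiv> {a + c *s w | c. cmod c \<le> 1}"

lemma compact_disc: "compact (cdisc a w)"
proof -
 have "cdisc a w = (\<lambda>c. a + c *s w) ` cball 0 1" by auto
 then show ?thesis by (auto intro!: compact_continuous_image continuous_intros)
qed

lemma circle_in_disc: "a + cis t *s w \<in> cdisc a w"
 by (auto intro!: exI[of _ "cis t"])

lemma center_in_disc: "a \<in> cdisc a w"
 by (auto intro!: exI[of _ "0::complex"])

lemma psh_disc_iff: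
 assumes usc: "\<And>t. open {z\<in>S. u z < t}" and lt: "\<And>z. z \<in> S \<Longrightarrow> u z < \<infinity>"
  and disc: "cdisc a w \<subseteq> S"
  and B: "\<And>z. z \<in> cdisc a w \<Longrightarrow> u z \<le> ereal B"
 shows "u a \<le> circle_mean u a w \<longleftrightarrow> cint (gap B u) a w \<le> ennreal (2*pi) * gap B u a"
proof (rule circle_mean_iff)
 show "(\<lambda>v. u (a + cis v *s w)) \<in> borel_measurable borel"
  by (rule usc_measurable_comp[OF usc circle_continuous]) (rule subsetD[OF disc circle_in_disc])
qed (rule B[OF circle_in_disc] lt[OF subsetD[OF disc center_in_disc]] B[OF center_in_disc])+

lemma psh_coord_cint:
 assumes u: "psh_coord S u" and S: "open S" and disc: "cdisc a w \<subseteq> S"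
  and B: "\<And>z. z \<in> cdisc a w \<Longrightarrow> u z \<le> ereal B"
 shows "cint (gap B u) a w \<le> ennreal (2*pi) * gap B u a"
proof -
 have "u a \<le> circle_mean u a w" using u disc unfolding psh_coord_def by blast
 then show ?thesis
  using psh_disc_iff[OF psh_coord_usc[OF u S] psh_coord_less_top[OF u] disc B] by simp
qed

text \<open>The bound \<open>B\<close> may depend on the disc: for every upper bound the inequality
  is equivalent to the sub-mean-value property, by \<open>psh_disc_iff\<close>.\<close>

lemma psh_coordI:
 assumes S: "open S" and lt: "\<And>z. z \<in> S \<Longrightarrow> u z < \<infinity>" and usc: "\<And>t. open {z\<in>S. u z < t}"
  and c: "\<And>a w. cdisc a w \<subseteq> S \<Longrightarrow>
   \<exists>B. (\<forall>z\<in>cdisc a w. u z \<le> ereal B) \<and> cint (gap B u) a w \<le> ennreal (2*pi) * gap B u a"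
 shows "psh_coord S u"
 unfolding psh_coord_def
proof (intro conjI ballI allI impI)
 fix t show "openin (top_of_set S) {z \<in> S. u z < t}"
  using usc[of t] by (simp add: openin_open_eq S)
next
 fix a w assume disc: "cdisc a w \<subseteq> S"
 from c[OF this] obtain B where B: "\<And>z. z \<in> cdisc a w \<Longrightarrow> u z \<le> ereal B" "cint (gap B u) a w \<le> ennreal (2*pi) * gap B u a"
  by blast
 then show "u a \<le> circle_mean u a w"
  using psh_disc_iff[OF usc lt disc B(1)] by simp
qed (use lt in auto)

lemma psh_coord_bound:
 assumes "psh_coord S u" "open S" "cdisc a w \<subseteq> S"
 shows "\<exists>B. \<forall>z\<in>cdisc a w. u z \<le> ereal B"
 using usc_bounded_above[OF psh_coord_usc[OF assms(1,2)] psh_coord_less_top[OF assms(1)] compact_disc assms(3)] less_imp_le by blast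

lemma psh_coord_subset: "psh_coord S u \<Longrightarrow> open T \<Longrightarrow> open S \<Longrightarrow> T \<subseteq> S \<Longrightarrow> psh_coord T u"
proof -
 assume u: "psh_coord S u" and T: "open T" "open S" "T \<subseteq> S"
 have "{z\<in>T. u z < t} = T \<inter> {z\<in>S. u z < t}" for t using T by auto
 then show ?thesis using u T psh_coord_usc[OF u T(2)] unfolding psh_coord_def
  by (auto intro!: open_openin_trans open_Int)
qed

lemma psh_coord_cong: "psh_coord S u \<Longrightarrow> open S \<Longrightarrow> (\<And>z. z \<in> S \<Longrightarrow> u z = v z) \<Longrightarrow> psh_coord S v"
proof (rule psh_coordI)
 assume u: "psh_coord S u" and S: "open S" and eq: "\<And>z. z \<in> S \<Longrightarrow> u z = v z"
 show "v z < \<infinity>" if "z \<in> S" for z using psh_coord_less_top[OF u that] eq[OF that] by simp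
 have "{z\<in>S. v z < t} = {z\<in>S. u z < t}" for t using eq by auto
 then show "open {z\<in>S. v z < t}" for t using psh_coord_usc[OF u S] by simp
 fix a w :: "complex^'a" assume d: "cdisc a w \<subseteq> S"
 obtain B where B: "\<And>z. z \<in> cdisc a w \<Longrightarrow> u z \<le> ereal B" using psh_coord_bound[OF u S d] by blast
 have "gap B v z = gap B u z" if "z \<in> S" for z using eq[OF that] by (simp add: gap_def)
 moreover have "a + cis b *s w \<in> S" "a \<in> S" for b by (rule subsetD[OF d circle_in_disc] subsetD[OF d center_in_disc])+
 ultimately have "cint (gap B v) a w = cint (gap B u) a w" "gap B v a = gap B u a" unfolding cint_def by simp_all
 with psh_coord_cint[OF u S d B] B eq d
 show "\<exists>B. (\<forall>z\<in>cdisc a w. v z \<le> ereal B) \<and> cint (gap B v) a w \<le> ennreal (2*pi) * gap B v a"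
  by (intro exI[of _ B]) (use d in force)
qed

lemma cint_continuous:
 assumes c: "continuous_on UNIV (\<lambda>t. G (a + cis t *s w))" and B: "\<And>t. G (a + cis t *s w) \<le> B"
 shows "cint (\<lambda>z. ennreal (B - G z)) a w = ennreal (2*pi*B - integral {0..2*pi} (\<lambda>t. G (a + cis t *s w)))"
proof -
 have "((\<lambda>t. G (a + cis t *s w)) has_integral integral {0..2*pi} (\<lambda>t. G (a + cis t *s w))) {0..2*pi}"
  by (intro integrable_integral integrable_continuous_interval continuous_on_subset[OF c]) auto
 from has_integral_diff[OF has_integral_const_real[of B 0 "2*pi"] this]
 have "((\<lambda>t. B - G (a + cis t *s w)) has_integral (2*pi*B - integral {0..2*pi} (\<lambda>t. G (a + cis t *s w)))) {0..2*pi}"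
  by (simp add: pi_ge_zero)
 from nn_integral_has_integral_lebesgue'[OF _ this] B show ?thesis by (simp add: cint_def)
qed

lemma usc_add:
 assumes u: "\<And>t::ereal. open {z\<in>S. u z < t}" and S: "open S" and G: "continuous_on S G"
 shows "open {z\<in>S. u z + ereal (G z) < t}"
proof -
 have "{z\<in>S. u z + ereal (G z) < t} = (\<Union>r::real. {z\<in>S. u z < ereal r} \<inter> {z\<in>S. ereal (G z) < t - ereal r})" (is "?L = ?R")
 proof (intro set_eqI iffI)
  fix z assume "z \<in> ?L"
  then have z: "z \<in> S" "u z + ereal (G z) < t" by auto
  then have "u z < t - ereal (G z)" by (cases "u z"; cases t) auto
  then obtain r where r: "u z < ereal r" "ereal r < t - ereal (G z)" using ereal_dense2 by blast
  then have "ereal (G z) < t - ereal r" by (cases t) auto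
  with z r show "z \<in> ?R" by auto
 next
  fix z assume "z \<in> ?R"
  then obtain r where "z \<in> S" "u z < ereal r" "ereal (G z) < t - ereal r" by auto
  then show "z \<in> ?L" by (cases "u z"; cases t) auto
 qed
 moreover have "open {z\<in>S. ereal (G z) < s}" for s
  using continuous_open_preimage[OF _ S open_lessThan, of "\<lambda>z. ereal (G z)" s] G
  by (simp add: vimage_def Int_def continuous_on_ereal)
 ultimately show ?thesis using u by (auto intro!: open_Int)
qed

text \<open>\<open>G\<close> is real and continuous, so its circle integral is an ordinary one, and
  the gaps of \<open>u\<close> with respect to \<open>B\<close> and of \<open>G\<close> with respect
  to \<open>B2\<close> simply add.\<close>

lemma psh_coord_add:
 fixes G :: "complex^'n::finite \<Rightarrow> real"
 assumes u: "psh_coord S u" and S: "open S" and G: "continuous_on S G"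
  and Gm: "\<And>a w. cdisc a w \<subseteq> S \<Longrightarrow> 2*pi*G a \<le> integral {0..2*pi} (\<lambda>v. G (a + cis v *s w))"
 shows "psh_coord S (\<lambda>z. u z + ereal (G z))"
proof (rule psh_coordI[OF S])
 show "u z + ereal (G z) < \<infinity>" if "z \<in> S" for z using psh_coord_less_top[OF u that] by (cases "u z") auto
 show "open {z\<in>S. u z + ereal (G z) < t}" for t by (rule usc_add[OF psh_coord_usc[OF u S] S G])
 fix a w :: "complex^'n" let ?D = "cdisc a w"
 assume d: "?D \<subseteq> S"
 obtain B where B: "\<And>z. z \<in> ?D \<Longrightarrow> u z \<le> ereal B" using psh_coord_bound[OF u S d] by blast
 have "bounded (G ` ?D)" by (intro compact_imp_bounded compact_continuous_image compact_disc continuous_on_subset[OF G d])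
 then obtain B2 where "\<forall>x\<in>G ` ?D. norm x \<le> B2" unfolding bounded_iff by blast
 then have B2: "G z \<le> B2" if "z \<in> ?D" for z
  using imageI[OF that, of G] abs_le_D1[of "G z" B2] unfolding real_norm_def by blast
 have circ: "a + cis v *s w \<in> ?D" "a \<in> ?D" for v by (rule circle_in_disc center_in_disc)+
 have gp: "gap (B + B2) (\<lambda>z. u z + ereal (G z)) z = gap B u z + ennreal (B2 - G z)" if "z \<in> ?D" for z
 proof (cases "u z")
  case (real r)
  then have "r \<le> B" using B[OF that] by simp
  then have "ennreal (B - r) + ennreal (B2 - G z) = ennreal ((B - r) + (B2 - G z))"
   using B2[OF that] by (intro ennreal_plus[symmetric]) auto
  then show ?thesis using real by (simp add: algebra_simps)
 qed (use psh_coord_less_top[OF u] that d in \<open>auto\<close>)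
 have mu: "(\<lambda>v. gap B u (a + cis v *s w)) \<in> borel_measurable borel" unfolding gap_def
  using usc_measurable_comp[OF psh_coord_usc[OF u S] circle_continuous[of UNIV a w]] subsetD[OF d circ(1)] by measurable
 have cG: "continuous_on UNIV (\<lambda>v. G (a + cis v *s w))"
  by (rule continuous_on_compose2[OF G circle_continuous]) (use circ d in auto)
 then have mG: "(\<lambda>v. G (a + cis v *s w)) \<in> borel_measurable borel" by (rule borel_measurable_continuous_onI)
 have "cint (gap (B + B2) (\<lambda>z. u z + ereal (G z))) a w = cint (\<lambda>z. gap B u z + ennreal (B2 - G z)) a w"
  unfolding cint_def using gp[OF circ(1)] by simp
 also have "\<dots> = cint (gap B u) a w + cint (\<lambda>z. ennreal (B2 - G z)) a w"
  unfolding cint_def distrib_right by (rule nn_integral_add) (use mu mG in measurable)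
 also have "cint (gap B u) a w \<le> ennreal (2*pi) * gap B u a" by (rule psh_coord_cint[OF u S d B])
 also have "cint (\<lambda>z. ennreal (B2 - G z)) a w = ennreal (2*pi*B2 - integral {0..2*pi} (\<lambda>v. G (a + cis v *s w)))"
  by (rule cint_continuous[OF cG B2[OF circ(1)]])
 also have "\<dots> \<le> ennreal (2*pi) * ennreal (B2 - G a)"
  using Gm[OF d] by (simp add: ennreal_mult''[symmetric] B2[OF circ(2)] ennreal_leI algebra_simps pi_ge_zero)
 also have "ennreal (2*pi) * gap B u a + ennreal (2*pi) * ennreal (B2 - G a) = ennreal (2*pi) * gap (B + B2) (\<lambda>z. u z + ereal (G z)) a"
  by (simp add: gp[OF circ(2)] distrib_left)
 finally have "cint (gap (B + B2) (\<lambda>z. u z + ereal (G z))) a w \<le> ennreal (2*pi) * gap (B + B2) (\<lambda>z. u z + ereal (G z)) a"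
  by (simp add: add_left_mono add_right_mono)
 moreover have "u z + ereal (G z) \<le> ereal (B + B2)" if "z \<in> ?D" for z
  using add_mono[OF B[OF that], of "ereal (G z)" "ereal B2"] B2[OF that] by simp
 ultimately show "\<exists>B. (\<forall>z\<in>?D. u z + ereal (G z) \<le> ereal B) \<and> cint (gap B (\<lambda>z. u z + ereal (G z))) a w \<le> ennreal (2*pi) * gap B (\<lambda>z. u z + ereal (G z)) a"
  by blast
qed

lemma has_levi_continuous: "has_levi S G P L \<Longrightarrow> continuous_on S G"
 unfolding has_levi_def by (meson continuous_at_imp_continuous_on has_derivative_continuous)

lemma psh_coord_add_levi:
 assumes u: "psh_coord S u" and S: "open S" and L: "has_levi S G P L"
  and pos: "\<And>z w. z \<in> S \<Longrightarrow> 0 \<le> qf (L z) w"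
 shows "psh_coord S (\<lambda>z. u z + ereal (G z))"
proof (rule psh_coord_add[OF u S has_levi_continuous[OF L]])
 fix a w assume d: "cdisc a w \<subseteq> S"
 show "2*pi*G a \<le> integral {0..2*pi} (\<lambda>t. G (a + cis t *s w))"
  using has_levi_mean[OF L, of a w 0] d pos by auto
qed

text \<open>The gap of the maximum lies below both gaps everywhere, and at the centre it equals one
  of them.\<close>

lemma psh_coord_max:
 assumes u: "psh_coord S u" and v: "psh_coord S v" and S: "open S"
 shows "psh_coord S (\<lambda>z. max (u z) (v z))"
proof (rule psh_coordI[OF S])
 show "max (u z) (v z) < \<infinity>" if "z \<in> S" for z using psh_coord_less_top[OF u that] psh_coord_less_top[OF v that] by (simp add: max_def)
 have "{z\<in>S. max (u z) (v z) < t} = {z\<in>S. u z < t} \<inter> {z\<in>S. v z < t}" for t by auto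
 then show "open {z\<in>S. max (u z) (v z) < t}" for t using psh_coord_usc[OF u S] psh_coord_usc[OF v S] by auto
 fix a w :: "complex^'a" let ?D = "cdisc a w"
 assume d: "?D \<subseteq> S"
 obtain B where B: "\<And>z. z \<in> ?D \<Longrightarrow> u z \<le> ereal B" using psh_coord_bound[OF u S d] by blast
 obtain B' where B': "\<And>z. z \<in> ?D \<Longrightarrow> v z \<le> ereal B'" using psh_coord_bound[OF v S d] by blast
 let ?B = "max B B'"
 have b: "u z \<le> ereal ?B" "v z \<le> ereal ?B" if "z \<in> ?D" for z
  using order_trans[OF B[OF that], of "ereal ?B"] order_trans[OF B'[OF that], of "ereal ?B"] by auto
 have g: "gap ?B (\<lambda>z. max (u z) (v z)) z \<le> gap ?B u z" "gap ?B (\<lambda>z. max (u z) (v z)) z \<le> gap ?B v z" for z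
  unfolding gap_def by (intro e2ennreal_mono ereal_minus_mono; simp)+
 have "cint (gap ?B (\<lambda>z. max (u z) (v z))) a w \<le> cint (gap ?B u) a w" "cint (gap ?B (\<lambda>z. max (u z) (v z))) a w \<le> cint (gap ?B v) a w"
  unfolding cint_def by (intro nn_integral_mono mult_right_mono g; simp)+
 with psh_coord_cint[OF u S d b(1)] psh_coord_cint[OF v S d b(2)]
 have "cint (gap ?B (\<lambda>z. max (u z) (v z))) a w \<le> ennreal (2*pi) * gap ?B (\<lambda>z. max (u z) (v z)) a"
  by (cases "u a \<le> v a") (auto simp: gap_def max_def)
 with b show "\<exists>B. (\<forall>z\<in>?D. max (u z) (v z) \<le> ereal B) \<and> cint (gap B (\<lambda>z. max (u z) (v z))) a w \<le> ennreal (2*pi) * gap B (\<lambda>z. max (u z) (v z)) a"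
  by (intro exI[of _ ?B]) auto
qed

lemma psh_coord_const: "open S \<Longrightarrow> c < \<infinity> \<Longrightarrow> psh_coord S (\<lambda>z::complex^'n::finite. c)"
proof (rule psh_coordI)
 assume S: "open S" and c: "c < \<infinity>"
 show "open {z\<in>S. c < t}" for t using S by (cases "c < t") auto
 fix a w :: "complex^'n"
 obtain B where B: "c \<le> ereal B" using c by (cases c) auto
 have "cint (gap B (\<lambda>z. c)) a w = ennreal (2*pi) * gap B (\<lambda>z. c) a"
  by (simp only: cint_def gap_def nn_integral_circle_const mult.commute[of _ "ennreal (2*pi)"])
 with B show "\<exists>B. (\<forall>z\<in>cdisc a w. c \<le> ereal B) \<and> cint (gap B (\<lambda>z. c)) a w \<le> ennreal (2*pi) * gap B (\<lambda>z. c) a"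
  by (intro exI[of _ B]) simp
qed auto

lemma psh_coord_scale:
 assumes u: "psh_coord S u" and S: "open S" and c: "c > 0"
 shows "psh_coord S (\<lambda>z. ereal c * u z)"
proof (rule psh_coordI[OF S])
 show "ereal c * u z < \<infinity>" if "z \<in> S" for z using psh_coord_less_top[OF u that] c by (cases "u z") auto
 have "ereal c * x < t \<longleftrightarrow> x < t / ereal c" for x t using c
  by (cases x; cases t) (auto simp: field_simps)
 then show "open {z\<in>S. ereal c * u z < t}" for t using psh_coord_usc[OF u S] by simp
 fix a w :: "complex^'a" let ?D = "cdisc a w"
 assume d: "?D \<subseteq> S"
 obtain B where B: "\<And>z. z \<in> ?D \<Longrightarrow> u z \<le> ereal B" using psh_coord_bound[OF u S d] by blast
 have circ: "a + cis v *s w \<in> S" "a \<in> S" for v by (rule subsetD[OF d circle_in_disc] subsetD[OF d center_in_disc])+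
 have g: "gap (c * B) (\<lambda>z. ereal c * u z) z = ennreal c * gap B u z" if "z \<in> S" for z
  using psh_coord_less_top[OF u that] c
  by (cases "u z") (auto simp: ennreal_mult'[symmetric] algebra_simps ennreal_mult_top)
 have mu: "(\<lambda>v. gap B u (a + cis v *s w)) \<in> borel_measurable borel" unfolding gap_def
  using usc_measurable_comp[OF psh_coord_usc[OF u S] circle_continuous[of UNIV a w]] circ(1) by measurable
 have "cint (gap (c * B) (\<lambda>z. ereal c * u z)) a w = ennreal c * cint (gap B u) a w"
  unfolding cint_def g[OF circ(1)] mult.assoc by (rule nn_integral_cmult) (use mu in measurable)
 also have "\<dots> \<le> ennreal c * (ennreal (2*pi) * gap B u a)" by (intro mult_left_mono psh_coord_cint[OF u S d B]) auto
 also have "\<dots> = ennreal (2*pi) * gap (c * B) (\<lambda>z. ereal c * u z) a" by (simp only: g[OF circ(2)] mult.left_commute)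
 finally have "cint (gap (c * B) (\<lambda>z. ereal c * u z)) a w \<le> ennreal (2*pi) * gap (c * B) (\<lambda>z. ereal c * u z) a" .
 moreover have "ereal c * u z \<le> ereal (c * B)" if "z \<in> ?D" for z
  using ereal_mult_left_mono[OF B[OF that], of "ereal c"] c by simp
 ultimately show "\<exists>B. (\<forall>z\<in>?D. ereal c * u z \<le> ereal B) \<and> cint (gap B (\<lambda>z. ereal c * u z)) a w \<le> ennreal (2*pi) * gap B (\<lambda>z. ereal c * u z) a"
  by blast
qed

text \<open>A Fatou argument: the sub-mean-value inequality passes to limits with \<open>limsup v\<^sub>n \<le> u\<close> on the circle
 and \<open>liminf v\<^sub>n \<ge> u\<close> at the centre.\<close>

lemma sub_mean_limit:
 fixes v :: "nat \<Rightarrow> complex^'n::finite \<Rightarrow> real"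
 assumes c: "\<And>n. continuous_on UNIV (\<lambda>b. v n (a + cis b *s w))"
  and B: "\<And>n b. v n (a + cis b *s w) \<le> B"
  and m: "\<And>n. 2*pi*(v n a) \<le> integral {0..2*pi} (\<lambda>b. v n (a + cis b *s w))"
  and up: "\<And>b t. u (a + cis b *s w) < ereal t \<Longrightarrow> eventually (\<lambda>n. v n (a + cis b *s w) \<le> t) sequentially"
  and lo: "\<And>t. ereal t < u a \<Longrightarrow> eventually (\<lambda>n. t \<le> v n a) sequentially"
 shows "cint (gap B u) a w \<le> ennreal (2*pi) * gap B u a"
proof -
 have vB: "v n a \<le> B" for n
 proof -
  have "integral {0..2*pi} (\<lambda>b. v n (a + cis b *s w)) \<le> integral {0..2*pi} (\<lambda>b. B)"
   by (intro integral_le integrable_continuous_interval continuous_on_subset[OF c] B) auto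
  moreover have "integral {0..2*pi} (\<lambda>b. B) = 2*pi*B" by (simp add: pi_ge_zero)
  ultimately have "2*pi*(v n a) \<le> 2*pi*B" using m[of n] by linarith
  then show ?thesis by simp
 qed
 have 1: "gap B u (a + cis b *s w) \<le> liminf (\<lambda>n. ennreal (B - v n (a + cis b *s w)))" for b
 proof (rule dense_le)
  fix x assume x: "x < gap B u (a + cis b *s w)"
  then obtain r where r: "x = ennreal r" "r \<ge> 0" by (cases x) auto
  have "u (a + cis b *s w) < ereal (B - r)" using x r
   by (cases "u (a + cis b *s w)") (auto simp: gap_def ennreal_less_iff e2ennreal_neg)
  from up[OF this] have "eventually (\<lambda>n. x \<le> ennreal (B - v n (a + cis b *s w))) sequentially"
   by eventually_elim (auto simp: r ennreal_leI)
  then show "x \<le> liminf (\<lambda>n. ennreal (B - v n (a + cis b *s w)))" by (rule Liminf_bounded)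
 qed
 have 2: "liminf (\<lambda>n. ennreal (B - v n a)) \<le> gap B u a"
 proof (rule dense_ge)
  fix x assume x: "gap B u a < x"
  show "liminf (\<lambda>n. ennreal (B - v n a)) \<le> x"
  proof (cases x)
   case (real r)
   have "ereal (B - r) < u a"
   proof (cases "u a")
    case (real s)
    have "\<not> r \<le> B - s" using x ennreal_leI[of r "B - s"] real \<open>x = ennreal r\<close> by auto
    then show ?thesis using real by simp
   qed (use x in \<open>auto simp: gap_def\<close>)
   from lo[OF this] have "eventually (\<lambda>n. ennreal (B - v n a) \<le> x) sequentially"
    by eventually_elim (use real in \<open>auto intro!: ennreal_leI\<close>)
   then show ?thesis by (rule order_trans[OF Liminf_le_Limsup[OF trivial_limit_sequentially] Limsup_bounded])
  qed simp
 qed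
 have "cint (gap B u) a w \<le> (\<integral>\<^sub>+b. liminf (\<lambda>n. ennreal (B - v n (a + cis b *s w)) * indicator {0..2*pi} b))"
  unfolding cint_def
 proof (rule nn_integral_mono)
  fix b :: real
  show "gap B u (a + cis b *s w) * indicator {0..2*pi} b \<le> liminf (\<lambda>n. ennreal (B - v n (a + cis b *s w)) * indicator {0..2*pi} b)"
   using 1[of b] by (cases "b \<in> {0..2*pi}") auto
 qed
 also have "\<dots> \<le> liminf (\<lambda>n. (\<integral>\<^sub>+b. ennreal (B - v n (a + cis b *s w)) * indicator {0..2*pi} b))"
 proof (rule nn_integral_liminf)
  fix n
  have [measurable]: "(\<lambda>b. v n (a + cis b *s w)) \<in> borel_measurable borel" by (rule borel_measurable_continuous_onI[OF c])
  show "(\<lambda>b. ennreal (B - v n (a + cis b *s w)) * indicator {0..2*pi} b) \<in> borel_measurable lborel" by measurable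
 qed
 also have "\<dots> \<le> liminf (\<lambda>n. ennreal (2*pi) * ennreal (B - v n a))"
 proof (rule Liminf_mono, rule always_eventually, rule allI)
  fix n
  have "cint (\<lambda>z. ennreal (B - v n z)) a w = ennreal (2*pi*B - integral {0..2*pi} (\<lambda>b. v n (a + cis b *s w)))"
   by (rule cint_continuous[OF c B])
  also have "\<dots> \<le> ennreal (2*pi) * ennreal (B - v n a)"
   using m[of n] by (simp add: ennreal_mult''[symmetric] vB ennreal_leI algebra_simps pi_ge_zero)
  finally show "(\<integral>\<^sub>+b. ennreal (B - v n (a + cis b *s w)) * indicator {0..2*pi} b) \<le> ennreal (2*pi) * ennreal (B - v n a)"
   by (simp add: cint_def)
 qed
 also have "\<dots> = ennreal (2*pi) * liminf (\<lambda>n. ennreal (B - v n a))"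
  by (rule Liminf_compose_continuous_mono[where f="\<lambda>x. ennreal (2*pi) * x"])
    (auto intro!: monoI mult_left_mono ennreal_continuous_on_cmult continuous_on_id)
 also have "\<dots> \<le> ennreal (2*pi) * gap B u a" by (intro mult_left_mono 2) auto
 finally show ?thesis .
qed

section \<open>Invariance of Lebesgue measure and convolutions\<close>

lemma nn_integral_shift:
 fixes f :: "'a::euclidean_space \<Rightarrow> ennreal"
 assumes [measurable]: "f \<in> borel_measurable borel"
 shows "(\<integral>\<^sub>+x. f (c + x)) = (\<integral>\<^sub>+x. f x)"
proof -
 have "(\<integral>\<^sub>+x. f x) = (\<integral>\<^sup>+x. f x \<partial>distr lborel borel ((+) c))" by (simp add: lborel_distr_plus)
 also have "\<dots> = (\<integral>\<^sub>+x. f (c + x))" by (rule nn_integral_distr) simp_all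
 finally show ?thesis ..
qed

lemma nn_integral_reflect:
 fixes f :: "'a::euclidean_space \<Rightarrow> ennreal"
 assumes [measurable]: "f \<in> borel_measurable borel"
 shows "(\<integral>\<^sub>+x. f (c - x)) = (\<integral>\<^sub>+x. f x)"
proof -
 have "lborel = distr lborel borel (\<lambda>x::'a. c + (-1) *\<^sub>R x)"
  using lborel_affine[of "-1" c] by (simp add: density_1)
 then have "(\<integral>\<^sub>+x. f x) = (\<integral>\<^sup>+x. f x \<partial>distr lborel borel (\<lambda>x. c + (-1) *\<^sub>R x))" by simp
 also have "\<dots> = (\<integral>\<^sub>+x. f (c + (-1) *\<^sub>R x))" by (rule nn_integral_distr) simp_all
 finally show ?thesis by simp
qed

text \<open>Averaging \<open>f\<close> over translates by a rotation invariant ball shows that a linear isometry preserves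
 Lebesgue measure.\<close>

lemma nn_integral_rotate:
 fixes f :: "complex^'n::finite \<Rightarrow> ennreal"
 assumes f[measurable]: "f \<in> borel_measurable borel"
 shows "(\<integral>\<^sub>+x. f (cis t *s x)) = (\<integral>\<^sub>+x. f x)"
proof -
 define r where "r x = cis t *s x" for x :: "complex^'n"
 define r' where "r' x = cis (-t) *s x" for x :: "complex^'n"
 define g :: "complex^'n \<Rightarrow> ennreal" where "g = indicator (ball 0 1)"
 have inv: "r (r' x) = x" for x by (simp add: r_def r'_def vector_smult_assoc cis_mult)
 have add: "r (x + y) = r x + r y" "r (x - y) = r x - r y" for x y
  by (simp_all add: r_def vector_add_ldistrib vector_ssub_ldistrib)
 have norm: "norm (r x) = norm x" for x by (simp add: r_def norm_scalar_mult)
 have "bounded_linear r" unfolding r_def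
  by (rule bounded_linear_intro[where K=1]) (auto simp: vector_add_ldistrib norm_scalar_mult vec_eq_iff algebra_simps)
 then have [measurable]: "r \<in> borel_measurable borel"
  by (intro borel_measurable_continuous_onI) (simp add: linear_continuous_on)
 have [measurable]: "g \<in> borel_measurable borel" unfolding g_def by (intro borel_measurable_indicator) simp
 let ?V = "(\<integral>\<^sub>+x. g x)"
 \<comment> \<open>This volume is cancelled at the end, so it must be neither 0 nor
   infinite.\<close>
 have V: "?V \<noteq> 0" "?V \<noteq> top"
 proof -
  have "?V = emeasure lborel (ball (0::complex^'n) 1)" by (simp add: g_def)
  then show "?V \<noteq> 0" "?V \<noteq> top"
   using emeasure_lborel_ball_finite[of "0::complex^'n" 1] content_ball_pos[of 1 "0::complex^'n"]
   by (auto simp: measure_def)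
 qed
 have "?V * (\<integral>\<^sub>+y. f (r y)) = (\<integral>\<^sub>+x. g x * (\<integral>\<^sub>+y. f (r y)))"
  by (simp add: nn_integral_multc)
 also have "\<dots> = (\<integral>\<^sub>+x. (\<integral>\<^sub>+y. g x * f (r y + x)))"
 proof (rule nn_integral_cong)
  fix x
  have "(\<integral>\<^sub>+y. f (r y + x)) = (\<integral>\<^sub>+y. f (r (r' x + y)))" by (simp add: add inv add.commute)
  also have "\<dots> = (\<integral>\<^sub>+y. f (r y))" by (rule nn_integral_shift[of "\<lambda>y. f (r y)"]) measurable
  finally show "g x * (\<integral>\<^sub>+y. f (r y)) = (\<integral>\<^sub>+y. g x * f (r y + x))"
   by (simp add: nn_integral_cmult)
 qed
 also have "\<dots> = (\<integral>\<^sub>+y. (\<integral>\<^sub>+x. g x * f (r y + x)))"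
  by (rule lborel_pair.Fubini') measurable
 also have "\<dots> = (\<integral>\<^sub>+y. (\<integral>\<^sub>+x. g (x - r y) * f x))"
 proof (rule nn_integral_cong)
  fix y
  show "(\<integral>\<^sub>+x. g x * f (r y + x)) = (\<integral>\<^sub>+x. g (x - r y) * f x)"
   using nn_integral_shift[of "\<lambda>x. g (x - r y) * f x" "r y"] by simp
 qed
 also have "\<dots> = (\<integral>\<^sub>+x. (\<integral>\<^sub>+y. g (x - r y) * f x))"
  by (rule lborel_pair.Fubini'[symmetric]) measurable
 also have "\<dots> = (\<integral>\<^sub>+x. ?V * f x)"
 proof (rule nn_integral_cong)
  fix x
  \<comment> \<open>Here it matters that \<open>r\<close> is an isometry: the indicator of a centred
    ball depends on the norm alone.\<close>
  have "g (x - r y) = g (r' x - y)" for y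
   using norm[of "r' x - y"] by (simp add: g_def add inv indicator_def)
  then have "(\<integral>\<^sub>+y. g (x - r y)) = ?V" by (simp add: nn_integral_reflect)
  then show "(\<integral>\<^sub>+y. g (x - r y) * f x) = ?V * f x" by (simp add: nn_integral_multc)
 qed
 also have "\<dots> = ?V * (\<integral>\<^sub>+x. f x)" by (simp add: nn_integral_cmult)
 finally show ?thesis using V by (simp add: ennreal_mult_cancel_left r_def)
qed

lemma compact_support_uniformly_continuous:
 fixes f :: "'a::euclidean_space \<Rightarrow> 'b::real_normed_vector"
 assumes c: "continuous_on UNIV f" and K: "compact K" "\<And>z. z \<notin> K \<Longrightarrow> f z = 0"
 shows "e > 0 \<Longrightarrow> \<exists>d>0. \<forall>x y. norm (x - y) < d \<longrightarrow> norm (f x - f y) < e" "\<exists>C\<ge>0. \<forall>z. norm (f z) \<le> C"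
proof -
 obtain R where R: "R > 0" "\<And>z. z \<in> K \<Longrightarrow> norm z \<le> R" using compact_imp_bounded[OF K(1)] bounded_pos by blast
 show "\<exists>d>0. \<forall>x y. norm (x - y) < d \<longrightarrow> norm (f x - f y) < e" if e: "e > 0"
 proof -
  have "uniformly_continuous_on (cball 0 (R+1)) f"
   by (intro compact_uniformly_continuous continuous_on_subset[OF c]) auto
  then obtain d where d: "d > 0" "\<And>x y. x \<in> cball 0 (R+1) \<Longrightarrow> y \<in> cball 0 (R+1) \<Longrightarrow> norm (x - y) < d \<Longrightarrow> norm (f x - f y) < e"
   using e unfolding uniformly_continuous_on_def dist_norm by (metis norm_minus_commute)
  have "norm (f x - f y) < e" if xy: "norm (x - y) < min d 1" for x y
  proof (cases "norm x \<le> R \<or> norm y \<le> R")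
   case True
   moreover have "norm x \<le> norm y + norm (x - y)" "norm y \<le> norm x + norm (x - y)"
    using norm_triangle_sub[of x y] norm_triangle_sub[of y x] by (auto simp: norm_minus_commute)
   ultimately have "x \<in> cball 0 (R+1)" "y \<in> cball 0 (R+1)" using xy by auto
   then show ?thesis using d(2) xy by auto
  next
   case False
   then have "x \<notin> K" "y \<notin> K" using R(2) by force+
   then show ?thesis using K(2) e by simp
  qed
  then show ?thesis using d(1) by (intro exI[of _ "min d 1"]) auto
 qed
 have "bounded (f ` K)" by (intro compact_imp_bounded compact_continuous_image continuous_on_subset[OF c] K(1)) auto
 then obtain C where "C > 0" "\<And>z. z \<in> K \<Longrightarrow> norm (f z) \<le> C" using bounded_pos by (metis imageI)
 then show "\<exists>C\<ge>0. \<forall>z. norm (f z) \<le> C" using K(2) by (intro exI[of _ C]) (metis less_imp_le norm_zero)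
qed

lemma integrable_mult_bounded:
 fixes f :: "'a::euclidean_space \<Rightarrow> 'b::euclidean_space"
 assumes k: "integrable lborel (k :: 'a \<Rightarrow> real)" and f: "f \<in> borel_measurable borel" and C: "\<And>z. norm (f z) \<le> C"
 shows "integrable lborel (\<lambda>y. k y *\<^sub>R f y)"
proof (rule Bochner_Integration.integrable_bound)
 show "integrable lborel (\<lambda>y. C * k y)" using k by simp
 show "(\<lambda>y. k y *\<^sub>R f y) \<in> borel_measurable lborel" using borel_measurable_integrable[OF k] f by measurable
 show "AE y in lborel. norm (k y *\<^sub>R f y) \<le> norm (C * k y)"
 proof (rule AE_I2)
  fix y
  have "\<bar>k y\<bar> * norm (f y) \<le> \<bar>k y\<bar> * C" by (intro mult_left_mono C) auto
  then show "norm (k y *\<^sub>R f y) \<le> norm (C * k y)" using order_trans[OF norm_ge_zero C] by (simp add: abs_mult mult.commute)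
 qed
qed

lemma conv_integrable:
 fixes f :: "'a::euclidean_space \<Rightarrow> 'b::euclidean_space"
 assumes k: "integrable lborel (k :: 'a \<Rightarrow> real)" and f: "continuous_on UNIV f" "compact K" "\<And>z. z \<notin> K \<Longrightarrow> f z = 0"
 shows "integrable lborel (\<lambda>y. k y *\<^sub>R f (x - y))"
proof -
 obtain C where "\<And>z. norm (f z) \<le> C" using compact_support_uniformly_continuous(2)[OF f] by blast
 moreover have "(\<lambda>y. f (x - y)) \<in> borel_measurable borel"
  by (intro borel_measurable_continuous_onI continuous_on_compose2[OF f(1)] continuous_intros) auto
 ultimately show ?thesis using integrable_mult_bounded[OF k, of "\<lambda>y. f (x - y)"] by blast
qed

lemma conv_bound:
 fixes f g :: "'a::euclidean_space \<Rightarrow> 'b::euclidean_space"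
 assumes k: "integrable lborel (k :: 'a \<Rightarrow> real)" and f: "integrable lborel (\<lambda>y. k y *\<^sub>R f y)" and e: "\<And>y. norm (f y) \<le> e"
 shows "norm (\<integral>\<^sub>Ly. k y *\<^sub>R f y) \<le> e * (\<integral>\<^sub>Ly. \<bar>k y\<bar>)"
proof -
 have "norm (\<integral>\<^sub>Ly. k y *\<^sub>R f y) \<le> (\<integral>\<^sub>Ly. e * \<bar>k y\<bar>)"
  using k f e by (intro Bochner_Integration.integral_norm_bound_integral) (auto simp: mult.commute[of e] intro!: mult_left_mono)
 then show ?thesis by simp
qed

lemma conv_continuous:
 fixes f :: "'a::euclidean_space \<Rightarrow> 'b::euclidean_space"
 assumes k: "integrable lborel (k :: 'a \<Rightarrow> real)" and f: "continuous_on UNIV f" "compact K" "\<And>z. z \<notin> K \<Longrightarrow> f z = 0"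
 shows "continuous_on S (\<lambda>x. (\<integral>\<^sub>Ly. k y *\<^sub>R f (x - y)))"
 unfolding continuous_on_iff
proof (intro ballI allI impI)
 fix x and e :: real assume "e > 0"
 let ?M = "(\<integral>\<^sub>Ly. \<bar>k y\<bar>)"
 have M: "?M \<ge> 0" by simp
 then have e': "e / (?M + 1) > 0" using \<open>e > 0\<close> by (intro divide_pos_pos) linarith+
 obtain d where d: "d > 0" "\<And>x y. norm (x - y) < d \<Longrightarrow> norm (f x - f y) < e / (?M + 1)"
  using compact_support_uniformly_continuous(1)[OF f e'] by blast
 show "\<exists>d>0. \<forall>x'\<in>S. dist x' x < d \<longrightarrow> dist (\<integral>\<^sub>Ly. k y *\<^sub>R f (x' - y)) (\<integral>\<^sub>Ly. k y *\<^sub>R f (x - y)) < e"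
 proof (intro exI[of _ d] conjI ballI impI d(1))
  fix x' assume "dist x' x < d"
  then have b: "norm (f (x' - y) - f (x - y)) \<le> e / (?M + 1)" for y
   by (intro less_imp_le d(2)) (simp add: dist_norm)
  have i: "integrable lborel (\<lambda>y. k y *\<^sub>R f (x - y))" for x by (rule conv_integrable[OF k f])
  have "norm (\<integral>\<^sub>Ly. k y *\<^sub>R (f (x' - y) - f (x - y))) \<le> e / (?M + 1) * ?M"
  proof (rule conv_bound[OF k _ b])
   show "integrable lborel (\<lambda>y. k y *\<^sub>R (f (x' - y) - f (x - y)))"
    unfolding scaleR_diff_right by (rule Bochner_Integration.integrable_diff[OF i i])
  qed
  also have "\<dots> = e * (?M / (?M + 1))" by simp
  also have "\<dots> < e * 1" using \<open>e > 0\<close> M by (intro mult_strict_left_mono, subst pos_divide_less_eq) (linarith | simp)+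
  finally show "dist (\<integral>\<^sub>Ly. k y *\<^sub>R f (x' - y)) (\<integral>\<^sub>Ly. k y *\<^sub>R f (x - y)) < e"
   using Bochner_Integration.integral_diff[OF i i] by (simp add: dist_norm scaleR_diff_right)
 qed
qed

text \<open>The kernel is merely integrable, so the derivative has to fall on \<open>f\<close>.
  Compact support makes \<open>D\<close> uniformly continuous; hence the linearization error of
  \<open>f\<close> is small relative to the increment, uniformly in the base point, and integration
  against \<open>k\<close> preserves this.\<close>

lemma conv_has_derivative:
 fixes f :: "'a::euclidean_space \<Rightarrow> 'b::euclidean_space"
 assumes k: "integrable lborel (k :: 'a \<Rightarrow> real)" and D: "\<And>z. (f has_derivative D z) (at z)"
  and cD: "\<And>h. continuous_on UNIV (\<lambda>z. D z h)" and K: "compact K" "\<And>z. z \<notin> K \<Longrightarrow> f z = 0" "\<And>z h. z \<notin> K \<Longrightarrow> D z h = 0"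
 shows "((\<lambda>x. (\<integral>\<^sub>Ly. k y *\<^sub>R f (x - y))) has_derivative (\<lambda>h. (\<integral>\<^sub>Ly. k y *\<^sub>R D (x - y) h))) (at x)"
proof -
 let ?M = "(\<integral>\<^sub>Ly. \<bar>k y\<bar>)"
 have M: "?M \<ge> 0" by simp
 have cf: "continuous_on UNIV f" using D by (meson continuous_at_imp_continuous_on has_derivative_continuous)
 have iD: "integrable lborel (\<lambda>y. k y *\<^sub>R D (x - y) h)" for x h by (rule conv_integrable[OF k cD K(1) K(3)])
 have i: "integrable lborel (\<lambda>y. k y *\<^sub>R f (x - y))" for x by (rule conv_integrable[OF k cf K(1,2)])
 have lin: "linear (D z)" for z using D has_derivative_linear by blast
 show ?thesis unfolding has_derivative_at_alt
 proof (intro conjI allI impI)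
  have "linear (\<lambda>h. (\<integral>\<^sub>Ly. k y *\<^sub>R D (x - y) h))"
  proof (rule linearI)
   fix b c and r :: real
   show "(\<integral>\<^sub>Ly. k y *\<^sub>R D (x - y) (b + c)) = (\<integral>\<^sub>Ly. k y *\<^sub>R D (x - y) b) + (\<integral>\<^sub>Ly. k y *\<^sub>R D (x - y) c)"
    using iD by (simp add: linear_add[OF lin] scaleR_add_right)
   have "k y *\<^sub>R D (x - y) (r *\<^sub>R b) = r *\<^sub>R (k y *\<^sub>R D (x - y) b)" for y by (simp add: linear_cmul[OF lin])
   then show "(\<integral>\<^sub>Ly. k y *\<^sub>R D (x - y) (r *\<^sub>R b)) = r *\<^sub>R (\<integral>\<^sub>Ly. k y *\<^sub>R D (x - y) b)"
    by (simp only: integral_scaleR_right)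
  qed
  then show "bounded_linear (\<lambda>h. (\<integral>\<^sub>Ly. k y *\<^sub>R D (x - y) h))" by (simp add: linear_conv_bounded_linear)
  fix e :: real assume "e > 0"
  \<comment> \<open>\<open>?M + 1\<close> absorbs the mass of the kernel, which may be 0, and the
    dimension absorbs the passage from basis vectors to arbitrary increments.\<close>
  define e' where "e' = e / (?M + 1) / (real DIM('a))"
  have e': "e' > 0" unfolding e'_def using \<open>e > 0\<close> M by (intro divide_pos_pos) (linarith | simp)+
  have "\<exists>d>0. \<forall>x y. norm (x - y) < d \<longrightarrow> norm (D x b - D y b) < e'" for b
   using compact_support_uniformly_continuous(1)[OF cD K(1) K(3) e'] by blast
  then obtain d where d: "\<And>b. d b > 0" "\<And>b x y. norm (x - y) < d b \<Longrightarrow> norm (D x b - D y b) < e'" by metis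
  define d0 where "d0 = Min (d ` (Basis :: 'a set))"
  have d0: "d0 > 0" "\<And>b. b \<in> Basis \<Longrightarrow> d0 \<le> d b" using d(1) by (auto simp: d0_def)
  have unif: "norm (D x h - D y h) \<le> e / (?M + 1) * norm h" if xy: "norm (x - y) < d0" for x y h
  proof -
   have "D x h - D y h = (\<Sum>b\<in>Basis. (h \<bullet> b) *\<^sub>R (D x b - D y b))"
   proof -
    have "D z h = (\<Sum>b\<in>Basis. (h \<bullet> b) *\<^sub>R D z b)" for z
     by (subst euclidean_representation[of h, symmetric]) (simp only: linear_sum[OF lin] linear_cmul[OF lin])
    then show ?thesis by (simp add: sum_subtractf scaleR_diff_right)
   qed
   also have "norm \<dots> \<le> (\<Sum>b\<in>(Basis::'a set). norm h * e')"
   proof (intro order_trans[OF norm_sum] sum_mono)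
    fix b :: 'a assume b: "b \<in> Basis"
    have "norm (D x b - D y b) < e'" using d(2) order_less_le_trans[OF xy d0(2)[OF b]] .
    then show "norm ((h \<bullet> b) *\<^sub>R (D x b - D y b)) \<le> norm h * e'"
     using Basis_le_norm[OF b, of h] by (auto intro!: mult_mono)
   qed
   also have "\<dots> = e / (?M + 1) * norm h" by (simp add: e'_def)
   finally show ?thesis .
  qed
  show "\<exists>d>0. \<forall>y. norm (y - x) < d \<longrightarrow> norm ((\<integral>\<^sub>Lya. k ya *\<^sub>R f (y - ya)) - (\<integral>\<^sub>Ly. k y *\<^sub>R f (x - y)) -
      (\<integral>\<^sub>Lya. k ya *\<^sub>R D (x - ya) (y - x))) \<le> e * norm (y - x)"
  proof (intro exI[of _ d0] conjI allI impI d0(1))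
   fix x' assume x': "norm (x' - x) < d0"
   have b: "norm (f (x' - y) - f (x - y) - D (x - y) (x' - x)) \<le> e / (?M + 1) * norm (x' - x)" for y
   proof -
    have "norm (f (x' - y) - f (x - y) - D (x - y) ((x' - y) - (x - y))) \<le> norm ((x' - y) - (x - y)) * (e / (?M + 1))"
    proof (rule differentiable_bound_linearization[where S="ball (x - y) d0" and f'=D])
     show "(x - y) + t *\<^sub>R ((x' - y) - (x - y)) \<in> ball (x - y) d0" if "t \<in> {0..1}" for t
     proof -
      have "\<bar>t\<bar> * norm (x' - x) \<le> 1 * norm (x' - x)" using that by (intro mult_right_mono) auto
      then show ?thesis using x' by (simp add: dist_norm)
     qed
     show "(f has_derivative D z) (at z within ball (x - y) d0)" for z by (rule has_derivative_at_withinI[OF D])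
     show "onorm (D z - D (x - y)) \<le> e / (?M + 1)" if "z \<in> ball (x - y) d0" for z
     proof (rule onorm_bound)
      show "0 \<le> e / (?M + 1)" using \<open>e > 0\<close> M by (intro divide_nonneg_pos) linarith+
      show "norm ((D z - D (x - y)) h) \<le> e / (?M + 1) * norm h" for h
       using unif[of z "x - y" h] that by (simp add: dist_norm norm_minus_commute)
     qed
     show "x - y \<in> ball (x - y) d0" using d0(1) by simp
    qed
    then show ?thesis by (simp add: mult.commute)
   qed
   have "norm (\<integral>\<^sub>Ly. k y *\<^sub>R (f (x' - y) - f (x - y) - D (x - y) (x' - x))) \<le> e / (?M + 1) * norm (x' - x) * ?M"
    by (rule conv_bound[OF k _ b], unfold scaleR_diff_right)
     (rule Bochner_Integration.integrable_diff[OF Bochner_Integration.integrable_diff[OF i i] iD])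
   also have "\<dots> = (e * norm (x' - x)) * (?M / (?M + 1))" by simp
   also have "\<dots> \<le> (e * norm (x' - x)) * 1" using \<open>e > 0\<close> M by (intro mult_left_mono, subst pos_divide_le_eq) (linarith | simp)+
   finally show "norm ((\<integral>\<^sub>Lya. k ya *\<^sub>R f (x' - ya)) - (\<integral>\<^sub>Ly. k y *\<^sub>R f (x - y)) -
      (\<integral>\<^sub>Lya. k ya *\<^sub>R D (x - ya) (x' - x))) \<le> e * norm (x' - x)"
    using i iD by (simp add: scaleR_diff_right)
  qed
 qed
qed

lemma matrix_linear: "bounded_linear (\<lambda>M::complex^'n::finite^'n. M *v h)"
 by (intro linear_conv_bounded_linear[THEN iffD1] linearI)
   (simp_all add: matrix_vector_mult_add_rdistrib scaleR_matrix_vector)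

section \<open>Uniqueness of the Levi form, and convolutions\<close>

lemma dotp_zero_imp: "(\<And>h. Re (dotp p h) = 0) \<Longrightarrow> p = 0"
proof -
 assume "\<And>h. Re (dotp p h) = 0"
 from this[of "cnjv p"] have "(\<Sum>j\<in>UNIV. (cmod (p $ j))^2) = 0"
  by (simp add: dotp_def cnjv_def cmod_power2) (simp add: power2_eq_square)
 then show "p = 0" by (simp add: sum_nonneg_eq_0_iff vec_eq_iff)
qed

text \<open>Replacing h by i h multiplies the linear part by i and the antilinear part by -i, which
  separates the two.\<close>

lemma antilinear_part_unique:
 fixes A B L M :: "complex^'n::finite^'m"
 assumes "\<And>h. A *v h + L *v cnjv h = B *v h + M *v cnjv h"
 shows "A = B" "L = M"
proof -
 have *: "(A - B) *v h + (L - M) *v cnjv h = 0" for h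
  using assms[of h] by (simp add: matrix_vector_mult_diff_rdistrib algebra_simps)
 have "(A - B) *v h = (L - M) *v cnjv h" for h
 proof -
  have "cnjv (\<i> *s h) = (-\<i>) *s cnjv h" by (simp add: cnjv_def vec_eq_iff)
  then have "\<i> *s ((A - B) *v h - (L - M) *v cnjv h) = 0"
   using *[of "\<i> *s h"] unfolding \<open>cnjv (\<i> *s h) = (-\<i>) *s cnjv h\<close> matrix_vector_scalar
   by (simp add: vec_eq_iff algebra_simps)
  then show ?thesis by (simp add: vec_eq_iff)
 qed
 have 1: "(A - B) *v h = 0" "(L - M) *v cnjv h = 0" for h
  using *[of h] \<open>(A - B) *v h = (L - M) *v cnjv h\<close> by (simp_all add: vec_eq_iff)
 show "A = B" using 1(1)[of "axis _ 1"] matrix_vector_mult_axis[of "A - B"] by (metis eq_iff_diff_eq_0 vec_eq_iff zero_index)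
 have "cnjv (axis j 1) = axis j 1" for j :: 'n by (simp add: cnjv_def vec_eq_iff axis_def)
 then show "L = M" using 1(2)[of "axis _ 1"] matrix_vector_mult_axis[of "L - M"] by (metis eq_iff_diff_eq_0 vec_eq_iff zero_index)
qed

text \<open>By uniqueness of derivatives, Levi forms of the same function that were obtained along
  different routes may be identified, and they vanish off the support.\<close>

lemma has_levi_unique:
 assumes L: "has_levi S G P L" and L': "has_levi S G' P' L'" and S: "open S" and eq: "\<And>z. z \<in> S \<Longrightarrow> G z = G' z" and z: "z \<in> S"
 shows "P z = P' z" "L z = L' z"
proof -
 have P: "P z = P' z" if z: "z \<in> S" for z
 proof -
  have "wder G (P z) z" "wder G' (P' z) z"
   using L L' z unfolding has_levi_def by auto
  from has_derivative_unique[OF this(1) has_derivative_transform_within_open[OF this(2) S z]] eq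
  have "2 * Re (dotp (P z) h) = 2 * Re (dotp (P' z) h)" for h by metis
  then have "Re (dotp (P z - P' z) h) = 0" for h
   using dotp_simps(1)[of "P z" "- P' z" h] dotp_simps(2)[of "P' z" h] by simp
  from dotp_zero_imp[OF this] show ?thesis by simp
 qed
 show "P z = P' z" by (rule P[OF z])
 obtain A A' where "lder P (A z) (L z) z" "lder P' (A' z) (L' z) z"
  using L L' z unfolding has_levi_def by blast
 from has_derivative_unique[OF this(1) has_derivative_transform_within_open[OF this(2) S z]] P
 have "A z *v h + L z *v cnjv h = A' z *v h + L' z *v cnjv h" for h by metis
 from antilinear_part_unique(2)[OF this] show "L z = L' z" .
qed

lemma has_levi_support:
 assumes L: "has_levi UNIV G P L" and K: "closed K" "\<And>z. z \<notin> K \<Longrightarrow> G z = 0" and z: "z \<notin> K"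
 shows "P z = 0" "L z = 0"
 using has_levi_unique[OF has_levi_subset[OF L, of "-K"] has_levi_const[of "-K" 0], of z] K z by (auto simp: open_Compl)

text \<open>\<open>P\<close>, \<open>L\<close> and the hidden \<open>A\<close> must all vanish off
  \<open>K\<close> before they can be convolved. For \<open>A\<close> this follows from uniqueness
  of the linear part, since \<open>P\<close> is locally 0 there.\<close>

lemma has_levi_conv:
 assumes k: "integrable lborel (k :: complex^'n::finite \<Rightarrow> real)" and L: "has_levi UNIV G P L"
  and K: "compact K" "\<And>z. z \<notin> K \<Longrightarrow> G z = 0"
 shows "has_levi UNIV (\<lambda>x. (\<integral>\<^sub>Ly. k y * G (x - y))) (\<lambda>x. (\<integral>\<^sub>Ly. k y *\<^sub>R P (x - y))) (\<lambda>x. (\<integral>\<^sub>Ly. k y *\<^sub>R L (x - y)))"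
proof -
 obtain A where A: "continuous_on UNIV A" "\<And>z. lder P (A z) (L z) z"
  and G: "\<And>z. wder G (P z) z" and cL: "continuous_on UNIV L"
  using L unfolding has_levi_def by blast
 have cP: "continuous_on UNIV P" using A(2) by (meson continuous_at_imp_continuous_on has_derivative_continuous)
 have P0: "P z = 0" and L0: "L z = 0" if "z \<notin> K" for z
  using has_levi_support[OF L compact_imp_closed[OF K(1)] K(2) that] by auto
 have A0: "A z = 0" if z: "z \<notin> K" for z
 proof -
  have d: "lder (\<lambda>z. 0) (A z) (L z) z"
   by (rule has_derivative_transform_within_open[OF A(2), of "-K"]) (use z P0 compact_imp_closed[OF K(1)] in auto)
  have "A z *v h + L z *v cnjv h = 0 *v h + 0 *v cnjv h" for h
   using fun_cong[OF has_derivative_unique[OF d has_derivative_const], of h] by simp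
  then show ?thesis by (rule antilinear_part_unique(1))
 qed
 have iP: "integrable lborel (\<lambda>y. k y *\<^sub>R P (x - y))" for x by (rule conv_integrable[OF k cP K(1) P0])
 have iA: "integrable lborel (\<lambda>y. k y *\<^sub>R A (x - y))" for x by (rule conv_integrable[OF k A(1) K(1) A0])
 have iL: "integrable lborel (\<lambda>y. k y *\<^sub>R L (x - y))" for x by (rule conv_integrable[OF k cL K(1) L0])
 show ?thesis unfolding has_levi_def
 proof (intro conjI ballI exI[of _ "\<lambda>x. (\<integral>\<^sub>Ly. k y *\<^sub>R A (x - y))"])
  fix x :: "complex^'n"
  have "((\<lambda>x. (\<integral>\<^sub>Ly. k y *\<^sub>R G (x - y))) has_derivative (\<lambda>h. (\<integral>\<^sub>Ly. k y *\<^sub>R (2 * Re (dotp (P (x - y)) h))))) (at x)"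
  proof (rule conv_has_derivative[OF k G _ K])
   show "continuous_on UNIV (\<lambda>z. 2 * Re (dotp (P z) h))" for h
    by (intro continuous_intros linear_continuous_on_compose[OF cP] bounded_linear.linear dotp_bounded_linear)
   show "2 * Re (dotp (P z) h) = 0" if "z \<notin> K" for z h using P0[OF that] by (simp add: dotp_simps)
  qed
  moreover have "(\<integral>\<^sub>Ly. k y *\<^sub>R (2 * Re (dotp (P (x - y)) h))) = 2 * Re (dotp (\<integral>\<^sub>Ly. k y *\<^sub>R P (x - y)) h)" for h
  proof -
   have bl: "bounded_linear (\<lambda>p. 2 * Re (dotp p h))"
    by (intro bounded_linear_const_mult bounded_linear_compose[OF bounded_linear_Re] dotp_bounded_linear)
   have "(\<integral>\<^sub>Ly. 2 * Re (dotp (k y *\<^sub>R P (x - y)) h)) = 2 * Re (dotp (\<integral>\<^sub>Ly. k y *\<^sub>R P (x - y)) h)"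
    by (rule integral_bounded_linear[OF bl iP])
   moreover have "2 * Re (dotp (k y *\<^sub>R P (x - y)) h) = k y *\<^sub>R (2 * Re (dotp (P (x - y)) h))" for y by (simp add: dotp_simps)
   ultimately show ?thesis by simp
  qed
  ultimately show "wder (\<lambda>x. (\<integral>\<^sub>Ly. k y * G (x - y))) (\<integral>\<^sub>Ly. k y *\<^sub>R P (x - y)) x"
   by simp
  have "((\<lambda>x. (\<integral>\<^sub>Ly. k y *\<^sub>R P (x - y))) has_derivative (\<lambda>h. (\<integral>\<^sub>Ly. k y *\<^sub>R (A (x - y) *v h + L (x - y) *v cnjv h)))) (at x)"
  proof (rule conv_has_derivative[OF k A(2) _ K(1) P0])
   show "continuous_on UNIV (\<lambda>z. A z *v h + L z *v cnjv h)" for h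
    by (intro continuous_intros linear_continuous_on_compose[OF A(1)] linear_continuous_on_compose[OF cL] bounded_linear.linear matrix_linear)
  qed (simp_all add: A0 L0)
  moreover have "(\<integral>\<^sub>Ly. k y *\<^sub>R (A (x - y) *v h + L (x - y) *v cnjv h)) =
    (\<integral>\<^sub>Ly. k y *\<^sub>R A (x - y)) *v h + (\<integral>\<^sub>Ly. k y *\<^sub>R L (x - y)) *v cnjv h" for h
  proof -
   have *: "k y *\<^sub>R (M *v v) = (k y *\<^sub>R M) *v v" for y and M :: "complex^'n^'n" and v by (simp add: scaleR_matrix_vector)
   show ?thesis unfolding scaleR_add_right *
    using integral_bounded_linear[OF matrix_linear iA] integral_bounded_linear[OF matrix_linear iL]
     integrable_bounded_linear[OF matrix_linear iA] integrable_bounded_linear[OF matrix_linear iL]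
    by simp
  qed
  ultimately show "((\<lambda>x. (\<integral>\<^sub>Ly. k y *\<^sub>R P (x - y))) has_derivative
    (\<lambda>h. (\<integral>\<^sub>Ly. k y *\<^sub>R A (x - y)) *v h + (\<integral>\<^sub>Ly. k y *\<^sub>R L (x - y)) *v cnjv h)) (at x)" by simp
  show "continuous_on UNIV (\<lambda>x. (\<integral>\<^sub>Ly. k y *\<^sub>R L (x - y)))" by (rule conv_continuous[OF k cL K(1) L0])
  show "continuous_on UNIV (\<lambda>x. (\<integral>\<^sub>Ly. k y *\<^sub>R A (x - y)))" by (rule conv_continuous[OF k A(1) K(1) A0])
 qed
qed

section \<open>Smooth functions and test functions\<close>

lemma Ck_on_cong:
 "Ck_on m f S \<Longrightarrow> open S \<Longrightarrow> (\<And>x. x \<in> S \<Longrightarrow> f x = g x) \<Longrightarrow> Ck_on m g S"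
proof (induction m arbitrary: f g)
 case 0
 then show ?case using continuous_on_cong[of S S f g] by simp
next
 case (Suc m)
 have d: "(g has_derivative frechet_derivative f (at x)) (at x)" if x: "x \<in> S" for x
  using Suc.prems x has_derivative_transform_within_open[of f _ x UNIV S g] by (auto simp: frechet_derivative_works)
 have "Ck_on m (\<lambda>x. frechet_derivative g (at x) v) S" for v
 proof (rule Suc.IH[of "\<lambda>x. frechet_derivative f (at x) v"])
  show "frechet_derivative f (at x) v = frechet_derivative g (at x) v" if "x \<in> S" for x
   using frechet_derivative_at[OF d[OF that]] by simp
 qed (use Suc.prems in auto)
 then show ?case using d by (auto simp: differentiable_def)
qed

text \<open>Lets any formula \<open>D\<close> for the derivative stand in for
  \<open>frechet_derivative\<close>, over which \<open>Ck_on\<close> recurses.\<close>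

lemma Ck_on_SucI:
 assumes "open S" "\<And>x. x \<in> S \<Longrightarrow> (f has_derivative D x) (at x)" "\<And>v. Ck_on m (\<lambda>x. D x v) S"
 shows "Ck_on (Suc m) f S"
proof -
 have "Ck_on m (\<lambda>x. frechet_derivative f (at x) v) S" for v
  by (rule Ck_on_cong[OF assms(3,1)]) (simp add: frechet_derivative_at[OF assms(2), symmetric])
 then show ?thesis using assms(2) by (auto simp: differentiable_def)
qed

lemma Ck_on_SucE:
 assumes "Ck_on (Suc m) f S"
 obtains D where "\<And>x. x \<in> S \<Longrightarrow> (f has_derivative D x) (at x)" "\<And>v. Ck_on m (\<lambda>x. D x v) S"
 using assms by (auto simp: frechet_derivative_works intro: that[of "\<lambda>x. frechet_derivative f (at x)"])

lemma Ck_on_SucD: "Ck_on (Suc m) f S \<Longrightarrow> Ck_on m f S"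
proof (induction m arbitrary: f)
 case 0
 then show ?case by (simp add: continuous_at_imp_continuous_on differentiable_imp_continuous_within)
qed auto

lemma Ck_on_const: "Ck_on m (\<lambda>x. c) S"
 by (induction m arbitrary: c) (auto simp: frechet_derivative_const)

lemma Ck_on_linear: assumes "bounded_linear B" "open S" shows "Ck_on m B S"
proof (cases m)
 case (Suc k)
 then show ?thesis using Ck_on_SucI[of S B "\<lambda>x. B" k] assms by (auto simp: Ck_on_const bounded_linear_imp_has_derivative)
qed (use assms in \<open>simp add: linear_continuous_on\<close>)

lemma Ck_on_add: "open S \<Longrightarrow> Ck_on m f S \<Longrightarrow> Ck_on m g S \<Longrightarrow> Ck_on m (\<lambda>x. f x + g x) S"
proof (induction m arbitrary: f g)
 case (Suc m)
 obtain D E where "\<And>x. x \<in> S \<Longrightarrow> (f has_derivative D x) (at x)" "\<And>v. Ck_on m (\<lambda>x. D x v) S"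
  "\<And>x. x \<in> S \<Longrightarrow> (g has_derivative E x) (at x)" "\<And>v. Ck_on m (\<lambda>x. E x v) S"
  using Suc.prems(2,3) by (metis Ck_on_SucE)
 then show ?case using Suc by (intro Ck_on_SucI[where D="\<lambda>x v. D x v + E x v"]) (auto intro!: has_derivative_add)
qed (auto intro: continuous_on_add)

lemma Ck_on_sum: "open S \<Longrightarrow> (\<And>i. i \<in> I \<Longrightarrow> Ck_on m (f i) S) \<Longrightarrow> Ck_on m (\<lambda>x. \<Sum>i\<in>I. f i x) S"
 by (induction I rule: infinite_finite_induct) (auto simp: Ck_on_const Ck_on_add)

lemma Ck_on_bilinear:
 assumes "bounded_bilinear b" and S: "open S"
 shows "Ck_on m f S \<Longrightarrow> Ck_on m g S \<Longrightarrow> Ck_on m (\<lambda>x. b (f x) (g x)) S"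
proof (induction m arbitrary: f g)
 case 0
 then show ?case using bounded_bilinear.continuous_on[OF assms(1)] by simp
next
 case (Suc m)
 obtain D E where D: "\<And>x. x \<in> S \<Longrightarrow> (f has_derivative D x) (at x)" "\<And>v. Ck_on m (\<lambda>x. D x v) S"
  "\<And>x. x \<in> S \<Longrightarrow> (g has_derivative E x) (at x)" "\<And>v. Ck_on m (\<lambda>x. E x v) S"
  using Suc.prems by (metis Ck_on_SucE)
 show ?case
  by (rule Ck_on_SucI[OF S bounded_bilinear.FDERIV[OF assms(1) D(1,3)]])
    (auto intro!: Ck_on_add S Suc.IH Suc.prems[THEN Ck_on_SucD] D)
qed

lemma Ck_on_compose_linear: "bounded_linear B \<Longrightarrow> open S \<Longrightarrow> Ck_on m f S \<Longrightarrow> Ck_on m (\<lambda>x. B (f x)) S"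
proof (induction m arbitrary: f)
 case 0
 then show ?case by (auto intro: bounded_linear.continuous_on)
next
 case (Suc m)
 obtain D where "\<And>x. x \<in> S \<Longrightarrow> (f has_derivative D x) (at x)" "\<And>v. Ck_on m (\<lambda>x. D x v) S"
  using Suc.prems by (metis Ck_on_SucE)
 then show ?case using Suc
  by (intro Ck_on_SucI[where D="\<lambda>x v. B (D x v)"]) (auto intro: bounded_linear.has_derivative)
qed

section \<open>Wirtinger derivatives and the Levi form of a test function\<close>

lemma wirtinger_Ck:
 assumes "Ck_on (Suc m) h S" "open S"
 shows "Ck_on m (wirtinger j h) S" "Ck_on m (wirtinger_bar j h) S"
proof -
 have 1: "Ck_on m (\<lambda>z. frechet_derivative h (at z) v) S" for v using assms by simp
 have 2: "Ck_on m (\<lambda>z. c * frechet_derivative h (at z) v) S" for c v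
  by (rule Ck_on_compose_linear[OF bounded_linear_mult_right assms(2) 1])
 have *: "wirtinger j h z = 1/2 * frechet_derivative h (at z) (axis j 1) + (-\<i>/2) * frechet_derivative h (at z) (axis j \<i>)"
  "wirtinger_bar j h z = 1/2 * frechet_derivative h (at z) (axis j 1) + (\<i>/2) * frechet_derivative h (at z) (axis j \<i>)" for z
  by (simp_all add: wirtinger_def wirtinger_bar_def field_simps)
 show "Ck_on m (wirtinger j h) S" "Ck_on m (wirtinger_bar j h) S"
  unfolding *[abs_def] by (intro Ck_on_add 2 assms(2))+
qed

lemma vec_sum_axis_Re_Im: "(v::complex^'n::finite) = (\<Sum>l\<in>UNIV. Re (v $ l) *\<^sub>R axis l 1 + Im (v $ l) *\<^sub>R axis l \<i>)"
proof -
 have "(\<Sum>l\<in>UNIV. Re (v $ l) *\<^sub>R axis l 1 + Im (v $ l) *\<^sub>R axis l \<i>) $ k = v $ k" for k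
 proof -
  have "(\<Sum>l\<in>UNIV. Re (v $ l) *\<^sub>R axis l 1 + Im (v $ l) *\<^sub>R axis l \<i>) $ k = (\<Sum>l\<in>UNIV. if l = k then v $ l else 0)"
   unfolding sum_component by (rule sum.cong) (auto simp: axis_def complex_eq_iff)
  then show ?thesis by simp
 qed
 then show ?thesis by (simp add: vec_eq_iff)
qed

lemma derivative_wirtinger:
 fixes p :: "complex^'n::finite \<Rightarrow> complex"
 assumes "p differentiable (at z)"
 shows "frechet_derivative p (at z) v = (\<Sum>l\<in>UNIV. wirtinger l p z * v $ l + wirtinger_bar l p z * cnj (v $ l))"
proof -
 have l: "linear (frechet_derivative p (at z))" using assms by (rule linear_frechet_derivative)
 have "frechet_derivative p (at z) v =
   (\<Sum>l\<in>UNIV. Re (v $ l) *\<^sub>R frechet_derivative p (at z) (axis l 1) + Im (v $ l) *\<^sub>R frechet_derivative p (at z) (axis l \<i>))"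
  by (subst vec_sum_axis_Re_Im) (simp add: linear_sum[OF l] linear_add[OF l] linear_cmul[OF l])
 also have "\<dots> = (\<Sum>l\<in>UNIV. wirtinger l p z * v $ l + wirtinger_bar l p z * cnj (v $ l))"
  by (rule sum.cong) (auto simp: wirtinger_def wirtinger_bar_def complex_eq_iff field_simps)
 finally show ?thesis .
qed

lemma wirtinger_cnj:
 assumes "p differentiable (at z)"
 shows "wirtinger j (\<lambda>z. cnj (p z)) z = cnj (wirtinger_bar j p z)"
proof -
 have "((\<lambda>z. cnj (p z)) has_derivative (\<lambda>v. cnj (frechet_derivative p (at z) v))) (at z)"
  using assms by (intro bounded_linear.has_derivative[OF bounded_linear_cnj]) (simp add: frechet_derivative_works)
 from frechet_derivative_at[OF this, symmetric] show ?thesis by (simp add: wirtinger_def wirtinger_bar_def)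
qed

abbreviation hess :: "(complex^'n::finite \<Rightarrow> complex) \<Rightarrow> complex^'n \<Rightarrow> complex^'n^'n" where
 "hess h z \<equiv> \<chi> j k. wirtinger j (wirtinger_bar k h) z"

text \<open>For a real function \<open>h\<close> the matrix \<open>\<partial>\<^sub>j\<partial>\<bar>\<^sub>k h\<close> is the conjugate transpose of the matrix
 \<open>\<partial>\<bar>\<^sub>k\<partial>\<^sub>j h\<close>; their quadratic forms agree because the latter one is real, so the symmetry of second
 derivatives is not needed.\<close>

lemma test_has_levi:
 fixes h :: "complex^'n::finite \<Rightarrow> complex"
 assumes h: "Ck_on 2 h UNIV" and real: "\<And>z. h z \<in> \<real>"
 shows "\<exists>P L. has_levi UNIV (\<lambda>z. Re (h z)) P L \<and>
   (\<forall>z w. hform (hess h z) w = hform (L z) w)"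
proof -
 let ?P = "\<lambda>z. (\<chi> j. wirtinger j h z)" and ?A = "\<lambda>z. (\<chi> j l. wirtinger l (wirtinger j h) z)"
  and ?L = "\<lambda>z. (\<chi> j l. wirtinger_bar l (wirtinger j h) z)"
 have h1: "Ck_on (Suc 1) h UNIV" using h by (simp add: numeral_2_eq_2)
 then have d: "h differentiable (at z)" for z by simp
 have w1: "Ck_on (Suc 0) (wirtinger j h) UNIV" for j
  using wirtinger_Ck(1)[OF h1, of j] by simp
 then have dw: "wirtinger j h differentiable (at z)" for j z by simp
 have cw: "continuous_on UNIV (wirtinger l (wirtinger j h))" "continuous_on UNIV (wirtinger_bar l (wirtinger j h))" for j l
  using wirtinger_Ck[OF w1 open_UNIV] by auto
 have Re_d: "((\<lambda>z. Re (h z)) has_derivative (\<lambda>v. Re (frechet_derivative h (at z) v))) (at z)" for z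
  using d by (intro bounded_linear.has_derivative[OF bounded_linear_Re]) (simp add: frechet_derivative_works)
 have "frechet_derivative h (at z) v = of_real (Re (frechet_derivative h (at z) v))" for z v
 proof -
  have "((\<lambda>z. complex_of_real (Re (h z))) has_derivative (\<lambda>v. of_real (Re (frechet_derivative h (at z) v)))) (at z)"
   by (rule bounded_linear.has_derivative[OF bounded_linear_of_real Re_d])
  then have "(h has_derivative (\<lambda>v. of_real (Re (frechet_derivative h (at z) v)))) (at z)"
   using real by simp
  from frechet_derivative_at[OF this] show ?thesis by metis
 qed
 then have Imh: "Im (frechet_derivative h (at z) v) = 0" for z v by (metis Im_complex_of_real)
 have bar: "wirtinger_bar k h z = cnj (wirtinger k h z)" for k z
  using Imh by (simp add: wirtinger_def wirtinger_bar_def complex_eq_iff)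
 have "2 * Re (dotp (?P z) v) = Re (frechet_derivative h (at z) v)" for z v
  by (simp add: derivative_wirtinger[OF d] bar dotp_def sum_distrib_left mult.commute)
 moreover have "(?P has_derivative (\<lambda>v. ?A z *v v + ?L z *v cnjv v)) (at z)" for z
 proof (rule has_derivative_vec_componentwise)
  fix l
  have "(?A z *v v + ?L z *v cnjv v) $ l = frechet_derivative (wirtinger l h) (at z) v" for v
   by (simp add: derivative_wirtinger[OF dw] matrix_vector_mult_def cnjv_def sum.distrib)
  then show "((\<lambda>z. ?P z $ l) has_derivative (\<lambda>v. (?A z *v v + ?L z *v cnjv v) $ l)) (at z)"
   using dw by (simp add: frechet_derivative_works)
 qed
 moreover have "continuous_on UNIV ?A" "continuous_on UNIV ?L"
  using cw by (auto intro!: continuous_on_vec_lambda)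
 ultimately have L: "has_levi UNIV (\<lambda>z. Re (h z)) ?P ?L" unfolding has_levi_def using Re_d by auto
 have "hform (hess h z) w = hform (?L z) w" for z w
 proof -
  have "wirtinger j (wirtinger_bar k h) z = cnj (?L z $ k $ j)" for j k
   using wirtinger_cnj[OF dw, of j k z] bar[abs_def] by simp
  then have "hform (hess h z) w = cnj (hform (?L z) w)"
  proof -
   have "cnj (hform (?L z) w) = (\<Sum>k\<in>UNIV. \<Sum>j\<in>UNIV. cnj (?L z $ k $ j) * w $ j * cnj (w $ k))"
    unfolding hform_def cnj_sum by (intro sum.cong refl) (simp add: mult_ac)
   also have "\<dots> = (\<Sum>j\<in>UNIV. \<Sum>k\<in>UNIV. cnj (?L z $ k $ j) * w $ j * cnj (w $ k))" by (rule sum.swap)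
   finally show ?thesis using \<open>\<And>k j. wirtinger j (wirtinger_bar k h) z = cnj (?L z $ k $ j)\<close> by (simp add: hform_def)
  qed
  then show ?thesis using has_levi_real[OF L open_UNIV UNIV_I, of z w] by (simp add: complex_eq_iff)
 qed
 with L show ?thesis by blast
qed

text \<open>The functions p(1/t) exp(-1/t), extended by 0, are closed under differentiation: the
  derivative replaces p by x^2 (p - p'). Carrying the polynomial along turns smoothness into an
  induction over the order.\<close>

definition flat :: "real poly \<Rightarrow> real \<Rightarrow> real" where
 "flat p t = (if t > 0 then poly p (1/t) * exp (- (1/t)) else 0)"

lemma poly_exp_decay: "((\<lambda>s::real. poly p s * exp (- s)) \<longlongrightarrow> 0) at_top"
proof -
 have "((\<lambda>s::real. \<Sum>i\<le>degree p. coeff p i * (s ^ i / exp s)) \<longlongrightarrow> (\<Sum>i\<le>degree p. coeff p i * 0)) at_top"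
  by (intro tendsto_sum tendsto_mult tendsto_const tendsto_power_div_exp_0)
 then show ?thesis by (simp add: poly_altdef sum_divide_distrib exp_minus divide_inverse sum_distrib_right mult.assoc)
qed

lemma flat_derivative: "(flat p has_real_derivative flat (monom 1 2 * (p - pderiv p)) t) (at t)"
proof -
 consider "t > 0" | "t < 0" | "t = 0" by linarith
 then show ?thesis
 proof cases
  case 1
  have "((\<lambda>t. poly p (1/t) * exp (- (1/t))) has_real_derivative flat (monom 1 2 * (p - pderiv p)) t) (at t)"
   using 1 by (auto intro!: derivative_eq_intros poly_DERIV[THEN DERIV_chain2] simp: flat_def poly_monom field_simps power2_eq_square)
  then show ?thesis
   by (rule has_field_derivative_transform_within_open[of _ _ _ "{0<..}"]) (use 1 in \<open>auto simp: flat_def\<close>)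
 next
  case 2
  have "((\<lambda>t. 0) has_real_derivative flat (monom 1 2 * (p - pderiv p)) t) (at t)" using 2 by (simp add: flat_def)
  then show ?thesis
   by (rule has_field_derivative_transform_within_open[of _ _ _ "{..<0}"]) (use 2 in \<open>auto simp: flat_def\<close>)
 next
  case 3
  have "((\<lambda>h. flat p h / h) \<longlongrightarrow> 0) (at 0)"
   unfolding filterlim_at_split
  proof
   have "eventually (\<lambda>h::real. 0 = flat p h / h) (at_left 0)"
    by (rule eventually_at_leftI[of "-1"]) (auto simp: flat_def)
   then show "((\<lambda>h. flat p h / h) \<longlongrightarrow> 0) (at_left 0)" by (rule Lim_transform_eventually[rotated]) simp
   \<comment> \<open>The difference quotient at 0 has the same shape again, with \<open>p\<close>
     multiplied by x.\<close>
   have "((\<lambda>h. poly (monom 1 1 * p) (inverse h) * exp (- inverse h)) \<longlongrightarrow> 0) (at_right 0)"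
    by (rule filterlim_compose[OF poly_exp_decay filterlim_inverse_at_top_right])
   moreover have "eventually (\<lambda>h. poly (monom 1 1 * p) (inverse h) * exp (- inverse h) = flat p h / h) (at_right 0)"
    by (rule eventually_at_rightI[of _ 1]) (auto simp: flat_def poly_monom field_simps)
   ultimately show "((\<lambda>h. flat p h / h) \<longlongrightarrow> 0) (at_right 0)" by (rule Lim_transform_eventually)
  qed
  then show ?thesis using 3 by (simp add: DERIV_def flat_def[of _ 0])
 qed
qed

lemma Ck_on_flat_norm: "Ck_on m (\<lambda>z::'a::euclidean_space. flat p (c - z \<bullet> z)) UNIV"
proof (induction m arbitrary: p)
 have d: "((\<lambda>z::'a. flat p (c - z \<bullet> z)) has_derivative (\<lambda>v. flat (monom 1 2 * (p - pderiv p)) (c - x \<bullet> x) * (- 2 * (x \<bullet> v)))) (at x)" for x p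
 proof -
  have "((\<lambda>z::'a. c - z \<bullet> z) has_derivative (\<lambda>v. - 2 * (x \<bullet> v))) (at x)"
   by (auto intro!: derivative_eq_intros simp: inner_commute)
  from has_derivative_compose[OF this flat_derivative[unfolded has_field_derivative_def]] show ?thesis .
 qed
 { case 0
  show ?case using d by (auto intro: continuous_at_imp_continuous_on has_derivative_continuous) }
 { case (Suc m)
  show ?case
   by (rule Ck_on_SucI[OF open_UNIV d])
     (intro Ck_on_bilinear[OF bounded_bilinear_mult open_UNIV Suc] Ck_on_linear bounded_linear_const_mult bounded_linear_inner_left open_UNIV) }
qed

text \<open>A function of the norm alone, entering through its smooth square. Rotation invariance of
  the kernel is what connects convolutions with circle means.\<close>

definition bump0 :: "real \<Rightarrow> complex^'n::finite \<Rightarrow> real" where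
 "bump0 d z = flat 1 (d\<^sup>2 - z \<bullet> z)"

definition bump :: "real \<Rightarrow> complex^'n::finite \<Rightarrow> real" where
 "bump d z = bump0 d z / (\<integral>\<^sub>Ly. bump0 d (y :: complex^'n))"

lemma bump0_pos: "norm z < d \<Longrightarrow> bump0 d z > 0"
proof -
 assume "norm z < d"
 then have "(norm z)\<^sup>2 < d\<^sup>2" by (intro power_strict_mono) auto
 then show ?thesis by (simp add: bump0_def flat_def dot_square_norm)
qed

lemma bump0_nonneg: "bump0 d z \<ge> 0" by (simp add: bump0_def flat_def)

lemma bump0_zero: "d > 0 \<Longrightarrow> norm z \<ge> d \<Longrightarrow> bump0 d z = 0"
proof -
 assume "d > 0" "norm z \<ge> d"
 then have "d\<^sup>2 \<le> (norm z)\<^sup>2" by (intro power_mono) auto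
 then show ?thesis by (simp add: bump0_def flat_def dot_square_norm)
qed

lemma bump0_Ck: "Ck_on m (bump0 d) UNIV"
 unfolding bump0_def[abs_def] by (rule Ck_on_flat_norm)

lemma bump0_integrable: assumes "d > 0" shows "integrable lborel (bump0 d :: complex^'n::finite \<Rightarrow> real)"
proof -
 have "integrable lborel (\<lambda>x. indicator (cball 0 d) x *\<^sub>R bump0 d (x :: complex^'n))"
  using borel_integrable_compact[of "cball (0::complex^'n) d" "bump0 d"] continuous_on_subset[of UNIV "bump0 d" "cball (0::complex^'n) d"] bump0_Ck[of 0 d]
  by auto
 then show ?thesis
  by (rule Bochner_Integration.integrable_cong[THEN iffD1, rotated -1]) (auto simp: indicator_def bump0_zero[OF assms])
qed

lemma bump0_integral_pos: assumes "d > 0" shows "(\<integral>\<^sub>Ly. bump0 d (y :: complex^'n::finite)) > 0"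
proof -
 have "(\<integral>\<^sub>Ly. bump0 d (y :: complex^'n)) \<noteq> 0"
 proof
  assume "(\<integral>\<^sub>Ly. bump0 d (y :: complex^'n)) = 0"
  then have "AE y in lborel. bump0 d (y :: complex^'n) = 0"
   using integral_nonneg_eq_0_iff_AE[OF bump0_integrable[OF assms, where 'n='n]] by (simp add: bump0_nonneg)
  then have "AE y in lborel. y \<notin> ball (0::complex^'n) d" by (rule AE_mp) (use bump0_pos[of _ d] in \<open>force intro!: AE_I2\<close>)
  then have "emeasure lborel (ball (0::complex^'n) d) = 0"
   using AE_iff_null_sets[of "ball (0::complex^'n) d" lborel] by (simp del: mem_ball_0 add: null_setsD1)
  then show False using content_ball_pos[OF assms, of "0::complex^'n"] by (simp add: measure_def)
 qed
 moreover have "(\<integral>\<^sub>Ly. bump0 d (y :: complex^'n)) \<ge> 0"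
  by (rule Bochner_Integration.integral_nonneg) (rule bump0_nonneg)
 ultimately show ?thesis by linarith
qed

lemma bump_props:
 fixes z z' :: "complex^'n::finite"
 assumes d: "d > 0"
 shows "bump d z \<ge> 0" "norm z < d \<Longrightarrow> bump d z > 0" "norm z \<ge> d \<Longrightarrow> bump d z = 0"
  "norm z = norm z' \<Longrightarrow> bump d z = bump d z'" "integrable lborel (bump d :: complex^'n \<Rightarrow> real)"
  "(\<integral>\<^sub>Ly. bump d (y :: complex^'n)) = 1"
proof -
 note p = bump0_integral_pos[OF d, where 'n='n]
 show "bump d z \<ge> 0" "norm z < d \<Longrightarrow> bump d z > 0" "norm z \<ge> d \<Longrightarrow> bump d z = 0"
  using p bump0_nonneg[of d z] bump0_pos[of z d] bump0_zero[OF d, of z] by (auto simp: bump_def)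
 show "norm z = norm z' \<Longrightarrow> bump d z = bump d z'" by (simp add: bump_def bump0_def dot_square_norm)
 show "integrable lborel (bump d :: complex^'n \<Rightarrow> real)" "(\<integral>\<^sub>Ly. bump d (y :: complex^'n)) = 1"
  using p bump0_integrable[OF d, where 'n='n] by (simp_all add: bump_def[abs_def])
qed

lemma bump_smooth: "Ck_on m (\<lambda>z. complex_of_real (bump d (z :: complex^'n::finite))) UNIV"
proof -
 have "bounded_linear (\<lambda>x. complex_of_real (x / (\<integral>\<^sub>Ly. bump0 d (y :: complex^'n))))"
  by (intro bounded_linear_compose[OF bounded_linear_of_real] bounded_linear_divide)
 from Ck_on_compose_linear[OF this open_UNIV bump0_Ck] show ?thesis by (simp add: bump_def)
qed

lemma bump_continuous: "continuous_on UNIV (bump d :: complex^'n::finite \<Rightarrow> real)"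
 using Ck_on_compose_linear[OF bounded_linear_Re open_UNIV bump_smooth[where m=0]] by simp

lemma bump_levi: "\<exists>P L. has_levi UNIV (bump d :: complex^'n::finite \<Rightarrow> real) P L"
 using test_has_levi[OF bump_smooth[where 'n='n and d=d]] by auto

lemma Ck_on_shift: "Ck_on m f UNIV \<Longrightarrow> Ck_on m (\<lambda>y. f (x - y)) UNIV"
proof (induction m arbitrary: f)
 case 0
 then show ?case by (auto intro!: continuous_on_compose2[of UNIV f] continuous_intros)
next
 case (Suc m)
 obtain D where D: "\<And>x. (f has_derivative D x) (at x)" "\<And>v. Ck_on m (\<lambda>x. D x v) UNIV"
  using Suc.prems by (metis Ck_on_SucE UNIV_I)
 have "((\<lambda>y. x - y) has_derivative (\<lambda>v. - v)) (at y)" for y by (auto intro!: derivative_eq_intros)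
 from has_derivative_compose[OF this D(1)] Suc.IH[OF D(2)]
 show ?case by (intro Ck_on_SucI[where D="\<lambda>y v. D (x - y) (- v)"]) auto
qed

section \<open>Regularization of plurisubharmonic functions\<close>

lemma cis_scaled_measurable [measurable]:
 "(\<lambda>p. a + cis (fst p) *s snd p) \<in> borel_measurable (borel \<Otimes>\<^sub>M (borel :: (complex^'n::finite) measure))"
 unfolding borel_prod vector_scalar_mult_def
 by (intro borel_measurable_continuous_onI continuous_intros)

lemma disc_in_cball: "norm w \<le> d \<Longrightarrow> cdisc a w \<subseteq> cball (a::complex^'n::finite) d"
 by (auto simp: dist_norm norm_scalar_mult intro!: order_trans[OF mult_left_le_one_le])

text \<open>The kernel is invariant under y \<mapsto> cis t y, so \<open>I\<close> may be averaged
  over t. After exchanging the integrals, the inner one runs over the circle around \<open>x\<close>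
  through \<open>x + y\<close>, where the sub-mean-value property applies; for
  \<open>norm y > d\<close> the kernel vanishes.\<close>

lemma psh_bump_mean:
 fixes u :: "complex^'n::finite \<Rightarrow> ereal"
 assumes u: "psh_coord S u" and S: "open S" and d: "d > 0" "cball x d \<subseteq> S" and B: "\<And>z. z \<in> cball x d \<Longrightarrow> u z \<le> ereal B"
 shows "(\<integral>\<^sub>+y. (if y \<in> S then gap B u y else 0) * ennreal (bump d (x - y))) \<le> gap B u x"
proof -
 define g where "g y = (if y \<in> S then gap B u y else 0)" for y
 have [measurable]: "g \<in> borel_measurable borel"
  unfolding g_def[abs_def] by (rule usc_measurable[OF psh_coord_usc[OF u S] S])
 have [measurable]: "bump d \<in> borel_measurable (borel :: (complex^'n) measure)"
  by (rule borel_measurable_continuous_onI[OF bump_continuous])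
 define I where "I = (\<integral>\<^sub>+y. g (x + y) * ennreal (bump d y))"
 have "(\<integral>\<^sub>+y. g y * ennreal (bump d (x - y))) = (\<integral>\<^sub>+y. g (x + y) * ennreal (bump d (x - (x + y))))"
  by (rule nn_integral_shift[symmetric]) measurable
 also have "\<dots> = I" unfolding I_def using bump_props(4)[OF d(1) norm_minus_cancel, where 'n='n] by simp
 finally have 1: "(\<integral>\<^sub>+y. g y * ennreal (bump d (x - y))) = I" .
 have rot: "(\<integral>\<^sub>+y. g (x + cis t *s y) * ennreal (bump d y)) = I" for t
 proof -
  have "bump d (cis t *s y) = bump d y" for y :: "complex^'n"
   by (rule bump_props(4)[OF d(1)]) (simp add: norm_scalar_mult)
  then show ?thesis unfolding I_def
   using nn_integral_rotate[of "\<lambda>y. g (x + y) * ennreal (bump d y)" t] by simp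
 qed
 have "I * ennreal (2*pi) = (\<integral>\<^sub>+t. I * indicator {0..2*pi} t)"
  by (rule nn_integral_circle_const[symmetric])
 also have "\<dots> = (\<integral>\<^sub>+t. (\<integral>\<^sub>+y. g (x + cis t *s y) * ennreal (bump d y) * indicator {0..2*pi} t))"
 proof (rule nn_integral_cong)
  fix t :: real
  have [measurable]: "(\<lambda>y. g (x + cis t *s y)) \<in> borel_measurable borel"
   using measurable_compose[OF _ \<open>g \<in> borel_measurable borel\<close>, of "\<lambda>y. x + cis t *s y" borel]
   by (simp add: borel_measurable_continuous_onI continuous_intros vector_scalar_mult_def)
  show "I * indicator {0..2*pi} t = (\<integral>\<^sub>+y. g (x + cis t *s y) * ennreal (bump d y) * indicator {0..2*pi} t)"
   by (subst nn_integral_multc) (measurable, simp add: rot)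
 qed
 also have "\<dots> = (\<integral>\<^sub>+y. (\<integral>\<^sub>+t. g (x + cis t *s y) * ennreal (bump d y) * indicator {0..2*pi} t))"
 proof (rule lborel_pair.Fubini'[symmetric])
  have "(\<lambda>p. g (x + cis (fst p) *s snd p) * ennreal (bump d (snd p)) * indicator {0..2*pi} (fst p))
   \<in> borel_measurable (borel \<Otimes>\<^sub>M borel)" by measurable
  then show "(\<lambda>(t, y). g (x + cis t *s y) * ennreal (bump d y) * indicator {0..2*pi} t) \<in> borel_measurable (lborel \<Otimes>\<^sub>M lborel)"
   by (simp add: case_prod_unfold cong: measurable_cong_sets)
 qed
 also have "\<dots> \<le> (\<integral>\<^sub>+y. ennreal (2*pi) * gap B u x * ennreal (bump d (y :: complex^'n)))"
 proof (rule nn_integral_mono)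
  fix y :: "complex^'n"
  have [measurable]: "(\<lambda>t. g (x + cis t *s y)) \<in> borel_measurable borel"
   using measurable_compose[OF _ \<open>g \<in> borel_measurable borel\<close>, of "\<lambda>t. x + cis t *s y" borel]
   by (simp add: borel_measurable_continuous_onI circle_continuous)
  show "(\<integral>\<^sub>+t. g (x + cis t *s y) * ennreal (bump d y) * indicator {0..2*pi} t) \<le> ennreal (2*pi) * gap B u x * ennreal (bump d y)"
  proof (cases "norm y \<le> d")
   case True
   note D = disc_in_cball[OF True, of x]
   have eq: "g (x + cis t *s y) = gap B u (x + cis t *s y)" for t
    using subsetD[OF order_trans[OF D d(2)] circle_in_disc[of x t y]] by (simp add: g_def)
   have "(\<integral>\<^sub>+t. g (x + cis t *s y) * ennreal (bump d y) * indicator {0..2*pi} t) = (\<integral>\<^sub>+t. g (x + cis t *s y) * indicator {0..2*pi} t * ennreal (bump d y))"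
    by (simp only: mult_ac)
   also have "\<dots> = cint g x y * ennreal (bump d y)" unfolding cint_def
    by (rule nn_integral_multc) measurable
   also have "cint g x y = cint (gap B u) x y" unfolding cint_def eq ..
   also have "cint (gap B u) x y \<le> ennreal (2*pi) * gap B u x"
    by (rule psh_coord_cint[OF u S order_trans[OF D d(2)]]) (use D B in blast)
   finally show ?thesis by (simp add: mult_right_mono)
  qed (simp add: bump_props(3)[OF d(1)])
 qed
 also have "\<dots> = ennreal (2*pi) * gap B u x * (\<integral>\<^sub>+y. ennreal (bump d (y :: complex^'n)))"
  by (rule nn_integral_cmult) measurable
 also have "(\<integral>\<^sub>+y. ennreal (bump d (y :: complex^'n))) = 1"
  using bump_props(1,5,6)[OF d(1), where 'n='n] by (subst nn_integral_eq_integral) auto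
 finally have "ennreal (2*pi) * I \<le> ennreal (2*pi) * gap B u x" by (simp add: mult.commute)
 then have "I \<le> gap B u x" by (rule ennreal_mult_le_mult_iff[THEN iffD1, rotated -1]) auto
 then show ?thesis using 1 by (simp add: g_def)
qed

lemma bump_shift_integral:
 assumes d: "d > 0"
 shows "integrable lborel (\<lambda>y. bump d (x - y :: complex^'n::finite))" "(\<integral>\<^sub>Ly. bump d (x - y :: complex^'n)) = 1"
  "(\<integral>\<^sub>+y. ennreal (bump d (x - y :: complex^'n))) = 1"
proof -
 have m: "bump d \<in> borel_measurable (borel :: (complex^'n) measure)"
  by (rule borel_measurable_continuous_onI[OF bump_continuous])
 have "(\<integral>\<^sub>+y. ennreal (bump d (x - y :: complex^'n))) = (\<integral>\<^sub>+y. ennreal (bump d (y :: complex^'n)))"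
  using m by (intro nn_integral_reflect) measurable
 also have "\<dots> = 1"
  using bump_props(1,5,6)[OF d, where 'n='n] by (subst nn_integral_eq_integral) auto
 finally show 3: "(\<integral>\<^sub>+y. ennreal (bump d (x - y :: complex^'n))) = 1" .
 show 1: "integrable lborel (\<lambda>y. bump d (x - y :: complex^'n))"
  using 3 m bump_props(1)[OF d, where 'n='n] by (intro integrableI_nonneg) auto
 show "(\<integral>\<^sub>Ly. bump d (x - y :: complex^'n)) = 1"
  using nn_integral_eq_integral[OF 1] 3 bump_props(1)[OF d, where 'n='n]
  by (metis (no_types, lifting) AE_I2 ennreal_eq_1)
qed

lemma bump_conv_integrable:
 assumes k: "integrable lborel (k :: complex^'n::finite \<Rightarrow> real)" and d: "d > 0"
 shows "integrable lborel (\<lambda>y. k y * bump d (x - y))"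
proof -
 have "integrable lborel (\<lambda>y. k y *\<^sub>R bump d (x - y))"
  by (rule conv_integrable[OF k bump_continuous compact_cball[of 0 d]]) (simp add: bump_props(3)[OF d])
 then show ?thesis by simp
qed

text \<open>On the null set where a singular function is -\<infinity> its real representative has
  the default value 0 and may violate the bound; hence the hypothesis almost everywhere.\<close>

lemma bump_conv_le:
 assumes k: "integrable lborel (k :: complex^'n::finite \<Rightarrow> real)" and d: "d > 0"
  and t: "AE y in lborel. dist x y < d \<longrightarrow> k y \<le> t"
 shows "(\<integral>\<^sub>Ly. k y * bump d (x - y)) \<le> t"
proof -
 have "(\<integral>\<^sub>Ly. k y * bump d (x - y)) \<le> (\<integral>\<^sub>Ly. t * bump d (x - y))"
 proof (rule integral_mono_AE[OF bump_conv_integrable[OF k d]])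
  show "integrable lborel (\<lambda>y. t * bump d (x - y))" using bump_shift_integral(1)[OF d, of x] by simp
  show "AE y in lborel. k y * bump d (x - y) \<le> t * bump d (x - y)" using t
  proof eventually_elim
   case (elim y)
   show ?case
   proof (cases "dist x y < d")
    case True
    then show ?thesis using elim bump_props(1)[OF d, of "x - y"] by (intro mult_right_mono) auto
   qed (simp add: bump_props(3)[OF d] dist_norm)
  qed
 qed
 then show ?thesis using bump_shift_integral(2)[OF d, of x] by simp
qed

text \<open>\<open>psh_bump_mean\<close> in terms of real integrals: \<open>k\<close> is a real
  representative of \<open>u\<close>, which may be -\<infinity> on a null set.\<close>

lemma psh_le_bump_conv:
 fixes u :: "complex^'n::finite \<Rightarrow> ereal"
 assumes u: "psh_coord S u" and S: "open S" and d: "d > 0" "cball x d \<subseteq> S"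
  and k: "integrable lborel k" "AE y in lborel. y \<in> cball x d \<longrightarrow> u y = ereal (k y)"
 shows "u x \<le> ereal (\<integral>\<^sub>Ly. k y * bump d (x - y))"
proof (cases "u x")
 case (real r)
 obtain B where B: "\<And>z. z \<in> cball x d \<Longrightarrow> u z \<le> ereal B"
  using usc_bounded_above[OF psh_coord_usc[OF u S] psh_coord_less_top[OF u] compact_cball d(2)] less_imp_le by blast
 have i: "integrable lborel (\<lambda>y. (B - k y) * bump d (x - y))"
  using bump_conv_integrable[OF k(1) d(1)] bump_shift_integral(1)[OF d(1), of x] by (simp add: left_diff_distrib)
 have eq: "AE y in lborel. (if y \<in> S then gap B u y else 0) * ennreal (bump d (x - y)) = ennreal ((B - k y) * bump d (x - y))
   \<and> 0 \<le> (B - k y) * bump d (x - y)"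
  using k(2)
 proof eventually_elim
  case (elim y)
  show ?case
  proof (cases "y \<in> cball x d")
   case True
   then have "u y = ereal (k y)" "y \<in> S" using elim d by auto
   moreover from this have "k y \<le> B" using B[OF True] by simp
   ultimately show ?thesis using bump_props(1)[OF d(1), of "x - y"] by (simp add: ennreal_mult'')
  next
   case False
   then have "bump d (x - y) = 0" by (intro bump_props(3)[OF d(1)]) (simp add: dist_norm)
   then show ?thesis by simp
  qed
 qed
 have "ennreal (B - (\<integral>\<^sub>Ly. k y * bump d (x - y))) = ennreal (\<integral>\<^sub>Ly. (B - k y) * bump d (x - y))"
  using bump_conv_integrable[OF k(1) d(1)] bump_shift_integral[OF d(1), of x] by (simp add: left_diff_distrib)
 also have "\<dots> = (\<integral>\<^sub>+y. ennreal ((B - k y) * bump d (x - y)))"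
  by (rule nn_integral_eq_integral[symmetric, OF i]) (use eq in auto)
 also have "\<dots> = (\<integral>\<^sub>+y. (if y \<in> S then gap B u y else 0) * ennreal (bump d (x - y)))"
  by (rule nn_integral_cong_AE) (use eq in auto)
 also have "\<dots> \<le> gap B u x" by (rule psh_bump_mean[OF u S d B])
 finally have "ennreal (B - (\<integral>\<^sub>Ly. k y * bump d (x - y))) \<le> ennreal (B - r)" using real by simp
 moreover have "r \<le> B" using B[of x] d(1) real by simp
 ultimately show ?thesis using real by (simp add: ennreal_le_iff)
qed (use psh_coord_less_top[OF u, of x] d in \<open>auto simp: subset_iff\<close>)

text \<open>One finite value is enough: at that point \<open>psh_bump_mean\<close> bounds the
  integral of the gap against the bump, and on the half ball the bump is at least a positive
  constant.\<close>

lemma psh_locally_integrable: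
 fixes u :: "complex^'n::finite \<Rightarrow> ereal"
 assumes u: "psh_coord S u" and S: "open S" and d: "d > 0" "cball x d \<subseteq> S" and fin: "u x \<noteq> -\<infinity>"
 shows "AE y in lborel. y \<in> cball x (d/2) \<longrightarrow> u y \<noteq> -\<infinity>"
  "integrable lborel (\<lambda>y. indicator (cball x (d/2)) y * real_of_ereal (u y))"
proof -
 obtain B where B: "\<And>z. z \<in> cball x d \<Longrightarrow> u z \<le> ereal B"
  using usc_bounded_above[OF psh_coord_usc[OF u S] psh_coord_less_top[OF u] compact_cball d(2)] less_imp_le by blast
 define g where "g y = (if y \<in> S then gap B u y else 0)" for y
 have [measurable]: "g \<in> borel_measurable borel"
  unfolding g_def[abs_def] by (rule usc_measurable[OF psh_coord_usc[OF u S] S])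
 have [measurable]: "bump d \<in> borel_measurable (borel :: (complex^'n) measure)"
  by (rule borel_measurable_continuous_onI[OF bump_continuous])
 have "\<exists>c>0. \<forall>y\<in>cball (0::complex^'n) (d/2). c \<le> bump d y"
 proof -
  have "\<exists>y0\<in>cball (0::complex^'n) (d/2). \<forall>y\<in>cball (0::complex^'n) (d/2). bump d y0 \<le> bump d y"
   by (intro continuous_attains_inf continuous_on_subset[OF bump_continuous]) (use d(1) in auto)
  then obtain y0 where "y0 \<in> cball (0::complex^'n) (d/2)" "\<forall>y\<in>cball (0::complex^'n) (d/2). bump d y0 \<le> bump d y"
   by blast
  then show ?thesis using bump_props(2)[OF d(1), of y0] d(1) by (intro exI[of _ "bump d y0"]) auto
 qed
 then obtain c where c: "c > 0" "\<And>y::complex^'n. norm y \<le> d/2 \<Longrightarrow> c \<le> bump d y" by auto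
 have [measurable]: "cball x (d/2) \<in> sets borel" by simp
 define I where "I = (\<integral>\<^sub>+y. g y * indicator (cball x (d/2)) y)"
 have "ennreal c * I = (\<integral>\<^sub>+y. ennreal c * (g y * indicator (cball x (d/2)) y))"
  unfolding I_def by (rule nn_integral_cmult[symmetric]) measurable
 also have "\<dots> \<le> (\<integral>\<^sub>+y. g y * ennreal (bump d (x - y)))"
 proof (rule nn_integral_mono)
  fix y
  show "ennreal c * (g y * indicator (cball x (d/2)) y) \<le> g y * ennreal (bump d (x - y))"
  proof (cases "y \<in> cball x (d/2)")
   case True
   then have "ennreal c * g y \<le> ennreal (bump d (x - y)) * g y"
    by (intro mult_right_mono ennreal_leI c(2)) (auto simp: dist_norm)
   then show ?thesis using True by (simp add: mult.commute)
  qed simp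
 qed
 also have "\<dots> \<le> gap B u x" unfolding g_def by (rule psh_bump_mean[OF u S d B])
 also have "\<dots> < top" using fin psh_coord_less_top[OF u, of x] subsetD[OF d(2), of x] d(1) by (cases "u x") auto
 finally have I: "I < top" using c(1) by (auto simp: ennreal_mult_less_top)
 have "AE y in lborel. g y * indicator (cball x (d/2)) y \<noteq> top"
 proof -
  have m: "(\<lambda>y. g y * indicator (cball x (d/2)) y) \<in> borel_measurable lborel" by measurable
  show ?thesis using nn_integral_PInf_AE[OF m] I unfolding I_def infinity_ennreal_def by auto
 qed
 then show AE: "AE y in lborel. y \<in> cball x (d/2) \<longrightarrow> u y \<noteq> -\<infinity>"
 proof eventually_elim
  case (elim y)
  show ?case
  proof (intro impI notI)
   assume "y \<in> cball x (d/2)" "u y = -\<infinity>"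
   moreover from this have "y \<in> S" using d subset_cball[of "d/2" d x] by auto
   ultimately show False using elim by (simp add: g_def)
  qed
 qed
 have "integrable lborel (\<lambda>y. enn2real (g y * indicator (cball x (d/2)) y))"
 proof (rule integrableI_bounded)
  have "(\<integral>\<^sub>+y. ennreal (norm (enn2real (g y * indicator (cball x (d/2)) y)))) \<le> I"
   unfolding I_def by (rule nn_integral_mono) (auto simp: ennreal_enn2real_if)
  then show "(\<integral>\<^sub>+y. ennreal (norm (enn2real (g y * indicator (cball x (d/2)) y)))) < \<infinity>"
   using I by (simp add: le_less_trans)
 qed measurable
 moreover have "integrable lborel (\<lambda>y. B * indicator (cball x (d/2)) y :: real)"
  using emeasure_lborel_cball_finite[of x "d/2"] by (intro integrable_mult_right integrable_real_indicator) auto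
 ultimately have i: "integrable lborel (\<lambda>y. B * indicator (cball x (d/2)) y - enn2real (g y * indicator (cball x (d/2)) y))"
  by (intro Bochner_Integration.integrable_diff)
 have eq: "B * indicator (cball x (d/2)) y - enn2real (g y * indicator (cball x (d/2)) y) = indicator (cball x (d/2)) y * real_of_ereal (u y)"
  if "y \<in> cball x (d/2) \<longrightarrow> u y \<noteq> -\<infinity>" for y
 proof (cases "y \<in> cball x (d/2)")
  case True
  then have y: "y \<in> cball x d" "y \<in> S" using d subset_cball[of "d/2" d x] by auto
  have "u y \<noteq> -\<infinity>" using that True by blast
  then obtain r where r: "u y = ereal r" using psh_coord_less_top[OF u y(2)] by (cases "u y") auto
  then have "r \<le> B" using B[OF y(1)] by simp
  then show ?thesis using True r y by (simp add: g_def)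
 qed simp
 have "(\<lambda>y. indicator (cball x (d/2)) y * real_of_ereal (u y)) \<in> borel_measurable borel"
 proof -
  have "indicator (cball x (d/2)) y * real_of_ereal (u y) =
    (if g y = top then 0 else B * indicator (cball x (d/2)) y - enn2real (g y * indicator (cball x (d/2)) y))" for y
  proof (cases "y \<in> cball x (d/2)")
   case True
   then have y: "y \<in> cball x d" "y \<in> S" using d subset_cball[of "d/2" d x] by auto
   show ?thesis
   proof (cases "u y = -\<infinity>")
    case True
    then show ?thesis using y by (simp add: g_def)
   next
    case False
    then have "g y \<noteq> top" using psh_coord_less_top[OF u y(2)] y by (cases "u y") (auto simp: g_def)
    then show ?thesis using eq[of y] False by simp
   qed
  qed simp
  then show ?thesis by simp
 qed
 then show "integrable lborel (\<lambda>y. indicator (cball x (d/2)) y * real_of_ereal (u y))"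
  using AE eq by (intro integrable_cong_AE_imp[OF i]) (auto elim!: eventually_mono)
qed

text \<open>Converse of \<open>has_levi_mean\<close>: a negative value of the form at
  \<open>x\<close> persists nearby by continuity, and then \<open>- G\<close> would gain strictly on
  a small circle in the direction \<open>w\<close>.\<close>

lemma has_levi_nonneg:
 assumes L: "has_levi S G P L" and S: "open S" "x \<in> S" and j: "j > 0"
  and m: "\<And>w. norm w \<le> j \<Longrightarrow> 2*pi*G x \<le> integral {0..2*pi} (\<lambda>t. G (x + cis t *s w))"
 shows "0 \<le> qf (L x) w"
proof (rule ccontr)
 assume neg: "\<not> 0 \<le> qf (L x) w"
 define c where "c = - qf (L x) w / 2"
 have c: "c > 0" using neg by (simp add: c_def)
 have "continuous_on S (\<lambda>z. qf (L z) w)"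
  using L unfolding has_levi_def by (intro continuous_intros) auto
 then have "open {z\<in>S. qf (L z) w < - c}"
  using continuous_open_preimage[OF _ S(1) open_lessThan, of "\<lambda>z. qf (L z) w" "-c"] by (simp add: vimage_def Int_def)
 moreover have "x \<in> {z\<in>S. qf (L z) w < - c}" using S c by (simp add: c_def)
 ultimately obtain e where e: "e > 0" "ball x e \<subseteq> {z\<in>S. qf (L z) w < - c}" by (meson openE)
 \<comment> \<open>Scales \<open>w\<close> into the range \<open>j\<close> of the hypothesis and
   into the ball where the form stays below \<open>- c\<close>; the 1 avoids a division by
   0.\<close>
 define r where "r = min j (e/2) / (norm w + 1)"
 have r: "r > 0" using j e(1) by (auto simp: r_def intro!: divide_pos_pos add_nonneg_pos)
 have "r * norm w \<le> r * (norm w + 1)" using r by (intro mult_left_mono) auto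
 also have "\<dots> = min j (e/2)"
  using norm_ge_zero[of w] by (simp add: r_def add_nonneg_eq_0_iff)
 finally have rw: "norm (of_real r *s w) \<le> j" "norm (of_real r *s w) \<le> e/2" using r by (auto simp: norm_scalar_mult)
 have in_ball: "x + b *s (of_real r *s w) \<in> ball x e" if "cmod b \<le> 1" for b
  using disc_in_cball[OF rw(2), of x] that e(1) by (force simp: dist_norm)
 have "2*pi*(- G x + r^2 * c) \<le> integral {0..2*pi} (\<lambda>t. - G (x + cis t *s (of_real r *s w)))"
 proof (rule has_levi_mean[OF has_levi_uminus[OF L]])
  fix b assume z: "cmod b \<le> 1"
  show "x + b *s (of_real r *s w) \<in> S" using in_ball[OF z] e(2) by auto
  have "r^2 * c \<le> r^2 * (- qf (L (x + b *s (of_real r *s w))) w)"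
   using in_ball[OF z] e(2) r by (intro mult_left_mono) auto
  then show "r^2 * c \<le> qf (- L (x + b *s (of_real r *s w))) (of_real r *s w)"
   using r by (simp add: hform_minus hform_scale)
 qed
 then have "2*pi*(G x - r^2 * c) \<ge> integral {0..2*pi} (\<lambda>t. G (x + cis t *s (of_real r *s w)))"
  by (simp add: algebra_simps)
 moreover have "2*pi*G x \<le> integral {0..2*pi} (\<lambda>t. G (x + cis t *s (of_real r *s w)))" by (rule m[OF rw(1)])
 moreover have "0 < 2*pi*(r^2*c)" using r c by simp
 ultimately show False by (simp add: right_diff_distrib)
qed

lemma bump_conv_levi:
 assumes k: "integrable lborel (k :: complex^'n::finite \<Rightarrow> real)" and d: "d > 0" and L: "has_levi UNIV (bump d) P L"
 shows "has_levi UNIV (\<lambda>x. (\<integral>\<^sub>Ly. k y * bump d (x - y))) (\<lambda>x. (\<integral>\<^sub>Ly. k y *\<^sub>R P (x - y))) (\<lambda>x. (\<integral>\<^sub>Ly. k y *\<^sub>R L (x - y)))"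
 by (rule has_levi_conv[OF k L compact_cball[of 0 d]]) (simp add: bump_props(3)[OF d])

text \<open>The sub-mean-value property of a convolution is an average of those of translates.\<close>

lemma bump_conv_sub_mean:
 fixes u :: "complex^'n::finite \<Rightarrow> ereal"
 assumes u: "psh_coord S u" and S: "open S" and d: "d > 0" and w: "norm w \<le> r" and sub: "cball x (d + r) \<subseteq> S"
  and k: "integrable lborel k" "\<And>y. y \<in> cball x (d + r) \<Longrightarrow> u y = ereal (k y)" and kb: "\<And>y. k y \<le> B" "k \<in> borel_measurable borel"
 defines "v \<equiv> \<lambda>x. (\<integral>\<^sub>Ly. k y * bump d (x - y))"
 shows "2*pi*(v x) \<le> integral {0..2*pi} (\<lambda>t. v (x + cis t *s w))"
proof -
 have [measurable]: "k \<in> borel_measurable borel" by (rule kb(2))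
 have [measurable]: "bump d \<in> borel_measurable (borel :: (complex^'n) measure)"
  by (rule borel_measurable_continuous_onI[OF bump_continuous])
 have vB: "v z \<le> B" for z unfolding v_def by (rule bump_conv_le[OF k(1) d]) (use kb in auto)
 have gapv: "ennreal (B - v z) = (\<integral>\<^sub>+y. ennreal (B - k (z + y)) * ennreal (bump d y))" for z
 proof -
  have i: "integrable lborel (\<lambda>y. (B - k y) * bump d (z - y))"
   using bump_conv_integrable[OF k(1) d] bump_shift_integral(1)[OF d, of z] by (simp add: left_diff_distrib)
  have "ennreal (B - v z) = ennreal (\<integral>\<^sub>Ly. (B - k y) * bump d (z - y))"
   using bump_conv_integrable[OF k(1) d] bump_shift_integral[OF d, of z] by (simp add: left_diff_distrib v_def)
  also have "\<dots> = (\<integral>\<^sub>+y. ennreal ((B - k y) * bump d (z - y)))"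
   by (rule nn_integral_eq_integral[symmetric, OF i]) (intro AE_I2 mult_nonneg_nonneg, auto simp: kb(1) bump_props(1)[OF d])
  also have "\<dots> = (\<integral>\<^sub>+y. ennreal ((B - k (z + y)) * bump d (z - (z + y))))"
   by (rule nn_integral_shift[symmetric]) measurable
  also have "\<dots> = (\<integral>\<^sub>+y. ennreal (B - k (z + y)) * ennreal (bump d y))"
  proof (rule nn_integral_cong)
   fix y
   have "bump d (z - (z + y)) = bump d y" by (rule bump_props(4)[OF d]) simp
   then show "ennreal ((B - k (z + y)) * bump d (z - (z + y))) = ennreal (B - k (z + y)) * ennreal (bump d y)"
    using kb(1) bump_props(1)[OF d, where 'n='n] by (simp add: ennreal_mult)
  qed
  finally show ?thesis .
 qed
 have cv: "continuous_on UNIV v" unfolding v_def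
  using conv_continuous[OF k(1) bump_continuous compact_cball[of 0 d]] bump_props(3)[OF d, where 'n='n] by simp
 have "ennreal (2*pi*B - integral {0..2*pi} (\<lambda>t. v (x + cis t *s w))) = cint (\<lambda>z. ennreal (B - v z)) x w"
  by (rule cint_continuous[symmetric, OF continuous_on_compose2[OF cv circle_continuous[of UNIV]] vB]) simp
 also have "\<dots> = (\<integral>\<^sub>+t. (\<integral>\<^sub>+y. ennreal (B - k ((x + cis t *s w) + y)) * ennreal (bump d y) * indicator {0..2*pi} t))"
  unfolding cint_def gapv by (intro nn_integral_cong nn_integral_multc[symmetric]) measurable
 also have "\<dots> = (\<integral>\<^sub>+y. (\<integral>\<^sub>+t. ennreal (B - k ((x + cis t *s w) + y)) * ennreal (bump d y) * indicator {0..2*pi} t))"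
 proof (rule lborel_pair.Fubini'[symmetric])
  have [measurable]: "(\<lambda>p. (x + cis (fst p) *s w) + snd p) \<in> borel_measurable (borel \<Otimes>\<^sub>M borel)"
   unfolding borel_prod vector_scalar_mult_def by (intro borel_measurable_continuous_onI continuous_intros)
  have "(\<lambda>p. ennreal (B - k ((x + cis (fst p) *s w) + snd p)) * ennreal (bump d (snd p)) * indicator {0..2*pi} (fst p))
   \<in> borel_measurable (borel \<Otimes>\<^sub>M borel)" by measurable
  then show "(\<lambda>(t, y). ennreal (B - k ((x + cis t *s w) + y)) * ennreal (bump d y) * indicator {0..2*pi} t) \<in> borel_measurable (lborel \<Otimes>\<^sub>M lborel)"
   by (simp add: case_prod_unfold cong: measurable_cong_sets)
 qed
 also have "\<dots> \<le> (\<integral>\<^sub>+y. ennreal (2*pi) * (ennreal (B - k (x + y)) * ennreal (bump d y)))"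
 proof (rule nn_integral_mono)
  fix y :: "complex^'n"
  show "(\<integral>\<^sub>+t. ennreal (B - k ((x + cis t *s w) + y)) * ennreal (bump d y) * indicator {0..2*pi} t)
    \<le> ennreal (2*pi) * (ennreal (B - k (x + y)) * ennreal (bump d y))"
  proof (cases "norm y \<le> d")
   case True
   have c: "cball (x + y) r \<subseteq> cball x (d + r)"
   proof
    fix z assume "z \<in> cball (x + y) r"
    then show "z \<in> cball x (d + r)" using True norm_triangle_ineq[of "x + y - z" "- y"] by (simp add: dist_norm)
   qed
   note D = order_trans[OF disc_in_cball[OF w] c]
   have eq: "gap B u z = ennreal (B - k z)" if "z \<in> cball x (d + r)" for z using k(2)[OF that] by simp
   have [measurable]: "(\<lambda>t. k ((x + cis t *s w) + y)) \<in> borel_measurable borel"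
    using measurable_compose[OF _ kb(2), of "\<lambda>t. (x + cis t *s w) + y" borel]
    by (simp add: borel_measurable_continuous_onI continuous_intros vector_scalar_mult_def)
   have "(\<integral>\<^sub>+t. ennreal (B - k ((x + cis t *s w) + y)) * ennreal (bump d y) * indicator {0..2*pi} t)
    = (\<integral>\<^sub>+t. ennreal (B - k ((x + cis t *s w) + y)) * indicator {0..2*pi} t * ennreal (bump d y))"
    by (simp only: mult_ac)
   also have "\<dots> = (\<integral>\<^sub>+t. ennreal (B - k ((x + cis t *s w) + y)) * indicator {0..2*pi} t) * ennreal (bump d y)"
    by (rule nn_integral_multc) measurable
   also have "(\<integral>\<^sub>+t. ennreal (B - k ((x + cis t *s w) + y)) * indicator {0..2*pi} t) = cint (gap B u) (x + y) w"
    unfolding cint_def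
   proof (rule nn_integral_cong)
    fix t
    have "(x + y) + cis t *s w \<in> cball x (d + r)" by (rule subsetD[OF D circle_in_disc])
    from eq[OF this] show "ennreal (B - k ((x + cis t *s w) + y)) * indicator {0..2*pi} t = gap B u ((x + y) + cis t *s w) * indicator {0..2*pi} t"
     by (simp add: algebra_simps)
   qed
   also have "cint (gap B u) (x + y) w \<le> ennreal (2*pi) * gap B u (x + y)"
   proof (rule psh_coord_cint[OF u S order_trans[OF D sub]])
    fix z assume "z \<in> cdisc (x + y) w"
    then show "u z \<le> ereal B" using k(2)[OF subsetD[OF D]] kb(1) by simp
   qed
   also have "gap B u (x + y) = ennreal (B - k (x + y))" by (rule eq[OF subsetD[OF D center_in_disc]])
   finally show ?thesis by (simp add: mult_right_mono mult.assoc)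
  qed (simp add: bump_props(3)[OF d])
 qed
 also have "\<dots> = ennreal (2*pi) * ennreal (B - v x)"
  unfolding gapv by (rule nn_integral_cmult) measurable
 also have "\<dots> = ennreal (2*pi*B - 2*pi*(v x))"
  using vB by (simp add: ennreal_mult''[symmetric] right_diff_distrib)
 finally have "2*pi*B - integral {0..2*pi} (\<lambda>t. v (x + cis t *s w)) \<le> 2*pi*B - 2*pi*(v x)"
  using vB[of x] by (subst (asm) ennreal_le_iff) (auto simp: pi_ge_zero)
 then show ?thesis by simp
qed

text \<open>\<open>u\<close> may be -\<infinity> on a large set, even identically. So it is first
  truncated to max u (-n), which is bounded on compact sets, and then convolved with bumps whose
  radius tends to 0. Instead of monotone convergence the result records what
  \<open>sub_mean_limit\<close> uses: the approximants lie above \<open>u\<close>, and their upper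
  limit is at most \<open>u\<close>.\<close>

lemma psh_regularize:
 fixes u :: "complex^'n::finite \<Rightarrow> ereal"
 assumes u: "psh_coord S u" and S: "open S" and K: "compact K" "K \<subseteq> S"
 obtains v P L B where "\<And>n::nat. has_levi UNIV (v n) (P n) (L n)"
  "\<And>n x w. x \<in> K \<Longrightarrow> 0 \<le> qf (L n x) w" "\<And>n x. v n x \<le> B" "\<And>x. x \<in> K \<Longrightarrow> u x \<le> ereal B"
  "\<And>x t. x \<in> K \<Longrightarrow> u x < ereal t \<Longrightarrow> eventually (\<lambda>n. v n x \<le> t) sequentially"
  "\<And>n x. x \<in> K \<Longrightarrow> u x \<le> ereal (v n x)"
proof -
 obtain e where e: "e > 0" "(\<Union>x\<in>K. cball x e) \<subseteq> S"
  using compact_subset_open_imp_cball_epsilon_subset[OF K(1) S K(2)] by blast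
 \<comment> \<open>Thickening by \<open>e\<close> makes room for the radius of the kernel and the
   radius of the circle, each at most e/2.\<close>
 define K' where "K' = {x + y | x y. x \<in> K \<and> y \<in> cball 0 e}"
 have cK': "compact K'" unfolding K'_def by (intro compact_sums K compact_cball)
 have KK': "cball x e \<subseteq> K'" if "x \<in> K" for x
 proof
  fix z assume "z \<in> cball x e"
  then have "z = x + (z - x)" "z - x \<in> cball 0 e" by (auto simp: dist_norm norm_minus_commute)
  then show "z \<in> K'" unfolding K'_def using that by blast
 qed
 have K'S: "K' \<subseteq> S"
 proof
  fix z assume "z \<in> K'"
  then obtain x y where "x \<in> K" "y \<in> cball 0 e" "z = x + y" by (auto simp: K'_def)
  then show "z \<in> S" using e(2) by (auto simp: dist_norm intro!: subsetD[OF e(2)] bexI[of _ x])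
 qed
 obtain B0 where "\<forall>z\<in>K'. u z < ereal B0"
  using usc_bounded_above[OF psh_coord_usc[OF u S] psh_coord_less_top[OF u] cK' K'S] by blast
 then have B0: "u z < ereal (max B0 0)" if "z \<in> K'" for z using that by (auto intro: less_le_trans)
 \<comment> \<open>At least 0, so that it also bounds \<open>k\<close>, which is 0 off
   \<open>K'\<close>.\<close>
 define B where "B = max B0 0"
 define U where "U n z = max (u z) (ereal (- real n))" for n z
 define k where "k n y = (if y \<in> K' then real_of_ereal (U n y) else 0)" for n y
 have UB: "- real n \<le> k n y \<and> k n y \<le> B \<and> U n y = ereal (k n y)" if "y \<in> K'" for n y
  using B0[OF that] that by (cases "u y") (auto simp: k_def U_def B_def max_def)
 have kB: "k n y \<le> B" for n y using UB[of y n] by (cases "y \<in> K'") (auto simp: k_def B_def)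
 have pU: "psh_coord S (U n)" for n
  unfolding U_def[abs_def] by (rule psh_coord_max[OF u psh_coord_const S]) (use S in auto)
 have mk: "k n \<in> borel_measurable borel" for n
 proof -
  have [measurable]: "(\<lambda>z. if z \<in> S then gap B (U n) z else 0) \<in> borel_measurable borel"
   by (rule usc_measurable[OF psh_coord_usc[OF pU S] S])
  have [measurable]: "K' \<in> sets borel" using cK' by (simp add: borel_compact)
  have "k n y = (if y \<in> K' then B - enn2real (if y \<in> S then gap B (U n) y else 0) else 0)" for y
   using UB[of y n] K'S by (auto simp: k_def)
  then have *: "k n = (\<lambda>y. if y \<in> K' then B - enn2real (if y \<in> S then gap B (U n) y else 0) else 0)" by blast
  show ?thesis unfolding * by measurable
 qed
 have ik: "integrable lborel (k n)" for n
 proof (rule Bochner_Integration.integrable_bound)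
  show "integrable lborel (\<lambda>y. max B (real n) * indicator K' y)"
   using cK' emeasure_compact_finite[OF cK'] by (intro integrable_mult_right integrable_real_indicator) (auto simp: borel_compact)
  show "AE y in lborel. norm (k n y) \<le> norm (max B (real n) * indicator K' y)"
  proof (rule AE_I2)
   fix y
   show "norm (k n y) \<le> norm (max B (real n) * indicator K' y)"
   proof (cases "y \<in> K'")
    case True
    have "\<bar>k n y\<bar> \<le> max B (real n)" using UB[OF True, of n] unfolding abs_le_iff by linarith
    then show ?thesis using True by simp
   qed (simp add: k_def)
  qed
 qed (use mk in measurable)
 define d where "d n = e / 2 / real (Suc n)" for n
 have d: "d n > 0" "d n \<le> e/2" for n using e(1) by (auto simp: d_def field_simps)
 obtain P0 L0 where PL: "\<And>n. has_levi UNIV (bump (d n) :: complex^'n \<Rightarrow> real) (P0 n) (L0 n)"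
 proof -
  have "\<forall>n. \<exists>PL. has_levi UNIV (bump (d n) :: complex^'n \<Rightarrow> real) (fst PL) (snd PL)" using bump_levi by fastforce
  from choice[OF this] obtain f where "\<And>n. has_levi UNIV (bump (d n) :: complex^'n \<Rightarrow> real) (fst (f n)) (snd (f n))" by blast
  then show thesis by (rule that[of "\<lambda>n. fst (f n)" "\<lambda>n. snd (f n)"])
 qed
 define v where "v n x = (\<integral>\<^sub>Ly. k n y * bump (d n) (x - y))" for n x
 define P where "P n x = (\<integral>\<^sub>Ly. k n y *\<^sub>R P0 n (x - y))" for n x
 define L where "L n x = (\<integral>\<^sub>Ly. k n y *\<^sub>R L0 n (x - y))" for n x
 have lev: "has_levi UNIV (v n) (P n) (L n)" for n
  unfolding v_def[abs_def] P_def[abs_def] L_def[abs_def] by (rule bump_conv_levi[OF ik d(1) PL])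
 show thesis
 proof (rule that[OF lev])
  show "0 \<le> qf (L n x) w" if x: "x \<in> K" for n x w
  proof (rule has_levi_nonneg[OF lev open_UNIV UNIV_I])
   show "e/2 > 0" using e by simp
   fix w' :: "complex^'n" assume "norm w' \<le> e/2"
   moreover have "cball x (d n + e/2) \<subseteq> K'" using order_trans[OF subset_cball KK'[OF x], of "d n + e/2"] d(2)[of n] by auto
   ultimately show "2*pi*(v n x) \<le> integral {0..2*pi} (\<lambda>b. v n (x + cis b *s w'))"
    unfolding v_def using UB K'S
    by (intro bump_conv_sub_mean[OF pU S d(1) _ _ ik, where r="e/2" and n1=n and B=B] kB mk) auto
  qed
  show "v n x \<le> B" for n x unfolding v_def by (rule bump_conv_le[OF ik d(1)]) (use kB in auto)
  show "u x \<le> ereal B" if "x \<in> K" for x using B0[of x] KK'[OF that] e(1) by (force simp: B_def intro: less_imp_le)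
  show "u x \<le> ereal (v n x)" if x: "x \<in> K" for n x
  proof -
   have "cball x (d n) \<subseteq> K'" using order_trans[OF subset_cball KK'[OF x], of "d n"] d(2)[of n] e(1) by auto
   then have "U n x \<le> ereal (v n x)" unfolding v_def
    by (intro psh_le_bump_conv[OF pU S d(1) _ ik] AE_I2) (use K'S UB in auto)
   then show ?thesis by (auto simp: U_def)
  qed
  fix x t assume x: "x \<in> K" and t: "u x < ereal t"
  have "open {z\<in>S. u z < ereal t}" by (rule psh_coord_usc[OF u S])
  moreover have "x \<in> {z\<in>S. u z < ereal t}" using t K x by auto
  ultimately obtain j where j: "j > 0" "ball x j \<subseteq> {z\<in>S. u z < ereal t}" by (meson openE)
  have "d \<longlonglongrightarrow> 0" unfolding d_def[abs_def] by (rule LIMSEQ_Suc[OF lim_const_over_n])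
  from order_tendstoD(2)[OF this j(1)]
  have "eventually (\<lambda>n. d n < j \<and> - t < real n) sequentially"
   using filterlim_real_sequentially by (auto simp: filterlim_at_top_dense eventually_conj_iff)
  then show "eventually (\<lambda>n. v n x \<le> t) sequentially"
  proof eventually_elim
   case (elim n)
   show ?case unfolding v_def
   proof (rule bump_conv_le[OF ik d(1)], rule AE_I2, rule impI)
    fix y assume y: "dist x y < d n"
    then have "y \<in> K'" using KK'[OF x] d(2)[of n] e(1) by (auto intro!: subsetD[OF KK'[OF x]])
    moreover have "y \<in> ball x j" using y elim by simp
    then have "u y < ereal t" using j(2) by blast
    ultimately have "ereal (k n y) \<le> ereal t" using UB[of y n] elim unfolding U_def
     by (metis ereal_less_eq(3) less_imp_le max.bounded_iff uminus_ereal.simps(1) minus_le_iff)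
    then show "k n y \<le> t" by simp
   qed
  qed
 qed
qed

text \<open>The definition tests discs in complex lines only, and \<open>F\<close> bends them. For
  approximants with a Levi form the chain rule \<open>has_levi_compose\<close> applies, and
  \<open>sub_mean_limit\<close> passes to \<open>u\<close>; it is enough to regularize near the
  compact image of one disc at a time.\<close>

lemma psh_coord_compose:
 fixes u :: "complex^'n::finite \<Rightarrow> ereal" and F :: "complex^'m::finite \<Rightarrow> complex^'n"
 assumes u: "psh_coord S u" and S: "open S" and F: "holo_on F T" "open T" "F ` T \<subseteq> S"
 shows "psh_coord T (\<lambda>z. u (F z))"
proof (rule psh_coordI[OF F(2)])
 show "u (F z) < \<infinity>" if "z \<in> T" for z using psh_coord_less_top[OF u] F(3) that by blast
 have "{z\<in>T. u (F z) < t} = T \<inter> F -` {z\<in>S. u z < t}" for t using F(3) by auto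
 then show "open {z\<in>T. u (F z) < t}" for t
  using continuous_open_preimage[OF holo_on_continuous[OF F(1)] F(2) psh_coord_usc[OF u S]] by simp
 fix a w :: "complex^'m" let ?D = "cdisc a w"
 assume D: "?D \<subseteq> T"
 have K: "compact (F ` ?D)" "F ` ?D \<subseteq> S"
  using D F(3) by (auto intro!: compact_continuous_image compact_disc continuous_on_subset[OF holo_on_continuous[OF F(1)]])
 obtain v P L B where L: "\<And>n::nat. has_levi UNIV (v n) (P n) (L n)"
  and pos: "\<And>n x w. x \<in> F ` ?D \<Longrightarrow> 0 \<le> qf (L n x) w" and vB: "\<And>n x. v n x \<le> B"
  and uB: "\<And>x. x \<in> F ` ?D \<Longrightarrow> u x \<le> ereal B"
  and up: "\<And>x t. x \<in> F ` ?D \<Longrightarrow> u x < ereal t \<Longrightarrow> eventually (\<lambda>n. v n x \<le> t) sequentially"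
  and lo: "\<And>n x. x \<in> F ` ?D \<Longrightarrow> u x \<le> ereal (v n x)"
  using psh_regularize[OF u S K] by blast
 have L': "has_levi T (\<lambda>z. v n (F z)) (\<lambda>z. transpose (Jac F z) *v P n (F z)) (\<lambda>z. pullback_matrix (Jac F z) (L n (F z)))" for n
  by (rule has_levi_compose[OF L F(1,2)]) simp
 have "cint (gap B (\<lambda>z. u (F z))) a w \<le> ennreal (2*pi) * gap B (\<lambda>z. u (F z)) a"
 proof (rule sub_mean_limit[where v="\<lambda>n z. v n (F z)"])
  show "continuous_on UNIV (\<lambda>b. v n (F (a + cis b *s w)))" for n
   by (rule continuous_on_compose2[OF has_levi_continuous[OF L'] circle_continuous]) (use D circle_in_disc in blast)
  show "v n (F (a + cis b *s w)) \<le> B" for n b by (rule vB)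
  show "2*pi*(v n (F a)) \<le> integral {0..2*pi} (\<lambda>b. v n (F (a + cis b *s w)))" for n
  proof -
   have "2*pi*(v n (F a) + 0) \<le> integral {0..2*pi} (\<lambda>b. v n (F (a + cis b *s w)))"
   proof (rule has_levi_mean[OF L'])
    fix c assume "cmod c \<le> 1"
    then have "a + c *s w \<in> ?D" by blast
    then show "a + c *s w \<in> T" "0 \<le> qf (pullback_matrix (Jac F (a + c *s w)) (L n (F (a + c *s w)))) w"
     using D pos by (auto simp: hform_pullback)
   qed
   then show ?thesis by simp
  qed
  show "eventually (\<lambda>n. v n (F (a + cis b *s w)) \<le> t) sequentially" if "u (F (a + cis b *s w)) < ereal t" for b t
   by (rule up[OF imageI[OF circle_in_disc] that])
  show "eventually (\<lambda>n. t \<le> v n (F a)) sequentially" if "ereal t < u (F a)" for t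
   using lo[OF imageI[OF center_in_disc]] that by (intro always_eventually allI) (meson ereal_less_eq(3) less_imp_le order_trans)
 qed
 then show "\<exists>B. (\<forall>z\<in>?D. u (F z) \<le> ereal B) \<and> cint (gap B (\<lambda>z. u (F z))) a w \<le> ennreal (2*pi) * gap B (\<lambda>z. u (F z)) a"
  using uB by blast
qed

text \<open>If \<open>G \<ge> 0\<close> satisfies \<open>|\<partial>G|\<^sup>2 \<le> G \<partial>\<partial>\<bar>G\<close>, for example \<open>G = |f|\<^sup>2\<close> with \<open>f\<close> holomorphic, then
 \<open>ln (G + 1/n)\<close> has nonnegative Levi form and decreases to \<open>ln G\<close>.\<close>

definition log_psh :: "(complex^'n::finite) set \<Rightarrow> (complex^'n \<Rightarrow> real) \<Rightarrow> (complex^'n \<Rightarrow> complex^'n) \<Rightarrow> (complex^'n \<Rightarrow> complex^'n^'n) \<Rightarrow> bool" where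
 "log_psh S G P L \<longleftrightarrow> has_levi S G P L \<and> (\<forall>z\<in>S. 0 \<le> G z) \<and>
   (\<forall>z\<in>S. \<forall>w. 0 \<le> qf (L z) w \<and> (cmod (dotp (P z) w))\<^sup>2 \<le> G z * qf (L z) w)"

definition eln :: "real \<Rightarrow> ereal" where "eln r = (if r > 0 then ereal (ln r) else -\<infinity>)"

lemma Re_hform_log: "qf (q *\<^sub>R L + (- q\<^sup>2) *\<^sub>R outer p p) w = q * qf L w - q\<^sup>2 * (cmod (dotp p w))\<^sup>2"
 unfolding hform_add hform_scaleR hform_outer complex_norm_square[symmetric] of_real_mult[symmetric] by simp

lemma psh_coord_eln:
 assumes G: "log_psh S G P L" and S: "open S"
 shows "psh_coord S (\<lambda>z. eln (G z))"
proof (rule psh_coordI[OF S])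
 have L: "has_levi S G P L" and G0: "\<And>z. z \<in> S \<Longrightarrow> 0 \<le> G z"
  and cs: "\<And>z w. z \<in> S \<Longrightarrow> 0 \<le> qf (L z) w" "\<And>z w. z \<in> S \<Longrightarrow> (cmod (dotp (P z) w))\<^sup>2 \<le> G z * qf (L z) w"
  using G by (auto simp: log_psh_def)
 have cG: "continuous_on S G" by (rule has_levi_continuous[OF L])
 show "eln (G z) < \<infinity>" for z by (simp add: eln_def)
 have lt: "eln r < ereal t \<longleftrightarrow> r < exp t" for r t
 proof (cases "r > 0")
  case True
  then show ?thesis using ln_less_cancel_iff[of r "exp t"] by (simp add: eln_def)
 next
  case False
  then show ?thesis using less_le_trans[of r 0 "exp t"] le_less_trans[of r 0 "exp t"] by (simp add: eln_def)
 qed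
 show "open {z\<in>S. eln (G z) < t}" for t
 proof (cases t)
  case (real r)
  then show ?thesis
   using continuous_open_preimage[OF cG S open_lessThan, of "exp r"] by (simp add: lt vimage_def Int_def)
 next
  case PInf
  then show ?thesis using S by (simp add: eln_def)
 qed simp
 fix a w :: "complex^'a" let ?D = "cdisc a w"
 assume D: "?D \<subseteq> S"
 have "bounded (G ` ?D)" by (intro compact_imp_bounded compact_continuous_image compact_disc continuous_on_subset[OF cG D])
 then obtain M where "\<forall>x\<in>G ` ?D. norm x \<le> M" unfolding bounded_iff by blast
 then have M: "G z \<le> M" if "z \<in> ?D" for z
  using imageI[OF that, of G] abs_le_D1[of "G z" M] unfolding real_norm_def by blast
 define e where "e n = 1 / real (Suc n)" for n
 have e: "e n > 0" "e n \<le> 1" for n by (auto simp: e_def)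
 have e0: "e \<longlonglongrightarrow> 0" unfolding e_def[abs_def] by (rule LIMSEQ_Suc[OF lim_1_over_n])
 have L': "has_levi S (\<lambda>z. ln (G z + e n)) (\<lambda>z. inverse (G z + e n) *\<^sub>R P z)
   (\<lambda>z. inverse (G z + e n) *\<^sub>R L z + (- (inverse (G z + e n))\<^sup>2) *\<^sub>R outer (P z) (P z))" for n
 proof (rule has_levi_chain[OF L, where I="{0..}"])
  fix x :: real assume x: "x \<in> {0..}"
  then have "x + e n > 0" using e(1)[of n] by auto
  then show "((\<lambda>x. ln (x + e n)) has_real_derivative inverse (x + e n)) (at x)"
   "((\<lambda>x. inverse (x + e n)) has_real_derivative - (inverse (x + e n))\<^sup>2) (at x)"
   by (auto intro!: derivative_eq_intros simp: field_simps power2_eq_square)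
 next
  show "continuous_on {0..} (\<lambda>x. - (inverse (x + e n))\<^sup>2)"
   using e(1)[of n] by (intro continuous_intros) (auto simp: add_nonneg_eq_0_iff)
 qed (use G0 in auto)
 define B where "B = ln (M + 1)"
 have vB: "ln (G z + e n) \<le> B" if "z \<in> ?D" for z n
  unfolding B_def using M[OF that] e[of n] G0[OF subsetD[OF D that]] by (intro ln_mono) auto
 have "cint (gap B (\<lambda>z. eln (G z))) a w \<le> ennreal (2*pi) * gap B (\<lambda>z. eln (G z)) a"
 proof (rule sub_mean_limit[where v="\<lambda>n z. ln (G z + e n)"])
  show "continuous_on UNIV (\<lambda>b. ln (G (a + cis b *s w) + e n))" for n
   by (rule continuous_on_compose2[OF has_levi_continuous[OF L'] circle_continuous]) (use D circle_in_disc in blast)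
  show "ln (G (a + cis b *s w) + e n) \<le> B" for n b by (rule vB[OF circle_in_disc])
  show "2*pi*ln (G a + e n) \<le> integral {0..2*pi} (\<lambda>b. ln (G (a + cis b *s w) + e n))" for n
  proof -
   have "2*pi*(ln (G a + e n) + 0) \<le> integral {0..2*pi} (\<lambda>b. ln (G (a + cis b *s w) + e n))"
   proof (rule has_levi_mean[OF L'])
    fix c assume "cmod c \<le> 1"
    then have z: "a + c *s w \<in> S" (is "?z \<in> S") using D by blast
    then show "?z \<in> S" .
    let ?q = "inverse (G ?z + e n)" and ?h = "qf (L ?z) w"
    have q: "?q > 0" using G0[OF z] e(1)[of n] by (simp add: add_nonneg_pos)
    \<comment> \<open>The negative term in the Levi form of the logarithm is absorbed by the
      positive one, through the gradient bound in \<open>log_psh\<close> and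
      \<open>?q * G ?z \<le> 1\<close>.\<close>
    have "?q^2 * (cmod (dotp (P ?z) w))\<^sup>2 \<le> ?q^2 * (G ?z * ?h)" by (intro mult_left_mono cs(2)[OF z]) auto
    also have "\<dots> = (?q * G ?z) * (?q * ?h)" by (simp add: power2_eq_square)
    also have "\<dots> \<le> 1 * (?q * ?h)"
    proof (rule mult_right_mono)
     have "?q * G ?z \<le> ?q * (G ?z + e n)" using q e(1)[of n] by (intro mult_left_mono) auto
     then show "?q * G ?z \<le> 1" using q by (auto simp: field_simps)
     show "0 \<le> ?q * ?h" by (rule mult_nonneg_nonneg[OF less_imp_le[OF q] cs(1)[OF z]])
    qed
    finally have "0 \<le> ?q * ?h - ?q^2 * (cmod (dotp (P ?z) w))\<^sup>2" by simp
    also have "\<dots> = qf (?q *\<^sub>R L ?z + (- ?q\<^sup>2) *\<^sub>R outer (P ?z) (P ?z)) w"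
     by (rule Re_hform_log[symmetric])
    finally show "0 \<le> qf (?q *\<^sub>R L ?z + (- ?q\<^sup>2) *\<^sub>R outer (P ?z) (P ?z)) w" .
   qed
   then show ?thesis by simp
  qed
  show "eventually (\<lambda>n. ln (G (a + cis b *s w) + e n) \<le> t) sequentially" if "eln (G (a + cis b *s w)) < ereal t" for b t
  proof -
   let ?g = "G (a + cis b *s w)"
   have "?g < exp t" using that by (simp add: lt)
   with order_tendstoD(2)[OF e0, of "exp t - ?g"] have "eventually (\<lambda>n. e n < exp t - ?g) sequentially" by simp
   then show ?thesis
   proof eventually_elim
    case (elim n)
    have "0 < ?g + e n" using G0[OF subsetD[OF D circle_in_disc], of b] e(1)[of n] by simp
    then have "ln (?g + e n) \<le> ln (exp t)" using elim by (intro ln_mono) auto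
    then show ?case by simp
   qed
  qed
  show "eventually (\<lambda>n. t \<le> ln (G a + e n)) sequentially" if "ereal t < eln (G a)" for t
  proof (intro always_eventually allI)
   fix n
   have "0 < G a" "t < ln (G a)" using that by (auto simp: eln_def split: if_splits)
   moreover from this have "ln (G a) \<le> ln (G a + e n)" using e(1)[of n] by (intro ln_mono) auto
   ultimately show "t \<le> ln (G a + e n)" by linarith
  qed
 qed
 moreover have "eln (G z) \<le> ereal B" if "z \<in> ?D" for z
  using M[OF that] by (auto simp: eln_def B_def intro!: ln_mono)
 ultimately show "\<exists>B. (\<forall>z\<in>?D. eln (G z) \<le> ereal B) \<and> cint (gap B (\<lambda>z. eln (G z))) a w \<le> ennreal (2*pi) * gap B (\<lambda>z. eln (G z)) a"
  by blast
qed

section \<open>From positive currents to local plurisubharmonicity\<close>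

lemma hform_bound: "cmod (hform M w) \<le> (\<Sum>j\<in>UNIV. \<Sum>k\<in>UNIV. cmod (M $ j $ k)) * (norm (w::complex^'n::finite))\<^sup>2"
proof -
 have "cmod (hform M w) \<le> (\<Sum>j\<in>UNIV. \<Sum>k\<in>UNIV. cmod (M $ j $ k) * (norm w)\<^sup>2)"
  unfolding hform_def
 proof (intro order_trans[OF norm_sum] sum_mono)
  fix j k
  have "cmod (w $ j) * cmod (w $ k) \<le> norm w * norm w" by (intro mult_mono Finite_Cartesian_Product.norm_nth_le) auto
  then have "cmod (M $ j $ k) * (cmod (w $ j) * cmod (w $ k)) \<le> cmod (M $ j $ k) * (norm w * norm w)" by (rule mult_left_mono) simp
  then show "cmod (M $ j $ k * w $ j * cnj (w $ k)) \<le> cmod (M $ j $ k) * (norm w)\<^sup>2"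
   by (simp add: norm_mult power2_eq_square mult.assoc)
 qed
 then show ?thesis by (simp add: sum_distrib_right)
qed

lemma usc_measurable_ereal:
 assumes "\<And>t::ereal. open {z\<in>S. u z < t}" "open S"
 shows "(\<lambda>z. if z \<in> S then u z else 0) \<in> borel_measurable (borel :: 'a::topological_space measure)"
proof (rule borel_measurableI_less)
 fix t
 have "{x \<in> space borel. (if x \<in> S then u x else 0) < t} = {z\<in>S. u z < t} \<union> (if 0 < t then - S else {})" by auto
 moreover have "{z\<in>S. u z < t} \<in> sets borel" "- S \<in> sets borel" using assms by auto
 ultimately show "{x \<in> space borel. (if x \<in> S then u x else 0) < t} \<in> sets borel" by auto
qed

text \<open>Positivity at \<open>p\<close> is uniform on the compact unit sphere, so it survives a
  change of the coefficients by less than the minimum \<open>m\<close>; homogeneity extends it to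
  all vectors.\<close>

lemma hform_pos_open:
 fixes a :: "'b::metric_space \<Rightarrow> complex^'n::finite^'n"
 assumes a: "continuous_on S a" and S: "open S" "p \<in> S" and pos: "\<And>v. v \<noteq> 0 \<Longrightarrow> 0 < qf (a p) v"
 obtains r where "r > 0" "ball p r \<subseteq> S" "\<And>z v. z \<in> ball p r \<Longrightarrow> v \<noteq> 0 \<Longrightarrow> 0 < qf (a z) v"
proof -
 have "\<exists>x\<in>sphere (0::complex^'n) 1. \<forall>y\<in>sphere 0 1. qf (a p) x \<le> qf (a p) y"
  by (intro continuous_attains_inf continuous_intros) auto
 then obtain x where x: "norm x = 1" "\<And>y::complex^'n. norm y = 1 \<Longrightarrow> qf (a p) x \<le> qf (a p) y" by auto
 define m where "m = qf (a p) x"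
 have m: "m > 0" using pos[of x] x(1) by (force simp: m_def)
 let ?f = "\<lambda>z. \<Sum>j\<in>UNIV. \<Sum>k\<in>UNIV. cmod ((a z - a p) $ j $ k)"
 have "open {z\<in>S. ?f z < m}"
 proof -
  have "continuous_on S ?f" using a by (intro continuous_intros)
  from continuous_open_preimage[OF this S(1) open_lessThan, of m] show ?thesis by (simp add: vimage_def Int_def)
 qed
 moreover have "p \<in> {z\<in>S. ?f z < m}" using S m by simp
 ultimately obtain r where r: "r > 0" "ball p r \<subseteq> {z\<in>S. ?f z < m}" by (meson openE)
 show thesis
 proof (rule that[OF r(1)])
  show "ball p r \<subseteq> S" using r(2) by auto
  fix z and v :: "complex^'n" assume z: "z \<in> ball p r" and v: "v \<noteq> 0"
  define y where "y = of_real (inverse (norm v)) *s v"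
  have y: "norm y = 1" using v by (simp add: y_def norm_scalar_mult norm_inverse)
  have "qf (a z) y = qf (a p) y + qf (a z - a p) y" by (simp add: hform_diff)
  moreover have "\<bar>qf (a z - a p) y\<bar> \<le> ?f z"
   using order_trans[OF abs_Re_le_cmod hform_bound[of "a z - a p" y]] y by simp
  moreover have "?f z < m" using r(2) z by auto
  moreover have "m \<le> qf (a p) y" unfolding m_def by (rule x(2)[OF y])
  ultimately have "0 < qf (a z) y" by linarith
  moreover have "hform (a z) y = of_real ((inverse (norm v))\<^sup>2) * hform (a z) v"
   by (simp only: y_def hform_scale norm_of_real abs_inverse abs_norm_cancel)
  ultimately show "0 < qf (a z) v" using v by (simp add: zero_less_mult_iff)
 qed
qed

text \<open>Needed for the kernel y \<mapsto> G (x - y) of a convolution; the two sign changes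
  cancel in the Levi form.\<close>

lemma has_levi_reflect:
 assumes "has_levi UNIV G P L"
 shows "has_levi UNIV (\<lambda>y. G (x - y)) (\<lambda>y. - P (x - y)) (\<lambda>y. L (x - y))"
proof -
 obtain A where A: "continuous_on UNIV A" "\<And>z. lder P (A z) (L z) z"
  and G: "\<And>z. wder G (P z) z" and cL: "continuous_on UNIV L"
  using assms unfolding has_levi_def by blast
 have d: "((\<lambda>y. x - y) has_derivative (\<lambda>v. - v)) (at y)" for y by (auto intro!: derivative_eq_intros)
 have m: "M *v (- h) = - (M *v h)" for M :: "complex^'a^'a" and h using matrix_vector_scalar[of M "-1" h] by simp
 have c: "cnjv (- h) = - cnjv (h :: complex^'a)" for h by (simp add: cnjv_def vec_eq_iff)
 have dd: "dotp p (- h) = - dotp p (h :: complex^'a)" for p h by (simp add: dotp_def sum_negf)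
 show ?thesis unfolding has_levi_def
 proof (intro conjI ballI exI[of _ "\<lambda>y. A (x - y)"])
  fix y
  show "wder (\<lambda>y. G (x - y)) (- P (x - y)) y"
   using has_derivative_compose[OF d G] by (simp add: dd dotp_simps)
  show "lder (\<lambda>y. - P (x - y)) (A (x - y)) (L (x - y)) y"
   using has_derivative_minus[OF has_derivative_compose[OF d A(2)]] by (simp add: m c add.commute)
 qed (auto intro!: continuous_on_compose2[OF A(1)] continuous_on_compose2[OF cL] continuous_intros)
qed

lemma hform_linear: "bounded_linear (\<lambda>M::complex^'n::finite^'n. qf M v)"
 by (intro linear_conv_bounded_linear[THEN iffD1] linearI) (simp_all add: hform_add hform_scaleR)

text \<open>If \<open>\<i>\<partial>\<partial>\<bar>v + g \<ge> 0\<close> as a current, then the convolutions of \<open>v\<close> with bumps have Levi form at least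
 \<open>-H\<close> near \<open>p\<close> whenever \<open>H > g p\<close>, and \<open>v\<close> is their limit.\<close>

lemma psh_of_current:
 fixes u :: "complex^'n::finite \<Rightarrow> ereal" and f :: "complex^'n \<Rightarrow> real"
 assumes u: "psh_coord S u" and S: "open S" "p \<in> S" and f: "continuous_on S f"
  and dense: "\<And>e. e > 0 \<Longrightarrow> \<exists>q. dist p q < e \<and> u q \<noteq> -\<infinity>"
  and g: "continuous_on S g" and H: "hermitian H" "\<And>j. j \<noteq> 0 \<Longrightarrow> qf (g p) j < qf H j"
  and cur: "\<And>h K j. smooth_on h UNIV \<Longrightarrow> (\<And>z. h z \<in> \<real>\<^sub>\<ge>\<^sub>0) \<Longrightarrow> compact K \<Longrightarrow> K \<subseteq> S \<Longrightarrow> (\<And>z. z \<notin> K \<Longrightarrow> h z = 0) \<Longrightarrow>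
   0 \<le> (LINT z:S|lborel. real_of_ereal (u z + ereal (f z)) * qf (hess h z) j)
    + (LINT z:S|lborel. qf (g z) j * Re (h z))"
 shows "\<exists>r>0. ball p r \<subseteq> S \<and> psh_coord (ball p r) (\<lambda>z. (u z + ereal (f z)) + ereal (qf H z))"
proof -
 have "continuous_on S (\<lambda>z. H - g z)" by (intro continuous_intros g)
 then obtain rg where rg: "rg > 0" "\<And>z j. z \<in> ball p rg \<Longrightarrow> j \<noteq> 0 \<Longrightarrow> 0 < qf (H - g z) j"
  by (rule hform_pos_open[OF _ S]) (use H(2) in \<open>auto simp: hform_diff\<close>)
 have gH: "qf (g z) j \<le> qf H j" if "z \<in> ball p rg" for z j
  using rg(2)[OF that, of j] by (cases "j = 0") (auto simp: hform_diff)
 obtain e0 where e0: "e0 > 0" "cball p e0 \<subseteq> S" using S by (meson open_contains_cball)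
 \<comment> \<open>\<open>u p\<close> itself may be -\<infinity>, while local integrability needs a
   centre with finite value. The factor 1/8 makes a ball around \<open>q\<close>, still inside
   \<open>S\<close>, contain a neighbourhood of \<open>p\<close>.\<close>
 obtain q where q: "dist p q < e0/8" "u q \<noteq> -\<infinity>" using dense[of "e0/8"] e0 by auto
 have qS: "cball q (e0/2) \<subseteq> S"
 proof (rule order_trans[OF _ e0(2)], rule subsetI)
  fix z assume "z \<in> cball q (e0/2)"
  then show "z \<in> cball p e0" using q(1) dist_triangle[of p z q] e0(1) by simp
 qed
 define R where "R = min (e0/8) (rg/2)"
 have R: "R > 0" "R \<le> e0/8" "R < rg" using e0 rg by (auto simp: R_def)
 let ?C = "cball p R"
 have CS: "?C \<subseteq> S" using order_trans[OF subset_cball e0(2), of R] R e0 by auto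
 have Cq: "?C \<subseteq> cball q (e0/2/2)"
 proof
  fix z assume "z \<in> ?C"
  then show "z \<in> cball q (e0/2/2)" using q(1) R(2) dist_triangle[of q z p] by (simp add: dist_commute)
 qed
 note li = psh_locally_integrable[OF u S(1) _ qS q(2)]
 have AEf: "AE y in lborel. y \<in> ?C \<longrightarrow> u y \<noteq> -\<infinity>" using li(1) e0(1) Cq by (auto elim!: eventually_mono)
 define ku where "ku y = indicator ?C y * real_of_ereal (u y)" for y
 define k where "k y = indicator ?C y * real_of_ereal (u y + ereal (f y))" for y
 have iku: "integrable lborel ku"
 proof -
  have "integrable lborel (\<lambda>y. indicator ?C y *\<^sub>R (indicator (cball q (e0/2/2)) y * real_of_ereal (u y)))"
   using li(2) e0(1) by (intro integrable_mult_indicator) auto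
  moreover have "indicator ?C y *\<^sub>R (indicator (cball q (e0/2/2)) y * real_of_ereal (u y)) = ku y" for y
   using Cq by (auto simp: ku_def indicator_def)
  ultimately show ?thesis by simp
 qed
 have if0: "integrable lborel (\<lambda>y. indicator ?C y *\<^sub>R f y)"
  using borel_integrable_compact[OF compact_cball continuous_on_subset[OF f CS]] .
 have kk: "AE y in lborel. k y = ku y + indicator ?C y *\<^sub>R f y"
  using AEf
 proof eventually_elim
  case (elim y)
  show ?case
  proof (cases "y \<in> ?C")
   case True
   then have "u y \<noteq> -\<infinity>" "u y < \<infinity>" using elim psh_coord_less_top[OF u] CS by auto
   then show ?thesis using True by (cases "u y") (auto simp: k_def ku_def)
  qed (simp add: k_def ku_def)
 qed
 have mk: "k \<in> borel_measurable borel"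
 proof -
  have [measurable]: "(\<lambda>z. if z \<in> S then u z else 0) \<in> borel_measurable borel"
   by (rule usc_measurable_ereal[OF psh_coord_usc[OF u S(1)] S(1)])
  have [measurable]: "(\<lambda>y. indicator ?C y *\<^sub>R f y) \<in> borel_measurable borel" using if0 by simp
  have [measurable]: "?C \<in> sets borel" by simp
  have "k y = (if y \<in> ?C then real_of_ereal ((if y \<in> S then u y else 0) + ereal (indicator ?C y *\<^sub>R f y)) else 0)" for y
   using CS by (auto simp: k_def)
  then have *: "k = (\<lambda>y. if y \<in> ?C then real_of_ereal ((if y \<in> S then u y else 0) + ereal (indicator ?C y *\<^sub>R f y)) else 0)" by blast
  show ?thesis unfolding * by measurable
 qed
 have ik: "integrable lborel k"
  by (rule integrable_cong_AE_imp[OF Bochner_Integration.integrable_add[OF iku if0]]) (use mk kk in \<open>auto elim: eventually_mono\<close>)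
 define r where "r = R/2"
 have r: "r > 0" "r = R/2" "r < R" using R by (auto simp: r_def)
 define d where "d n = r / 2 / real (Suc n)" for n
 have d: "d n > 0" "d n \<le> r/2" for n using r(1) by (auto simp: d_def field_simps)
 have d0: "d \<longlonglongrightarrow> 0" unfolding d_def[abs_def] by (rule LIMSEQ_Suc[OF lim_const_over_n])
 have sub: "cball x (d n) \<subseteq> ball p R" if "x \<in> ball p r" for x n
 proof
  fix z assume "z \<in> cball x (d n)"
  then show "z \<in> ball p R" using that d(2)[of n] r dist_triangle[of p z x] by simp
 qed
 obtain P0 L0 where PL: "\<And>n. has_levi UNIV (bump (d n) :: complex^'n \<Rightarrow> real) (P0 n) (L0 n)"
 proof -
  have "\<forall>n. \<exists>PL. has_levi UNIV (bump (d n) :: complex^'n \<Rightarrow> real) (fst PL) (snd PL)" using bump_levi by fastforce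
  from choice[OF this] obtain f where "\<And>n. has_levi UNIV (bump (d n) :: complex^'n \<Rightarrow> real) (fst (f n)) (snd (f n))" by blast
  then show thesis by (rule that[of "\<lambda>n. fst (f n)" "\<lambda>n. snd (f n)"])
 qed
 define v where "v n x = (\<integral>\<^sub>Ly. k y * bump (d n) (x - y))" for n x
 define L where "L n x = (\<integral>\<^sub>Ly. k y *\<^sub>R L0 n (x - y))" for n x
 have lev: "has_levi UNIV (v n) (\<lambda>x. (\<integral>\<^sub>Ly. k y *\<^sub>R P0 n (x - y))) (L n)" for n
  unfolding v_def[abs_def] L_def[abs_def] by (rule bump_conv_levi[OF ik d(1) PL])
 let ?q = "\<lambda>z. qf H z"
 have levq: "has_levi UNIV (\<lambda>z. v n z + ?q z) (\<lambda>x. (\<integral>\<^sub>Ly. k y *\<^sub>R P0 n (x - y)) + H *v cnjv x) (\<lambda>x. L n x + H)" for n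
  by (rule has_levi_add[OF lev has_levi_quad[OF H(1)]])
 have pos: "0 \<le> qf (L n x + H) j" if x: "x \<in> ball p r" for n x j
 proof -
  \<comment> \<open>The shifted bump is a legitimate test function. Pairing it with the current
    gives the Levi form of the convolution at \<open>x\<close>, because Levi forms do not notice the
    reflection.\<close>
  let ?K = "cball x (d n)" and ?h = "\<lambda>y. complex_of_real (bump (d n) (x - y))"
  have KC: "?K \<subseteq> ?C" "?K \<subseteq> S" "?K \<subseteq> ball p rg" using sub[OF x, of n] CS R(3) by force+
  have sm: "smooth_on ?h UNIV" unfolding smooth_on_def using Ck_on_shift[OF bump_smooth] by blast
  obtain P' L' where L': "has_levi UNIV (\<lambda>y. Re (?h y)) P' L'"
   "\<And>z w. hform (hess ?h z) w = hform (L' z) w"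
   using test_has_levi[of ?h] sm unfolding smooth_on_def by auto
  have "has_levi UNIV (\<lambda>y. Re (?h y)) (\<lambda>y. - P0 n (x - y)) (\<lambda>y. L0 n (x - y))"
   using has_levi_reflect[OF PL[of n], of x] by simp
  then have hL: "hform (hess ?h z) w = hform (L0 n (x - z)) w" for z w
   using has_levi_unique(2)[OF L'(1) _ open_UNIV refl UNIV_I] L'(2) by simp
  have L00: "L0 n z = 0" if "z \<notin> cball 0 (d n)" for z
   by (rule has_levi_support(2)[OF PL closed_cball _ that]) (simp add: bump_props(3)[OF d(1)])
  have h0: "?h z = 0" if "z \<notin> ?K" for z using that by (simp add: dist_norm bump_props(3)[OF d(1)])
  have "0 \<le> (LINT z:S|lborel. real_of_ereal (u z + ereal (f z)) * qf (hess ?h z) j)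
    + (LINT z:S|lborel. qf (g z) j * Re (?h z))"
   by (rule cur[OF sm _ compact_cball KC(2) h0]) (simp_all add: bump_props(1)[OF d(1)])
  also have "(LINT z:S|lborel. real_of_ereal (u z + ereal (f z)) * qf (hess ?h z) j)
    = (\<integral>\<^sub>Ly. qf (k y *\<^sub>R L0 n (x - y)) j)"
   unfolding set_lebesgue_integral_def
  proof (rule Bochner_Integration.integral_cong[OF refl])
   fix y
   show "indicator S y *\<^sub>R (real_of_ereal (u y + ereal (f y)) * qf (hess ?h y) j)
    = qf (k y *\<^sub>R L0 n (x - y)) j"
   proof (cases "y \<in> ?K")
    case True
    then have "y \<in> S" "y \<in> ?C" using KC by auto
    then show ?thesis by (simp add: hL hform_scaleR k_def)
   next
    case False
    then have "L0 n (x - y) = 0" by (intro L00) (simp add: dist_norm norm_minus_commute)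
    then show ?thesis by (simp add: hL)
   qed
  qed
  also have "\<dots> = qf (L n x) j" unfolding L_def
   by (rule integral_bounded_linear[OF hform_linear conv_integrable[OF ik _ compact_cball[of 0 "d n"] L00]])
     (use PL in \<open>auto simp: has_levi_def\<close>)
  also have "(LINT z:S|lborel. qf (g z) j * Re (?h z)) \<le> (\<integral>\<^sub>Ly. ?q j * bump (d n) (x - y))"
   unfolding set_lebesgue_integral_def
  proof (rule integral_mono)
   have "integrable lborel (\<lambda>y. indicator ?K y *\<^sub>R (qf (g y) j * bump (d n) (x - y)))"
    by (intro borel_integrable_compact compact_cball continuous_intros continuous_on_subset[OF g KC(2)]
      continuous_on_compose2[OF bump_continuous]) auto
   moreover have "indicator ?K y *\<^sub>R (qf (g y) j * bump (d n) (x - y)) = indicator S y *\<^sub>R (qf (g y) j * Re (?h y))" for y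
    using KC(2) h0[of y] by (auto simp: indicator_def)
   ultimately show "integrable lborel (\<lambda>y. indicator S y *\<^sub>R (qf (g y) j * Re (?h y)))" by (simp only:)
   show "integrable lborel (\<lambda>y. ?q j * bump (d n) (x - y))" using bump_shift_integral(1)[OF d(1)[of n], of x] by simp
   fix y
   show "indicator S y *\<^sub>R (qf (g y) j * Re (?h y)) \<le> ?q j * bump (d n) (x - y)"
   proof (cases "y \<in> ?K")
    case True
    then have "y \<in> S" "y \<in> ball p rg" using KC by blast+
    then show ?thesis using mult_right_mono[OF gH bump_props(1)[OF d(1)[of n], of "x - y"]] by simp
   qed (use h0[of y] in auto)
  qed
  also have "(\<integral>\<^sub>Ly. ?q j * bump (d n) (x - y)) = ?q j" using bump_shift_integral(2)[OF d(1)[of n], of x] by simp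
  finally show ?thesis by (simp add: hform_add)
 qed
 obtain B0 where B0: "\<And>z. z \<in> ?C \<Longrightarrow> u z + ereal (f z) < ereal B0"
  using usc_bounded_above[OF usc_add[OF psh_coord_usc[OF u S(1)] S(1) f] _ compact_cball CS] psh_coord_less_top[OF u] by force
 define B1 where "B1 = max B0 0"
 have kB: "k y \<le> B1" for y
 proof (cases "y \<in> ?C")
  case True
  from B0[OF this] show ?thesis using True by (cases "u y + ereal (f y)") (auto simp: k_def B1_def)
 qed (simp add: k_def B1_def)
 have vB: "v n x \<le> B1" for n x unfolding v_def by (rule bump_conv_le[OF ik d(1)]) (use kB in auto)
 let ?V = "\<lambda>z. (u z + ereal (f z)) + ereal (?q z)"
 have bS: "ball p r \<subseteq> S" using CS r(3) by (force simp: subset_iff)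
 have cq: "continuous_on T ?q" for T by (intro continuous_intros)
 have "psh_coord (ball p r) ?V"
 proof (rule psh_coordI[OF open_ball])
  show "?V z < \<infinity>" if "z \<in> ball p r" for z using psh_coord_less_top[OF u] bS that by (cases "u z") auto
  have o: "open {z\<in>S. ?V z < t}" for t by (rule usc_add[OF usc_add[OF psh_coord_usc[OF u S(1)] S(1) f] S(1) cq])
  have "{z\<in>ball p r. ?V z < t} = ball p r \<inter> {z\<in>S. ?V z < t}" for t using bS by auto
  then show "open {z\<in>ball p r. ?V z < t}" for t using open_Int[OF open_ball o[of t], of p r] by (simp only:)
  fix a w :: "complex^'n" let ?D = "cdisc a w"
  assume D: "?D \<subseteq> ball p r"
  have "bounded (?q ` ?D)" by (intro compact_imp_bounded compact_continuous_image compact_disc cq)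
  then obtain B2 where "\<forall>x\<in>?q ` ?D. norm x \<le> B2" unfolding bounded_iff by blast
  then have B2: "?q z \<le> B2" if "z \<in> ?D" for z
   using imageI[OF that, of ?q] abs_le_D1[of "?q z" B2] unfolding real_norm_def by blast
  define B where "B = B1 + B2"
  have "cint (gap B ?V) a w \<le> ennreal (2*pi) * gap B ?V a"
  proof (rule sub_mean_limit[where v="\<lambda>n z. v n z + ?q z"])
   show "continuous_on UNIV (\<lambda>b. v n (a + cis b *s w) + ?q (a + cis b *s w))" for n
    by (rule continuous_on_compose2[OF has_levi_continuous[OF levq] circle_continuous]) simp
   show "v n (a + cis b *s w) + ?q (a + cis b *s w) \<le> B" for n b
    unfolding B_def by (rule add_mono[OF vB B2[OF circle_in_disc]])
   show "2*pi*(v n a + ?q a) \<le> integral {0..2*pi} (\<lambda>b. v n (a + cis b *s w) + ?q (a + cis b *s w))" for n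
   proof -
    have "2*pi*((v n a + ?q a) + 0) \<le> integral {0..2*pi} (\<lambda>b. v n (a + cis b *s w) + ?q (a + cis b *s w))"
     by (rule has_levi_mean[OF levq]) (use D pos in blast)+
    then show ?thesis by simp
   qed
  next
   fix b t assume t: "?V (a + cis b *s w) < ereal t"
   let ?x = "a + cis b *s w"
   have x: "?x \<in> ball p r" by (rule subsetD[OF D circle_in_disc])
   let ?s = "t - ?q ?x"
   have "open {z\<in>S. u z + ereal (f z) < ereal ?s}" by (rule usc_add[OF psh_coord_usc[OF u S(1)] S(1) f])
   moreover have "?x \<in> {z\<in>S. u z + ereal (f z) < ereal ?s}" using t x bS by (cases "u ?x") auto
   ultimately obtain l where l: "l > 0" "ball ?x l \<subseteq> {z\<in>S. u z + ereal (f z) < ereal ?s}" by (meson openE)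
   from order_tendstoD(2)[OF d0 l(1)] show "eventually (\<lambda>n. v n ?x + ?q ?x \<le> t) sequentially"
   proof eventually_elim
    case (elim n)
    have "v n ?x \<le> ?s" unfolding v_def
    proof (rule bump_conv_le[OF ik d(1)])
     show "AE y in lborel. dist ?x y < d n \<longrightarrow> k y \<le> ?s" using AEf
     proof eventually_elim
      case (elim y)
      show ?case
      proof
       assume y: "dist ?x y < d n"
       then have yC: "y \<in> ?C" using sub[OF x, of n] by (auto simp: subset_iff less_imp_le)
       have "y \<in> ball ?x l" using y \<open>d n < l\<close> by simp
       then have "u y + ereal (f y) < ereal ?s" using l(2) by blast
       then show "k y \<le> ?s" using elim yC psh_coord_less_top[OF u subsetD[OF CS yC]]
        by (cases "u y") (auto simp: k_def)
      qed
     qed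
    qed
    then show ?case by simp
   qed
  next
   \<comment> \<open>Only \<open>u\<close> has sub-mean values, \<open>f\<close> is merely
     continuous. So the convolution of \<open>u\<close> is bounded below by \<open>u a\<close>, and
     the contribution of \<open>f\<close> is controlled by its oscillation near \<open>a\<close>,
     with slack \<open>e\<close>.\<close>
   fix t assume t: "ereal t < ?V a"
   have a: "a \<in> ball p r" by (rule subsetD[OF D center_in_disc])
   then have aS: "a \<in> S" using bS by auto
   obtain r0 where r0: "u a = ereal r0" using t psh_coord_less_top[OF u aS] by (cases "u a") auto
   define e where "e = r0 + f a + ?q a - t"
   have e: "e > 0" using t r0 by (simp add: e_def)
   have "open {z\<in>S. f a - e < f z}"
    using continuous_open_preimage[OF f S(1) open_greaterThan, of "f a - e"] by (simp add: vimage_def Int_def)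
   moreover have "a \<in> {z\<in>S. f a - e < f z}" using aS e by simp
   ultimately obtain l where l: "l > 0" "ball a l \<subseteq> {z\<in>S. f a - e < f z}" by (meson openE)
   from order_tendstoD(2)[OF d0 l(1)] show "eventually (\<lambda>n. t \<le> v n a + ?q a) sequentially"
   proof eventually_elim
    case (elim n)
    have "u a \<le> ereal (\<integral>\<^sub>Ly. ku y * bump (d n) (a - y))"
    proof (rule psh_le_bump_conv[OF u S(1) d(1) _ iku])
     show "cball a (d n) \<subseteq> S" using sub[OF a, of n] CS by force
     show "AE y in lborel. y \<in> cball a (d n) \<longrightarrow> u y = ereal (ku y)" using AEf
     proof eventually_elim
      case (elim y)
      show ?case
      proof
       assume "y \<in> cball a (d n)"
       then have yC: "y \<in> ?C" using sub[OF a, of n] by (force simp: subset_iff less_imp_le)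
       then show "u y = ereal (ku y)" using elim psh_coord_less_top[OF u subsetD[OF CS yC]]
        by (cases "u y") (auto simp: ku_def)
      qed
     qed
    qed
    moreover have "(\<integral>\<^sub>Ly. (ku y - k y) * bump (d n) (a - y)) \<le> - (f a - e)"
    proof (rule bump_conv_le[OF Bochner_Integration.integrable_diff[OF iku ik] d(1)])
     show "AE y in lborel. dist a y < d n \<longrightarrow> ku y - k y \<le> - (f a - e)" using kk
     proof eventually_elim
      case (elim y)
      show ?case
      proof
       assume y: "dist a y < d n"
       then have "y \<in> ?C" using sub[OF a, of n] by (auto simp: subset_iff less_imp_le)
       moreover have "y \<in> ball a l" using y \<open>d n < l\<close> by simp
       then have "f a - e < f y" using l(2) by blast
       ultimately show "ku y - k y \<le> - (f a - e)" using elim by simp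
      qed
     qed
    qed
    moreover have "(\<integral>\<^sub>Ly. (ku y - k y) * bump (d n) (a - y)) = (\<integral>\<^sub>Ly. ku y * bump (d n) (a - y)) - v n a"
     unfolding v_def left_diff_distrib by (intro Bochner_Integration.integral_diff bump_conv_integrable iku ik d(1))
    ultimately show ?case using r0 by (simp add: e_def)
   qed
  qed
  moreover have "?V z \<le> ereal B" if "z \<in> ?D" for z
  proof -
   have "z \<in> ?C" using D r(3) that by force
   from B0[OF this] B2[OF that] show ?thesis by (cases "u z") (auto simp: B_def B1_def)
  qed
  ultimately show "\<exists>B. (\<forall>z\<in>?D. ?V z \<le> ereal B) \<and> cint (gap B ?V) a w \<le> ennreal (2*pi) * gap B ?V a" by blast
 qed
 with r(1) bS show ?thesis by blast
qed

section \<open>From local plurisubharmonicity to positive currents\<close>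

lemma set_integrable_local:
 fixes f :: "'a::euclidean_space \<Rightarrow> 'b::{banach, second_countable_topology}"
 assumes loc: "\<And>p. p \<in> K \<Longrightarrow> \<exists>T. open T \<and> p \<in> T \<and> set_integrable lborel T f \<and> (AE y in lborel. y \<in> T \<longrightarrow> P y)"
  and K: "compact K"
 shows "set_integrable lborel K f" "AE y in lborel. y \<in> K \<longrightarrow> P y"
proof -
 obtain T where T: "\<And>p. p \<in> K \<Longrightarrow> open (T p) \<and> p \<in> T p \<and> set_integrable lborel (T p) f \<and> (AE y in lborel. y \<in> T p \<longrightarrow> P y)"
  using loc by metis
 obtain K0 where K0: "K0 \<subseteq> K" "finite K0" "K \<subseteq> (\<Union>p\<in>K0. T p)"
  using compactE_image[OF K, of K T] T by blast
 have "set_integrable lborel (\<Union>p\<in>K0. T p) f"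
  using T K0(1) by (intro set_integrable_UN K0(2)) (auto intro: borel_open)
 then show "set_integrable lborel K f"
  by (rule set_integrable_subset) (use K K0(3) in \<open>auto simp: borel_compact\<close>)
 have "AE y in lborel. \<forall>p\<in>K0. y \<in> T p \<longrightarrow> P y" using T K0(1) by (intro AE_finite_allI K0(2)) auto
 then show "AE y in lborel. y \<in> K \<longrightarrow> P y" by eventually_elim (use K0(3) in auto)
qed

text \<open>A singular point lies in a ball around some nearby point with finite value, where
  \<open>psh_locally_integrable\<close> applies; the continuous \<open>f\<close> is subtracted
  afterwards.\<close>

lemma qpsh_integrable:
 fixes \<phi> :: "complex^'n::finite \<Rightarrow> ereal"
 assumes loc: "\<And>p. p \<in> S \<Longrightarrow> \<exists>T f. open T \<and> p \<in> T \<and> T \<subseteq> S \<and> continuous_on T (f :: _ \<Rightarrow> real) \<and> psh_coord T (\<lambda>z. \<phi> z + ereal (f z))"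
  and dense: "\<And>p e. p \<in> S \<Longrightarrow> e > 0 \<Longrightarrow> \<exists>q\<in>S. dist p q < e \<and> \<phi> q \<noteq> -\<infinity>"
  and K: "compact K" "K \<subseteq> S"
 shows "set_integrable lborel K (\<lambda>z. real_of_ereal (\<phi> z))" "AE y in lborel. y \<in> K \<longrightarrow> \<phi> y \<noteq> -\<infinity>"
proof -
 have "\<exists>W. open W \<and> p \<in> W \<and> set_integrable lborel W (\<lambda>z. real_of_ereal (\<phi> z)) \<and> (AE y in lborel. y \<in> W \<longrightarrow> \<phi> y \<noteq> -\<infinity>)"
  if "p \<in> K" for p
 proof -
  have pS: "p \<in> S" using that K by auto
  obtain T f where T: "open T" "p \<in> T" "T \<subseteq> S" and f: "continuous_on T (f :: _ \<Rightarrow> real)" and u: "psh_coord T (\<lambda>z. \<phi> z + ereal (f z))"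
   using loc[OF pS] by blast
  obtain e where e: "e > 0" "cball p e \<subseteq> T" using T by (meson open_contains_cball)
  obtain q where q: "dist p q < e/8" "\<phi> q \<noteq> -\<infinity>" using dense[OF pS, of "e/8"] e by auto
  have qT: "cball q (e/2) \<subseteq> T"
  proof (rule order_trans[OF _ e(2)], rule subsetI)
   fix z assume "z \<in> cball q (e/2)"
   then show "z \<in> cball p e" using q(1) dist_triangle[of p z q] e(1) by simp
  qed
  have "\<phi> q + ereal (f q) \<noteq> -\<infinity>" using q(2) by (cases "\<phi> q") auto
  note li = psh_locally_integrable[OF u T(1) _ qT this]
  let ?C = "cball q (e/2/2)"
  have CT: "?C \<subseteq> T" using order_trans[OF subset_cball qT, of "e/2/2"] e(1) by auto
  have AE: "AE y in lborel. y \<in> ?C \<longrightarrow> \<phi> y \<noteq> -\<infinity>" using li(1) e(1) by (auto elim!: eventually_mono)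
  have meas: "(\<lambda>y. indicator ?C y * real_of_ereal (\<phi> y)) \<in> borel_measurable lborel"
  proof -
   have [measurable]: "(\<lambda>z. if z \<in> T then \<phi> z + ereal (f z) else 0) \<in> borel_measurable borel"
    by (rule usc_measurable_ereal[OF psh_coord_usc[OF u T(1)] T(1)])
   have [measurable]: "(\<lambda>y. indicator ?C y *\<^sub>R f y) \<in> borel_measurable borel"
    using borel_integrable_compact[OF compact_cball continuous_on_subset[OF f CT]] by simp
   have [measurable]: "?C \<in> sets borel" by simp
   have *: "indicator ?C y * real_of_ereal (\<phi> y) = (if y \<in> ?C then real_of_ereal ((if y \<in> T then \<phi> y + ereal (f y) else 0) - ereal (indicator ?C y *\<^sub>R f y)) else 0)" for y
    using CT by (cases "\<phi> y") (auto simp: indicator_def)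
   show ?thesis unfolding * by measurable
  qed
  have "integrable lborel (\<lambda>y. indicator ?C y * real_of_ereal (\<phi> y + ereal (f y)) - indicator ?C y *\<^sub>R f y)"
   using li(2) e(1) borel_integrable_compact[OF compact_cball continuous_on_subset[OF f CT]] by (intro Bochner_Integration.integrable_diff) auto
  then have "integrable lborel (\<lambda>y. indicator ?C y * real_of_ereal (\<phi> y))"
  proof (rule integrable_cong_AE_imp[OF _ meas])
   show "AE y in lborel. indicator ?C y * real_of_ereal (\<phi> y + ereal (f y)) - indicator ?C y *\<^sub>R f y = indicator ?C y * real_of_ereal (\<phi> y)"
    using AE
   proof eventually_elim
    case (elim y)
    show ?case
    proof (cases "y \<in> ?C")
     case True
     then have "\<phi> y \<noteq> -\<infinity>" "\<phi> y + ereal (f y) < \<infinity>" using elim psh_coord_less_top[OF u] CT by auto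
     then show ?thesis using True by (cases "\<phi> y") auto
    qed simp
   qed
  qed
  then have "set_integrable lborel ?C (\<lambda>z. real_of_ereal (\<phi> z))" by (simp add: set_integrable_def)
  then have "set_integrable lborel (ball p (e/8)) (\<lambda>z. real_of_ereal (\<phi> z))"
  proof (rule set_integrable_subset)
   show "ball p (e/8) \<subseteq> ?C"
   proof
    fix z assume "z \<in> ball p (e/8)"
    then show "z \<in> ?C" using q(1) dist_triangle[of q z p] by (simp add: dist_commute)
   qed
  qed auto
  moreover have "AE y in lborel. y \<in> ball p (e/8) \<longrightarrow> \<phi> y \<noteq> -\<infinity>"
   using AE
  proof eventually_elim
   case (elim y)
   show ?case
   proof
    assume "y \<in> ball p (e/8)"
    then have "y \<in> ?C" using q(1) dist_triangle[of q y p] by (simp add: dist_commute)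
    then show "\<phi> y \<noteq> -\<infinity>" using elim by blast
   qed
  qed
  ultimately show ?thesis using e(1) by (intro exI[of _ "ball p (e/8)"]) auto
 qed
 from set_integrable_local[OF this K(1)] show "set_integrable lborel K (\<lambda>z. real_of_ereal (\<phi> z))" "AE y in lborel. y \<in> K \<longrightarrow> \<phi> y \<noteq> -\<infinity>"
  by auto
qed

text \<open>The convolution of the indicator of a large ball with a test function is locally constant.\<close>

lemma integral_levi_zero:
 assumes L: "has_levi UNIV G P L" and K: "compact K" "\<And>z. z \<notin> K \<Longrightarrow> G z = 0"
 shows "(\<integral>\<^sub>Ly. L y) = (0 :: complex^'n::finite^'n)"
proof -
 obtain R where R: "R > 0" "\<And>z. z \<in> K \<Longrightarrow> norm z \<le> R" using compact_imp_bounded[OF K(1)] unfolding bounded_pos by blast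
 let ?L = "\<lambda>y. L (0 - y)" and ?G = "\<lambda>y. G (0 - y)"
 let ?K = "cball (0 :: complex^'n) R"
 have L': "has_levi UNIV ?G (\<lambda>y. - P (0 - y)) ?L" by (rule has_levi_reflect[OF L])
 have K': "?G z = 0" if "z \<notin> ?K" for z using that R(2)[of "-z"] K(2)[of "-z"] by auto
 have L0: "?L z = 0" if "z \<notin> ?K" for z by (rule has_levi_support(2)[OF L' closed_cball K' that])
 define k where "k = (indicator (cball (0::complex^'n) (R+1)) :: complex^'n \<Rightarrow> real)"
 have k: "integrable lborel k" unfolding k_def using emeasure_lborel_cball_finite[of 0 "R+1"] by (intro integrable_real_indicator) auto
 have c: "has_levi UNIV (\<lambda>x. (\<integral>\<^sub>Ly. k y * ?G (x - y))) (\<lambda>x. (\<integral>\<^sub>Ly. k y *\<^sub>R (- P (0 - (x - y))))) (\<lambda>x. (\<integral>\<^sub>Ly. k y *\<^sub>R ?L (x - y)))"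
  by (rule has_levi_conv[OF k L' compact_cball K'])
 have kin: "k y = 1" if "x \<in> ball 0 1" "x - y \<in> ?K" for x y
 proof -
  have "norm y \<le> norm x + norm (x - y)" using norm_triangle_ineq4[of x "x - y"] by simp
  then show ?thesis using that by (simp add: k_def)
 qed
 have const: "(\<integral>\<^sub>Ly. k y * ?G (x - y)) = (\<integral>\<^sub>Ly. G y)" if x: "x \<in> ball 0 1" for x
 proof -
  have "k y * ?G (x - y) = G (y - x)" for y using kin[OF x, of y] K'[of "x - y"] by (cases "x - y \<in> ?K") auto
  moreover have "(\<integral>\<^sub>Ly. G (y - x)) = (\<integral>\<^sub>Ly. G y)"
  proof -
   have [measurable]: "G \<in> borel_measurable borel" by (rule borel_measurable_continuous_onI[OF has_levi_continuous[OF L]])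
   have "(\<integral>\<^sub>Ly. G (y - x)) = (\<integral>y. G (y - x) \<partial>distr lborel borel ((+) x))" by (simp only: lborel_distr_plus)
   also have "\<dots> = (\<integral>\<^sub>Ly. G (x + y - x))" by (rule integral_distr) measurable
   finally show ?thesis by simp
  qed
  ultimately show ?thesis by (simp only:)
 qed
 have "(\<integral>\<^sub>Ly. k y *\<^sub>R ?L (0 - y)) = 0"
  using has_levi_unique(2)[OF has_levi_subset[OF c subset_UNIV] has_levi_const open_ball const, of "0::complex^'n" 1 0] by simp
 moreover have "k y *\<^sub>R ?L (0 - y) = L y" for y using kin[of 0 y] L0[of "0 - y"] by (cases "0 - y \<in> ?K") auto
 ultimately show ?thesis by simp
qed

lemma hform_mat1: "hform (mat 1) (w :: complex^'n::finite) = of_real ((norm w)\<^sup>2)"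
proof -
 have "hform (mat 1) w = (\<Sum>j\<in>UNIV. w $ j * cnj (w $ j))"
  unfolding hform_def mat_def by (rule sum.cong) (simp_all add: if_distrib[of "\<lambda>x. x * _"] cong: if_cong)
 also have "\<dots> = of_real (\<Sum>j\<in>UNIV. (cmod (w $ j))\<^sup>2)" by (simp add: complex_norm_square del: of_real_power)
 also have "(\<Sum>j\<in>UNIV. (cmod (w $ j))\<^sup>2) = (norm w)\<^sup>2"
  by (simp add: norm_vec_def L2_set_def sum_nonneg)
 finally show ?thesis .
qed

lemma hermitian_simps: "hermitian (mat 1 :: complex^'n::finite^'n)" "hermitian A \<Longrightarrow> hermitian B \<Longrightarrow> hermitian (A + B)"
  "hermitian A \<Longrightarrow> hermitian (r *\<^sub>R A)"
proof -
 show "hermitian (mat 1 :: complex^'n^'n)" by (simp add: hermitian_def mat_def)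
 show "hermitian (A + B)" if "hermitian A" "hermitian B"
  unfolding hermitian_def
 proof (intro allI)
  fix j k
  have "A $ k $ j = cnj (A $ j $ k)" "B $ k $ j = cnj (B $ j $ k)" using that unfolding hermitian_def by blast+
  then show "(A + B) $ k $ j = cnj ((A + B) $ j $ k)" by (simp only: vector_add_component complex_cnj_add)
 qed
 show "hermitian (r *\<^sub>R A)" if "hermitian A"
  unfolding hermitian_def
 proof (intro allI)
  fix j k
  have "A $ k $ j = cnj (A $ j $ k)" using that unfolding hermitian_def by blast
  then show "(r *\<^sub>R A) $ k $ j = cnj ((r *\<^sub>R A) $ j $ k)" by (simp only: vector_scaleR_component complex_cnj_scaleR)
 qed
qed

text \<open>The circle mean of a quadratic form is known exactly: \<open>has_levi_mean\<close> for
  the form and for its negative gives both inequalities in \<open>I\<close>. Taking it away from the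
  inequality for \<phi> + H leaves the error 2 pi H(w), quadratic in the radius. The subtraction is
  carried out as cancellation of a finite summand.\<close>

lemma sub_mean_minus_quad:
 fixes \<phi> :: "complex^'n::finite \<Rightarrow> ereal"
 assumes V: "psh_coord T (\<lambda>z. \<phi> z + ereal (qf H z))" and T: "open T" and H: "hermitian H" "0 \<le> qf H w"
  and D: "cdisc a w \<subseteq> T"
  and B: "\<And>z. z \<in> cdisc a w \<Longrightarrow> \<phi> z \<le> ereal B"
 shows "cint (gap B \<phi>) a w \<le> ennreal (2*pi) * gap B \<phi> a + ennreal (2*pi * qf H w)"
proof -
 let ?D = "cdisc a w"
 let ?q = "\<lambda>z. qf H z" and ?V = "\<lambda>z. \<phi> z + ereal (qf H z)"
 have cq: "continuous_on X ?q" for X by (intro continuous_intros)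
 have L: "has_levi UNIV ?q (\<lambda>z. H *v cnjv z) (\<lambda>z. H)" by (rule has_levi_quad[OF H(1)])
 have "bounded (?q ` ?D)" by (intro compact_imp_bounded compact_continuous_image compact_disc cq)
 then obtain B2 where "\<forall>x\<in>?q ` ?D. norm x \<le> B2" unfolding bounded_iff by blast
 then have B2: "?q z \<le> B2" if "z \<in> ?D" for z
  using imageI[OF that, of ?q] abs_le_D1[of "?q z" B2] unfolding real_norm_def by blast
 have circ: "a + cis t *s w \<in> ?D" "a \<in> ?D" for t by (rule circle_in_disc center_in_disc)+
 have gp: "gap (B + B2) ?V z = gap B \<phi> z + ennreal (B2 - ?q z)" if "z \<in> ?D" for z
 proof (cases "\<phi> z")
  case (real r)
  then have "r \<le> B" using B[OF that] by simp
  then have "ennreal (B - r) + ennreal (B2 - ?q z) = ennreal ((B - r) + (B2 - ?q z))"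
   using B2[OF that] by (intro ennreal_plus[symmetric]) auto
  then show ?thesis using real by (simp add: algebra_simps)
 qed (use B[OF that] in auto)
 have VB: "?V z \<le> ereal (B + B2)" if "z \<in> ?D" for z
  using B[OF that] B2[OF that] by (cases "\<phi> z") auto
 have mq: "(\<lambda>t. ?q (a + cis t *s w)) \<in> borel_measurable borel"
  by (intro borel_measurable_continuous_onI continuous_on_compose2[OF cq[of UNIV] circle_continuous]) auto
 have mV: "(\<lambda>t. ?V (a + cis t *s w)) \<in> borel_measurable borel"
  by (rule usc_measurable_comp[OF psh_coord_usc[OF V T] circle_continuous]) (use D circ in blast)
 have mu: "(\<lambda>t. gap B \<phi> (a + cis t *s w)) \<in> borel_measurable borel"
 proof -
  have *: "\<phi> z = ?V z - ereal (?q z)" for z by (cases "\<phi> z") auto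
  show ?thesis unfolding gap_def by (subst *) (use mq mV in measurable)
 qed
 define I where "I = integral {0..2*pi} (\<lambda>t. ?q (a + cis t *s w))"
 have I: "I = 2*pi*(?q a + ?q w)"
 proof (rule antisym)
  have "2*pi*(- ?q a + - ?q w) \<le> integral {0..2*pi} (\<lambda>t. - ?q (a + cis t *s w))"
   by (rule has_levi_mean[OF has_levi_uminus[OF L]]) (auto simp: hform_minus)
  then show "I \<le> 2*pi*(?q a + ?q w)" by (simp add: I_def algebra_simps)
  show "2*pi*(?q a + ?q w) \<le> I" unfolding I_def by (rule has_levi_mean[OF L]) auto
 qed
 have cI: "cint (\<lambda>z. ennreal (B2 - ?q z)) a w = ennreal (2*pi*B2 - I)" unfolding I_def
  by (rule cint_continuous[OF continuous_on_compose2[OF cq[of UNIV] circle_continuous] B2[OF circ(1)]]) auto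
 have I2: "I \<le> 2*pi*B2"
 proof -
  have "I \<le> integral {0..2*pi} (\<lambda>t. B2)" unfolding I_def
   by (intro integral_le integrable_continuous_interval continuous_on_compose2[OF cq[of UNIV] circle_continuous] B2[OF circ(1)]) auto
  then show ?thesis by (simp add: pi_ge_zero)
 qed
 have "ennreal (2*pi*B2 - I) + cint (gap B \<phi>) a w = cint (\<lambda>z. gap B \<phi> z + ennreal (B2 - ?q z)) a w"
 proof -
  have "cint (\<lambda>z. gap B \<phi> z + ennreal (B2 - ?q z)) a w = cint (gap B \<phi>) a w + cint (\<lambda>z. ennreal (B2 - ?q z)) a w"
   unfolding cint_def distrib_right by (rule nn_integral_add) (use mu mq in measurable)
  then show ?thesis unfolding cI by (simp only: add.commute)
 qed
 also have "\<dots> = cint (gap (B + B2) ?V) a w" unfolding cint_def using gp[OF circ(1)] by simp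
 also have "\<dots> \<le> ennreal (2*pi) * gap (B + B2) ?V a" by (rule psh_coord_cint[OF V T D VB])
 also have "\<dots> = ennreal (2*pi) * gap B \<phi> a + ennreal (2*pi*(B2 - ?q a))"
  by (simp add: gp[OF circ(2)] distrib_left ennreal_mult''[symmetric] B2[OF circ(2)])
 also have "2*pi*(B2 - ?q a) = (2*pi*B2 - I) + 2*pi*?q w" by (simp add: I algebra_simps)
 also have "ennreal \<dots> = ennreal (2*pi*B2 - I) + ennreal (2*pi*?q w)"
  using I2 H(2) by (intro ennreal_plus) auto
 finally have "ennreal (2*pi*B2 - I) + cint (gap B \<phi>) a w \<le> ennreal (2*pi*B2 - I) + (ennreal (2*pi) * gap B \<phi> a + ennreal (2*pi*?q w))"
  by (simp add: ac_simps)
 then show ?thesis by (simp add: ennreal_add_left_cancel_le)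
qed

text \<open>Averaging over circles is self-adjoint up to the sign of \<open>w\<close>, by Tonelli
  and translation invariance. This plays the part of integration by parts: it moves the mean from
  the singular function to the test function.\<close>

lemma cint_duality:
 assumes [measurable]: "k \<in> borel_measurable borel" "h \<in> borel_measurable borel"
 shows "(\<integral>\<^sub>+z. h z * cint k z w) = (\<integral>\<^sub>+y. k y * cint h y (- w :: complex^'n::finite))"
proof -
 have 1 [measurable]: "(\<lambda>p. snd p + cis (fst p) *s w) \<in> borel_measurable (borel \<Otimes>\<^sub>M borel)" for w :: "complex^'n"
  unfolding borel_prod vector_scalar_mult_def by (intro borel_measurable_continuous_onI continuous_intros)
 have 2 [measurable]: "(\<lambda>t. z + cis t *s w) \<in> borel_measurable borel" for z w :: "complex^'n"
  by (intro borel_measurable_continuous_onI circle_continuous)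
 have 3 [measurable]: "(\<lambda>z. z + cis t *s w) \<in> borel_measurable borel" for t and w :: "complex^'n"
  by (intro borel_measurable_continuous_onI continuous_intros)
 have "(\<integral>\<^sub>+z. h z * cint k z w) = (\<integral>\<^sub>+z. (\<integral>\<^sub>+t. h z * (k (z + cis t *s w) * indicator {0..2*pi} t)))"
  unfolding cint_def by (intro nn_integral_cong nn_integral_cmult[symmetric]) measurable
 also have "\<dots> = (\<integral>\<^sub>+t. (\<integral>\<^sub>+z. h z * (k (z + cis t *s w) * indicator {0..2*pi} t)))"
 proof (rule lborel_pair.Fubini')
  have "(\<lambda>p. h (snd p) * (k (snd p + cis (fst p) *s w) * indicator {0..2*pi} (fst p))) \<in> borel_measurable (borel \<Otimes>\<^sub>M borel)" by measurable
  then show "(\<lambda>(t, z). h z * (k (z + cis t *s w) * indicator {0..2*pi} t)) \<in> borel_measurable (lborel \<Otimes>\<^sub>M lborel)"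
   by (simp add: case_prod_unfold cong: measurable_cong_sets)
 qed
 also have "\<dots> = (\<integral>\<^sub>+t. (\<integral>\<^sub>+y. k y * (h (y + cis t *s (- w)) * indicator {0..2*pi} t)))"
 proof (rule nn_integral_cong)
  fix t :: real
  have "(\<integral>\<^sub>+z. h z * (k (z + cis t *s w) * indicator {0..2*pi} t))
   = (\<integral>\<^sub>+y. h (cis t *s (- w) + y) * (k ((cis t *s (- w) + y) + cis t *s w) * indicator {0..2*pi} t))"
   by (rule nn_integral_shift[symmetric, of "\<lambda>z. h z * (k (z + cis t *s w) * indicator {0..2*pi} t)"]) measurable
  moreover have "(cis t *s (- w) + y) + cis t *s w = y" for y by (simp add: vec_eq_iff)
  ultimately show "(\<integral>\<^sub>+z. h z * (k (z + cis t *s w) * indicator {0..2*pi} t))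
   = (\<integral>\<^sub>+y. k y * (h (y + cis t *s (- w)) * indicator {0..2*pi} t))"
   by (simp only: add.commute[of "cis t *s (- w)"] mult.left_commute)
 qed
 also have "\<dots> = (\<integral>\<^sub>+y. (\<integral>\<^sub>+t. k y * (h (y + cis t *s (- w)) * indicator {0..2*pi} t)))"
 proof (rule lborel_pair.Fubini'[symmetric])
  have "(\<lambda>p. k (snd p) * (h (snd p + cis (fst p) *s (- w)) * indicator {0..2*pi} (fst p))) \<in> borel_measurable (borel \<Otimes>\<^sub>M borel)" by measurable
  then show "(\<lambda>(t, y). k y * (h (y + cis t *s (- w)) * indicator {0..2*pi} t)) \<in> borel_measurable (lborel \<Otimes>\<^sub>M lborel)"
   by (simp add: case_prod_unfold cong: measurable_cong_sets)
 qed
 also have "\<dots> = (\<integral>\<^sub>+y. k y * cint h y (- w))"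
  unfolding cint_def by (intro nn_integral_cong nn_integral_cmult) measurable
 finally show ?thesis .
qed

lemma integral_le_nn_integral:
 assumes f: "integrable M f" shows "ennreal (integral\<^sup>L M f) \<le> (\<integral>\<^sup>+x. ennreal (f x) \<partial>M)"
proof -
 have i: "integrable M (\<lambda>x. max 0 (f x))" using f by simp
 have "integral\<^sup>L M f \<le> (\<integral>x. max 0 (f x) \<partial>M)" by (rule integral_mono[OF f i]) simp
 then have "ennreal (integral\<^sup>L M f) \<le> ennreal (\<integral>x. max 0 (f x) \<partial>M)" by (rule ennreal_leI)
 also have "\<dots> = (\<integral>\<^sup>+x. ennreal (max 0 (f x)) \<partial>M)" by (rule nn_integral_eq_integral[symmetric, OF i]) simp
 also have "\<dots> = (\<integral>\<^sup>+x. ennreal (f x) \<partial>M)" by (intro nn_integral_cong) (simp add: max_def ennreal_neg)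
 finally show ?thesis .
qed

text \<open>Converse of \<open>psh_of_current\<close>. With \<open>a\<close> = B - \<phi> and w = r
  k, consider the integral of \<open>h\<close> times the circle integral of \<open>a\<close>. The
  sub-mean-value inequality bounds it above; after \<open>cint_duality\<close> the second order
  expansion of \<open>h\<close> bounds it below. The terms of order 0 agree, division by r^2 leaves
  the claim up to a multiple of \<open>j\<close>, and \<open>j\<close> tends to 0. The constant
  \<open>B\<close> drops out because the Levi form of \<open>h\<close> has integral 0.\<close>

lemma current_of_psh:
 fixes \<phi> :: "complex^'n::finite \<Rightarrow> ereal"
 assumes S: "open S" and h: "smooth_on h UNIV" "\<And>z. h z \<in> \<real>\<^sub>\<ge>\<^sub>0" and K: "compact K" "K \<subseteq> S" "\<And>z. z \<notin> K \<Longrightarrow> h z = 0"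
  and g: "continuous_on S g" "\<And>z. z \<in> S \<Longrightarrow> hermitian (g z)" "\<And>z k. z \<in> S \<Longrightarrow> 0 \<le> qf (g z) k"
  and loc: "\<And>p H. p \<in> S \<Longrightarrow> hermitian H \<Longrightarrow> (\<And>k. k \<noteq> 0 \<Longrightarrow> qf (g p) k < qf H k) \<Longrightarrow>
   \<exists>T. open T \<and> p \<in> T \<and> T \<subseteq> S \<and> psh_coord T (\<lambda>z. \<phi> z + ereal (qf H z))"
  and dense: "\<And>p e. p \<in> S \<Longrightarrow> e > 0 \<Longrightarrow> \<exists>q\<in>S. dist p q < e \<and> \<phi> q \<noteq> -\<infinity>"
 shows "0 \<le> (LINT z:S|lborel. real_of_ereal (\<phi> z) * qf (hess h z) k)
    + (LINT z:S|lborel. qf (g z) k * Re (h z))"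
proof -
 have hr: "h z \<in> \<real>" for z using h(2)[of z] nonneg_Reals_subset_Reals by blast
 obtain P L where L: "has_levi UNIV (\<lambda>y. Re (h y)) P L"
  "\<And>z w. hform (hess h z) w = hform (L z) w"
  using test_has_levi[of h, OF _ hr] h(1) unfolding smooth_on_def by blast
 define h0 where "h0 z = Re (h z)" for z
 define l where "l z = qf (L z) k" for z
 define \<gamma> where "\<gamma> z = qf (g z) k" for z
 have Lh: "has_levi UNIV h0 P L" using L(1) by (simp add: h0_def[abs_def])
 have h0: "0 \<le> h0 z" "z \<notin> K \<Longrightarrow> h0 z = 0" for z using h(2)[of z] K(3)[of z] by (auto simp: h0_def complex_nonneg_Reals_iff)
 have L0: "L z = 0" if "z \<notin> K" for z by (rule has_levi_support(2)[OF Lh compact_imp_closed[OF K(1)] h0(2) that])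
 have l0: "l z = 0" if "z \<notin> K" for z using L0[OF that] by (simp add: l_def)
 have cL: "continuous_on UNIV L" using Lh by (simp add: has_levi_def)
 have ch: "continuous_on UNIV h0" by (rule has_levi_continuous[OF Lh])
 have cl: "continuous_on UNIV l" unfolding l_def[abs_def] by (intro continuous_intros cL)
 have l_int: "integrable lborel l" "integral\<^sup>L lborel l = 0"
 proof -
  have i: "integrable lborel L"
  proof -
   have "integrable lborel (\<lambda>y. indicator K y *\<^sub>R L y)" by (rule borel_integrable_compact[OF K(1) continuous_on_subset[OF cL subset_UNIV]])
   moreover have "indicator K y *\<^sub>R L y = L y" for y using L0[of y] by (auto simp: indicator_def)
   ultimately show ?thesis by (simp only:)
  qed
  show "integrable lborel l" unfolding l_def[abs_def] by (rule integrable_bounded_linear[OF hform_linear i])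
  show "integral\<^sup>L lborel l = 0" unfolding l_def[abs_def] integral_bounded_linear[OF hform_linear i]
   using integral_levi_zero[OF Lh K(1) h0(2)] by simp
 qed
 have loc1: "\<exists>T H. open T \<and> p \<in> T \<and> T \<subseteq> S \<and> hermitian H \<and> psh_coord T (\<lambda>z. \<phi> z + ereal (qf H z)) \<and>
   (\<forall>w. 0 \<le> qf H w) \<and> (\<forall>z\<in>T. qf H k \<le> \<gamma> z + j * (1 + (norm k)\<^sup>2))" if p: "p \<in> S" and j: "j > 0" for p j
 proof -
  \<comment> \<open>\<open>loc\<close> needs a form strictly above \<open>g p\<close>; the excess
    \<open>j\<close> returns as the error that is finally sent to 0.\<close>
  define H where "H = g p + j *\<^sub>R mat 1"
  have eq: "qf H w = qf (g p) w + j * (norm w)\<^sup>2" for w by (simp add: H_def hform_add hform_scaleR hform_mat1)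
  have H: "hermitian H" unfolding H_def by (intro hermitian_simps g(2) p)
  obtain T where T: "open T" "p \<in> T" "T \<subseteq> S" "psh_coord T (\<lambda>z. \<phi> z + ereal (qf H z))"
   using loc[OF p H] j by (auto simp: eq)
  have "open {z\<in>S. \<gamma> p - j < \<gamma> z}"
  proof -
   have "continuous_on S \<gamma>" unfolding \<gamma>_def[abs_def] by (intro continuous_intros g(1))
   from continuous_open_preimage[OF this S open_greaterThan, of "\<gamma> p - j"] show ?thesis by (simp add: vimage_def Int_def)
  qed
  then have o: "open (T \<inter> {z\<in>S. \<gamma> p - j < \<gamma> z})" by (intro open_Int T(1))
  show ?thesis
  proof (intro exI[of _ "T \<inter> {z\<in>S. \<gamma> p - j < \<gamma> z}"] exI[of _ H] conjI allI ballI H o)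
   show "psh_coord (T \<inter> {z\<in>S. \<gamma> p - j < \<gamma> z}) (\<lambda>z. \<phi> z + ereal (qf H z))"
    by (rule psh_coord_subset[OF T(4) o T(1)]) auto
   show "0 \<le> qf H w" for w using g(3)[OF p, of w] j by (simp add: eq)
   fix z assume "z \<in> T \<inter> {z\<in>S. \<gamma> p - j < \<gamma> z}"
   then show "qf H k \<le> \<gamma> z + j * (1 + (norm k)\<^sup>2)" by (auto simp: eq \<gamma>_def algebra_simps)
  qed (use T p j in auto)
 qed
 have lt: "\<phi> z < \<infinity>" if zS: "z \<in> S" for z
 proof -
  obtain T H where "z \<in> T" "psh_coord T (\<lambda>z. \<phi> z + ereal (qf H z))" using loc1[OF zS, of 1] by auto
  from psh_coord_less_top[OF this(2,1)] show ?thesis by (cases "\<phi> z") auto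
 qed
 have usc: "open {z\<in>S. \<phi> z < t}" for t
 proof (rule openI)
  fix p assume p: "p \<in> {z\<in>S. \<phi> z < t}"
  then obtain T H where T: "open T" "p \<in> T" "T \<subseteq> S" "psh_coord T (\<lambda>z. \<phi> z + ereal (qf H z))"
   using loc1[of p 1] by auto
  have eq: "(\<phi> z + ereal (qf H z)) + ereal (- qf H z) = \<phi> z" for z by (cases "\<phi> z") auto
  have "open {z\<in>T. (\<phi> z + ereal (qf H z)) + ereal (- qf H z) < t}"
   by (rule usc_add[OF psh_coord_usc[OF T(4,1)] T(1)]) (intro continuous_intros)
  then have "open {z\<in>T. \<phi> z < t}" unfolding eq .
  moreover have "p \<in> {z\<in>T. \<phi> z < t}" "{z\<in>T. \<phi> z < t} \<subseteq> {z\<in>S. \<phi> z < t}" using T p by auto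
  ultimately show "\<exists>e>0. ball p e \<subseteq> {z\<in>S. \<phi> z < t}" by (meson openE order_trans)
 qed
 obtain e where e: "e > 0" "(\<Union>x\<in>K. cball x e) \<subseteq> S"
  using compact_subset_open_imp_cball_epsilon_subset[OF K(1) S K(2)] by blast
 define K' where "K' = {x + y | x y. x \<in> K \<and> y \<in> cball 0 e}"
 have cK': "compact K'" unfolding K'_def by (intro compact_sums K compact_cball)
 have KK': "cball x e \<subseteq> K'" if "x \<in> K" for x
 proof
  fix z assume "z \<in> cball x e"
  then have "z = x + (z - x)" "z - x \<in> cball 0 e" by (auto simp: dist_norm norm_minus_commute)
  then show "z \<in> K'" unfolding K'_def using that by blast
 qed
 have K'S: "K' \<subseteq> S"
 proof
  fix z assume "z \<in> K'"
  then obtain x y where "x \<in> K" "y \<in> cball 0 e" "z = x + y" by (auto simp: K'_def)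
  then show "z \<in> S" using e(2) by (auto simp: dist_norm intro!: subsetD[OF e(2)] bexI[of _ x])
 qed
 have K_K': "K \<subseteq> K'" using KK' e(1) by force
 obtain B where B: "\<And>z. z \<in> K' \<Longrightarrow> \<phi> z < ereal B" using usc_bounded_above[OF usc lt cK' K'S] by blast
 have loc2: "\<exists>T f. open T \<and> p \<in> T \<and> T \<subseteq> S \<and> continuous_on T (f :: _ \<Rightarrow> real) \<and> psh_coord T (\<lambda>z. \<phi> z + ereal (f z))" if pS: "p \<in> S" for p
 proof -
  obtain T H where "open T" "p \<in> T" "T \<subseteq> S" "psh_coord T (\<lambda>z. \<phi> z + ereal (qf H z))" using loc1[OF pS, of 1] by auto
  then show ?thesis by (intro exI[of _ T] exI[of _ "\<lambda>z. qf H z"]) (auto intro!: continuous_intros)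
 qed
 have qi: "set_integrable lborel K' (\<lambda>z. real_of_ereal (\<phi> z))" "AE y in lborel. y \<in> K' \<longrightarrow> \<phi> y \<noteq> -\<infinity>"
  by (rule qpsh_integrable[where S=S and \<phi>=\<phi>]; (rule loc2 dense cK' K'S; assumption?))+
 have mK' [measurable]: "K' \<in> sets borel" using cK' by (simp add: borel_compact)
 \<comment> \<open>Cut off outside the compact thickening \<open>K'\<close> to be integrable; small
   discs centred in \<open>K\<close> do not see the cut.\<close>
 define a where "a y = (if y \<in> K' then (if y \<in> S then gap B \<phi> y else 0) else 0)" for y
 have m\<kappa> [measurable]: "a \<in> borel_measurable borel"
 proof -
  have [measurable]: "(\<lambda>y. if y \<in> S then gap B \<phi> y else 0) \<in> borel_measurable borel" by (rule usc_measurable[OF usc S])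
  show ?thesis unfolding a_def[abs_def] by measurable
 qed
 define kr where "kr y = B * indicator K' y - indicator K' y *\<^sub>R real_of_ereal (\<phi> y)" for y
 have ikr: "integrable lborel kr" unfolding kr_def[abs_def]
 proof (rule Bochner_Integration.integrable_diff)
  show "integrable lborel (\<lambda>y. B * indicator K' y)"
   using emeasure_compact_finite[OF cK'] by (intro integrable_mult_right integrable_real_indicator) auto
  show "integrable lborel (\<lambda>y. indicator K' y *\<^sub>R real_of_ereal (\<phi> y))" using qi(1) by (simp add: set_integrable_def)
 qed
 have kr: "AE y in lborel. a y = ennreal (kr y) \<and> 0 \<le> kr y" using qi(2)
 proof eventually_elim
  case (elim y)
  show ?case
  proof (cases "y \<in> K'")
   case True
   then have "\<phi> y \<noteq> -\<infinity>" "\<phi> y < ereal B" "y \<in> S" using elim B K'S by auto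
   then show ?thesis using True by (cases "\<phi> y") (auto simp: a_def kr_def)
  qed (simp add: a_def kr_def)
 qed
 have mh: "h0 \<in> borel_measurable borel" "l \<in> borel_measurable borel" using ch cl by (auto intro: borel_measurable_continuous_onI)
 obtain Ch where Ch: "\<And>z. norm (h0 z) \<le> Ch" using compact_support_uniformly_continuous(2)[OF ch K(1) h0(2)] by blast
 obtain Cl where Cl: "\<And>z. norm (l z) \<le> Cl" using compact_support_uniformly_continuous(2)[OF cl K(1) l0] by blast
 have ikh: "integrable lborel (\<lambda>y. kr y * h0 y)" "integrable lborel (\<lambda>y. kr y * l y)"
  using integrable_mult_bounded[OF ikr mh(1) Ch] integrable_mult_bounded[OF ikr mh(2) Cl] by auto
 have ih: "integrable lborel h0"
 proof -
  have "integrable lborel (\<lambda>y. indicator K y *\<^sub>R h0 y)" by (rule borel_integrable_compact[OF K(1) continuous_on_subset[OF ch subset_UNIV]])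
  moreover have "indicator K y *\<^sub>R h0 y = h0 y" for y using h0(2)[of y] by (auto simp: indicator_def)
  ultimately show ?thesis by (simp only:)
 qed
 define hg where "hg y = indicator K y *\<^sub>R (\<gamma> y * h0 y)" for y
 have ihg: "integrable lborel hg" unfolding hg_def[abs_def] \<gamma>_def
  by (intro borel_integrable_compact K(1) continuous_intros continuous_on_subset[OF g(1) K(2)] continuous_on_subset[OF ch subset_UNIV])
 define C where "C = 1 + (norm k)\<^sup>2"
 have C: "C \<ge> 1" by (simp add: C_def)
 have main: "integral\<^sup>L lborel (\<lambda>y. kr y * l y) \<le> integral\<^sup>L lborel hg + j * (integral\<^sup>L lborel kr + C * integral\<^sup>L lborel h0)" if j: "j > 0" for j
 proof -
  let ?\<G> = "{T. open T \<and> T \<subseteq> S \<and> (\<exists>H. hermitian H \<and> psh_coord T (\<lambda>z. \<phi> z + ereal (qf H z)) \<and>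
   (\<forall>w. 0 \<le> qf H w) \<and> (\<forall>z\<in>T. qf H k \<le> \<gamma> z + j * C))}"
  have cov: "K \<subseteq> \<Union> ?\<G>"
  proof
   fix p assume "p \<in> K"
   then have "p \<in> S" using K(2) by auto
   from loc1[OF this j, folded C_def] show "p \<in> \<Union> ?\<G>" by blast
  qed
  \<comment> \<open>A Lebesgue number: one radius serves all centres in \<open>K\<close>, although
    the quadratic form changes from set to set.\<close>
  have "\<exists>u>0. \<forall>x\<in>K. \<exists>G\<in>?\<G>. ball x u \<subseteq> G" by (rule Heine_Borel_lemma[OF K(1) cov]) auto
  then obtain u where u: "u > 0" "\<And>x. x \<in> K \<Longrightarrow> \<exists>G\<in>?\<G>. ball x u \<subseteq> G" by blast
  obtain d where d: "d > 0" "\<And>x y. norm (x - y) < d \<Longrightarrow> norm (l x - l y) < j"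
   using compact_support_uniformly_continuous(1)[OF cl K(1) l0 j] by blast
  \<comment> \<open>Small enough for the thickening, for the Lebesgue number and for the uniform
    continuity of \<open>l\<close> at once.\<close>
  define m where "m = min e (min u d) / 2"
  have m: "m > 0" "m < e" "m < u" "m < d" using e(1) u(1) d(1) by (auto simp: m_def min_def)
  define r where "r = m / (norm k + 1)"
  have r: "r > 0" unfolding r_def using m by (intro divide_pos_pos add_nonneg_pos) auto
  define w where "w = of_real r *s k"
  have "r * norm k \<le> r * (norm k + 1)" using r by (intro mult_left_mono) auto
  also have "\<dots> = m" using norm_ge_zero[of k] by (simp add: r_def add_nonneg_eq_0_iff)
  finally have w: "norm w \<le> m" "norm (- w) \<le> m" using r by (auto simp: w_def norm_scalar_mult)
  have hw: "hform A w = of_real (r\<^sup>2) * hform A k" "hform A (- w) = of_real (r\<^sup>2) * hform A k" for A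
   using r hform_scale[of A "of_real r" k] hform_scale[of A "- of_real r" k] by (auto simp: w_def)
  have i: "cint a z w \<le> ennreal (2*pi) * a z + ennreal (2*pi * (r\<^sup>2 * (\<gamma> z + j * C)))" if z: "z \<in> K" for z
  proof -
   let ?D = "cdisc z w"
   obtain T H where T: "open T" "T \<subseteq> S" "hermitian H" "psh_coord T (\<lambda>z. \<phi> z + ereal (qf H z))"
    "\<And>w. 0 \<le> qf H w" "\<And>z. z \<in> T \<Longrightarrow> qf H k \<le> \<gamma> z + j * C" "ball z u \<subseteq> T"
    using u(2)[OF z] by auto
   have D: "?D \<subseteq> cball z m" by (rule disc_in_cball[OF w(1)])
   have DT: "?D \<subseteq> T" using D m(3) T(7) by (force simp: subset_iff)
   have DK: "?D \<subseteq> K'" using D m(2) KK'[OF z] by (force simp: subset_iff)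
   have eq: "a y = gap B \<phi> y" if "y \<in> ?D" for y using subsetD[OF DK that] K'S by (auto simp: a_def)
   have "cint a z w = cint (gap B \<phi>) z w" unfolding cint_def using eq[OF circle_in_disc] by simp
   also have "\<dots> \<le> ennreal (2*pi) * gap B \<phi> z + ennreal (2*pi * qf H w)"
    using DK B by (intro sub_mean_minus_quad[OF T(4,1,3) T(5) DT]) (auto intro: less_imp_le)
   also have "\<dots> \<le> ennreal (2*pi) * a z + ennreal (2*pi * (r\<^sup>2 * (\<gamma> z + j * C)))"
   proof -
    have "z \<in> T" using T(7) u(1) by auto
    from T(6)[OF this] have "r\<^sup>2 * qf H k \<le> r\<^sup>2 * (\<gamma> z + j * C)" by (rule mult_left_mono) simp
    then have "2*pi * qf H w \<le> 2*pi * (r\<^sup>2 * (\<gamma> z + j * C))" unfolding hw by simp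
    then show ?thesis by (simp add: eq[OF center_in_disc] add_left_mono ennreal_leI)
   qed
   finally show ?thesis .
  qed
  have ii: "ennreal (2*pi * (h0 y + r\<^sup>2 * (l y - j))) \<le> cint (\<lambda>z. ennreal (h0 z)) y (- w)" for y
  proof -
   have c: "continuous_on UNIV (\<lambda>v. - h0 (y + cis v *s (- w)))"
    by (intro continuous_intros continuous_on_compose2[OF ch circle_continuous]) auto
   have "cint (\<lambda>z. ennreal (0 - (- h0 z))) y (- w) = ennreal (2*pi*0 - integral {0..2*pi} (\<lambda>v. - h0 (y + cis v *s (- w))))"
    by (rule cint_continuous[OF c]) (simp add: h0)
   then have "cint (\<lambda>z. ennreal (h0 z)) y (- w) = ennreal (integral {0..2*pi} (\<lambda>v. h0 (y + cis v *s (- w))))" by simp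
   moreover have "2*pi * (h0 y + r\<^sup>2 * (l y - j)) \<le> integral {0..2*pi} (\<lambda>v. h0 (y + cis v *s (- w)))"
   proof (rule has_levi_mean[OF Lh UNIV_I])
    fix b assume "cmod b \<le> 1"
    then have "y + b *s (- w) \<in> cball y m" using disc_in_cball[OF w(2), of y] by blast
    then have "norm (l y - l (y + b *s (- w))) < j" using m(4) by (intro d(2)) (simp add: dist_norm)
    then have "l y - j \<le> l (y + b *s (- w))" by (simp add: abs_less_iff)
    then have "r\<^sup>2 * (l y - j) \<le> r\<^sup>2 * l (y + b *s (- w))" by (rule mult_left_mono) simp
    then show "r\<^sup>2 * (l y - j) \<le> qf (L (y + b *s (- w))) (- w)" unfolding hw l_def by simp
   qed
   ultimately show ?thesis by (simp add: ennreal_leI)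
  qed
  let ?l = "\<lambda>y. kr y * (2*pi * (h0 y + r\<^sup>2 * (l y - j)))"
  let ?r = "\<lambda>y. 2*pi * (kr y * h0 y) + 2*pi*r\<^sup>2 * (hg y + j * C * h0 y)"
  have il: "integrable lborel ?l"
  proof -
   have "integrable lborel (\<lambda>y. 2*pi * (kr y * h0 y) + 2*pi*r\<^sup>2 * (kr y * l y - j * kr y))"
    using ikh ikr by (intro Bochner_Integration.integrable_add integrable_mult_right Bochner_Integration.integrable_diff)
   then show ?thesis by (simp add: algebra_simps)
  qed
  have ir: "integrable lborel ?r" using ikh ihg ih by (intro Bochner_Integration.integrable_add integrable_mult_right)
  have hg0: "0 \<le> hg y" for y using K(2) g(3) h0(1) by (auto simp: hg_def indicator_def \<gamma>_def)
  have "ennreal (integral\<^sup>L lborel ?l) \<le> (\<integral>\<^sub>+y. ennreal (?l y))" by (rule integral_le_nn_integral[OF il])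
  also have "\<dots> \<le> (\<integral>\<^sub>+y. a y * cint (\<lambda>z. ennreal (h0 z)) y (- w))"
  proof (rule nn_integral_mono_AE)
   show "AE y in lborel. ennreal (?l y) \<le> a y * cint (\<lambda>z. ennreal (h0 z)) y (- w)" using kr
   proof eventually_elim
    case (elim y)
    then have "ennreal (?l y) = a y * ennreal (2*pi * (h0 y + r\<^sup>2 * (l y - j)))" by (simp add: ennreal_mult')
    also have "\<dots> \<le> a y * cint (\<lambda>z. ennreal (h0 z)) y (- w)" by (intro mult_left_mono ii) simp
    finally show ?case .
   qed
  qed
  also have "\<dots> = (\<integral>\<^sub>+z. ennreal (h0 z) * cint a z w)"
   by (rule cint_duality[symmetric]) (use mh m\<kappa> in measurable)
  also have "\<dots> \<le> (\<integral>\<^sub>+z. ennreal (?r z))"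
  proof (rule nn_integral_mono_AE)
   show "AE z in lborel. ennreal (h0 z) * cint a z w \<le> ennreal (?r z)" using kr
   proof eventually_elim
    case (elim z)
    show ?case
    proof (cases "z \<in> K")
     case True
     have "0 \<le> \<gamma> z" using g(3) True K(2) by (auto simp: \<gamma>_def)
     then have *: "0 \<le> 2*pi * (r\<^sup>2 * (\<gamma> z + j * C))" using C j by (intro mult_nonneg_nonneg add_nonneg_nonneg) auto
     have "ennreal (h0 z) * cint a z w \<le> ennreal (h0 z) * (ennreal (2*pi) * a z + ennreal (2*pi * (r\<^sup>2 * (\<gamma> z + j * C))))"
      by (intro mult_left_mono i[OF True]) simp
     also have "\<dots> = ennreal (h0 z * (2*pi * kr z + 2*pi * (r\<^sup>2 * (\<gamma> z + j * C))))"
      using elim h0(1)[of z] * by (simp add: ennreal_mult ennreal_plus)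
     also have "h0 z * (2*pi * kr z + 2*pi * (r\<^sup>2 * (\<gamma> z + j * C))) = ?r z"
      using True by (simp add: hg_def algebra_simps)
     finally show ?thesis .
    qed (simp add: h0(2))
   qed
  qed
  also have "\<dots> = ennreal (integral\<^sup>L lborel ?r)"
  proof (rule nn_integral_eq_integral[OF ir])
   show "AE y in lborel. 0 \<le> ?r y" using kr
    by eventually_elim (use hg0 h0(1) C j in \<open>auto intro!: add_nonneg_nonneg mult_nonneg_nonneg\<close>)
  qed
  finally have le: "ennreal (integral\<^sup>L lborel ?l) \<le> ennreal (integral\<^sup>L lborel ?r)" .
  have "0 \<le> integral\<^sup>L lborel ?r"
  proof (rule integral_nonneg_AE)
   show "AE y in lborel. 0 \<le> ?r y" using kr
    by eventually_elim (use hg0 h0(1) C j in \<open>auto intro!: add_nonneg_nonneg mult_nonneg_nonneg\<close>)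
  qed
  with le have le: "integral\<^sup>L lborel ?l \<le> integral\<^sup>L lborel ?r" by (simp add: ennreal_le_iff)
  have "integral\<^sup>L lborel ?l = integral\<^sup>L lborel (\<lambda>y. 2*pi * (kr y * h0 y) + 2*pi*r\<^sup>2 * (kr y * l y - j * kr y))"
   by (simp add: algebra_simps)
  also have "\<dots> = 2*pi * integral\<^sup>L lborel (\<lambda>y. kr y * h0 y) + 2*pi*r\<^sup>2 * (integral\<^sup>L lborel (\<lambda>y. kr y * l y) - j * integral\<^sup>L lborel kr)"
   using ikh ikr by simp
  finally have 1: "integral\<^sup>L lborel ?l = 2*pi * integral\<^sup>L lborel (\<lambda>y. kr y * h0 y) + 2*pi*r\<^sup>2 * (integral\<^sup>L lborel (\<lambda>y. kr y * l y) - j * integral\<^sup>L lborel kr)" .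
  have 2: "integral\<^sup>L lborel ?r = 2*pi * integral\<^sup>L lborel (\<lambda>y. kr y * h0 y) + 2*pi*r\<^sup>2 * (integral\<^sup>L lborel hg + j * C * integral\<^sup>L lborel h0)"
   using ikh ihg ih by simp
  have "2*pi*r\<^sup>2 > 0" using r by simp
  then have "integral\<^sup>L lborel (\<lambda>y. kr y * l y) - j * integral\<^sup>L lborel kr \<le> integral\<^sup>L lborel hg + j * C * integral\<^sup>L lborel h0"
   using le unfolding 1 2 add_le_cancel_left by (simp only: mult_le_cancel_left_pos)
  then show ?thesis by (simp add: algebra_simps)
 qed
 have "integral\<^sup>L lborel (\<lambda>y. kr y * l y) \<le> integral\<^sup>L lborel hg"
 proof (rule field_le_epsilon)
  fix x :: real assume x: "x > 0"
  let ?M = "integral\<^sup>L lborel kr + C * integral\<^sup>L lborel h0"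
  have M: "0 \<le> ?M" using kr h0(1) C
   by (intro add_nonneg_nonneg mult_nonneg_nonneg integral_nonneg_AE) (auto elim: eventually_mono)
  have "x / (?M + 1) > 0" using x M by (intro divide_pos_pos) linarith+
  note main[OF this]
  also have "x / (?M + 1) * ?M \<le> x"
  proof -
   have "x / (?M + 1) * ?M = x * (?M / (?M + 1))" by simp
   also have "\<dots> \<le> x * 1" using x M by (intro mult_left_mono, subst pos_divide_le_eq) (linarith | simp)+
   finally show ?thesis by simp
  qed
  finally show "integral\<^sup>L lborel (\<lambda>y. kr y * l y) \<le> integral\<^sup>L lborel hg + x" by simp
 qed
 moreover have "(LINT z:S|lborel. qf (g z) k * Re (h z)) = integral\<^sup>L lborel hg"
  unfolding set_lebesgue_integral_def
 proof (rule Bochner_Integration.integral_cong[OF refl])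
  fix y
  show "indicator S y *\<^sub>R (qf (g y) k * Re (h y)) = hg y"
   using K(2) K(3)[of y] by (cases "y \<in> K") (auto simp: hg_def \<gamma>_def h0_def)
 qed
 moreover have "(LINT z:S|lborel. real_of_ereal (\<phi> z) * qf (hess h z) k) = - integral\<^sup>L lborel (\<lambda>y. kr y * l y)"
 proof -
  have "(LINT z:S|lborel. real_of_ereal (\<phi> z) * qf (hess h z) k) = integral\<^sup>L lborel (\<lambda>y. B * l y - kr y * l y)"
   unfolding set_lebesgue_integral_def
  proof (rule Bochner_Integration.integral_cong[OF refl])
   fix y
   show "indicator S y *\<^sub>R (real_of_ereal (\<phi> y) * qf (hess h y) k) = B * l y - kr y * l y"
   proof (cases "y \<in> K")
    case True
    then have "y \<in> S" "y \<in> K'" using K(2) K_K' by auto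
    then show ?thesis by (simp add: L(2) kr_def l_def algebra_simps)
   next
    case False
    then show ?thesis using l0[of y] L0[of y] by (simp add: L(2))
   qed
  qed
  then show ?thesis using l_int ikh by simp
 qed
 ultimately show ?thesis by simp
qed

section \<open>Charts\<close>

lemma chart_inj: "is_chart X c \<Longrightarrow> inj_on (snd c) (fst c)"
 unfolding is_chart_def using homeomorphic_imp_injective_map[of "subtopology X (fst c)"] openin_subset[of X "fst c"]
 by (auto simp: topspace_subtopology inf_absorb2)

lemma chart_open_image:
 assumes c: "is_chart X c" and W: "openin X W"
 shows "open (snd c ` (fst c \<inter> W))"
proof -
 have "open_map (subtopology X (fst c)) (top_of_set (chart_image c)) (snd c)"
  using c unfolding is_chart_def by (blast intro: homeomorphic_imp_open_map)
 then have "openin (top_of_set (chart_image c)) (snd c ` (fst c \<inter> W))"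
  using W unfolding open_map_def by (blast intro: openin_subtopology_Int2)
 then show ?thesis using c unfolding is_chart_def by (simp add: openin_open_eq)
qed

lemma chart_open_preimage:
 assumes c: "is_chart X c" and S: "open S"
 shows "openin X {p \<in> fst c. snd c p \<in> S}"
proof -
 have cm: "continuous_map (subtopology X (fst c)) (top_of_set (chart_image c)) (snd c)"
  using c unfolding is_chart_def by (blast intro: homeomorphic_imp_continuous_map)
 have "openin (subtopology X (fst c)) {x \<in> topspace (subtopology X (fst c)). snd c x \<in> S \<inter> chart_image c}"
  by (rule openin_continuous_map_preimage[OF cm]) (use openin_open_Int[OF S, of "chart_image c"] in \<open>simp add: Int_commute\<close>)
 moreover have "{x \<in> topspace (subtopology X (fst c)). snd c x \<in> S \<inter> chart_image c} = {p \<in> fst c. snd c p \<in> S}"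
  using c openin_subset[of X "fst c"] unfolding is_chart_def by auto
 ultimately show ?thesis using c unfolding is_chart_def by (auto intro: openin_trans_full)
qed

lemma AE_open_ex:
 assumes "AE y in lborel. P y" "open Q" "(x::'a::euclidean_space) \<in> Q"
 shows "\<exists>y\<in>Q. P y"
proof (rule ccontr)
 assume n: "\<not> (\<exists>y\<in>Q. P y)"
 obtain e where e: "e > 0" "ball x e \<subseteq> Q" using assms(2,3) by (meson openE)
 have "AE y in lborel. y \<notin> ball x e" using assms(1) by eventually_elim (use n e in auto)
 then have "ball x e \<in> null_sets lborel" by (subst AE_iff_null_sets) auto
 then show False using content_ball_pos[OF e(1), of x] by (simp add: measure_def null_setsD1 del: mem_ball)
qed

text \<open>Let \<open>B\<close> be the largest open set on which \<phi> is -\<infinity>. A point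
  outside \<open>B\<close> has finite values arbitrarily close by, so \<phi> is finite almost
  everywhere near it, and a whole neighbourhood avoids \<open>B\<close>. Thus \<open>B\<close> is
  open and closed, and a component that meets \<open>B\<close> lies in it, against the definition of
  \<open>quasi_psh\<close>.\<close>

lemma quasi_psh_dense:
 fixes A :: "('a, 'n::finite) chart set"
 assumes A: "\<And>c. c \<in> A \<Longrightarrow> is_chart X c" "topspace X \<subseteq> \<Union> (fst ` A)" and q: "quasi_psh X A \<phi>"
  and W: "openin X W" "p \<in> W"
 shows "\<exists>q\<in>W. \<phi> q \<noteq> -\<infinity>"
proof (rule ccontr)
 assume contra: "\<not> (\<exists>q\<in>W. \<phi> q \<noteq> -\<infinity>)"
 define B where "B = \<Union> {W. openin X W \<and> (\<forall>q\<in>W. \<phi> q = -\<infinity>)}"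
 have oB: "openin X B" unfolding B_def by blast
 have pB: "p \<in> B" using contra W unfolding B_def by blast
 have oC: "openin X (topspace X - B)"
 proof (subst openin_subopen, rule ballI)
  fix y assume y: "y \<in> topspace X - B"
  obtain c where c: "c \<in> A" "y \<in> fst c" using A(2) y by auto
  note ch = A(1)[OF c(1)]
  obtain W0 u f where W0: "openin X W0" "y \<in> W0" "psh_on A W0 u" "\<forall>x\<in>W0. \<phi> x = u x + ereal (f x)"
   using q y unfolding quasi_psh_def by blast
  let ?S = "snd c ` (fst c \<inter> W0)" and ?u = "u \<circ> chart_inv c"
  have S: "open ?S" by (rule chart_open_image[OF ch W0(1)])
  have u: "psh_coord ?S ?u" using W0(3) c(1) unfolding psh_on_def by blast
  have inv: "chart_inv c (snd c x) = x" if "x \<in> fst c" for x using chart_inj[OF ch] that by simp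
  have "snd c y \<in> ?S" using c W0(2) by blast
  then obtain e where e: "e > 0" "cball (snd c y) e \<subseteq> ?S" using S open_contains_cball by blast
  let ?O = "{x \<in> fst c. snd c x \<in> ball (snd c y) (e/8)}"
  have O: "openin X ?O" by (rule chart_open_preimage[OF ch open_ball])
  have yO: "y \<in> ?O" using c e by simp
  have OW: "x \<in> W0" if "x \<in> ?O" for x
  proof -
   have "snd c x \<in> ?S" using that e by auto
   then obtain x' where "x' \<in> fst c" "x' \<in> W0" "snd c x = snd c x'" by auto
   then show ?thesis using that inj_onD[OF chart_inj[OF ch]] by auto
  qed
  obtain q where q: "q \<in> ?O" "\<phi> q \<noteq> -\<infinity>"
  proof (rule ccontr)
   assume "\<not> thesis"
   then have "?O \<subseteq> B" using O that unfolding B_def by blast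
   then show False using yO y by auto
  qed
  then have uq: "?u (snd c q) \<noteq> -\<infinity>" using W0(4) OW[OF q(1)] inv[of q] by auto
  have sub: "cball (snd c q) (e/2) \<subseteq> ?S"
  proof (rule order_trans[OF _ e(2)], rule subsetI)
   fix z assume "z \<in> cball (snd c q) (e/2)"
   then show "z \<in> cball (snd c y) e" using q(1) dist_triangle[of "snd c y" z "snd c q"] e(1) by simp
  qed
  have AE: "AE z in lborel. z \<in> cball (snd c q) (e/2/2) \<longrightarrow> ?u z \<noteq> -\<infinity>"
   using psh_locally_integrable(1)[OF u S _ sub uq] e(1) by simp
  have "?O \<subseteq> topspace X - B"
  proof
   fix x assume x: "x \<in> ?O"
   have "x \<notin> B"
   proof
    assume "x \<in> B"
    then obtain W' where W': "openin X W'" "x \<in> W'" "\<And>q. q \<in> W' \<Longrightarrow> \<phi> q = -\<infinity>" unfolding B_def by blast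
    let ?Q = "snd c ` (fst c \<inter> (W' \<inter> ?O))"
    have "open ?Q" by (rule chart_open_image[OF ch]) (intro openin_Int W' O)
    moreover have "snd c x \<in> ?Q" using x W' by auto
    ultimately obtain z where z: "z \<in> ?Q" "z \<in> cball (snd c q) (e/2/2) \<longrightarrow> ?u z \<noteq> -\<infinity>"
     using AE_open_ex[OF AE] by blast
    then obtain x' where x': "x' \<in> fst c" "x' \<in> W'" "x' \<in> ?O" "z = snd c x'" by auto
    have "z \<in> cball (snd c q) (e/2/2)"
     using x' q(1) dist_triangle[of "snd c q" z "snd c y"] by (simp add: dist_commute)
    with z(2) x' inv have "u x' \<noteq> -\<infinity>" by simp
    then show False using W'(3)[OF x'(2)] W0(4) OW[OF x'(3)] by (cases "u x'") auto
   qed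
   then show "x \<in> topspace X - B" using x openin_subset[OF O] by blast
  qed
  then show "\<exists>T. openin X T \<and> y \<in> T \<and> T \<subseteq> topspace X - B" using O yO by blast
 qed
 let ?C = "connected_component_of_set X p"
 have pX: "p \<in> topspace X" using W openin_subset by auto
 have C: "?C \<in> connected_components_of X" using pX unfolding connected_components_of_def by blast
 then obtain x where x: "x \<in> ?C" "\<phi> x \<noteq> -\<infinity>" using q unfolding quasi_psh_def by blast
 have "connectedin X ?C" by (rule connectedin_connected_component_of)
 moreover have "x \<notin> B" using x(2) unfolding B_def by blast
 moreover have "?C \<subseteq> topspace X" by (rule connected_component_of_subset_topspace)
 moreover have "p \<in> ?C" using pX by (simp add: connected_component_of_refl)
 ultimately show False using oB oC pB x(1) unfolding connectedin by blast
qed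

text \<open>Parametrized pieces of \<open>X\<close>: charts of \<open>X\<close>, or charts of a submanifold.\<close>

definition good_param :: "('a, 'n::finite) chart set \<Rightarrow> ('a, 'm::finite) chart \<Rightarrow> bool" where
 "good_param A d \<longleftrightarrow> open (chart_image d) \<and> inj_on (snd d) (fst d) \<and> fst d \<subseteq> \<Union> (fst ` A) \<and>
   (\<forall>c\<in>A. open (snd d ` (fst d \<inter> fst c)) \<and> holo_on (snd c \<circ> chart_inv d) (snd d ` (fst d \<inter> fst c)) \<and>
    (\<exists>R M. open M \<and> holo_on R M \<and> (\<forall>z\<in>snd d ` (fst d \<inter> fst c). snd c (chart_inv d z) \<in> M \<and> R (snd c (chart_inv d z)) = z)))"

lemma good_param_compatible:
 assumes X: "complex_manifold X A" and d: "compatible_chart X A d"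
 shows "good_param A d"
 unfolding good_param_def
proof (intro conjI ballI)
 have ch: "is_chart X d" using d by (simp add: compatible_chart_def)
 show "open (chart_image d)" using ch by (simp add: is_chart_def)
 show inj: "inj_on (snd d) (fst d)" by (rule chart_inj[OF ch])
 show "fst d \<subseteq> \<Union> (fst ` A)" using ch X openin_subset[of X "fst d"] by (auto simp: is_chart_def complex_manifold_def)
 fix c assume c: "c \<in> A"
 then have cc: "is_chart X c" using X by (simp add: complex_manifold_def)
 show "open (snd d ` (fst d \<inter> fst c))" using cc by (intro chart_open_image[OF ch]) (simp add: is_chart_def)
 show "holo_on (snd c \<circ> chart_inv d) (snd d ` (fst d \<inter> fst c))"
  using d c by (simp add: compatible_chart_def holo_transition_def)
 show "\<exists>R M. open M \<and> holo_on R M \<and> (\<forall>z\<in>snd d ` (fst d \<inter> fst c). snd c (chart_inv d z) \<in> M \<and> R (snd c (chart_inv d z)) = z)"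
 proof (intro exI[of _ "snd d \<circ> chart_inv c"] exI[of _ "snd c ` (fst c \<inter> fst d)"] conjI ballI)
  show "open (snd c ` (fst c \<inter> fst d))" using ch by (intro chart_open_image[OF cc]) (simp add: is_chart_def)
  show "holo_on (snd d \<circ> chart_inv c) (snd c ` (fst c \<inter> fst d))"
   using d c by (simp add: compatible_chart_def holo_transition_def)
  fix z assume "z \<in> snd d ` (fst d \<inter> fst c)"
  then obtain x where x: "x \<in> fst d" "x \<in> fst c" "z = snd d x" by auto
  show "snd c (chart_inv d z) \<in> snd c ` (fst c \<inter> fst d)" "(snd d \<circ> chart_inv c) (snd c (chart_inv d z)) = z"
   using x inj chart_inj[OF cc] by auto
 qed
qed

lemma pullback_matrix_mult: "pullback_matrix (J2 ** J1) g = pullback_matrix J1 (pullback_matrix J2 g)"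
proof -
 have "(\<chi> m k. cnj ((J2 ** J1) $ m $ k)) = (\<chi> m k. cnj (J2 $ m $ k)) ** (\<chi> m k. cnj (J1 $ m $ k))"
  by (simp add: matrix_matrix_mult_def vec_eq_iff)
 then show ?thesis by (simp add: pullback_matrix_alt matrix_transpose_mul matrix_mul_assoc)
qed

lemma good_paramD:
 assumes d: "good_param A d" and q: "q \<in> fst d"
 shows "chart_inv d (snd d q) = q"
 using assms unfolding good_param_def by simp

text \<open>The chart to which this is applied need not belong to the atlas: it can be an adapted
  chart of \<open>X\<close> or a chart of \<open>V\<close>. Pulling back along the identity covers
  both cases, and the second one is \<omega> restricted to \<open>V\<close>.\<close>

abbreviation (input) "metr A \<omega> \<equiv> pullback_form A (\<lambda>x. x) \<omega>"

text \<open>The chart that \<open>SOME\<close> picks in \<open>pullback_form\<close> is irrelevant: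
  another choice changes the Jacobian by the chain rule and the coefficients by the transformation
  law, and the two changes cancel.\<close>

lemma pullback_form_eq:
 assumes X: "complex_manifold X A" and \<omega>: "smooth_form11 A \<omega>" and d: "good_param A d" and c: "c \<in> A" and q: "q \<in> fst d" "q \<in> fst c"
 shows "metr A \<omega> d q = pullback_matrix (Jac (snd c \<circ> chart_inv d) (snd d q)) (\<omega> c q)"
proof -
 define c' where "c' = (SOME c. c \<in> A \<and> q \<in> fst c)"
 have c': "c' \<in> A" "q \<in> fst c'" using someI[of "\<lambda>c. c \<in> A \<and> q \<in> fst c" c] c q unfolding c'_def by auto
 note inv = good_paramD[OF d]
 have ch: "is_chart X c" using X c by (simp add: complex_manifold_def)
 let ?tr = "snd c' \<circ> chart_inv c" and ?F = "snd c \<circ> chart_inv d" and ?F' = "snd c' \<circ> chart_inv d"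
 let ?N = "snd d ` (fst d \<inter> fst c) \<inter> snd d ` (fst d \<inter> fst c')" and ?M = "snd c ` (fst c \<inter> fst c')"
 have N: "open ?N" and z: "snd d q \<in> ?N" using d c c' q unfolding good_param_def by auto
 have pt: "\<exists>x. x \<in> fst d \<and> x \<in> fst c \<and> x \<in> fst c' \<and> z = snd d x" if "z \<in> ?N" for z
  using that d unfolding good_param_def inj_on_def by blast
 have hF: "holo_on ?F ?N" "holo_on ?F' ?N" using d c c' unfolding good_param_def by (auto intro: holo_on_subset)
 have htr: "holo_on ?tr ?M" using X c c' unfolding complex_manifold_def holo_transition_def by blast
 have im: "?F ` ?N \<subseteq> ?M"
 proof
  fix y assume "y \<in> ?F ` ?N"
  then obtain z where z: "z \<in> ?N" "y = ?F z" by blast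
  obtain x where x: "x \<in> fst d" "x \<in> fst c" "x \<in> fst c'" "z = snd d x" using pt[OF z(1)] by blast
  then have "y = snd c x" using z(2) inv[OF x(1)] by simp
  then show "y \<in> ?M" using x by blast
 qed
 have eq: "?F' z = (?tr \<circ> ?F) z" if "z \<in> ?N" for z
  using pt[OF that] inv chart_inj[OF ch] by auto
 have "Jac ?F' (snd d q) = Jac (?tr \<circ> ?F) (snd d q)"
 proof (rule Jac_unique)
  have "(?tr \<circ> ?F has_derivative (*v) (Jac (?tr \<circ> ?F) (snd d q))) (at (snd d q))"
   by (rule holo_on_Jac[OF holo_on_compose(1)[OF hF(1) htr im] z])
  then show "(?F' has_derivative (*v) (Jac (?tr \<circ> ?F) (snd d q))) (at (snd d q))"
   by (rule has_derivative_transform_within_open[OF _ N z]) (simp only: eq)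
 qed
 also have "\<dots> = Jac ?tr (?F (snd d q)) ** Jac ?F (snd d q)" by (rule holo_on_compose(2)[OF hF(1) htr im z])
 also have "?F (snd d q) = snd c q" using inv[OF q(1)] by simp
 finally have J: "Jac ?F' (snd d q) = Jac ?tr (snd c q) ** Jac ?F (snd d q)" .
 have jac: "jacobian d (\<lambda>x. x) c' q = Jac ?F' (snd d q)" "jacobian c (\<lambda>x. x) c' q = Jac ?tr (snd c q)"
  by (simp_all add: jacobian_def Jac_def o_def)
 have "\<omega> c q = pullback_matrix (Jac ?tr (snd c q)) (\<omega> c' q)"
  using \<omega> c c' q jac(2) unfolding smooth_form11_def by (metis IntI)
 then show ?thesis
  unfolding pullback_form_def c'_def[symmetric] Let_def jac(1) J pullback_matrix_mult by simp
qed

text \<open>The derivative of the left inverse \<open>R\<close> inverts the Jacobian from the left.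
  This keeps the induced metric definite on \<open>V\<close>.\<close>

lemma good_param_injective:
 assumes d: "good_param A d" and c: "c \<in> A" and q: "q \<in> fst d" "q \<in> fst c" and b: "b \<noteq> 0"
 shows "Jac (snd c \<circ> chart_inv d) (snd d q) *v b \<noteq> 0"
proof
 assume 0: "Jac (snd c \<circ> chart_inv d) (snd d q) *v b = 0"
 let ?F = "snd c \<circ> chart_inv d" and ?N = "snd d ` (fst d \<inter> fst c)"
 obtain R M where R: "open M" "holo_on R M" "\<And>z. z \<in> ?N \<Longrightarrow> ?F z \<in> M \<and> R (?F z) = z"
  using d c unfolding good_param_def by fastforce
 have N: "open ?N" "snd d q \<in> ?N" and hF: "holo_on ?F ?N" using d c q unfolding good_param_def by auto
 have im: "?F ` ?N \<subseteq> M" using R(3) by auto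
 have "(R \<circ> ?F has_derivative (*v) (Jac R (?F (snd d q)) ** Jac ?F (snd d q))) (at (snd d q))"
  using holo_on_Jac[OF holo_on_compose(1)[OF hF R(2) im] N(2)] holo_on_compose(2)[OF hF R(2) im N(2)] by simp
 moreover have "((\<lambda>z. z) has_derivative (\<lambda>h. h)) (at (snd d q))" by (rule has_derivative_ident)
 then have "(R \<circ> ?F has_derivative (\<lambda>h. h)) (at (snd d q))"
  by (rule has_derivative_transform_within_open[OF _ N]) (use R(3) in simp)
 ultimately have "(*v) (Jac R (?F (snd d q)) ** Jac ?F (snd d q)) = (\<lambda>h. h)" by (rule has_derivative_unique)
 then have "Jac R (?F (snd d q)) *v (Jac ?F (snd d q) *v b) = b" by (metis matrix_vector_mul_assoc)
 then show False using 0 b by simp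
qed

lemma hermitian_posdefD:
 assumes "hermitian_posdef g" shows "hermitian g" "v \<noteq> 0 \<Longrightarrow> 0 < qf g v" "0 \<le> qf g v"
proof -
 show "hermitian g" using assms unfolding hermitian_posdef_def hermitian_def by blast
 show *: "0 < qf g v" if "v \<noteq> 0" using assms that unfolding hermitian_posdef_def hform_def by blast
 show "0 \<le> qf g v" using * by (cases "v = 0") auto
qed

lemma pullback_form_props:
 assumes X: "complex_manifold X A" and \<omega>: "kaehler_form A \<omega>" and d: "good_param A d"
 shows "q \<in> fst d \<Longrightarrow> hermitian (metr A \<omega> d q)"
  "q \<in> fst d \<Longrightarrow> v \<noteq> 0 \<Longrightarrow> 0 < qf (metr A \<omega> d q) v"
  "continuous_on (chart_image d) (\<lambda>z. metr A \<omega> d (chart_inv d z))"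
proof -
 have s: "smooth_form11 A \<omega>" using \<omega> by (simp add: kaehler_form_def)
 note eq = pullback_form_eq[OF X s d]
 have pd: "hermitian_posdef (\<omega> c q)" if "c \<in> A" "q \<in> fst c" for c q using \<omega> that by (simp add: kaehler_form_def)
 { assume q: "q \<in> fst d"
  obtain c where c: "c \<in> A" "q \<in> fst c" using d q unfolding good_param_def by auto
  show "hermitian (metr A \<omega> d q)" unfolding eq[OF c(1) q c(2)]
   by (rule hermitian_pullback[OF hermitian_posdefD(1)[OF pd[OF c]]])
  show "0 < qf (metr A \<omega> d q) v" if "v \<noteq> 0"
   unfolding eq[OF c(1) q c(2)] hform_pullback
   by (rule hermitian_posdefD(2)[OF pd[OF c] good_param_injective[OF d c(1) q c(2) that]]) }
 show "continuous_on (chart_image d) (\<lambda>z. metr A \<omega> d (chart_inv d z))"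
 proof (rule continuous_at_imp_continuous_on, rule ballI)
  fix z assume "z \<in> chart_image d"
  then obtain q where q: "q \<in> fst d" "z = snd d q" by auto
  obtain c where c: "c \<in> A" "q \<in> fst c" using d q unfolding good_param_def by auto
  have ch: "is_chart X c" using X c by (simp add: complex_manifold_def)
  let ?F = "snd c \<circ> chart_inv d" and ?N = "snd d ` (fst d \<inter> fst c)"
  have N: "open ?N" "z \<in> ?N" and hF: "holo_on ?F ?N" using d c q unfolding good_param_def by auto
  have cw: "continuous_on (chart_image c) (\<lambda>z. \<omega> c (chart_inv c z) $ j $ k)" for j k
   using s c(1) Ck_on.simps(1)[of "\<lambda>z. \<omega> c (chart_inv c z) $ j $ k" "chart_image c"]
   unfolding smooth_form11_def smooth_on_def by blast
  have cF: "continuous_on ?N (\<lambda>z. \<omega> c (chart_inv c (?F z)) $ j $ k)" for j k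
   by (rule continuous_on_compose2[OF cw holo_on_continuous[OF hF]]) (use good_paramD[OF d] in auto)
  have cJ: "continuous_on ?N (\<lambda>z. Jac ?F z $ j $ k)" for j k
   using Jac_continuous[OF hF N(1)] by (intro continuous_intros)
  have "continuous_on ?N (\<lambda>z. pullback_matrix (Jac ?F z) (\<omega> c (chart_inv c (?F z))))"
   unfolding pullback_matrix_def by (intro continuous_on_vec_lambda continuous_intros cF cJ)
  moreover have "metr A \<omega> d (chart_inv d y) = pullback_matrix (Jac ?F y) (\<omega> c (chart_inv c (?F y)))" if y: "y \<in> ?N" for y
  proof -
   obtain x where x: "x \<in> fst d" "x \<in> fst c" "y = snd d x" using y by blast
   then show ?thesis using eq[OF c(1) x(1,2)] good_paramD[OF d x(1)] chart_inj[OF ch] by simp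
  qed
  ultimately have "continuous_on ?N (\<lambda>z. metr A \<omega> d (chart_inv d z))"
   by (metis (no_types, lifting) continuous_on_cong)
  then show "isCont (\<lambda>z. metr A \<omega> d (chart_inv d z)) z"
   using continuous_on_eq_continuous_at[OF N(1)] N(2) by blast
 qed
qed

section \<open>Functions with positive \<open>t \<omega> + \<i>\<partial>\<partial>\<bar>v\<close>\<close>

text \<open>\<open>upsh A \<omega> t v p\<close> says that \<open>t \<omega> + \<i>\<partial>\<partial>\<bar>v \<ge> 0\<close> at \<open>p\<close>, up to an arbitrarily small error: in a chart, \<open>v\<close> plus any
 quadratic form \<open>H > t \<omega>(p)\<close> is plurisubharmonic near \<open>p\<close>. In contrast to positivity of currents this is
 visibly stable under maxima.\<close>

definition upsh :: "('a, 'n::finite) chart set \<Rightarrow> ('a, 'n) form11 \<Rightarrow> real \<Rightarrow> ('a \<Rightarrow> ereal) \<Rightarrow> 'a \<Rightarrow> bool" where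
 "upsh A \<omega> t v p \<longleftrightarrow> (\<forall>c\<in>A. p \<in> fst c \<longrightarrow> (\<forall>H. hermitian H \<and> (\<forall>b. b \<noteq> 0 \<longrightarrow> t * qf (\<omega> c p) b < qf H b) \<longrightarrow>
   (\<exists>T. open T \<and> snd c p \<in> T \<and> T \<subseteq> chart_image c \<and> psh_coord T (\<lambda>z. v (chart_inv c z) + ereal (qf H z)))))"

lemma upsh_cong:
 assumes X: "complex_manifold X A" and W: "openin X W" "p \<in> W" and eq: "\<And>x. x \<in> W \<Longrightarrow> v x = w x" and v: "upsh A \<omega> t v p"
 shows "upsh A \<omega> t w p"
 unfolding upsh_def
proof (intro ballI impI allI, elim conjE)
 fix c H assume c: "c \<in> A" "p \<in> fst c" and H: "hermitian H" "\<forall>b. b \<noteq> 0 \<longrightarrow> t * qf (\<omega> c p) b < qf H b"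
 have ch: "is_chart X c" using X c by (simp add: complex_manifold_def)
 obtain T where T: "open T" "snd c p \<in> T" "T \<subseteq> chart_image c" "psh_coord T (\<lambda>z. v (chart_inv c z) + ereal (qf H z))"
  using v c H unfolding upsh_def by blast
 let ?T = "T \<inter> snd c ` (fst c \<inter> W)"
 have o: "open ?T" by (intro open_Int T(1) chart_open_image[OF ch W(1)])
 have "psh_coord ?T (\<lambda>z. v (chart_inv c z) + ereal (qf H z))" by (rule psh_coord_subset[OF T(4) o T(1)]) simp
 then have "psh_coord ?T (\<lambda>z. w (chart_inv c z) + ereal (qf H z))"
 proof (rule psh_coord_cong[OF _ o])
  fix z assume "z \<in> ?T"
  then obtain x where "x \<in> fst c" "x \<in> W" "z = snd c x" by blast
  then show "v (chart_inv c z) + ereal (qf H z) = w (chart_inv c z) + ereal (qf H z)"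
   using eq chart_inj[OF ch] by simp
 qed
 then show "\<exists>T. open T \<and> snd c p \<in> T \<and> T \<subseteq> chart_image c \<and> psh_coord T (\<lambda>z. w (chart_inv c z) + ereal (qf H z))"
  using o T c W(2) by (intro exI[of _ ?T]) auto
qed

lemma upsh_max:
 assumes v: "upsh A \<omega> t v p" and w: "upsh A \<omega> t w p"
 shows "upsh A \<omega> t (\<lambda>x. max (v x) (w x)) p"
 unfolding upsh_def
proof (intro ballI impI allI)
 fix c H assume c: "c \<in> A" "p \<in> fst c" and H: "hermitian H \<and> (\<forall>y. y \<noteq> 0 \<longrightarrow> t * qf (\<omega> c p) y < qf H y)"
 obtain T where T: "open T" "snd c p \<in> T" "T \<subseteq> chart_image c" "psh_coord T (\<lambda>z. v (chart_inv c z) + ereal (qf H z))"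
  using v c H unfolding upsh_def by blast
 obtain T' where T': "open T'" "snd c p \<in> T'" "psh_coord T' (\<lambda>z. w (chart_inv c z) + ereal (qf H z))"
  using w c H unfolding upsh_def by blast
 have o: "open (T \<inter> T')" using T T' by auto
 have "psh_coord (T \<inter> T') (\<lambda>z. max (v (chart_inv c z) + ereal (qf H z)) (w (chart_inv c z) + ereal (qf H z)))"
  by (intro psh_coord_max psh_coord_subset[OF T(4) o T(1)] psh_coord_subset[OF T'(3) o T'(1)] o) auto
 moreover have "max (a + ereal r) (b + ereal r) = max a b + ereal r" for a b r by (cases a; cases b) (auto simp: max_def)
 ultimately show "\<exists>T. open T \<and> snd c p \<in> T \<and> T \<subseteq> chart_image c \<and>
   psh_coord T (\<lambda>z. max (v (chart_inv c z)) (w (chart_inv c z)) + ereal (qf H z))"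
  using o T T' by (intro exI[of _ "T \<inter> T'"]) auto
qed

text \<open>Allows \<open>upsh\<close> to be verified in a single chart \<open>d\<close>, possibly
  outside the atlas, and with a weight \<open>G\<close> that is not quadratic. In a chart of the
  atlas, v + H = (v + G) + (H - G): the first summand stays plurisubharmonic under the holomorphic
  transition, and the second has positive Levi form near the point.\<close>

lemma upsh_at:
 assumes X: "complex_manifold X A" and \<omega>: "kaehler_form A \<omega>" and d: "compatible_chart X A d"
  and T: "open T" "T \<subseteq> chart_image d" and q: "q \<in> fst d" "snd d q \<in> T"
  and u: "psh_coord T (\<lambda>z. v (chart_inv d z) + ereal (G z))" and L: "has_levi T G P L"
  and lt: "\<And>y. y \<noteq> 0 \<Longrightarrow> qf (L (snd d q)) y < t * qf (metr A \<omega> d q) y"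
 shows "upsh A \<omega> t v q"
 unfolding upsh_def
proof (intro ballI impI allI, elim conjE)
 fix c H assume c: "c \<in> A" "q \<in> fst c" and H: "hermitian H" "\<forall>y. y \<noteq> 0 \<longrightarrow> t * qf (\<omega> c q) y < qf H y"
 have ch: "is_chart X c" using X c by (simp add: complex_manifold_def)
 have cd: "is_chart X d" using d by (simp add: compatible_chart_def)
 have gd: "good_param A d" by (rule good_param_compatible[OF X d])
 have s: "smooth_form11 A \<omega>" using \<omega> by (simp add: kaehler_form_def)
 let ?tr = "snd d \<circ> chart_inv c" and ?N = "snd c ` (fst c \<inter> fst d)" and ?z = "snd c q"
 let ?F = "snd c \<circ> chart_inv d" and ?M = "snd d ` (fst d \<inter> fst c)"
 have N: "open ?N" using cd by (intro chart_open_image[OF ch]) (simp add: is_chart_def)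
 have zN: "?z \<in> ?N" using c q by auto
 have htr: "holo_on ?tr ?N" and hF: "holo_on ?F ?M" using d c by (auto simp: compatible_chart_def holo_transition_def)
 have inv: "x \<in> fst c \<Longrightarrow> chart_inv c (snd c x) = x" "x \<in> fst d \<Longrightarrow> chart_inv d (snd d x) = x" for x
  using chart_inj[OF ch] chart_inj[OF cd] by auto
 have trM: "?tr ` ?N \<subseteq> ?M" using inv by auto
 define J where "J = Jac ?tr ?z"
 define JF where "JF = Jac ?F (snd d q)"
 have "(?F \<circ> ?tr has_derivative (*v) (JF ** J)) (at ?z)"
  using holo_on_Jac[OF holo_on_compose(1)[OF htr hF trM] zN] holo_on_compose(2)[OF htr hF trM zN] inv(1)[OF c(2)]
  by (simp add: J_def JF_def)
 moreover have "(?F \<circ> ?tr has_derivative (\<lambda>h. h)) (at ?z)"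
  by (rule has_derivative_transform_within_open[OF has_derivative_ident N zN]) (use inv in auto)
 ultimately have "(*v) (JF ** J) = (\<lambda>h. h)" by (rule has_derivative_unique)
 \<comment> \<open>The transition is invertible, so nonzero vectors stay nonzero and the strict
   inequality \<open>lt\<close> can be transported.\<close>
 then have JJ: "JF *v (J *v y) = y" for y by (metis matrix_vector_mul_assoc)
 have \<Omega>: "hform (metr A \<omega> d q) (J *v y) = hform (\<omega> c q) y" for y
  unfolding pullback_form_eq[OF X s gd c(1) q(1) c(2)] hform_pullback JF_def[symmetric] JJ ..
 define T' where "T' = ?N \<inter> ?tr -` T"
 have T': "open T'" unfolding T'_def by (rule continuous_open_preimage[OF holo_on_continuous[OF htr] N T(1)])
 have zT': "?z \<in> T'" unfolding T'_def using zN q inv(1)[OF c(2)] by simp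
 have htr': "holo_on ?tr T'" by (rule holo_on_subset[OF htr]) (simp add: T'_def)
 have im: "?tr ` T' \<subseteq> T" by (auto simp: T'_def)
 have u': "psh_coord T' (\<lambda>z. v (chart_inv d (?tr z)) + ereal (G (?tr z)))" by (rule psh_coord_compose[OF u T(1) htr' T' im])
 have L': "has_levi T' (\<lambda>z. G (?tr z)) (\<lambda>z. transpose (Jac ?tr z) *v P (?tr z)) (\<lambda>z. pullback_matrix (Jac ?tr z) (L (?tr z)))"
  by (rule has_levi_compose[OF L htr' T' im])
 note LQ = has_levi_add[OF has_levi_quad[OF H(1), of T'] has_levi_uminus[OF L']]
 obtain r where r: "r > 0" "ball ?z r \<subseteq> T'" "\<And>z y. z \<in> ball ?z r \<Longrightarrow> y \<noteq> 0 \<Longrightarrow> 0 < qf (H + - pullback_matrix (Jac ?tr z) (L (?tr z))) y"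
 proof (rule hform_pos_open[OF _ T' zT'])
  show "continuous_on T' (\<lambda>z. H + - pullback_matrix (Jac ?tr z) (L (?tr z)))" using LQ by (simp add: has_levi_def)
  fix y :: "complex^'b" assume y: "y \<noteq> 0"
  then have "J *v y \<noteq> 0" using JJ[of y] by auto
  from lt[OF this] H(2) y have "qf (L (snd d q)) (J *v y) < qf H y" by (auto simp: \<Omega>)
  then show "0 < qf (H + - pullback_matrix (Jac ?tr ?z) (L (?tr ?z))) y"
   using inv(1)[OF c(2)] by (simp add: hform_diff hform_pullback J_def)
 qed (rule that; assumption)
 have "psh_coord (ball ?z r) (\<lambda>z. (v (chart_inv d (?tr z)) + ereal (G (?tr z))) + ereal (qf H z + - G (?tr z)))"
 proof (rule psh_coord_add_levi[OF psh_coord_subset[OF u' open_ball T' r(2)] open_ball has_levi_subset[OF LQ r(2)]])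
  show "0 \<le> qf (H + - pullback_matrix (Jac ?tr z) (L (?tr z))) w" if "z \<in> ball ?z r" for z w
   using r(3)[OF that, of w] by (cases "w = 0") auto
 qed
 then have "psh_coord (ball ?z r) (\<lambda>z. v (chart_inv c z) + ereal (qf H z))"
 proof (rule psh_coord_cong[OF _ open_ball])
  fix z assume "z \<in> ball ?z r"
  then have "z \<in> ?N" using r(2) by (auto simp: T'_def)
  then obtain x where "x \<in> fst c" "x \<in> fst d" "z = snd c x" by blast
  then have "chart_inv d (?tr z) = chart_inv c z" using inv by simp
  then show "(v (chart_inv d (?tr z)) + ereal (G (?tr z))) + ereal (qf H z + - G (?tr z)) = v (chart_inv c z) + ereal (qf H z)"
   by (cases "v (chart_inv c z)") auto
 qed
 then show "\<exists>T. open T \<and> ?z \<in> T \<and> T \<subseteq> chart_image c \<and> psh_coord T (\<lambda>z. v (chart_inv c z) + ereal (qf H z))"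
  using r by (intro exI[of _ "ball ?z r"]) (auto simp: T'_def)
qed

text \<open>\<open>lt\<close> is a strict inequality between continuous coefficients, hence an open
  condition; the same weight \<open>G\<close> then serves at all points near
  \<open>q\<close>.\<close>

lemma upsh_near:
 assumes X: "complex_manifold X A" and \<omega>: "kaehler_form A \<omega>" and d: "compatible_chart X A d"
  and T: "open T" "T \<subseteq> chart_image d" and q: "q \<in> fst d" "snd d q \<in> T"
  and u: "psh_coord T (\<lambda>z. v (chart_inv d z) + ereal (G z))" and L: "has_levi T G P L"
  and lt: "\<And>b. b \<noteq> 0 \<Longrightarrow> qf (L (snd d q)) b < t * qf (metr A \<omega> d q) b"
 shows "\<exists>W. openin X W \<and> q \<in> W \<and> W \<subseteq> fst d \<and> (\<forall>x\<in>W. upsh A \<omega> t v x)"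
proof -
 have cd: "is_chart X d" using d by (simp add: compatible_chart_def)
 have inv: "x \<in> fst d \<Longrightarrow> chart_inv d (snd d x) = x" for x using chart_inj[OF cd] by auto
 let ?a = "\<lambda>z. t *\<^sub>R metr A \<omega> d (chart_inv d z) - L z"
 obtain r where r: "r > 0" "ball (snd d q) r \<subseteq> T" "\<And>z b. z \<in> ball (snd d q) r \<Longrightarrow> b \<noteq> 0 \<Longrightarrow> 0 < qf (?a z) b"
 proof (rule hform_pos_open[OF _ T(1) q(2)])
  show "continuous_on T ?a"
   using L T(2) by (intro continuous_intros continuous_on_subset[OF pullback_form_props(3)[OF X \<omega> good_param_compatible[OF X d]]])
    (auto simp: has_levi_def)
 qed (use lt inv[OF q(1)] in \<open>auto simp: hform_diff hform_scaleR\<close>)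
 let ?W = "{x \<in> fst d. snd d x \<in> ball (snd d q) r}"
 have "upsh A \<omega> t v x" if x: "x \<in> ?W" for x
 proof (rule upsh_at[OF X \<omega> d T _ _ u L])
  show "x \<in> fst d" "snd d x \<in> T" using x r(2) by auto
  show "qf (L (snd d x)) b < t * qf (metr A \<omega> d x) b" if "b \<noteq> 0" for b
   using r(3)[OF _ that, of "snd d x"] x inv[of x] by (simp add: hform_diff hform_scaleR)
 qed
 moreover have "openin X ?W" by (rule chart_open_preimage[OF cd open_ball])
 ultimately show ?thesis using q(1) r(1) by (intro exI[of _ ?W]) auto
qed

section \<open>The value of a current on a test function\<close>

lemma sum_integral_hform:
 assumes i: "\<And>j k. set_integrable lborel S (\<lambda>z. m z $ j $ k * b z)"
 shows "(\<Sum>j\<in>UNIV. \<Sum>k\<in>UNIV. (LINT z:S|lborel. m z $ j $ k * b z) * v $ j * cnj (v $ k)) = (LINT z:S|lborel. hform (m z) v * b z)"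
proof -
 have i': "integrable lborel (\<lambda>z. indicator S z *\<^sub>R (m z $ j $ k * b z) * (v $ j * cnj (v $ k)))" for j k
  using i[of j k] unfolding set_integrable_def by (intro integrable_mult_left)
 have "(LINT z:S|lborel. hform (m z) v * b z) = (\<integral>\<^sub>Lz. (\<Sum>j\<in>UNIV. \<Sum>k\<in>UNIV. indicator S z *\<^sub>R (m z $ j $ k * b z) * (v $ j * cnj (v $ k))))"
  unfolding set_lebesgue_integral_def hform_def
  by (intro Bochner_Integration.integral_cong refl) (simp add: sum_distrib_left sum_distrib_right scaleR_sum_right mult_ac)
 also have "\<dots> = (\<Sum>j\<in>UNIV. \<Sum>k\<in>UNIV. (\<integral>\<^sub>Lz. indicator S z *\<^sub>R (m z $ j $ k * b z) * (v $ j * cnj (v $ k))))"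
  by (simp only: Bochner_Integration.integral_sum[OF Bochner_Integration.integrable_sum[OF i']] Bochner_Integration.integral_sum[OF i'])
 also have "\<dots> = (\<Sum>j\<in>UNIV. \<Sum>k\<in>UNIV. (LINT z:S|lborel. m z $ j $ k * b z) * (v $ j * cnj (v $ k)))"
  unfolding set_lebesgue_integral_def using i unfolding set_integrable_def by (intro sum.cong refl Bochner_Integration.integral_mult_left)
 finally show ?thesis by (simp add: mult.assoc)
qed

lemma wirtinger_zero:
 assumes "open W" "z \<in> W" "\<And>y. y \<in> W \<Longrightarrow> f y = 0"
 shows "wirtinger j f z = 0" "wirtinger_bar j f z = 0"
proof -
 have "(f has_derivative (\<lambda>h. 0)) (at z)"
  by (rule has_derivative_transform_within_open[OF has_derivative_const[of 0] assms(1,2)]) (simp add: assms(3))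
 then have "frechet_derivative f (at z) = (\<lambda>h. 0)" by (rule frechet_derivative_at[symmetric])
 then show "wirtinger j f z = 0" "wirtinger_bar j f z = 0" by (simp_all add: wirtinger_def wirtinger_bar_def)
qed

text \<open>Both coefficient matrices have real quadratic forms, that of \<omega> by hermitian
  symmetry and the Hessian of \<open>h\<close> by \<open>has_levi_real\<close>; so the complex
  pairing reduces to real integrals.\<close>

lemma current_value:
 fixes c :: "('a, 'm::finite) chart"
 assumes S: "open (chart_image c)" and h: "smooth_on h UNIV" "\<And>z. h z \<in> \<real>"
  and K: "compact K" "K \<subseteq> chart_image c" "\<And>z. z \<notin> K \<Longrightarrow> h z = 0"
  and \<phi>: "set_integrable lborel K (\<lambda>z. real_of_ereal (\<phi> (chart_inv c z)))"
  and \<omega>: "continuous_on (chart_image c) (\<lambda>z. \<omega> c (chart_inv c z))" "\<And>q. q \<in> fst c \<Longrightarrow> hermitian (\<omega> c q)"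
 shows "(\<Sum>j\<in>UNIV. \<Sum>k\<in>UNIV. current_add (current_add (current_of_form \<omega>) (i_ddbar \<phi>))
    (current_scale (-1) (current_scale \<epsilon> (current_of_form \<omega>))) c j k h * v $ j * cnj (v $ k))
  = of_real ((LINT z:chart_image c|lborel. real_of_ereal (\<phi> (chart_inv c z)) * qf (hess h z) v)
   + (LINT z:chart_image c|lborel. qf ((1 - \<epsilon>) *\<^sub>R \<omega> c (chart_inv c z)) v * Re (h z)))"
proof -
 let ?S = "chart_image c" and ?w = "\<lambda>z. \<omega> c (chart_inv c z)" and ?M = "\<lambda>z. (hess h z)"
  and ?f = "\<lambda>z. real_of_ereal (\<phi> (chart_inv c z))"
 have Ck: "Ck_on m h UNIV" for m using h(1) by (simp add: smooth_on_def)
 have i1: "set_integrable lborel ?S (\<lambda>z. ?w z $ j $ k * h z)" for j k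
 proof -
  have "integrable lborel (\<lambda>z. indicator K z *\<^sub>R (?w z $ j $ k * h z))"
   using Ck[of 0] by (intro borel_integrable_compact K(1) continuous_intros continuous_on_subset[OF \<omega>(1) K(2)])
    (auto intro: continuous_on_subset)
  moreover have "indicator K z *\<^sub>R (?w z $ j $ k * h z) = indicator ?S z *\<^sub>R (?w z $ j $ k * h z)" for z
   using K(2) K(3)[of z] by (auto simp: indicator_def)
  ultimately show ?thesis unfolding set_integrable_def by (simp only:)
 qed
 have M0: "wirtinger j (wirtinger_bar k h) z = 0" if z: "z \<notin> K" for j k z
 proof -
  have o: "open (- K)" using compact_imp_closed[OF K(1)] by auto
  have "wirtinger_bar k h y = 0" if "y \<in> - K" for y by (rule wirtinger_zero(2)[OF o that]) (use K(3) in auto)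
  from wirtinger_zero(1)[OF o _ this] z show ?thesis by auto
 qed
 have cM: "continuous_on UNIV (wirtinger j (wirtinger_bar k h))" for j k
  using wirtinger_Ck(1)[OF wirtinger_Ck(2)[OF Ck[of "Suc (Suc 0)"] open_UNIV] open_UNIV, of j k] by simp
 have i2: "set_integrable lborel ?S (\<lambda>z. ?M z $ j $ k * of_real (?f z))" for j k
 proof -
  obtain C where C: "\<And>z. norm (wirtinger j (wirtinger_bar k h) z) \<le> C"
   using compact_support_uniformly_continuous(2)[OF cM K(1) M0] by blast
  have "integrable lborel (\<lambda>z. (indicator K z *\<^sub>R ?f z) *\<^sub>R wirtinger j (wirtinger_bar k h) z)"
   using \<phi> unfolding set_integrable_def by (rule integrable_mult_bounded[OF _ borel_measurable_continuous_onI[OF cM] C])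
  moreover have "(indicator K z *\<^sub>R ?f z) *\<^sub>R wirtinger j (wirtinger_bar k h) z = indicator ?S z *\<^sub>R (?M z $ j $ k * of_real (?f z))" for z
   using K(2) M0[of z j k] by (auto simp: indicator_def scaleR_conv_of_real)
  ultimately show ?thesis unfolding set_integrable_def by (simp only:)
 qed
 obtain P L where L: "has_levi UNIV (\<lambda>y. Re (h y)) P L" "\<And>z w. hform (?M z) w = hform (L z) w"
  using test_has_levi[of h, OF Ck h(2)] by blast
 have Mr: "hform (?M z) v = of_real (qf (?M z) v)" for z
  using has_levi_real[OF L(1) open_UNIV UNIV_I, of z v] by (simp add: L(2) complex_eq_iff)
 have hr: "h z = of_real (Re (h z))" for z using h(2)[of z] by (simp add: complex_is_Real_iff complex_eq_iff)
 have 1: "(LINT z:?S|lborel. hform (?w z) v * h z) = of_real (LINT z:?S|lborel. qf (?w z) v * Re (h z))"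
 proof -
  have "indicator ?S z *\<^sub>R (hform (?w z) v * h z) = complex_of_real (indicator ?S z *\<^sub>R (qf (?w z) v * Re (h z)))" for z
  proof (cases "z \<in> ?S")
   case True
   then have "hermitian (?w z)" by (intro \<omega>(2) inv_into_into)
   then have "hform (?w z) v = of_real (qf (?w z) v)" using hermitian_hform_real by (simp add: complex_eq_iff)
   then show ?thesis using hr[of z] True by (metis indicator_simps(1) of_real_mult scaleR_one)
  qed simp
  then show ?thesis unfolding set_lebesgue_integral_def by (simp only: integral_complex_of_real)
 qed
 have 2: "(LINT z:?S|lborel. hform (?M z) v * of_real (?f z)) = of_real (LINT z:?S|lborel. ?f z * qf (?M z) v)"
 proof -
  have "indicator ?S z *\<^sub>R (hform (?M z) v * of_real (?f z)) = complex_of_real (indicator ?S z *\<^sub>R (?f z * qf (?M z) v))" for z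
   by (subst Mr) (simp add: scaleR_conv_of_real mult_ac)
  then show ?thesis unfolding set_lebesgue_integral_def by (simp only: integral_complex_of_real)
 qed
 have "(\<Sum>j\<in>UNIV. \<Sum>k\<in>UNIV. current_add (current_add (current_of_form \<omega>) (i_ddbar \<phi>))
    (current_scale (-1) (current_scale \<epsilon> (current_of_form \<omega>))) c j k h * v $ j * cnj (v $ k))
  = (\<Sum>j\<in>UNIV. \<Sum>k\<in>UNIV. of_real (1 - \<epsilon>) * ((LINT z:?S|lborel. ?w z $ j $ k * h z) * v $ j * cnj (v $ k))
    + (LINT z:?S|lborel. ?M z $ j $ k * of_real (?f z)) * v $ j * cnj (v $ k))"
  unfolding current_add_def current_scale_def current_of_form_def i_ddbar_def
  by (intro sum.cong refl) (simp add: algebra_simps)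
 also have "\<dots> = of_real (1 - \<epsilon>) * (LINT z:?S|lborel. hform (?w z) v * h z) + (LINT z:?S|lborel. hform (?M z) v * of_real (?f z))"
  unfolding sum.distrib sum_distrib_left[symmetric] sum_integral_hform[OF i1] sum_integral_hform[OF i2] ..
 also have "\<dots> = of_real ((LINT z:?S|lborel. ?f z * qf (?M z) v) + (1 - \<epsilon>) * (LINT z:?S|lborel. qf (?w z) v * Re (h z)))"
  unfolding 1 2 by simp
 also have "(1 - \<epsilon>) * (LINT z:?S|lborel. qf (?w z) v * Re (h z)) = (LINT z:?S|lborel. qf ((1 - \<epsilon>) *\<^sub>R ?w z) v * Re (h z))"
  by (simp add: hform_scaleR mult.assoc)
 finally show ?thesis .
qed

text \<open>The final \<epsilon> is 1 - t. Locally v = (v + H) - H with H = \<omega>(p), which is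
  admissible because t < 1. This gives quasi-plurisubharmonicity, and with it the density of finite
  values that \<open>current_of_psh\<close>, applied with g = t \<omega>, requires.\<close>

lemma upsh_final:
 assumes X: "complex_manifold X A" and \<omega>: "kaehler_form A \<omega>" and t: "0 \<le> t" "t < 1"
  and v: "\<And>p. p \<in> topspace X \<Longrightarrow> upsh A \<omega> t v p"
  and comp: "\<And>C. C \<in> connected_components_of X \<Longrightarrow> \<exists>x\<in>C. v x \<noteq> -\<infinity>"
 shows "quasi_psh X A v \<and> (\<exists>\<epsilon>>0. current_ge A (current_add (current_of_form \<omega>) (i_ddbar v)) (current_scale \<epsilon> (current_of_form \<omega>)))"
proof -
 have ch: "is_chart X c" if "c \<in> A" for c using X that by (simp add: complex_manifold_def)
 have cov: "topspace X \<subseteq> \<Union> (fst ` A)" using X by (simp add: complex_manifold_def)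
 have s: "smooth_form11 A \<omega>" using \<omega> by (simp add: kaehler_form_def)
 have pd: "hermitian_posdef (\<omega> c q)" if "c \<in> A" "q \<in> fst c" for c q using \<omega> that by (simp add: kaehler_form_def)
 have sub: "fst c \<subseteq> topspace X" if "c \<in> A" for c using ch[OF that] openin_subset by (auto simp: is_chart_def)
 have ex: "\<exists>H T. hermitian H \<and> open T \<and> snd c p \<in> T \<and> T \<subseteq> chart_image c \<and> psh_coord T (\<lambda>z. v (chart_inv c z) + ereal (qf H z))"
  if c: "c \<in> A" "p \<in> fst c" for c p
 proof -
  have "t * qf (\<omega> c p) b < qf (\<omega> c p) b" if "b \<noteq> 0" for b
   using hermitian_posdefD(2)[OF pd[OF c] that] t(2) by simp
  then show ?thesis using v[of p] c sub hermitian_posdefD(1)[OF pd[OF c]] unfolding upsh_def by blast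
 qed
 have qp: "quasi_psh X A v" unfolding quasi_psh_def
 proof (intro conjI ballI)
  fix p assume p: "p \<in> topspace X"
  obtain c where c: "c \<in> A" "p \<in> fst c" using cov p by auto
  obtain H T where H: "hermitian H" and T: "open T" "snd c p \<in> T" "T \<subseteq> chart_image c"
   and psh: "psh_coord T (\<lambda>z. v (chart_inv c z) + ereal (qf H z))" using ex[OF c] by blast
  have inv: "chart_inv c (snd c x) = x" if "x \<in> fst c" for x using chart_inj[OF ch[OF c(1)]] that by simp
  show "v p < \<infinity>" using psh_coord_less_top[OF psh T(2)] inv[OF c(2)] by (cases "v p") auto
  define W where "W = {x \<in> fst c. snd c x \<in> T}"
  define u where "u x = v x + ereal (qf H (snd c x))" for x
  define f where "f x = - qf H (snd c x)" for x
  have W: "openin X W" unfolding W_def by (rule chart_open_preimage[OF ch[OF c(1)] T(1)])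
  have main: "open (snd d ` (fst d \<inter> W)) \<and> holo_on (snd c \<circ> chart_inv d) (snd d ` (fst d \<inter> W)) \<and>
    (\<forall>x\<in>fst d \<inter> W. chart_inv d (snd d x) = x)" if d: "d \<in> A" for d
  proof (intro conjI ballI)
   show "open (snd d ` (fst d \<inter> W))" by (rule chart_open_image[OF ch[OF d] W])
   have "holo_on (snd c \<circ> chart_inv d) (snd d ` (fst d \<inter> fst c))"
    using X c d unfolding complex_manifold_def holo_transition_def by blast
   then show "holo_on (snd c \<circ> chart_inv d) (snd d ` (fst d \<inter> W))" by (rule holo_on_subset) (auto simp: W_def)
   show "chart_inv d (snd d x) = x" if "x \<in> fst d \<inter> W" for x using chart_inj[OF ch[OF d]] that by simp
  qed
  have "psh_on A W u" unfolding psh_on_def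
  proof
   fix d assume d: "d \<in> A"
   let ?N = "snd d ` (fst d \<inter> W)"
   have N: "open ?N" and hol: "holo_on (snd c \<circ> chart_inv d) ?N" and id: "\<And>x. x \<in> fst d \<inter> W \<Longrightarrow> chart_inv d (snd d x) = x"
    using main[OF d] by blast+
   have im: "(snd c \<circ> chart_inv d) ` ?N \<subseteq> T" using id by (auto simp: W_def)
   show "psh_coord ?N (u \<circ> chart_inv d)"
    by (rule psh_coord_cong[OF psh_coord_compose[OF psh T(1) hol N im] N])
     (use id inv in \<open>auto simp: u_def W_def\<close>)
  qed
  moreover have "smooth_function_on A W f" unfolding smooth_function_on_def smooth_on_def
  proof (intro ballI allI)
   fix d m assume d: "d \<in> A"
   let ?N = "snd d ` (fst d \<inter> W)" and ?F = "snd c \<circ> chart_inv d"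
   have N: "open ?N" and hol: "holo_on ?F ?N" using main[OF d] by blast+
   have F: "Ck_on m (\<lambda>z. ?F z $ l) ?N" for l using hol hol_fun_Ck[OF N] by (simp add: holo_on_iff)
   have "Ck_on m (\<lambda>z. \<Sum>j\<in>UNIV. \<Sum>k\<in>UNIV. H $ j $ k * ?F z $ j * cnj (?F z $ k)) ?N"
    by (intro Ck_on_sum N Ck_on_bilinear[OF bounded_bilinear_mult] Ck_on_const F Ck_on_compose_linear[OF bounded_linear_cnj])
   from Ck_on_compose_linear[OF bounded_linear_minus[OF bounded_linear_Re] N this]
   show "Ck_on m (f \<circ> chart_inv d) ?N" by (simp add: f_def[abs_def] hform_def o_def)
  qed
  moreover have "v x = u x + ereal (f x)" for x by (cases "v x") (auto simp: u_def f_def)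
  ultimately show "\<exists>W u f. openin X W \<and> p \<in> W \<and> psh_on A W u \<and> smooth_function_on A W f \<and> (\<forall>x\<in>W. v x = u x + ereal (f x))"
   using W c T(2) by (intro exI[of _ W] exI[of _ u] exI[of _ f]) (auto simp: W_def)
 qed (use comp in auto)
 have "current_ge A (current_add (current_of_form \<omega>) (i_ddbar v)) (current_scale (1 - t) (current_of_form \<omega>))"
  unfolding current_ge_def positive_current_def
 proof (intro ballI allI impI, elim conjE)
  fix c h b assume c: "c \<in> A" and h: "test_function (chart_image c) h" "\<forall>z. h z \<in> \<real>\<^sub>\<ge>\<^sub>0"
  let ?S = "chart_image c" and ?\<phi> = "\<lambda>z. v (chart_inv c z)" and ?g = "\<lambda>z. t *\<^sub>R \<omega> c (chart_inv c z)"
  obtain K where K: "smooth_on h UNIV" "compact K" "K \<subseteq> ?S" "\<And>z. z \<notin> K \<Longrightarrow> h z = 0" using h(1) unfolding test_function_def by blast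
  have S: "open ?S" using ch[OF c] by (simp add: is_chart_def)
  have inv: "chart_inv c (snd c x) = x" if "x \<in> fst c" for x using chart_inj[OF ch[OF c]] that by simp
  have iS: "chart_inv c z \<in> fst c \<and> snd c (chart_inv c z) = z" if "z \<in> ?S" for z using inv_into_into[OF that] f_inv_into_f[OF that] by simp
  have cw: "continuous_on ?S (\<lambda>z. \<omega> c (chart_inv c z))"
  proof -
   have "continuous_on ?S (\<lambda>z. \<omega> c (chart_inv c z) $ j $ k)" for j k
    using s c Ck_on.simps(1)[of "\<lambda>z. \<omega> c (chart_inv c z) $ j $ k" ?S] unfolding smooth_form11_def smooth_on_def by blast
   then have "continuous_on ?S (\<lambda>z. \<chi> j k. \<omega> c (chart_inv c z) $ j $ k)" by (intro continuous_on_vec_lambda)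
   then show ?thesis by simp
  qed
  have dense: "\<exists>q\<in>?S. dist p q < e \<and> ?\<phi> q \<noteq> -\<infinity>" if p: "p \<in> ?S" and e: "e > 0" for p e
  proof -
   let ?W = "{x \<in> fst c. snd c x \<in> ball p e}"
   have "\<exists>q\<in>?W. v q \<noteq> -\<infinity>"
   proof (rule quasi_psh_dense[where p="chart_inv c p", OF _ cov qp chart_open_preimage[OF ch[OF c] open_ball]])
    show "chart_inv c p \<in> ?W" using iS[OF p] e by simp
   qed (rule ch)
   then obtain q where "q \<in> fst c" "snd c q \<in> ball p e" "v q \<noteq> -\<infinity>" by blast
   then show ?thesis using inv by (intro bexI[of _ "snd c q"]) auto
  qed
  have loc: "\<exists>T. open T \<and> p \<in> T \<and> T \<subseteq> ?S \<and> psh_coord T (\<lambda>z. ?\<phi> z + ereal (qf H z))"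
   if p: "p \<in> ?S" and H: "hermitian H" "\<And>b. b \<noteq> 0 \<Longrightarrow> qf (?g p) b < qf H b" for p H
  proof -
   have "chart_inv c p \<in> fst c" and e: "snd c (chart_inv c p) = p" using iS[OF p] by auto
   moreover have "upsh A \<omega> t v (chart_inv c p)" using v sub[OF c] \<open>chart_inv c p \<in> fst c\<close> by blast
   moreover have "\<forall>b. b \<noteq> 0 \<longrightarrow> t * qf (\<omega> c (chart_inv c p)) b < qf H b" using H(2) by (simp add: hform_scaleR)
   ultimately have "\<exists>T. open T \<and> snd c (chart_inv c p) \<in> T \<and> T \<subseteq> ?S \<and> psh_coord T (\<lambda>z. ?\<phi> z + ereal (qf H z))"
    using c H(1) unfolding upsh_def by blast
   then show ?thesis unfolding e .
  qed
  have g: "continuous_on ?S ?g" "\<And>z. z \<in> ?S \<Longrightarrow> hermitian (?g z)" "\<And>z b. z \<in> ?S \<Longrightarrow> 0 \<le> qf (?g z) b"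
   using iS hermitian_posdefD(1,3)[OF pd[OF c]] t(1) by (auto intro!: continuous_intros cw hermitian_simps simp: hform_scaleR)
  have loc2: "\<exists>T f. open T \<and> p \<in> T \<and> T \<subseteq> ?S \<and> continuous_on T (f :: _ \<Rightarrow> real) \<and> psh_coord T (\<lambda>z. ?\<phi> z + ereal (f z))" if p: "p \<in> ?S" for p
  proof -
   obtain H T where "open T" "p \<in> T" "T \<subseteq> ?S" "psh_coord T (\<lambda>z. ?\<phi> z + ereal (qf H z))"
    using ex[OF c, of "chart_inv c p"] iS[OF p] by auto
   then show ?thesis by (intro exI[of _ T] exI[of _ "\<lambda>z. qf H z"]) (auto intro!: continuous_intros)
  qed
  have si: "set_integrable lborel K (\<lambda>z. real_of_ereal (?\<phi> z))"
   by (rule qpsh_integrable(1)[where S="?S"]; (rule loc2 dense K(2,3); assumption?))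
  have hr: "h z \<in> \<real>" for z using h(2) nonneg_Reals_subset_Reals by blast
  have hw: "hermitian (\<omega> c q)" if "q \<in> fst c" for q by (rule hermitian_posdefD(1)[OF pd[OF c that]])
  have tt: "1 - (1 - t) = t" by simp
  note val = current_value[where \<phi>=v and \<omega>=\<omega> and c=c and K=K and h=h and \<epsilon>="1 - t" and v=b, OF S K(1) hr K(2-4) si cw hw, unfolded tt]
  have "0 \<le> (LINT z:?S|lborel. real_of_ereal (?\<phi> z) * qf (hess h z) b)
    + (LINT z:?S|lborel. qf (?g z) b * Re (h z))"
   by (rule current_of_psh[OF S K(1) _ K(2-4) g loc dense]) (use h in auto)
  then have "complex_of_real ((LINT z:?S|lborel. real_of_ereal (?\<phi> z) * qf (hess h z) b)
    + (LINT z:?S|lborel. qf (?g z) b * Re (h z))) \<in> \<real>\<^sub>\<ge>\<^sub>0"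
   by (simp only: nonneg_Reals_of_real_iff)
  then show "(\<Sum>j\<in>UNIV. \<Sum>k\<in>UNIV. current_add (current_add (current_of_form \<omega>) (i_ddbar v))
    (current_scale (-1) (current_scale (1 - t) (current_of_form \<omega>))) c j k h * b $ j * cnj (b $ k)) \<in> \<real>\<^sub>\<ge>\<^sub>0"

   by (subst val)
 qed
 with qp t(2) show ?thesis by (intro conjI exI[of _ "1 - t"]) auto
qed

section \<open>The submanifold\<close>

definition prj :: "('k::finite \<Rightarrow> 'n) \<Rightarrow> complex^'n::finite \<Rightarrow> complex^'k" where "prj \<iota> z = (\<chi> j. z $ \<iota> j)"

definition emb :: "('k::finite \<Rightarrow> 'n) \<Rightarrow> complex^'k \<Rightarrow> complex^'n::finite" where
 "emb \<iota> w = (\<chi> i. if i \<in> range \<iota> then w $ (inv \<iota> i) else 0)"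

definition vchart :: "'a set \<Rightarrow> ('k::finite \<Rightarrow> 'n) \<Rightarrow> ('a, 'n::finite) chart \<Rightarrow> ('a, 'k) chart" where
 "vchart V \<iota> d = (fst d \<inter> V, \<lambda>x. prj \<iota> (snd d x))"

lemma prj_emb: "inj \<iota> \<Longrightarrow> prj \<iota> (emb \<iota> w) = w"
 by (simp add: prj_def emb_def vec_eq_iff)

lemma emb_prj: "inj \<iota> \<Longrightarrow> (\<And>i. i \<notin> range \<iota> \<Longrightarrow> z $ i = 0) \<Longrightarrow> emb \<iota> (prj \<iota> z) = z"
 by (auto simp: prj_def emb_def vec_eq_iff f_inv_into_f)

lemma emb_linear: "bounded_linear (emb \<iota>)" "emb \<iota> (c *s w) = c *s emb \<iota> w"
 by (intro linear_conv_bounded_linear[THEN iffD1] linearI) (simp_all add: emb_def vec_eq_iff)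

lemma prj_linear: "bounded_linear (prj \<iota>)" "prj \<iota> (c *s w) = c *s prj \<iota> w"
 by (intro linear_conv_bounded_linear[THEN iffD1] linearI) (simp_all add: prj_def vec_eq_iff)

lemma holo_on_linear: "bounded_linear f \<Longrightarrow> (\<And>c w. f (c *s w) = c *s f w) \<Longrightarrow> holo_on f S"
 unfolding holo_on_def by (blast intro: bounded_linear_imp_has_derivative)

lemma Jac_linear: "bounded_linear f \<Longrightarrow> (\<And>c w. f (c *s w) = c *s f w) \<Longrightarrow> Jac f z *v h = f h"
proof -
 assume f: "bounded_linear f" "\<And>c w. f (c *s w) = c *s f w"
 have "(f has_derivative (*v) (Jac f z)) (at z)" using holo_on_Jac[OF holo_on_linear[OF f] UNIV_I] by simp
 from has_derivative_unique[OF this bounded_linear_imp_has_derivative[OF f(1)]] show ?thesis by metis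
qed

text \<open>\<open>d\<close> is a chart of \<open>X\<close> adapted to \<open>V\<close>, and
  \<open>e\<close> will be the chart of \<open>V\<close> that it induces. The linear maps
  \<open>prj\<close> and \<open>emb\<close> pass between the two, so all properties of
  \<open>e\<close> are inherited from \<open>d\<close>.\<close>

locale adapted =
 fixes X :: "'a topology" and A :: "('a, 'n::finite) chart set" and V :: "'a set" and \<iota> :: "'k::finite \<Rightarrow> 'n" and d :: "('a, 'n) chart"
 assumes X: "complex_manifold X A" and ad: "adapted_chart X A V \<iota> d" and VX: "V \<subseteq> topspace X"
begin

abbreviation e where "e \<equiv> vchart V \<iota> d"

lemma inj: "inj \<iota>" and comp: "compatible_chart X A d"
 and im: "snd d ` (fst d \<inter> V) = {z \<in> chart_image d. \<forall>i. i \<notin> range \<iota> \<longrightarrow> z $ i = 0}"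
 using ad by (auto simp: adapted_chart_def)

lemma chd: "is_chart X d" using comp by (simp add: compatible_chart_def)

lemma invd: "x \<in> fst d \<Longrightarrow> chart_inv d (snd d x) = x" using chart_inj[OF chd] by simp

lemma e_in: "e \<in> submanifold_atlas X A V"
 unfolding submanifold_atlas_def vchart_def prj_def using ad by blast

lemma inV: "x \<in> fst d \<Longrightarrow> x \<in> V \<longleftrightarrow> (\<forall>i. i \<notin> range \<iota> \<longrightarrow> snd d x $ i = 0)"
proof
 assume x: "x \<in> fst d"
 show "\<forall>i. i \<notin> range \<iota> \<longrightarrow> snd d x $ i = 0" if "x \<in> V" using im x that by blast
 assume "\<forall>i. i \<notin> range \<iota> \<longrightarrow> snd d x $ i = 0"
 then have "snd d x \<in> snd d ` (fst d \<inter> V)" using x im by blast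
 then obtain y where "y \<in> fst d" "y \<in> V" "snd d y = snd d x" by auto
 then show "x \<in> V" using x inj_onD[OF chart_inj[OF chd]] by metis
qed

lemma fst_e: "fst e = fst d \<inter> V" and snd_e: "snd e x = prj \<iota> (snd d x)" by (simp_all add: vchart_def)

lemma emb_e: "x \<in> fst d \<Longrightarrow> x \<in> V \<Longrightarrow> emb \<iota> (snd e x) = snd d x"
 unfolding snd_e using inV by (intro emb_prj[OF inj]) auto

lemma image_e: "snd e ` (fst e \<inter> W) = {w. emb \<iota> w \<in> snd d ` (fst d \<inter> W)}"
proof (intro set_eqI iffI)
 fix w assume "w \<in> snd e ` (fst e \<inter> W)"
 then obtain x where "x \<in> fst d" "x \<in> V" "x \<in> W" "w = snd e x" unfolding fst_e by blast
 then show "w \<in> {w. emb \<iota> w \<in> snd d ` (fst d \<inter> W)}" using emb_e by auto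
next
 fix w assume "w \<in> {w. emb \<iota> w \<in> snd d ` (fst d \<inter> W)}"
 then obtain x where x: "x \<in> fst d" "x \<in> W" "emb \<iota> w = snd d x" by blast
 then have "x \<in> V" using inV[OF x(1)] x(3)[symmetric] by (simp add: emb_def)
 moreover have "snd e x = w" unfolding snd_e x(3)[symmetric] by (rule prj_emb[OF inj])
 ultimately show "w \<in> snd e ` (fst e \<inter> W)" using x unfolding fst_e by force
qed

lemma open_image_e: "openin X W \<Longrightarrow> open (snd e ` (fst e \<inter> W))"
 using open_vimage[OF chart_open_image[OF chd] linear_continuous_on[OF emb_linear(1)]] unfolding image_e by (simp add: vimage_def)

lemma inj_e: "inj_on (snd e) (fst e)"
 unfolding fst_e by (rule inj_onI) (metis IntE emb_e invd)

lemma inv_e: "x \<in> fst e \<Longrightarrow> chart_inv e (snd e x) = x" using inj_e by simp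

lemma inv_e_d: "w \<in> chart_image e \<Longrightarrow> chart_inv e w = chart_inv d (emb \<iota> w)"
 using inv_e emb_e invd by (auto simp: fst_e)

lemma is_chart_e: "is_chart (subtopology X V) e"
proof -
 have top: "fst d \<subseteq> topspace X" using chd openin_subset by (auto simp: is_chart_def)
 have o: "openin (subtopology X V) (fst e)" unfolding fst_e using chd by (auto simp: is_chart_def intro: openin_subtopology_Int)
 have img: "open (chart_image e)" using open_image_e[OF openin_topspace] VX unfolding fst_e by (simp add: Int_absorb2 le_infI2)
 have eq: "subtopology (subtopology X V) (fst e) = subtopology X (fst d \<inter> V)"
  by (simp add: subtopology_subtopology fst_e Int_ac)
 have "homeomorphic_map (subtopology X (fst d \<inter> V)) (top_of_set (chart_image e)) (snd e)"
 proof (rule bijective_open_imp_homeomorphic_map)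
  have "continuous_map (subtopology X (fst d)) euclidean (snd d)"
   using homeomorphic_imp_continuous_map[of "subtopology X (fst d)" "top_of_set (chart_image d)" "snd d"] chd
   unfolding is_chart_def continuous_map_in_subtopology by blast
  then have "continuous_map (subtopology X (fst d \<inter> V)) euclidean (snd d)" by (rule continuous_map_from_subtopology_mono) auto
  moreover have "continuous_map euclidean euclidean (prj \<iota>)" using linear_continuous_on[OF prj_linear(1)] by simp
  ultimately have "continuous_map (subtopology X (fst d \<inter> V)) euclidean (prj \<iota> \<circ> snd d)" by (rule continuous_map_compose)
  then show "continuous_map (subtopology X (fst d \<inter> V)) (top_of_set (chart_image e)) (snd e)"
   unfolding continuous_map_in_subtopology by (auto simp: vchart_def o_def)
  show "open_map (subtopology X (fst d \<inter> V)) (top_of_set (chart_image e)) (snd e)"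
   unfolding open_map_def
  proof (intro allI impI)
   fix Q assume "openin (subtopology X (fst d \<inter> V)) Q"
   then obtain W where W: "openin X W" "Q = W \<inter> (fst d \<inter> V)" unfolding openin_subtopology by blast
   have "snd e ` Q = snd e ` (fst e \<inter> W)" unfolding W(2) fst_e by (simp add: Int_commute)
   then show "openin (top_of_set (chart_image e)) (snd e ` Q)"
    using open_image_e[OF W(1)] img by (auto simp: openin_open_eq)
  qed
  show "snd e ` topspace (subtopology X (fst d \<inter> V)) = topspace (top_of_set (chart_image e))"
   using top by (simp add: fst_e topspace_subtopology Int_absorb1 le_infI1)
  show "inj_on (snd e) (topspace (subtopology X (fst d \<inter> V)))" using inj_e by (rule inj_on_subset) (auto simp: fst_e)
 qed
 then show ?thesis unfolding is_chart_def eq using o img by simp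
qed

lemma good_d: "good_param A d" by (rule good_param_compatible[OF X comp])

text \<open>On \<open>V\<close> the inverse of \<open>e\<close> is the inverse of \<open>d\<close>
  after \<open>emb\<close>; all claims follow from this factorization, the last one by the chain
  rule.\<close>

lemma transition_e:
 assumes c: "c \<in> A"
 shows "open (snd e ` (fst e \<inter> fst c))" "holo_on (snd c \<circ> chart_inv e) (snd e ` (fst e \<inter> fst c))"
  "q \<in> fst e \<Longrightarrow> q \<in> fst c \<Longrightarrow> Jac (snd c \<circ> chart_inv e) (snd e q) *v b = Jac (snd c \<circ> chart_inv d) (snd d q) *v emb \<iota> b"
proof -
 let ?N = "snd e ` (fst e \<inter> fst c)" and ?M = "snd d ` (fst d \<inter> fst c)"
 show N: "open ?N" using c X by (intro open_image_e) (simp add: complex_manifold_def is_chart_def)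
 have hd: "holo_on (snd c \<circ> chart_inv d) ?M" using good_d c by (simp add: good_param_def)
 have imN: "emb \<iota> ` ?N \<subseteq> ?M" unfolding image_e by blast
 note he = holo_on_linear[OF emb_linear(1) emb_linear(2), of \<iota> ?N]
 have h: "holo_on ((snd c \<circ> chart_inv d) \<circ> emb \<iota>) ?N" by (rule holo_on_compose(1)[OF he hd imN])
 have eq: "((snd c \<circ> chart_inv d) \<circ> emb \<iota>) w = (snd c \<circ> chart_inv e) w" if "w \<in> ?N" for w
  using that inv_e_d by auto
 show "holo_on (snd c \<circ> chart_inv e) ?N" by (rule holo_on_cong_open[OF h N eq])
 assume q: "q \<in> fst e" "q \<in> fst c"
 then have z: "snd e q \<in> ?N" by auto
 have "Jac (snd c \<circ> chart_inv e) (snd e q) = Jac ((snd c \<circ> chart_inv d) \<circ> emb \<iota>) (snd e q)"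
  by (rule Jac_unique[OF has_derivative_transform_within_open[OF holo_on_Jac[OF h z] N z eq]])
 also have "\<dots> = Jac (snd c \<circ> chart_inv d) (emb \<iota> (snd e q)) ** Jac (emb \<iota>) (snd e q)"
  by (rule holo_on_compose(2)[OF he hd imN z])
 also have "emb \<iota> (snd e q) = snd d q" using q by (intro emb_e) (auto simp: fst_e)
 finally show "Jac (snd c \<circ> chart_inv e) (snd e q) *v b = Jac (snd c \<circ> chart_inv d) (snd d q) *v emb \<iota> b"
  by (simp only: matrix_vector_mul_assoc[symmetric] Jac_linear[OF emb_linear])
qed

lemma good_e: "good_param A e"
 unfolding good_param_def
proof (intro conjI ballI inj_e)
 show "open (chart_image e)" using is_chart_e by (simp add: is_chart_def)
 show "fst e \<subseteq> \<Union> (fst ` A)" using good_d by (auto simp: good_param_def fst_e)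
 fix c assume c: "c \<in> A"
 show "open (snd e ` (fst e \<inter> fst c))" "holo_on (snd c \<circ> chart_inv e) (snd e ` (fst e \<inter> fst c))" by (rule transition_e[OF c])+
 have cc: "is_chart X c" using X c by (simp add: complex_manifold_def)
 let ?M = "snd c ` (fst c \<inter> fst d)"
 show "\<exists>R M. open M \<and> holo_on R M \<and> (\<forall>z\<in>snd e ` (fst e \<inter> fst c). snd c (chart_inv e z) \<in> M \<and> R (snd c (chart_inv e z)) = z)"
 \<comment> \<open>The left inverse lives on an open set of the larger space: return to the
   coordinates of \<open>d\<close> and forget the normal ones.\<close>
 proof (intro exI[of _ "prj \<iota> \<circ> (snd d \<circ> chart_inv c)"] exI[of _ ?M] conjI ballI)
  show "open ?M" using chd by (intro chart_open_image[OF cc]) (simp add: is_chart_def)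
  show "holo_on (prj \<iota> \<circ> (snd d \<circ> chart_inv c)) ?M"
   using comp c by (intro holo_on_compose(1)[OF _ holo_on_linear[OF prj_linear] subset_UNIV]) (simp add: compatible_chart_def holo_transition_def)
  fix z assume "z \<in> snd e ` (fst e \<inter> fst c)"
  then obtain x where x: "x \<in> fst d" "x \<in> V" "x \<in> fst c" "z = snd e x" by (auto simp: fst_e)
  then have "chart_inv e z = x" "chart_inv c (snd c x) = x" using inv_e[of x] chart_inj[OF cc] by (auto simp: fst_e)
  then show "snd c (chart_inv e z) \<in> ?M" "(prj \<iota> \<circ> (snd d \<circ> chart_inv c)) (snd c (chart_inv e z)) = z"
   using x by (auto simp: snd_e)
 qed
qed

lemma pullback_e:
 assumes \<omega>: "kaehler_form A \<omega>" and q: "q \<in> fst e"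
 shows "hform (metr A \<omega> e q) b = hform (metr A \<omega> d q) (emb \<iota> b)"
proof -
 have s: "smooth_form11 A \<omega>" using \<omega> by (simp add: kaehler_form_def)
 have qd: "q \<in> fst d" using q by (simp add: fst_e)
 obtain c where c: "c \<in> A" "q \<in> fst c" using good_d qd by (auto simp: good_param_def)
 show ?thesis
  unfolding pullback_form_eq[OF X s good_e c(1) q c(2)] pullback_form_eq[OF X s good_d c(1) qd c(2)] hform_pullback
   transition_e(3)[OF c(1) q c(2)] ..
qed

end

lemma set_lebesgue_integral_support:
 assumes "\<And>z. z \<notin> K \<Longrightarrow> f z = (0::real)" "K \<subseteq> S" "K \<subseteq> S'"
 shows "(LINT z:S|M. f z) = (LINT z:S'|M. f z)"
 unfolding set_lebesgue_integral_def
 by (rule Bochner_Integration.integral_cong[OF refl]) (use assms in \<open>auto simp: indicator_def\<close>)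

context adapted
begin

lemma psh_near_V:
 assumes \<omega>: "kaehler_form A \<omega>" and cov: "V \<subseteq> \<Union> (fst ` (submanifold_atlas X A V :: ('a, 'k) chart set))"
  and charts: "\<And>c. c \<in> (submanifold_atlas X A V :: ('a, 'k) chart set) \<Longrightarrow> is_chart (subtopology X V) c"
  and q: "quasi_psh (subtopology X V) (submanifold_atlas X A V :: ('a, 'k) chart set) \<phi>"
  and cur: "current_ge (submanifold_atlas X A V :: ('a, 'k) chart set) (current_add (current_of_form (metr A \<omega>)) (i_ddbar \<phi>))
         (current_scale \<epsilon> (current_of_form (metr A \<omega>)))"
  and p: "p \<in> fst e" and s: "1 - \<epsilon> < s"
 shows "\<exists>r>0. ball (snd e p) r \<subseteq> chart_image e \<and>
   psh_coord (ball (snd e p) r) (\<lambda>z. \<phi> (chart_inv e z) + ereal (qf (s *\<^sub>R metr A \<omega> e p) z))"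
proof -
 let ?\<Omega> = "metr A \<omega> :: ('a, 'k) form11"
 note pp = pullback_form_props[OF X \<omega> good_e]
 have topV: "topspace (subtopology X V) = V" using VX by auto
 have pV: "p \<in> V" using p by (simp add: fst_e)
 obtain W u f where W: "openin (subtopology X V) W" "p \<in> W" "psh_on (submanifold_atlas X A V :: ('a, 'k) chart set) W u"
  "smooth_function_on (submanifold_atlas X A V :: ('a, 'k) chart set) W f" "\<forall>x\<in>W. \<phi> x = u x + ereal (f x)"
  using q pV unfolding quasi_psh_def topV by blast
 let ?S = "snd e ` (fst e \<inter> W)" and ?u = "u \<circ> chart_inv e" and ?f = "f \<circ> chart_inv e" and ?g = "\<lambda>z. (1 - \<epsilon>) *\<^sub>R ?\<Omega> e (chart_inv e z)"
 have S: "open ?S" "snd e p \<in> ?S" using chart_open_image[OF is_chart_e W(1)] p W(2) by auto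
 have Sim: "?S \<subseteq> chart_image e" by blast
 have u: "psh_coord ?S ?u" using W(3) e_in unfolding psh_on_def by blast
 have f: "continuous_on ?S ?f" using W(4) e_in Ck_on.simps(1)[of ?f ?S] unfolding smooth_function_on_def smooth_on_def by blast
 have dec: "\<phi> (chart_inv e z) = ?u z + ereal (?f z)" if "z \<in> ?S" for z using that W(5) inv_e by auto
 have dense: "\<exists>y\<in>?S. dist z y < r \<and> \<phi> (chart_inv e y) \<noteq> -\<infinity>" if z: "z \<in> ?S" and r: "r > 0" for z r
 proof -
  let ?W = "{x \<in> fst e. snd e x \<in> ball z r \<inter> ?S}"
  have "\<exists>x\<in>?W. \<phi> x \<noteq> -\<infinity>"
  proof (rule quasi_psh_dense[OF charts _ q])
   show "openin (subtopology X V) ?W" by (rule chart_open_preimage[OF is_chart_e open_Int[OF open_ball S(1)]])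
   show "chart_inv e z \<in> ?W" using z r inv_e by auto
  qed (use cov topV in auto)
  then obtain x where "x \<in> fst e" "snd e x \<in> ball z r" "snd e x \<in> ?S" "\<phi> x \<noteq> -\<infinity>" by blast
  then show ?thesis using inv_e by (intro bexI[of _ "snd e x"]) auto
 qed
 have "\<exists>r>0. ball (snd e p) r \<subseteq> ?S \<and> psh_coord (ball (snd e p) r) (\<lambda>z. (?u z + ereal (?f z)) + ereal (qf (s *\<^sub>R ?\<Omega> e p) z))"
 proof (rule psh_of_current[OF u S f])
  show "\<exists>y. dist (snd e p) y < r \<and> ?u y \<noteq> -\<infinity>" if r: "r > 0" for r
  proof -
   obtain y where y: "y \<in> ?S" "dist (snd e p) y < r" "\<phi> (chart_inv e y) \<noteq> -\<infinity>" using dense[OF S(2) r] by blast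
   then show ?thesis using dec[OF y(1)] by (intro exI[of _ y]) auto
  qed
  show "continuous_on ?S ?g" by (intro continuous_intros continuous_on_subset[OF pp(3) Sim])
  show "hermitian (s *\<^sub>R ?\<Omega> e p)" by (intro hermitian_simps pp(1) p)
  show "qf (?g (snd e p)) v < qf (s *\<^sub>R ?\<Omega> e p) v" if "v \<noteq> 0" for v
   using pp(2)[OF p that] s inv_e[OF p] by (simp add: hform_scaleR)
  fix h :: "complex^'k \<Rightarrow> complex" and K v assume h: "smooth_on h UNIV" "\<And>z. h z \<in> \<real>\<^sub>\<ge>\<^sub>0" and K: "compact K" "K \<subseteq> ?S" "\<And>z. z \<notin> K \<Longrightarrow> h z = 0"
  let ?M = "\<lambda>z. (hess h z)"
  have o: "open (- K)" using compact_imp_closed[OF K(1)] by auto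
  have wb: "wirtinger_bar k h y = 0" if "y \<in> - K" for y k by (rule wirtinger_zero(2)[OF o that]) (use K(3) in auto)
  have w0: "wirtinger j (wirtinger_bar k h) z = 0" if "z \<in> - K" for j k z by (rule wirtinger_zero(1)[OF o that wb])
  have M0: "hform (?M z) v = 0" if "z \<notin> K" for z using w0 that by (simp add: hform_def)
  have hr: "h z \<in> \<real>" for z using h(2) nonneg_Reals_subset_Reals by blast
  have loc: "\<exists>T f. open T \<and> z \<in> T \<and> T \<subseteq> ?S \<and> continuous_on T (f :: _ \<Rightarrow> real) \<and> psh_coord T (\<lambda>z. \<phi> (chart_inv e z) + ereal (f z))"
   if "z \<in> ?S" for z
  proof (intro exI[of _ ?S] exI[of _ "\<lambda>z. - ?f z"] conjI S(1) that order_refl continuous_on_minus f)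
   show "psh_coord ?S (\<lambda>z. \<phi> (chart_inv e z) + ereal (- ?f z))"
   proof (rule psh_coord_cong[OF u S(1)])
    show "?u z = \<phi> (chart_inv e z) + ereal (- ?f z)" if "z \<in> ?S" for z using dec[OF that] by (cases "?u z") auto
   qed
  qed
  have si: "set_integrable lborel K (\<lambda>z. real_of_ereal (\<phi> (chart_inv e z)))"
   by (rule qpsh_integrable(1)[where S="?S"]; (rule loc dense K(1,2); assumption?))
  have K2: "K \<subseteq> chart_image e" using K(2) Sim by blast
  have oe: "open (chart_image e)" using is_chart_e by (simp add: is_chart_def)
  note val = current_value[where \<phi>=\<phi> and \<omega>="?\<Omega>" and c=e and K=K and h=h and \<epsilon>=\<epsilon> and v=v, OF oe h(1) hr K(1) K2 K(3) si pp(3,1)]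
  have "test_function (chart_image e) h" unfolding test_function_def using h(1) K(1,3) K2 by blast
  then have "(\<Sum>j\<in>UNIV. \<Sum>k\<in>UNIV. current_add (current_add (current_of_form ?\<Omega>) (i_ddbar \<phi>))
    (current_scale (-1) (current_scale \<epsilon> (current_of_form ?\<Omega>))) e j k h * v $ j * cnj (v $ k)) \<in> \<real>\<^sub>\<ge>\<^sub>0"
   using cur e_in h(2) unfolding current_ge_def positive_current_def by blast
  then have "0 \<le> (LINT z:chart_image e|lborel. real_of_ereal (\<phi> (chart_inv e z)) * qf (?M z) v)
   + (LINT z:chart_image e|lborel. qf (?g z) v * Re (h z))"
   by (subst (asm) val) (simp_all only: nonneg_Reals_of_real_iff not_False_eq_True)
  also have "(LINT z:chart_image e|lborel. real_of_ereal (\<phi> (chart_inv e z)) * qf (?M z) v) =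
    (LINT z:?S|lborel. real_of_ereal (\<phi> (chart_inv e z)) * qf (?M z) v)"
   by (rule set_lebesgue_integral_support[OF _ K2 K(2)]) (simp add: M0)
  also have "\<dots> = (LINT z:?S|lborel. real_of_ereal (?u z + ereal (?f z)) * qf (?M z) v)"
   using dec S(1) by (intro set_lebesgue_integral_cong) auto
  also have "(LINT z:chart_image e|lborel. qf (?g z) v * Re (h z)) = (LINT z:?S|lborel. qf (?g z) v * Re (h z))"
   by (rule set_lebesgue_integral_support[OF _ K2 K(2)]) (simp add: K(3))
  finally show "0 \<le> (LINT z:?S|lborel. real_of_ereal (?u z + ereal (?f z)) * qf (?M z) v)
    + (LINT z:?S|lborel. qf (?g z) v * Re (h z))" .
 qed
 then obtain r where r: "r > 0" "ball (snd e p) r \<subseteq> ?S"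
  "psh_coord (ball (snd e p) r) (\<lambda>z. (?u z + ereal (?f z)) + ereal (qf (s *\<^sub>R ?\<Omega> e p) z))" by blast
 have "psh_coord (ball (snd e p) r) (\<lambda>z. \<phi> (chart_inv e z) + ereal (qf (s *\<^sub>R ?\<Omega> e p) z))"
  by (rule psh_coord_cong[OF r(3) open_ball]) (use dec r(2) in auto)
 then show ?thesis using r Sim by blast
qed

end

text \<open>On the compact set where a \<le> 0 the function \<open>b\<close> has a positive minimum,
  so a large multiple of it outweighs the minimum of \<open>a\<close>; elsewhere \<open>a\<close> is
  already positive.\<close>

lemma compact_penalize:
 fixes a b :: "'b::topological_space \<Rightarrow> real"
 assumes K: "compact K" and a: "continuous_on K a" and b: "continuous_on K b" "\<And>x. x \<in> K \<Longrightarrow> 0 \<le> b x"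
  and pos: "\<And>x. x \<in> K \<Longrightarrow> b x = 0 \<Longrightarrow> 0 < a x"
 shows "\<exists>C\<ge>0. \<forall>C'\<ge>C. \<forall>x\<in>K. 0 < a x + C' * b x"
proof -
 let ?L = "K \<inter> a -` {..0}"
 have "compact ?L" by (rule closedin_compact[OF K continuous_closedin_preimage[OF a closed_atMost]])
 show ?thesis
 proof (cases "?L = {}")
  case True
  have "0 < a x + C' * b x" if "C' \<ge> 0" "x \<in> K" for C' x
  proof -
   have "0 < a x" using True that(2) by (force simp: not_le)
   then show ?thesis using b(2)[OF that(2)] that(1) by (simp add: add_pos_nonneg)
  qed
  then show ?thesis by (intro exI[of _ 0]) auto
 next
  case False
  obtain x0 where x0: "x0 \<in> ?L" "\<And>x. x \<in> ?L \<Longrightarrow> b x0 \<le> b x"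
   using continuous_attains_inf[OF \<open>compact ?L\<close> False continuous_on_subset[OF b(1)]] by blast
  obtain y0 where y0: "y0 \<in> ?L" "\<And>x. x \<in> ?L \<Longrightarrow> a y0 \<le> a x"
   using continuous_attains_inf[OF \<open>compact ?L\<close> False continuous_on_subset[OF a]] by blast
  have m: "b x0 > 0" using x0(1) b(2)[of x0] pos[of x0] by (force simp: less_le)
  define C where "C = (1 - a y0) / b x0"
  have C: "C \<ge> 0" using m y0(1) by (auto simp: C_def)
  have "0 < a x + C' * b x" if C': "C' \<ge> C" and x: "x \<in> K" for C' x
  proof (cases "x \<in> ?L")
   case True
   have "1 - a y0 = C * b x0" using m by (simp add: C_def)
   also have "\<dots> \<le> C' * b x" using C' C x0(2)[OF True] m by (intro mult_mono) auto
   finally show ?thesis using y0(2)[OF True] by linarith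
  next
   case False
   then have "0 < a x" using x by (auto simp: not_le)
   then show ?thesis using b(2)[OF x] C' C by (simp add: add_pos_nonneg)
  qed
  with C show ?thesis by (intro exI[of _ C]) auto
 qed
qed

lemma hform_pos_sphere:
 assumes "\<And>v::complex^'n::finite. norm v = 1 \<Longrightarrow> 0 < qf M v" and v: "v \<noteq> 0"
 shows "0 < qf M v"
proof -
 define y where "y = of_real (inverse (norm v)) *s v"
 have "norm y = 1" using v by (simp add: y_def norm_scalar_mult norm_inverse)
 then have "0 < qf M y" by (rule assms)
 moreover have "hform M y = of_real ((inverse (norm v))\<^sup>2) * hform M v"
  by (simp only: y_def hform_scale norm_of_real abs_inverse abs_norm_cancel)
 ultimately show ?thesis using v by (simp add: zero_less_mult_iff)
qed

context adapted
begin

text \<open>\<open>F\<close> is \<pi> in the coordinates \<open>d\<close> and \<open>e\<close>. Its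
  holomorphy is given in charts of the atlas cut down to \<open>U\<close> and is carried over
  locally. The last claim comes from differentiating \<open>F (emb \<iota> w) = w\<close>, which
  holds because \<pi> fixes \<open>V\<close>: the differential of \<pi> is the identity on tangent
  vectors of \<open>V\<close>.\<close>

lemma retraction_chart:
 assumes \<pi>: "holomorphic_retraction TYPE('k) X A U V \<pi>" and U: "openin X U" "V \<subseteq> U"
 defines "N \<equiv> snd d ` {x \<in> fst d \<inter> U. \<pi> x \<in> fst d}" and "F \<equiv> snd e \<circ> \<pi> \<circ> chart_inv d"
 shows "open N" "holo_on F N" "\<And>x. x \<in> fst d \<Longrightarrow> x \<in> V \<Longrightarrow> snd d x \<in> N \<and> F (snd d x) = snd e x"
  "\<And>z. z \<in> N \<Longrightarrow> F z \<in> chart_image e \<and> chart_inv e (F z) = \<pi> (chart_inv d z)"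
  "\<And>p b. p \<in> fst d \<Longrightarrow> p \<in> V \<Longrightarrow> (\<And>i. i \<notin> range \<iota> \<Longrightarrow> b $ i = 0) \<Longrightarrow> emb \<iota> (Jac F (snd d p) *v b) = b"
proof -
 have cm: "continuous_map (subtopology X U) (subtopology X V) \<pi>"
  and hol: "\<And>c. c \<in> A \<Longrightarrow> holo_on (snd e \<circ> \<pi> \<circ> inv_into (fst c \<inter> U) (snd c)) (snd c ` {x \<in> fst c \<inter> U. \<pi> x \<in> fst e})"
  and id: "\<And>x. x \<in> V \<Longrightarrow> \<pi> x = x"
  using \<pi> e_in unfolding holomorphic_retraction_def holomorphic_map_def open_atlas_def by fastforce+
 have UX: "U \<subseteq> topspace X" using U(1) openin_subset by auto
 have piV: "\<pi> x \<in> V" if "x \<in> U" for x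
  using cm that UX VX unfolding continuous_map_def by (auto simp: Pi_iff)
 have op: "openin X {x \<in> U. \<pi> x \<in> W}" if W: "openin X W" for W
 proof -
  have "openin (subtopology X U) {x \<in> topspace (subtopology X U). \<pi> x \<in> W \<inter> V}"
   by (rule openin_continuous_map_preimage[OF cm]) (use W in \<open>simp add: openin_subtopology_Int\<close>)
  moreover have "{x \<in> topspace (subtopology X U). \<pi> x \<in> W \<inter> V} = {x \<in> U. \<pi> x \<in> W}" using UX piV by auto
  ultimately show ?thesis using U(1) by (auto intro: openin_trans_full)
 qed
 have od: "openin X (fst d)" using chd by (simp add: is_chart_def)
 have NN: "N = snd d ` (fst d \<inter> {x \<in> U. \<pi> x \<in> fst d})" unfolding N_def by (rule arg_cong[where f="image (snd d)"]) auto
 show oN: "open N" unfolding NN by (rule chart_open_image[OF chd op[OF od]])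
 have pt: "\<exists>x. x \<in> fst d \<and> x \<in> U \<and> \<pi> x \<in> fst d \<and> \<pi> x \<in> fst e \<and> z = snd d x \<and> chart_inv d z = x" if "z \<in> N" for z
  using that invd piV unfolding N_def fst_e by auto
 show FV: "snd d x \<in> N \<and> F (snd d x) = snd e x" if "x \<in> fst d" "x \<in> V" for x
  using that id[OF that(2)] invd U(2) unfolding N_def F_def by auto
 show Fe: "F z \<in> chart_image e \<and> chart_inv e (F z) = \<pi> (chart_inv d z)" if "z \<in> N" for z
  using pt[OF that] inv_e unfolding F_def by fastforce
 show hF: "holo_on F N" unfolding holo_on_def
 proof
  fix z assume z: "z \<in> N"
  obtain x where x: "x \<in> fst d" "x \<in> U" "\<pi> x \<in> fst e" "z = snd d x" using pt[OF z] by blast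
  obtain c where c: "c \<in> A" "x \<in> fst c" using good_d x(1) unfolding good_param_def by auto
  have cc: "is_chart X c" using X c by (simp add: complex_manifold_def)
  let ?G = "snd e \<circ> \<pi> \<circ> inv_into (fst c \<inter> U) (snd c)" and ?tr = "snd c \<circ> chart_inv d"
  let ?N = "N \<inter> snd d ` (fst d \<inter> fst c)"
  have oN': "open ?N" using oN good_d c(1) unfolding good_param_def by blast
  have zN: "z \<in> ?N" using z x c by blast
  have ht: "holo_on ?tr ?N" using good_d c(1) unfolding good_param_def by (blast intro: holo_on_subset)
  have pt2: "\<exists>y. y \<in> fst c \<and> y \<in> U \<and> \<pi> y \<in> fst e \<and> chart_inv d w = y \<and> inv_into (fst c \<inter> U) (snd c) (snd c y) = y" if w: "w \<in> ?N" for w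
  proof -
   obtain y where y: "y \<in> fst d" "y \<in> U" "\<pi> y \<in> fst e" "w = snd d y" "chart_inv d w = y" using pt w by blast
   obtain y' where y': "y' \<in> fst d" "y' \<in> fst c" "w = snd d y'" using w by blast
   have "y = y'" using invd[OF y'(1)] y(5) y'(3) by simp
   moreover have "inj_on (snd c) (fst c \<inter> U)" by (rule inj_on_subset[OF chart_inj[OF cc]]) blast
   ultimately show ?thesis using y y' by (metis IntI inv_into_f_f)
  qed
  have im: "?tr ` ?N \<subseteq> snd c ` {x \<in> fst c \<inter> U. \<pi> x \<in> fst e}"
  proof
   fix y assume "y \<in> ?tr ` ?N"
   then obtain w where "w \<in> ?N" "y = ?tr w" by blast
   then show "y \<in> snd c ` {x \<in> fst c \<inter> U. \<pi> x \<in> fst e}" using pt2[of w] by auto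
  qed
  have "holo_on F ?N"
  proof (rule holo_on_cong_open[OF holo_on_compose(1)[OF ht hol[OF c(1)] im] oN'])
   fix w assume "w \<in> ?N"
   from pt2[OF this] show "(?G \<circ> ?tr) w = F w" by (auto simp: F_def)
  qed
  then show "\<exists>D. (F has_derivative D) (at z) \<and> (\<forall>c v. D (c *s v) = c *s D v)"
   using zN unfolding holo_on_def by blast
 qed
 fix p b assume p: "p \<in> fst d" "p \<in> V" and b: "\<And>i. i \<notin> range \<iota> \<Longrightarrow> (b :: complex^'n) $ i = 0"
 let ?w = "snd e p"
 let ?W = "{w. emb \<iota> w \<in> N}"
 have oW: "open (?W \<inter> chart_image e)" using open_vimage[OF oN linear_continuous_on[OF emb_linear(1)]] is_chart_e
  by (auto simp: vimage_def is_chart_def)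
 have wW: "?w \<in> ?W \<inter> chart_image e" using FV[OF p] emb_e[OF p] p by (auto simp: fst_e)
 note he = holo_on_linear[OF emb_linear(1) emb_linear(2), of \<iota> "?W \<inter> chart_image e"]
 have im: "emb \<iota> ` (?W \<inter> chart_image e) \<subseteq> N" by blast
 have "(F \<circ> emb \<iota> has_derivative (*v) (Jac F (emb \<iota> ?w) ** Jac (emb \<iota>) ?w)) (at ?w)"
  using holo_on_Jac[OF holo_on_compose(1)[OF he hF im] wW] holo_on_compose(2)[OF he hF im wW] by simp
 moreover have "(F \<circ> emb \<iota> has_derivative (\<lambda>h. h)) (at ?w)"
 proof (rule has_derivative_transform_within_open[OF has_derivative_ident oW wW])
  fix w assume "w \<in> ?W \<inter> chart_image e"
  then obtain x where x: "x \<in> fst d" "x \<in> V" "w = snd e x" by (auto simp: fst_e)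
  then show "w = (F \<circ> emb \<iota>) w" using emb_e[OF x(1,2)] FV[OF x(1,2)] by simp
 qed
 ultimately have "(*v) (Jac F (emb \<iota> ?w) ** Jac (emb \<iota>) ?w) = (\<lambda>h. h)" by (rule has_derivative_unique)
 then have "Jac F (snd d p) *v emb \<iota> (prj \<iota> b) = prj \<iota> b"
  using emb_e[OF p] by (metis matrix_vector_mul_assoc Jac_linear[OF emb_linear])
 then show "emb \<iota> (Jac F (snd d p) *v b) = b" using emb_prj[OF inj b] by simp
qed

lemma upsh_retraction:
 assumes \<omega>: "kaehler_form A \<omega>" and \<pi>: "holomorphic_retraction TYPE('k) X A U V \<pi>" and U: "openin X U" "V \<subseteq> U"
  and psh: "\<And>p. p \<in> fst e \<Longrightarrow> \<exists>r>0. ball (snd e p) r \<subseteq> chart_image e \<and>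
    psh_coord (ball (snd e p) r) (\<lambda>z. \<phi> (chart_inv e z) + ereal (qf (s *\<^sub>R metr A \<omega> e p) z))"
  and s: "s < t" and L: "has_levi (chart_image d) E P L"
  and LV: "\<And>p y. p \<in> fst d \<Longrightarrow> p \<in> V \<Longrightarrow> 0 \<le> qf (L (snd d p)) y \<and> (qf (L (snd d p)) y = 0 \<longrightarrow> (\<forall>i. i \<notin> range \<iota> \<longrightarrow> y $ i = 0))"
  and K: "compact (snd d ` K)" "K \<subseteq> fst d \<inter> V"
 shows "\<exists>C\<ge>0. \<forall>C'\<ge>C. \<forall>p\<in>K. \<exists>W. openin X W \<and> p \<in> W \<and> W \<subseteq> fst d \<and> (\<forall>x\<in>W. upsh A \<omega> t (\<lambda>x. \<phi> (\<pi> x) + ereal (C' * E (snd d x))) x)"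
proof -
 define N where "N = snd d ` {x \<in> fst d \<inter> U. \<pi> x \<in> fst d}"
 define F where "F = snd e \<circ> \<pi> \<circ> chart_inv d"
 note R = retraction_chart[OF \<pi> U, folded N_def F_def]
 let ?\<Omega>d = "metr A \<omega> d" and ?\<Omega>e = "metr A \<omega> e"
 note pd = pullback_form_props[OF X \<omega> good_d]
 define a where "a z = t *\<^sub>R ?\<Omega>d (chart_inv d z)" for z
 define b where "b z y = qf (a z) y - s * qf (?\<Omega>d (chart_inv d z)) (emb \<iota> (Jac F z *v y))" for z y
 let ?S = "sphere (0 :: complex^'n) 1"
 have KN: "snd d ` K \<subseteq> N" "snd d ` K \<subseteq> chart_image d" using K(2) R(3) by blast+
 have "\<exists>C\<ge>0. \<forall>C'\<ge>C. \<forall>x\<in>snd d ` K \<times> ?S. 0 < b (fst x) (snd x) + C' * qf (L (fst x)) (snd x)"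
 proof (rule compact_penalize)
  show "compact (snd d ` K \<times> ?S)" by (intro compact_Times K(1) compact_sphere)
  have cf: "continuous_on (snd d ` K \<times> ?S) (\<lambda>x. G (fst x))" if "continuous_on (snd d ` K) G" for G :: "complex^'n \<Rightarrow> 'z::topological_space"
   by (rule continuous_on_compose2[OF that]) (auto intro!: continuous_intros)
  have c\<Omega>: "continuous_on (snd d ` K) (\<lambda>z. ?\<Omega>d (chart_inv d z))" by (rule continuous_on_subset[OF pd(3) KN(2)])
  have cJ: "continuous_on (snd d ` K) (Jac F)" by (rule continuous_on_subset[OF Jac_continuous[OF R(2,1)] KN(1)])
  have cv: "continuous_on (snd d ` K \<times> ?S) (\<lambda>x. emb \<iota> (Jac F (fst x) *v snd x))"
  proof -
   have "continuous_on (snd d ` K \<times> ?S) (\<lambda>x. Jac F (fst x) *v snd x)"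
    unfolding matrix_vector_mult_def by (intro continuous_on_vec_lambda continuous_intros cf[OF cJ])
   then show ?thesis by (rule bounded_linear.continuous_on[OF emb_linear(1)])
  qed
  show "continuous_on (snd d ` K \<times> ?S) (\<lambda>x. b (fst x) (snd x))"
   unfolding b_def a_def by (intro continuous_intros cf[OF c\<Omega>] cv)
  have "continuous_on (snd d ` K) L" using L KN(2) by (auto simp: has_levi_def intro: continuous_on_subset)
  then show "continuous_on (snd d ` K \<times> ?S) (\<lambda>x. qf (L (fst x)) (snd x))" by (intro continuous_intros cf)
  fix x assume x: "x \<in> snd d ` K \<times> ?S"
  then obtain p where p: "p \<in> fst d" "p \<in> V" "fst x = snd d p" "norm (snd x) = 1" using K(2) by (auto simp: mem_Times_iff)
  show "0 \<le> qf (L (fst x)) (snd x)" using LV[OF p(1,2)] p(3) by simp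
  assume "qf (L (fst x)) (snd x) = 0"
  then have "\<And>i. i \<notin> range \<iota> \<Longrightarrow> snd x $ i = 0" using LV[OF p(1,2), of "snd x"] p(3) by simp
  from R(5)[OF p(1,2) this] have eq: "emb \<iota> (Jac F (snd d p) *v snd x) = snd x" .
  have "snd x \<noteq> 0" using p(4) by auto
  then have "0 < qf (?\<Omega>d p) (snd x)" by (rule pd(2)[OF p(1)])
  then have "0 < (t - s) * qf (?\<Omega>d p) (snd x)" using s by simp
  then show "0 < b (fst x) (snd x)" using p(3) invd[OF p(1)] eq by (simp add: b_def a_def hform_scaleR left_diff_distrib)
 qed
 then obtain C where C: "C \<ge> 0" "\<And>C' z y. C' \<ge> C \<Longrightarrow> z \<in> snd d ` K \<Longrightarrow> norm y = 1 \<Longrightarrow> 0 < b z y + C' * qf (L z) y"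
  by force
 show ?thesis
 proof (intro exI[of _ C] conjI allI impI ballI C(1))
  fix C' p assume C': "C' \<ge> C" and pK: "p \<in> K"
  then have p: "p \<in> fst d" "p \<in> V" "p \<in> fst e" using K(2) by (auto simp: fst_e)
  let ?H = "s *\<^sub>R ?\<Omega>e p"
  have H: "hermitian ?H" by (intro hermitian_simps pullback_form_props(1)[OF X \<omega> good_e p(3)])
  obtain r where r: "r > 0" "ball (snd e p) r \<subseteq> chart_image e"
   "psh_coord (ball (snd e p) r) (\<lambda>z. \<phi> (chart_inv e z) + ereal (qf ?H z))" using psh[OF p(3)] by blast
  define T where "T = N \<inter> F -` ball (snd e p) r"
  have T: "open T" unfolding T_def by (rule continuous_open_preimage[OF holo_on_continuous[OF R(2)] R(1) open_ball])
  have TN: "T \<subseteq> N" "F ` T \<subseteq> ball (snd e p) r" by (auto simp: T_def)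
  have Td: "T \<subseteq> chart_image d" using TN(1) unfolding N_def by blast
  have pT: "snd d p \<in> T" using R(3)[OF p(1,2)] r(1) by (simp add: T_def)
  have hT: "holo_on F T" by (rule holo_on_subset[OF R(2) TN(1)])
  have u: "psh_coord T (\<lambda>z. \<phi> (chart_inv e (F z)) + ereal (qf ?H (F z)))"
   by (rule psh_coord_compose[OF r(3) open_ball hT T TN(2)])
  \<comment> \<open>The weight is the pulled-back frozen form minus \<open>C' * E\<close>: it has to
    undo the term \<open>C' * E\<close> in the function, so the Levi form of \<open>E\<close> works
    in favour of the inequality.\<close>
  note LG = has_levi_add[OF has_levi_compose[OF has_levi_quad[OF H, of UNIV] hT T subset_UNIV] has_levi_scale[OF has_levi_subset[OF L Td], of "- C'"]]
  show "\<exists>W. openin X W \<and> p \<in> W \<and> W \<subseteq> fst d \<and> (\<forall>x\<in>W. upsh A \<omega> t (\<lambda>x. \<phi> (\<pi> x) + ereal (C' * E (snd d x))) x)"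
  proof (rule upsh_near[OF X \<omega> comp T Td p(1) pT _ LG])
   show "psh_coord T (\<lambda>z. (\<phi> (\<pi> (chart_inv d z)) + ereal (C' * E (snd d (chart_inv d z)))) + ereal (qf ?H (F z) + - C' * E z))"
   proof (rule psh_coord_cong[OF u T])
    fix z assume z: "z \<in> T"
    have "chart_inv e (F z) = \<pi> (chart_inv d z)" using R(4) TN(1) z by blast
    moreover have "snd d (chart_inv d z) = z" using Td z by (auto intro: f_inv_into_f)
    ultimately show "\<phi> (chart_inv e (F z)) + ereal (qf ?H (F z)) =
      (\<phi> (\<pi> (chart_inv d z)) + ereal (C' * E (snd d (chart_inv d z)))) + ereal (qf ?H (F z) + - C' * E z)"
     by (cases "\<phi> (\<pi> (chart_inv d z))") auto
   qed
   fix y :: "complex^'n" assume y: "y \<noteq> 0"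
   let ?Q = "a (snd d p) + - (pullback_matrix (Jac F (snd d p)) ?H + - C' *\<^sub>R L (snd d p))"
   have Q: "qf ?Q y = b (snd d p) y + C' * qf (L (snd d p)) y" for y
    by (simp only: hform_add hform_minus hform_scaleR hform_pullback pullback_e[OF \<omega> p(3)] b_def invd[OF p(1)]) simp
   have "0 < qf ?Q y"
    by (rule hform_pos_sphere[OF _ y], unfold Q) (rule C(2)[OF C' imageI[OF pK]])
   then show "qf (pullback_matrix (Jac F (snd d p)) ?H + - C' *\<^sub>R L (snd d p)) y < t * qf (?\<Omega>d p) y"
    unfolding hform_add[of "a (snd d p)"] hform_minus by (simp add: a_def invd[OF p(1)] hform_scaleR)
  qed
 qed
qed

end

section \<open>Gluing\<close>

lemma chart_compactin:
 assumes c: "is_chart X c" and K: "compact K" "K \<subseteq> chart_image c"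
 shows "compactin X {x \<in> fst c. snd c x \<in> K}"
 unfolding compactin_def
proof (intro conjI allI impI)
 show "{x \<in> fst c. snd c x \<in> K} \<subseteq> topspace X" using c openin_subset by (auto simp: is_chart_def)
 fix \<U> assume U': "Ball \<U> (openin X) \<and> {x \<in> fst c. snd c x \<in> K} \<subseteq> \<Union> \<U>"
 then have U: "Ball \<U> (openin X)" "{x \<in> fst c. snd c x \<in> K} \<subseteq> \<Union> \<U>" by blast+
 have "K \<subseteq> (\<Union>W\<in>\<U>. snd c ` (fst c \<inter> W))"
 proof
  fix z assume z: "z \<in> K"
  then obtain x where x: "x \<in> fst c" "z = snd c x" using K(2) by blast
  then obtain W where "W \<in> \<U>" "x \<in> W" using z U(2) by blast
  then show "z \<in> (\<Union>W\<in>\<U>. snd c ` (fst c \<inter> W))" using x by blast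
 qed
 then obtain \<F> where F: "\<F> \<subseteq> \<U>" "finite \<F>" "K \<subseteq> (\<Union>W\<in>\<F>. snd c ` (fst c \<inter> W))"
  using compactE_image[OF K(1), of \<U> "\<lambda>W. snd c ` (fst c \<inter> W)"] chart_open_image[OF c] U(1) by blast
 have "{x \<in> fst c. snd c x \<in> K} \<subseteq> \<Union> \<F>"
 proof
  fix x assume x: "x \<in> {x \<in> fst c. snd c x \<in> K}"
  then obtain W y where W: "W \<in> \<F>" "y \<in> fst c" "y \<in> W" "snd c x = snd c y" using F(3) by blast
  then have "x = y" using x inj_onD[OF chart_inj[OF c]] by blast
  then show "x \<in> \<Union> \<F>" using W by blast
 qed
 then show "\<exists>\<F>. finite \<F> \<and> \<F> \<subseteq> \<U> \<and> {x \<in> fst c. snd c x \<in> K} \<subseteq> \<Union> \<F>" using F by blast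
qed

lemma compactin_finite_cover:
 assumes K: "compactin X K" and loc: "\<And>p. p \<in> K \<Longrightarrow> \<exists>W. openin X W \<and> p \<in> W \<and> Q p W"
 obtains P W where "finite P" "P \<subseteq> K" "\<And>p. p \<in> P \<Longrightarrow> openin X (W p) \<and> p \<in> W p \<and> Q p (W p)" "K \<subseteq> (\<Union>p\<in>P. W p)"
proof -
 obtain W where W: "\<And>p. p \<in> K \<Longrightarrow> openin X (W p) \<and> p \<in> W p \<and> Q p (W p)" using loc by metis
 have *: "\<forall>T\<in>W ` K. openin X T" "K \<subseteq> \<Union> (W ` K)" using W by auto
 obtain \<F> where "finite \<F>" "\<F> \<subseteq> W ` K" "K \<subseteq> \<Union> \<F>" using K * unfolding compactin_def by metis
 moreover from this obtain P where P: "P \<subseteq> K" "finite P" "\<F> = W ` P" by (metis finite_subset_image)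
 ultimately show thesis by (intro that[OF P(2,1) W[OF subsetD[OF P(1)]]]) auto
qed

text \<open>Compatibility is stated against the atlas only, so the transition is factored locally
  through a chart of the atlas.\<close>

lemma compatible_transition:
 assumes X: "complex_manifold X A" and d: "compatible_chart X A d" and d': "compatible_chart X A d'"
 shows "open (snd d ` (fst d \<inter> fst d'))" "holo_on (snd d' \<circ> chart_inv d) (snd d ` (fst d \<inter> fst d'))"
proof -
 have ch: "is_chart X d" "is_chart X d'" using d d' by (simp_all add: compatible_chart_def)
 show o: "open (snd d ` (fst d \<inter> fst d'))" using ch(2) by (intro chart_open_image[OF ch(1)]) (simp add: is_chart_def)
 show "holo_on (snd d' \<circ> chart_inv d) (snd d ` (fst d \<inter> fst d'))" unfolding holo_on_def
 proof
  fix z assume "z \<in> snd d ` (fst d \<inter> fst d')"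
  then obtain x where x: "x \<in> fst d" "x \<in> fst d'" "z = snd d x" by auto
  obtain c where c: "c \<in> A" "x \<in> fst c" using good_param_compatible[OF X d] x(1) by (auto simp: good_param_def)
  have cc: "is_chart X c" using X c by (simp add: complex_manifold_def)
  let ?N = "snd d ` (fst d \<inter> (fst d' \<inter> fst c))"
  have N: "open ?N" "z \<in> ?N" using ch(2) cc x c by (auto intro!: chart_open_image[OF ch(1)] openin_Int simp: is_chart_def)
  have h: "holo_on (snd c \<circ> chart_inv d) ?N" "holo_on (snd d' \<circ> chart_inv c) (snd c ` (fst c \<inter> fst d'))"
   using d d' c unfolding compatible_chart_def holo_transition_def by (auto intro: holo_on_subset)
  have inv: "chart_inv d (snd d y) = y" if "y \<in> fst d" for y using chart_inj[OF ch(1)] that by simp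
  have invc: "chart_inv c (snd c y) = y" if "y \<in> fst c" for y using chart_inj[OF cc] that by simp
  have im: "(snd c \<circ> chart_inv d) ` ?N \<subseteq> snd c ` (fst c \<inter> fst d')" using inv by auto
  have "holo_on (snd d' \<circ> chart_inv d) ?N"
   by (rule holo_on_cong_open[OF holo_on_compose(1)[OF h im] N(1)]) (use inv invc in auto)
  then show "\<exists>D. (snd d' \<circ> chart_inv d has_derivative D) (at z) \<and> (\<forall>c v. D (c *s v) = c *s D v)" using N(2) unfolding holo_on_def by blast
 qed
qed

section \<open>Squared normal coordinates, their weights and their comparison\<close>

lemma norm_matrix_vector: "norm (M *v h) \<le> (\<Sum>i\<in>UNIV. \<Sum>j\<in>UNIV. cmod (M $ i $ j)) * norm (h :: complex^'n::finite)"
proof -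
 have "norm (M *v h) \<le> (\<Sum>i\<in>UNIV. cmod ((M *v h) $ i))" unfolding norm_vec_def by (rule L2_set_le_sum) simp
 also have "\<dots> \<le> (\<Sum>i\<in>UNIV. \<Sum>j\<in>UNIV. cmod (M $ i $ j) * norm h)"
  unfolding matrix_vector_mult_def vec_lambda_beta
  by (intro sum_mono order_trans[OF norm_sum]) (simp add: norm_mult mult_left_mono Finite_Cartesian_Product.norm_nth_le)
 finally show ?thesis by (simp add: sum_distrib_right)
qed

lemma holo_on_lipschitz:
 fixes F :: "complex^'n::finite \<Rightarrow> complex^'m::finite"
 assumes F: "holo_on F S" and S: "open S" "z0 \<in> S"
 shows "\<exists>r>0. \<exists>L\<ge>0. ball z0 r \<subseteq> S \<and> (\<forall>z\<in>ball z0 r. \<forall>z'\<in>ball z0 r. norm (F z - F z') \<le> L * norm (z - z'))"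
proof -
 obtain r where r: "r > 0" "cball z0 r \<subseteq> S" using S by (meson open_contains_cball)
 let ?f = "\<lambda>z. \<Sum>i\<in>UNIV. \<Sum>j\<in>UNIV. cmod (Jac F z $ i $ j)"
 have "continuous_on (cball z0 r) ?f" by (intro continuous_intros continuous_on_subset[OF Jac_continuous[OF F S(1)] r(2)])
 then obtain L where L: "\<And>z. z \<in> cball z0 r \<Longrightarrow> ?f z \<le> L"
  using continuous_attains_sup[OF compact_cball, of z0 r ?f] r(1) by force
 have L0: "0 \<le> L" using order_trans[OF _ L[of z0]] r(1) by (simp add: sum_nonneg)
 have "norm (F z - F z') \<le> L * norm (z - z')" if "z \<in> ball z0 r" "z' \<in> ball z0 r" for z z'
 proof (rule differentiable_bound[OF convex_ball _ _ that])
  fix y assume y: "y \<in> ball z0 r"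
  show "(F has_derivative (*v) (Jac F y)) (at y within ball z0 r)"
   by (rule has_derivative_at_withinI[OF holo_on_Jac[OF F]]) (use y r(2) in auto)
  show "onorm ((*v) (Jac F y)) \<le> L"
   by (rule onorm_bound[OF L0]) (use order_trans[OF norm_matrix_vector mult_right_mono[OF L]] y in auto)
 qed
 with r L0 show ?thesis by (intro exI[of _ r] conjI exI[of _ L]) auto
qed

definition nrm :: "('k::finite \<Rightarrow> 'n) \<Rightarrow> complex^'n::finite \<Rightarrow> real" where
 "nrm \<iota> z = (\<Sum>i\<in>- range \<iota>. (cmod (z $ i))\<^sup>2)"

definition cdiag :: "('k::finite \<Rightarrow> 'n) \<Rightarrow> complex^'n::finite^'n" where
 "cdiag \<iota> = (\<chi> i j. if i = j \<and> i \<notin> range \<iota> then 1 else 0)"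

lemma nrm_zero: "nrm \<iota> z = 0 \<longleftrightarrow> (\<forall>i. i \<notin> range \<iota> \<longrightarrow> z $ i = 0)" "0 \<le> nrm \<iota> z"
 unfolding nrm_def by (subst sum_nonneg_eq_0_iff) (auto simp: sum_nonneg)

lemma nrm_le_norm: "nrm \<iota> z \<le> (norm z)\<^sup>2"
 unfolding nrm_def norm_vec_def L2_set_def by (simp add: sum_nonneg) (rule sum_mono2; simp)

lemma hform_cdiag: "hform (cdiag \<iota>) w = of_real (nrm \<iota> w)"
proof -
 have "hform (cdiag \<iota>) w = (\<Sum>j\<in>UNIV. if j \<in> - range \<iota> then of_real ((cmod (w $ j))\<^sup>2) else 0)"
  unfolding hform_def
 proof (rule sum.cong[OF refl])
  fix j
  have "(\<Sum>k\<in>UNIV. cdiag \<iota> $ j $ k * w $ j * cnj (w $ k)) = (\<Sum>k\<in>UNIV. if k = j then (if j \<notin> range \<iota> then w $ j * cnj (w $ j) else 0) else 0)"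
   by (rule sum.cong) (auto simp: cdiag_def)
  then show "(\<Sum>k\<in>UNIV. cdiag \<iota> $ j $ k * w $ j * cnj (w $ k)) = (if j \<in> - range \<iota> then of_real ((cmod (w $ j))\<^sup>2) else 0)"
   by (simp add: complex_norm_square del: of_real_power)
 qed
 also have "\<dots> = (\<Sum>j\<in>- range \<iota>. of_real ((cmod (w $ j))\<^sup>2))" by (simp add: sum.If_cases Compl_eq)
 finally show ?thesis by (simp add: nrm_def)
qed

text \<open>The bound on the gradient is the Cauchy-Schwarz inequality in the normal coordinates,
  since the Levi form of \<open>nrm\<close> is \<open>nrm\<close> itself as a quadratic
  form.\<close>

lemma log_psh_nrm: "log_psh S (nrm \<iota>) (\<lambda>z. cdiag \<iota> *v cnjv z) (\<lambda>z. cdiag \<iota>)"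
proof -
 have h: "hermitian (cdiag \<iota>)" by (auto simp: hermitian_def cdiag_def)
 have "(cmod (dotp (cdiag \<iota> *v cnjv z) w))\<^sup>2 \<le> nrm \<iota> z * nrm \<iota> w" for z w
 proof -
  have "(cdiag \<iota> *v cnjv z) $ i = (\<Sum>j\<in>UNIV. if j = i then (if i \<in> - range \<iota> then cnj (z $ i) else 0) else 0)" for i
   unfolding matrix_vector_mult_def vec_lambda_beta by (rule sum.cong) (auto simp: cdiag_def cnjv_def)
  then have "(cdiag \<iota> *v cnjv z) $ i = (if i \<in> - range \<iota> then cnj (z $ i) else 0)" for i by simp
  then have "dotp (cdiag \<iota> *v cnjv z) w = (\<Sum>i\<in>UNIV. if i \<in> - range \<iota> then cnj (z $ i) * w $ i else 0)"
   unfolding dotp_def by (intro sum.cong) auto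
  also have "\<dots> = (\<Sum>i\<in>- range \<iota>. cnj (z $ i) * w $ i)" by (simp add: sum.If_cases Compl_eq)
  also have "cmod \<dots> \<le> (\<Sum>i\<in>- range \<iota>. \<bar>cmod (z $ i)\<bar> * \<bar>cmod (w $ i)\<bar>)"
   by (intro order_trans[OF norm_sum]) (simp add: norm_mult)
  also have "\<dots> \<le> L2_set (\<lambda>i. cmod (z $ i)) (- range \<iota>) * L2_set (\<lambda>i. cmod (w $ i)) (- range \<iota>)" by (rule L2_set_mult_ineq)
  finally have "(cmod (dotp (cdiag \<iota> *v cnjv z) w))\<^sup>2 \<le> (L2_set (\<lambda>i. cmod (z $ i)) (- range \<iota>) * L2_set (\<lambda>i. cmod (w $ i)) (- range \<iota>))\<^sup>2"
   by (rule power_mono) simp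
  then show ?thesis by (simp add: power_mult_distrib L2_set_def nrm_def sum_nonneg)
 qed
 then show ?thesis using has_levi_quad[OF h, of S] by (simp add: log_psh_def hform_cdiag nrm_zero(2))
qed

lemma log_psh_one: "log_psh S (\<lambda>_. 1) (\<lambda>_. 0) (\<lambda>_. 0)"
 by (simp add: log_psh_def has_levi_const dotp_simps)

lemma sqdist_levi: "\<exists>P L. has_levi UNIV (\<lambda>z. (norm (z - z0 :: complex^'n::finite))\<^sup>2) P L \<and> (\<forall>z b. qf (L z) b = (norm b)\<^sup>2)"
proof -
 let ?F = "\<lambda>z :: complex^'n. z - z0"
 have d: "(?F has_derivative (\<lambda>h. mat 1 *v h)) (at z)" for z by (auto intro!: derivative_eq_intros)
 then have h: "holo_on ?F UNIV" unfolding holo_on_def by (intro ballI exI[of _ "\<lambda>h. h"]) (auto intro!: derivative_eq_intros)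
 have L: "has_levi UNIV (\<lambda>z. qf (mat 1) (?F z)) (\<lambda>z. transpose (Jac ?F z) *v (mat 1 *v cnjv (?F z))) (\<lambda>z. pullback_matrix (Jac ?F z) (mat 1))"
  by (rule has_levi_compose[OF has_levi_quad[OF hermitian_simps(1)] h open_UNIV subset_UNIV])
 have "qf (pullback_matrix (Jac ?F z) (mat 1)) b = (norm b)\<^sup>2" for z b
  unfolding hform_pullback Jac_unique[OF d] by (simp add: hform_mat1)
 with L show ?thesis unfolding hform_mat1 Re_complex_of_real by blast
qed

definition peak :: "real \<Rightarrow> complex^'n::finite \<Rightarrow> (complex^'n \<Rightarrow> real) \<Rightarrow> complex^'n \<Rightarrow> real" where
 "peak m z0 G z = G z * exp (- (m * (norm (z - z0))\<^sup>2))"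

text \<open>At a zero of \<open>G\<close> the bound in \<open>log_psh\<close> makes the gradient
  \<open>P\<close> vanish as well, and the product rule leaves only the weight times
  \<open>L\<close>. So on \<open>V\<close> the weighted function penalizes the same directions as
  the unweighted one.\<close>

lemma peak_levi:
 assumes G: "log_psh S G P L"
 shows "\<exists>P' L'. has_levi S (peak m z0 G) P' L' \<and>
  (\<forall>z\<in>S. \<forall>v. G z = 0 \<longrightarrow> qf (L' z) v = exp (- (m * (norm (z - z0))\<^sup>2)) * qf (L z) v)"
proof -
 obtain Pq Lq where q: "has_levi UNIV (\<lambda>z. (norm (z - z0))\<^sup>2) Pq Lq" using sqdist_levi[of z0] by blast
 have GL: "has_levi S G P L" using G by (simp add: log_psh_def)
 let ?k = "\<lambda>x::real. exp (- (m * x))"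
 have e: "has_levi S (\<lambda>z. ?k ((norm (z - z0))\<^sup>2)) (\<lambda>z. (- m * ?k ((norm (z - z0))\<^sup>2)) *\<^sub>R Pq z)
  (\<lambda>z. (- m * ?k ((norm (z - z0))\<^sup>2)) *\<^sub>R Lq z + (m * m * ?k ((norm (z - z0))\<^sup>2)) *\<^sub>R outer (Pq z) (Pq z))"
  by (rule has_levi_chain[OF has_levi_subset[OF q subset_UNIV], where I=UNIV]) (auto intro!: derivative_eq_intros continuous_intros)
 have P0: "P z = 0" if "z \<in> S" "G z = 0" for z
  using G that by (intro dotp_zero_imp) (force simp: log_psh_def)
 show ?thesis unfolding peak_def[abs_def]
 proof (intro exI conjI, rule has_levi_mult[OF GL e], intro ballI allI impI, goal_cases)
  case (1 z v)
  then show ?case using P0[of z] by (simp add: hform_add hform_scaleR hform_outer dotp_simps)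
 qed
qed

lemma eln_mult_exp: "r \<ge> 0 \<Longrightarrow> eln (r * exp a) = eln r + ereal a"
 by (simp add: eln_def ln_mult zero_less_mult_iff)

lemma eln_mono: "r \<le> s \<Longrightarrow> eln r \<le> eln s"
 by (simp add: eln_def)

text \<open>The local pieces of the gluing: near points of \<open>V\<close> the squared norm of the normal coordinates, elsewhere the
 constant 1.\<close>

definition datum :: "'k::finite itself \<Rightarrow> 'a topology \<Rightarrow> ('a, 'n::finite) chart set \<Rightarrow> 'a set \<Rightarrow> ('a, 'n) chart \<Rightarrow> complex^'n \<Rightarrow> real \<Rightarrow> (complex^'n \<Rightarrow> real) \<Rightarrow> bool" where
 "datum _ X A V d z0 R G \<longleftrightarrow> compatible_chart X A d \<and> R > 0 \<and> cball z0 R \<subseteq> chart_image d \<and>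
   ((\<exists>\<iota> :: 'k \<Rightarrow> 'n. adapted_chart X A V \<iota> d \<and> G = nrm \<iota>) \<or> ((\<forall>x\<in>fst d. snd d x \<in> cball z0 R \<longrightarrow> x \<notin> V) \<and> G = (\<lambda>_. 1)))"

definition dball :: "('a, 'n::finite) chart \<Rightarrow> complex^'n \<Rightarrow> real \<Rightarrow> 'a set" where "dball d z0 R = {x \<in> fst d. snd d x \<in> ball z0 R}"
definition dcball :: "('a, 'n::finite) chart \<Rightarrow> complex^'n \<Rightarrow> real \<Rightarrow> 'a set" where "dcball d z0 R = {x \<in> fst d. snd d x \<in> cball z0 R}"

lemma datum_log_psh:
 assumes "datum TYPE('k::finite) X A V d z0 R G"
 shows "\<exists>P L. log_psh S G P L" "0 \<le> G z" "continuous_on S G"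
proof -
 show 1: "\<exists>P L. log_psh S G P L" for S using assms log_psh_nrm log_psh_one unfolding datum_def by metis
 show "0 \<le> G z" "continuous_on S G" using 1[of UNIV] has_levi_continuous continuous_on_subset unfolding log_psh_def by blast+
qed

lemma datum_zero:
 assumes X: "complex_manifold X A" "V \<subseteq> topspace X" and d: "datum TYPE('k::finite) X A V d z0 R G" and x: "x \<in> dcball d z0 R"
 shows "G (snd d x) = 0 \<longleftrightarrow> x \<in> V"
 using d unfolding datum_def
proof (elim conjE disjE exE)
 fix \<iota> :: "'k \<Rightarrow> 'b" assume a: "adapted_chart X A V \<iota> d" "G = nrm \<iota>"
 interpret adapted X A V \<iota> d using X a by unfold_locales
 show ?thesis using inV[of x] x a(2) by (simp add: nrm_zero dcball_def)
qed (use x in \<open>auto simp: dcball_def\<close>)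

lemma datum_exists:
 assumes X: "complex_manifold X A" and V: "closed_submanifold TYPE('k::finite) X A V" and p: "p \<in> topspace X"
 shows "\<exists>d R G. datum TYPE('k) X A V d (snd d p) R G \<and> p \<in> fst d"
proof (cases "p \<in> V")
 case True
 then obtain \<iota> :: "'k \<Rightarrow> 'b" and d where d: "adapted_chart X A V \<iota> d" "p \<in> fst d" using V unfolding closed_submanifold_def by blast
 then have "compatible_chart X A d" "open (chart_image d)" by (auto simp: adapted_chart_def compatible_chart_def is_chart_def)
 moreover from this obtain R where "R > 0" "cball (snd d p) R \<subseteq> chart_image d" using d(2) open_contains_cball by (metis imageI)
 ultimately show ?thesis using d unfolding datum_def by blast
next
 case False
 obtain c where c: "c \<in> A" "p \<in> fst c" using X p unfolding complex_manifold_def by blast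
 have cc: "is_chart X c" "compatible_chart X A c" using X c unfolding complex_manifold_def compatible_chart_def by auto
 let ?S = "snd c ` (fst c \<inter> (topspace X - V))"
 have "open ?S" using V by (intro chart_open_image[OF cc(1)]) (auto simp: closed_submanifold_def)
 moreover have "snd c p \<in> ?S" using c p False by blast
 ultimately obtain R where R: "R > 0" "cball (snd c p) R \<subseteq> ?S" using open_contains_cball by metis
 have "x \<notin> V" if "x \<in> fst c" "snd c x \<in> cball (snd c p) R" for x
 proof -
  obtain y where "y \<in> fst c" "y \<notin> V" "snd c x = snd c y" using R(2) \<open>snd c x \<in> _\<close> by blast
  then show ?thesis using inj_onD[OF chart_inj[OF cc(1)]] that(1) by metis
 qed
 then show ?thesis using R cc(2) c(2) unfolding datum_def by (intro exI[of _ c] exI[of _ R] exI[of _ "\<lambda>_. 1"]) auto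
qed

text \<open>Near a point off \<open>V\<close> the function \<open>G'\<close> is bounded below. Near
  a point of \<open>V\<close> both functions are squared distances to \<open>V\<close> in
  coordinates: dropping the normal coordinates of a point in \<open>d'\<close> gives a point of
  \<open>V\<close>, where \<open>G\<close> vanishes, at squared distance \<open>G'\<close>, and the
  transition is Lipschitz.\<close>

lemma datum_compare:
 assumes X: "complex_manifold X A" "V \<subseteq> topspace X" and d: "datum TYPE('k::finite) X A V d z0 R G" and d': "datum TYPE('k) X A V d' z0' R' G'"
  and p: "p \<in> dcball d z0 R" "p \<in> dcball d' z0' R'"
 shows "\<exists>W. openin X W \<and> p \<in> W \<and> (\<exists>K. \<forall>x\<in>W. x \<in> fst d \<and> x \<in> fst d' \<and> G (snd d x) \<le> K * G' (snd d' x))"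
proof (cases "p \<in> V")
 case False
 have ch: "is_chart X d" "is_chart X d'" using d d' by (auto simp: datum_def compatible_chart_def)
 define a where "a = G (snd d p) + 1"
 define b where "b = G' (snd d' p) / 2"
 have b: "b > 0" using datum_log_psh(2)[OF d', of "snd d' p"] datum_zero[OF X d' p(2)] False by (simp add: b_def less_le)
 have a: "a > 0" using datum_log_psh(2)[OF d, of "snd d p"] by (simp add: a_def)
 have o: "open {z. G z < a}" "open {z. b < G' z}"
  using datum_log_psh(3)[OF d, of UNIV] datum_log_psh(3)[OF d', of UNIV] by (auto intro!: open_Collect_less continuous_intros)
 let ?W = "{x \<in> fst d. snd d x \<in> {z. G z < a}} \<inter> {x \<in> fst d'. snd d' x \<in> {z. b < G' z}}"
 have "openin X ?W" by (intro openin_Int chart_open_preimage ch o)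
 moreover have "p \<in> ?W" using p b by (auto simp: dcball_def a_def b_def)
 moreover have "G (snd d x) \<le> a / b * G' (snd d' x)" if "x \<in> ?W" for x
 proof -
  have "a / b * b \<le> a / b * G' (snd d' x)" using that a b by (intro mult_left_mono) auto
  then show ?thesis using that b by simp
 qed
 ultimately show ?thesis by (intro exI[of _ ?W] conjI exI[of _ "a / b"]) auto
next
 case True
 obtain \<iota> :: "'k \<Rightarrow> 'b" where i: "adapted_chart X A V \<iota> d" "G = nrm \<iota>" using d p True unfolding datum_def dcball_def by blast
 obtain c :: "'k \<Rightarrow> 'b" where k: "adapted_chart X A V c d'" "G' = nrm c" using d' p True unfolding datum_def dcball_def by blast
 interpret D: adapted X A V \<iota> d using X i by unfold_locales
 interpret D': adapted X A V c d' using X k by unfold_locales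
 let ?F = "snd d \<circ> chart_inv d'" and ?M = "snd d' ` (fst d' \<inter> fst d)" and ?z = "snd d' p"
 note tr = compatible_transition[OF X(1) D'.comp D.comp]
 have pp: "p \<in> fst d" "p \<in> fst d'" using p by (auto simp: dcball_def)
 then obtain r L where r: "r > 0" "L \<ge> 0" "ball ?z r \<subseteq> ?M" "\<And>z z'. z \<in> ball ?z r \<Longrightarrow> z' \<in> ball ?z r \<Longrightarrow> norm (?F z - ?F z') \<le> L * norm (z - z')"
  using holo_on_lipschitz[OF tr(2,1), of ?z] by auto
 let ?W = "{x \<in> fst d'. snd d' x \<in> ball ?z r}"
 have "x \<in> fst d \<and> G (snd d x) \<le> L\<^sup>2 * G' (snd d' x)" if x: "x \<in> ?W" for x
 proof -
  let ?y = "snd d' x"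
  \<comment> \<open>\<open>?z\<close> has no normal coordinates, so the projected point is no
    farther from it than \<open>?y\<close> and stays in the ball.\<close>
  define y' where "y' = emb c (prj c ?y)"
  have y'i: "y' $ i = (if i \<in> range c then ?y $ i else 0)" for i
   unfolding y'_def by (auto simp: emb_def prj_def f_inv_into_f)
  have nn: "(norm (?y - y'))\<^sup>2 = nrm c ?y"
  proof -
   have "(norm (?y - y'))\<^sup>2 = (\<Sum>i\<in>UNIV. if i \<in> - range c then (cmod (?y $ i))\<^sup>2 else 0)"
    unfolding norm_vec_def L2_set_def by (simp add: sum_nonneg) (intro sum.cong; simp add: y'i)
   then show ?thesis by (simp add: nrm_def sum.If_cases Compl_eq)
  qed
  have z0: "?z $ i = 0" if "i \<notin> range c" for i using D'.inV[OF pp(2)] True that by blast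
  have "norm (y' - ?z) \<le> norm (?y - ?z)" unfolding norm_vec_def
   by (rule L2_set_mono) (auto simp: y'i z0)
  then have yb: "?y \<in> ball ?z r" "y' \<in> ball ?z r" using x by (auto simp: dist_norm norm_minus_commute)
  then obtain x' where x': "x' \<in> fst d'" "x' \<in> fst d" "y' = snd d' x'" using r(3) by blast
  obtain w where w: "w \<in> fst d'" "w \<in> fst d" "?y = snd d' w" using r(3) yb(1) by blast
  have wx: "w = x" using w x inj_onD[OF chart_inj[OF D'.chd]] by (metis (no_types, lifting) mem_Collect_eq)
  have "x' \<in> V" using D'.inV[OF x'(1)] y'i x'(3) by simp
  then have 0: "(?F y') $ i = 0" if "i \<notin> range \<iota>" for i using D.inV[OF x'(2)] that x' D'.invd by simp
  have "nrm \<iota> (?F ?y) = nrm \<iota> (?F ?y - ?F y')" unfolding nrm_def by (rule sum.cong) (use 0 in auto)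
  also have "\<dots> \<le> (norm (?F ?y - ?F y'))\<^sup>2" by (rule nrm_le_norm)
  also have "\<dots> \<le> (L * norm (?y - y'))\<^sup>2" by (rule power_mono[OF r(4)[OF yb]]) simp
  finally have le: "nrm \<iota> (?F ?y) \<le> L\<^sup>2 * nrm c ?y" unfolding power_mult_distrib nn .
  have "x \<in> fst d" "?F ?y = snd d x" using w(1,2) wx D'.invd[of x] by auto
  then show ?thesis using le unfolding i(2) k(2) by simp
 qed
 then show ?thesis using chart_open_preimage[OF D'.chd open_ball] pp r(1) by (intro exI[of _ ?W]) auto
qed

text \<open>The logarithm of the weighted function is ln G, which is plurisubharmonic, minus m |z -
  z0|^2; so t \<omega> only has to beat a quadratic term of size s m. All small \<open>s\<close> are
  covered because one factor must later serve all pieces.\<close>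

lemma upsh_eln:
 assumes X: "complex_manifold X A" and \<omega>: "kaehler_form A \<omega>" and d: "datum TYPE('k::finite) X A V d z0 R G" and m: "m \<ge> 0" and t: "t > 0"
 shows "\<exists>s0>0. \<forall>s B. 0 < s \<longrightarrow> s \<le> s0 \<longrightarrow> (\<forall>x\<in>dball d z0 R. upsh A \<omega> t (\<lambda>x. ereal s * eln (peak m z0 G (snd d x)) + ereal B) x)"
proof -
 have c: "compatible_chart X A d" and R: "R > 0" "cball z0 R \<subseteq> chart_image d" using d by (auto simp: datum_def)
 have cd: "is_chart X d" using c by (simp add: compatible_chart_def)
 have oI: "open (chart_image d)" using cd by (simp add: is_chart_def)
 have inv: "chart_inv d (snd d x) = x" if "x \<in> fst d" for x using chart_inj[OF cd] that by simp
 note pp = pullback_form_props[OF X \<omega> good_param_compatible[OF X c]]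
 let ?\<Omega> = "\<lambda>z. metr A \<omega> d (chart_inv d z)"
 let ?K = "cball z0 R \<times> sphere (0::complex^'b) 1"
 have cc: "continuous_on ?K (\<lambda>x. qf (?\<Omega> (fst x)) (snd x))"
  by (intro continuous_intros continuous_on_compose2[OF pp(3)]) (use R(2) in auto)
 have "compact ?K" "?K \<noteq> {}" using R(1) by (auto intro: compact_Times)
 from continuous_attains_inf[OF this cc] obtain x0 where x0: "x0 \<in> ?K" "\<And>x. x \<in> ?K \<Longrightarrow> qf (?\<Omega> (fst x0)) (snd x0) \<le> qf (?\<Omega> (fst x)) (snd x)"
  by blast
 define j where "j = qf (?\<Omega> (fst x0)) (snd x0)"
 have "chart_inv d (fst x0) \<in> fst d" "snd x0 \<noteq> 0" using x0(1) R(2) by (auto intro!: inv_into_into)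
 then have j: "j > 0" unfolding j_def by (rule pp(2))
 \<comment> \<open>\<open>j\<close> is the least value of \<omega> on unit vectors over the closed
   ball; \<open>m + 1\<close> in place of \<open>m\<close> gives strictness and covers
   \<open>m = 0\<close>.\<close>
 define s0 where "s0 = t * j / (m + 1)"
 have s0: "s0 > 0" using t j m by (simp add: s0_def)
 obtain P L where GL: "log_psh (chart_image d) G P L" using datum_log_psh(1)[OF d] by blast
 obtain Pq Lq where q: "has_levi UNIV (\<lambda>z. (norm (z - z0))\<^sup>2) Pq Lq" "\<And>z v. qf (Lq z) v = (norm v)\<^sup>2" using sqdist_levi[of z0] by blast
 have "upsh A \<omega> t (\<lambda>x. ereal s * eln (peak m z0 G (snd d x)) + ereal B) x" if s: "0 < s" "s \<le> s0" and x: "x \<in> dball d z0 R" for s B x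
 proof (rule upsh_at[OF X \<omega> c oI order_refl])
  show xd: "x \<in> fst d" "snd d x \<in> chart_image d" using x by (auto simp: dball_def)
  show "has_levi (chart_image d) (\<lambda>z. (s * m) * (norm (z - z0))\<^sup>2 + - B) (\<lambda>z. (s * m) *\<^sub>R Pq z + 0) (\<lambda>z. (s * m) *\<^sub>R Lq z + 0)"
   by (intro has_levi_add has_levi_const has_levi_scale has_levi_subset[OF q(1)] subset_UNIV)
  have "psh_coord (chart_image d) (\<lambda>z. ereal s * eln (G z))" by (rule psh_coord_scale[OF psh_coord_eln[OF GL oI] oI s(1)])
  then show "psh_coord (chart_image d) (\<lambda>z. (ereal s * eln (peak m z0 G (snd d (chart_inv d z))) + ereal B) + ereal ((s * m) * (norm (z - z0))\<^sup>2 + - B))"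
  proof (rule psh_coord_cong[OF _ oI])
   fix z assume "z \<in> chart_image d"
   then have "snd d (chart_inv d z) = z" by (rule f_inv_into_f)
   moreover have "eln (peak m z0 G z) = eln (G z) + ereal (- (m * (norm (z - z0))\<^sup>2))"
    unfolding peak_def by (rule eln_mult_exp[OF datum_log_psh(2)[OF d]])
   ultimately show "ereal s * eln (G z) = (ereal s * eln (peak m z0 G (snd d (chart_inv d z))) + ereal B) + ereal ((s * m) * (norm (z - z0))\<^sup>2 + - B)"
    using s(1) by (cases "eln (G z)") (auto simp: algebra_simps)
  qed
  fix v :: "complex^'b" assume v: "v \<noteq> 0"
  let ?Q = "t *\<^sub>R ?\<Omega> (snd d x) + - ((s * m) *\<^sub>R Lq (snd d x))"
  have Q: "qf ?Q e = t * qf (?\<Omega> (snd d x)) e - s * m * (norm e)\<^sup>2" for e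
   by (simp only: hform_add hform_minus hform_scaleR) (simp add: q(2))
  have "0 < qf ?Q v"
  proof (rule hform_pos_sphere[OF _ v])
   fix e :: "complex^'b" assume e: "norm e = 1"
   have "s * m \<le> s0 * m" using s(2) m by (rule mult_right_mono)
   also have "\<dots> = t * j * (m / (m + 1))" by (simp add: s0_def)
   also have "\<dots> < t * j * 1" using t j m by (intro mult_strict_left_mono) auto
   also have "\<dots> \<le> t * qf (?\<Omega> (snd d x)) e"
    using x0(2)[of "(snd d x, e)"] x e t by (auto simp: j_def dball_def intro!: mult_left_mono)
   finally show "0 < qf ?Q e" unfolding Q using e by simp
  qed
  then show "qf ((s * m) *\<^sub>R Lq (snd d x) + 0) v < t * qf (metr A \<omega> d x) v"
   by (simp add: hform_scaleR hform_diff q(2) inv[OF xd(1)])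
 qed
 with s0 show ?thesis by blast
qed

text \<open>For a constant piece the closed ball misses \<open>V\<close> and the claim is vacuous.
  For normal coordinates the compact set in \<open>upsh_retraction\<close> is the zero set of
  \<open>nrm\<close> in the closed ball.\<close>

lemma datum_retraction:
 assumes X: "complex_manifold X A" "V \<subseteq> topspace X" and \<omega>: "kaehler_form A \<omega>"
  and \<pi>: "holomorphic_retraction TYPE('k::finite) X A U V \<pi>" and U: "openin X U" "V \<subseteq> U" and s: "s < t"
  and psh: "\<And>(\<iota> :: 'k \<Rightarrow> 'n) d p. adapted_chart X A V \<iota> d \<Longrightarrow> p \<in> fst (vchart V \<iota> d) \<Longrightarrow> \<exists>r>0. ball (snd (vchart V \<iota> d) p) r \<subseteq> chart_image (vchart V \<iota> d) \<and>
    psh_coord (ball (snd (vchart V \<iota> d) p) r) (\<lambda>z. \<phi> (chart_inv (vchart V \<iota> d) z) + ereal (qf (s *\<^sub>R metr A \<omega> (vchart V \<iota> d) p) z))"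
  and d: "datum TYPE('k) X A V (d :: ('a, 'n::finite) chart) z0 R G"
 shows "\<exists>C\<ge>0. \<forall>C'\<ge>C. \<forall>p\<in>V \<inter> dcball d z0 R. \<exists>W. openin X W \<and> p \<in> W \<and> W \<subseteq> fst d \<and> (\<forall>x\<in>W. upsh A \<omega> t (\<lambda>x. \<phi> (\<pi> x) + ereal (C' * peak m z0 G (snd d x))) x)"
 using d unfolding datum_def
proof (elim conjE disjE exE)
 fix \<iota> :: "'k \<Rightarrow> 'n" assume a: "adapted_chart X A V \<iota> d" "G = nrm \<iota>" and R: "cball z0 R \<subseteq> chart_image d"
 interpret adapted X A V \<iota> d using X a by unfold_locales
 let ?K = "V \<inter> dcball d z0 R"
 obtain P L where L: "has_levi (chart_image d) (peak m z0 G) P L"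
  "\<And>z v. z \<in> chart_image d \<Longrightarrow> nrm \<iota> z = 0 \<Longrightarrow> qf (L z) v = exp (- (m * (norm (z - z0))\<^sup>2)) * nrm \<iota> v"
  using peak_levi[OF log_psh_nrm[of "chart_image d" \<iota>], of m z0] unfolding a(2) hform_cdiag Re_complex_of_real by blast
 have "snd d ` ?K = cball z0 R \<inter> {z. nrm \<iota> z = 0}"
 proof (intro set_eqI iffI)
  fix z assume z: "z \<in> cball z0 R \<inter> {z. nrm \<iota> z = 0}"
  then have "z \<in> snd d ` (fst d \<inter> V)" unfolding im using R by (auto simp: nrm_zero)
  then show "z \<in> snd d ` ?K" using z by (auto simp: dcball_def)
 qed (auto simp: dcball_def nrm_zero inV)
 moreover have "closed {z. nrm \<iota> z = 0}" unfolding nrm_def by (intro closed_Collect_eq continuous_intros)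
 ultimately have K: "compact (snd d ` ?K)" by (simp add: compact_Int_closed)
 show ?thesis
 proof (rule upsh_retraction[OF \<omega> \<pi> U psh[OF a(1)] s L(1) _ K])
  fix p v assume p: "p \<in> fst d" "p \<in> V"
  then have "qf (L (snd d p)) v = exp (- (m * (norm (snd d p - z0))\<^sup>2)) * nrm \<iota> v" using inV by (intro L(2)) (auto simp: nrm_zero)
  then show "0 \<le> qf (L (snd d p)) v \<and> (qf (L (snd d p)) v = 0 \<longrightarrow> (\<forall>i. i \<notin> range \<iota> \<longrightarrow> v $ i = 0))"
   by (simp add: nrm_zero)
 qed (auto simp: dcball_def)
qed (auto simp: dcball_def intro!: exI[of _ 0])

lemma datum_compactin:
 assumes d: "datum TYPE('k::finite) X A V d z0 R G"
 shows "compactin X (dcball d z0 R)"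
proof -
 have "is_chart X d" "cball z0 R \<subseteq> chart_image d" using d unfolding datum_def compatible_chart_def by blast+
 then show ?thesis unfolding dcball_def by (rule chart_compactin[OF _ compact_cball])
qed

text \<open>The intersection of two closed balls is compact, so finitely many of the local constants
  from \<open>datum_compare\<close> suffice.\<close>

lemma datum_dominate:
 assumes X: "complex_manifold X A" "compact_space X" "V \<subseteq> topspace X" and d: "datum TYPE('k::finite) X A V d z0 R G" and d': "datum TYPE('k) X A V d' z0' R' G'"
 shows "\<exists>K. \<forall>x\<in>dcball d z0 R \<inter> dcball d' z0' R'. G (snd d x) \<le> K * G' (snd d' x)"
proof -
 have "compactin X (dcball d z0 R)" "compactin X (dcball d' z0' R')"
  by (rule datum_compactin[OF d] datum_compactin[OF d'])+
 then have "compactin X (dcball d z0 R \<inter> dcball d' z0' R')"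
  using X(1) by (intro closed_Int_compactin compactin_imp_closedin) (auto simp: complex_manifold_def)
 then obtain P W where P: "finite P" "P \<subseteq> dcball d z0 R \<inter> dcball d' z0' R'"
  "\<And>p. p \<in> P \<Longrightarrow> openin X (W p) \<and> p \<in> W p \<and> (\<exists>K. \<forall>x\<in>W p. x \<in> fst d \<and> x \<in> fst d' \<and> G (snd d x) \<le> K * G' (snd d' x))"
  "dcball d z0 R \<inter> dcball d' z0' R' \<subseteq> (\<Union>p\<in>P. W p)"
  by (rule compactin_finite_cover[where Q="\<lambda>p W. \<exists>K. \<forall>x\<in>W. x \<in> fst d \<and> x \<in> fst d' \<and> G (snd d x) \<le> K * G' (snd d' x)"])
   (use datum_compare[OF X(1,3) d d'] in auto)
 then obtain K where K: "\<And>p x. p \<in> P \<Longrightarrow> x \<in> W p \<Longrightarrow> G (snd d x) \<le> K p * G' (snd d' x)" by metis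
 show ?thesis
 proof (intro exI[of _ "\<Sum>p\<in>P. \<bar>K p\<bar>"] ballI)
  fix x assume "x \<in> dcball d z0 R \<inter> dcball d' z0' R'"
  then obtain p where p: "p \<in> P" "x \<in> W p" using P(4) by blast
  have "K p \<le> (\<Sum>p\<in>P. \<bar>K p\<bar>)" using member_le_sum[of p P "\<lambda>p. \<bar>K p\<bar>"] p(1) P(1) by simp
  from order_trans[OF K[OF p] mult_right_mono[OF this datum_log_psh(2)[OF d']]]
  show "G (snd d x) \<le> (\<Sum>p\<in>P. \<bar>K p\<bar>) * G' (snd d' x)" .
 qed
qed

text \<open>The index set of the maximum changes with \<open>x\<close>. An index that is inactive at
  \<open>p\<close> can become active nearby only if \<open>p\<close> lies in the closed set
  \<open>Wc g\<close> but not in \<open>W g\<close>; then \<open>dom\<close> supplies an index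
  active at \<open>p\<close> whose piece is at least as large. So near \<open>p\<close> only the
  indices active at \<open>p\<close> count.\<close>

lemma local_Max:
 fixes E :: "'i \<Rightarrow> 'a \<Rightarrow> real"
 assumes I: "finite I" and W: "\<And>g. g \<in> I \<Longrightarrow> openin X (W g)" "\<And>g. g \<in> I \<Longrightarrow> closedin X (Wc g)" "\<And>g. g \<in> I \<Longrightarrow> W g \<subseteq> Wc g"
  and p: "p \<in> topspace X" "\<exists>b\<in>I. p \<in> W b"
  and dom: "\<And>g. g \<in> I \<Longrightarrow> p \<in> Wc g \<Longrightarrow> p \<notin> W g \<Longrightarrow> \<exists>b\<in>I. p \<in> W b \<and> (\<exists>N. openin X N \<and> p \<in> N \<and> (\<forall>x\<in>N. x \<in> W g \<longrightarrow> x \<in> W b \<longrightarrow> E g x \<le> E b x))"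
 shows "\<exists>N. openin X N \<and> p \<in> N \<and> (\<forall>x\<in>N. {g\<in>I. p \<in> W g} \<subseteq> {g\<in>I. x \<in> W g} \<and>
   Max ((\<lambda>g. E g x) ` {g\<in>I. x \<in> W g}) = Max ((\<lambda>g. E g x) ` {g\<in>I. p \<in> W g}))"
proof -
 have "\<exists>N. openin X N \<and> p \<in> N \<and> (\<forall>x\<in>N. (p \<in> W g \<longrightarrow> x \<in> W g) \<and> (p \<notin> W g \<longrightarrow> x \<in> W g \<longrightarrow> (\<exists>b\<in>I. p \<in> W b \<and> (x \<in> W b \<longrightarrow> E g x \<le> E b x))))"
  if g: "g \<in> I" for g
 proof -
  consider "p \<in> W g" | "p \<notin> Wc g" | "p \<in> Wc g" "p \<notin> W g" by blast
  then show ?thesis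
  proof cases
   case 1
   then show ?thesis using W(1)[OF g] by blast
  next
   case 2
   then show ?thesis using W(2,3)[OF g] p(1) by (intro exI[of _ "topspace X - Wc g"]) auto
  next
   case 3
   then show ?thesis using dom[OF g] by metis
  qed
 qed
 then obtain N where N: "\<And>g. g \<in> I \<Longrightarrow> openin X (N g) \<and> p \<in> N g" "\<And>g x. g \<in> I \<Longrightarrow> x \<in> N g \<Longrightarrow> (p \<in> W g \<longrightarrow> x \<in> W g) \<and> (p \<notin> W g \<longrightarrow> x \<in> W g \<longrightarrow> (\<exists>b\<in>I. p \<in> W b \<and> (x \<in> W b \<longrightarrow> E g x \<le> E b x)))"
  by metis
 let ?N = "(\<Inter>g\<in>I. N g) \<inter> topspace X"
 have "openin X ?N" using N(1) I by (intro openin_INT) auto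
 moreover have "Max ((\<lambda>g. E g x) ` {g\<in>I. x \<in> W g}) = Max ((\<lambda>g. E g x) ` {g\<in>I. p \<in> W g})" if x: "x \<in> ?N" for x
 proof (rule antisym)
  have sub: "{g\<in>I. p \<in> W g} \<subseteq> {g\<in>I. x \<in> W g}" using N(2) x by auto
  show "Max ((\<lambda>g. E g x) ` {g\<in>I. p \<in> W g}) \<le> Max ((\<lambda>g. E g x) ` {g\<in>I. x \<in> W g})"
   using sub p(2) I by (intro Max_mono image_mono) auto
  show "Max ((\<lambda>g. E g x) ` {g\<in>I. x \<in> W g}) \<le> Max ((\<lambda>g. E g x) ` {g\<in>I. p \<in> W g})"
  proof (rule Max.boundedI)
   fix y assume "y \<in> (\<lambda>g. E g x) ` {g\<in>I. x \<in> W g}"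
   then obtain g where g: "g \<in> I" "x \<in> W g" "y = E g x" by auto
   have "\<exists>b\<in>{g\<in>I. p \<in> W g}. E g x \<le> E b x"
   proof (cases "p \<in> W g")
    case False
    then obtain b where b: "b \<in> I" "p \<in> W b" "x \<in> W b \<longrightarrow> E g x \<le> E b x" using N(2)[OF g(1), of x] x g by auto
    then show ?thesis using sub by blast
   qed (use g in auto)
   then obtain b where b: "b \<in> {g\<in>I. p \<in> W g}" "E g x \<le> E b x" by blast
   have "E b x \<le> Max ((\<lambda>g. E g x) ` {g\<in>I. p \<in> W g})" using b(1) I by (intro Max_ge) auto
   then show "y \<le> Max ((\<lambda>g. E g x) ` {g\<in>I. p \<in> W g})" using b(2) g(3) by linarith
  qed (use I sub p(2) in auto)
 qed
 ultimately show ?thesis using N p(1) by (intro exI[of _ ?N]) auto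
qed

lemma upsh_Max:
 assumes "finite I" "I \<noteq> {}" "\<And>g. g \<in> I \<Longrightarrow> upsh A \<omega> t (v g) p"
 shows "upsh A \<omega> t (\<lambda>x. Max ((\<lambda>g. v g x) ` I)) p"
 using assms
proof (induction I rule: finite_ne_induct)
 case (insert g I)
 have "upsh A \<omega> t (\<lambda>x. max (v g x) (Max ((\<lambda>g. v g x) ` I))) p" by (intro upsh_max insert) auto
 then show ?case using insert.hyps by simp
qed simp

lemma quasi_psh_bounded_above:
 fixes Y :: "'a topology"
 assumes K: "compact_space Y" and A: "\<And>c. c \<in> A \<Longrightarrow> is_chart Y c" "topspace Y \<subseteq> \<Union> (fst ` A)" and q: "quasi_psh Y A \<phi>"
 shows "\<exists>B::real. \<forall>x\<in>topspace Y. \<phi> x \<le> ereal B"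
proof -
 have loc: "\<exists>W. openin Y W \<and> p \<in> W \<and> (\<exists>B::real. \<forall>x\<in>W. \<phi> x \<le> ereal B)" if p: "p \<in> topspace Y" for p
 proof -
  obtain c where c: "c \<in> A" "p \<in> fst c" using A(2) p by auto
  note ch = A(1)[OF c(1)]
  obtain W u f where W: "openin Y W" "p \<in> W" "psh_on A W u" "smooth_function_on A W f" "\<forall>x\<in>W. \<phi> x = u x + ereal (f x)"
   using q p unfolding quasi_psh_def by blast
  let ?S = "snd c ` (fst c \<inter> W)"
  have S: "open ?S" by (rule chart_open_image[OF ch W(1)])
  have u: "psh_coord ?S (u \<circ> chart_inv c)" using W(3) c unfolding psh_on_def by blast
  have f: "continuous_on ?S (f \<circ> chart_inv c)"
   using W(4) c Ck_on.simps(1)[of "f \<circ> chart_inv c" ?S] unfolding smooth_function_on_def smooth_on_def by blast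
  have inv: "chart_inv c (snd c x) = x" if "x \<in> fst c" for x using chart_inj[OF ch] that by simp
  have "\<phi> p < \<infinity>" using q p unfolding quasi_psh_def by blast
  then obtain m where m: "\<phi> p < ereal m" using ereal_dense2[of "\<phi> p" \<infinity>] by blast
  let ?T = "{z\<in>?S. (u \<circ> chart_inv c) z + ereal ((f \<circ> chart_inv c) z) < ereal m}"
  have "open ?T" by (rule usc_add[OF psh_coord_usc[OF u S] S f])
  then have "openin Y {x \<in> fst c. snd c x \<in> ?T}" by (rule chart_open_preimage[OF ch])
  moreover have "\<phi> x \<le> ereal m" if x: "x \<in> fst c" "snd c x \<in> ?T" for x
  proof -
   obtain y where "y \<in> fst c" "y \<in> W" "snd c x = snd c y" using x(2) by blast
   then have "x \<in> W" using inv x(1) by metis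
   then show ?thesis using x inv W(5) by (auto intro: less_imp_le)
  qed
  moreover have "snd c p \<in> ?T" using c W(2,5) m inv by auto
  ultimately show ?thesis using c(2) by (intro exI[of _ "{x \<in> fst c. snd c x \<in> ?T}"]) blast
 qed
 have "compactin Y (topspace Y)" using K by (simp add: compact_space_def)
 then obtain P and W :: "'a \<Rightarrow> 'a set" where P: "finite P" "\<And>p. p \<in> P \<Longrightarrow> \<exists>B::real. \<forall>x\<in>W p. \<phi> x \<le> ereal B" "topspace Y \<subseteq> (\<Union>p\<in>P. W p)"
  by (rule compactin_finite_cover[OF _ loc]) blast+
 then obtain B where B: "\<And>p x. p \<in> P \<Longrightarrow> x \<in> W p \<Longrightarrow> \<phi> x \<le> ereal (B p)" by metis
 show ?thesis
 proof (intro exI[of _ "\<Sum>p\<in>P. \<bar>B p\<bar>"] ballI)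
  fix x assume "x \<in> topspace Y"
  then obtain p where p: "p \<in> P" "x \<in> W p" using P(3) by blast
  have "B p \<le> (\<Sum>p\<in>P. \<bar>B p\<bar>)" using member_le_sum[of p P "\<lambda>p. \<bar>B p\<bar>"] p(1) P(1) by simp
  then show "\<phi> x \<le> ereal (\<Sum>p\<in>P. \<bar>B p\<bar>)" using order_trans[OF B[OF p]] by simp
 qed
qed

theorem theorem1p1:
  fixes X :: "'a topology"
    and A :: "('a, 'n::finite) chart set"
    and \<omega> :: "('a, 'n) form11"
    and V U :: "'a set"
    and AV :: "('a, 'k::finite) chart set"
    and \<omega>V :: "('a, 'k) form11"
    and \<phi> :: "'a \<Rightarrow> ereal"
    and \<pi> :: "'a \<Rightarrow> 'a"
  assumes "compact_kaehler_manifold X A \<omega>"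
    and "closed_submanifold TYPE('k) X A V"
    and "AV = submanifold_atlas X A V"
    and "\<omega>V = pullback_form A (\<lambda>x. x) \<omega>"
    and "quasi_psh (subtopology X V) AV \<phi>"
    and "\<exists>\<epsilon>>0. current_ge AV (current_add (current_of_form \<omega>V) (i_ddbar \<phi>))
                              (current_scale \<epsilon> (current_of_form \<omega>V))"
    and "openin X U" and "V \<subseteq> U"
    and "holomorphic_retraction TYPE('k) X A U V \<pi>"
  shows "\<exists>\<Phi>. quasi_psh X A \<Phi> \<and> (\<forall>x\<in>V. \<Phi> x = \<phi> x) \<and>
           (\<exists>\<epsilon>'>0. current_ge A (current_add (current_of_form \<omega>) (i_ddbar \<Phi>))
                                (current_scale \<epsilon>' (current_of_form \<omega>)))"
proof -
 have X: "complex_manifold X A" and cX: "compact_space X" and \<omega>: "kaehler_form A \<omega>"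
  using assms(1) by (auto simp: compact_kaehler_manifold_def)
 have clV: "closedin X V" using assms(2) by (simp add: closed_submanifold_def)
 then have VX: "V \<subseteq> topspace X" by (rule closedin_subset)
 obtain \<epsilon> where \<epsilon>: "\<epsilon> > 0" and cur: "current_ge AV (current_add (current_of_form \<omega>V) (i_ddbar \<phi>)) (current_scale \<epsilon> (current_of_form \<omega>V))"
  using assms(6) by blast
 \<comment> \<open>The 1/2 keeps \<open>s\<close> and \<open>t\<close> positive when \<epsilon> is
   large; \<open>t\<close> is the midpoint of \<open>s\<close> and 1.\<close>
 define s where "s = max (1 - \<epsilon>/2) (1/2)"
 define t where "t = (1 + s) / 2"
 have st: "1 - \<epsilon> < s" "s < t" "0 < t" "t < 1" using \<epsilon> by (auto simp: s_def t_def max_def)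

 \<comment> \<open>The data on V in local form\<close>
 have covV: "V \<subseteq> \<Union> (fst ` AV)"
 proof
  fix p assume "p \<in> V"
  then obtain \<iota> :: "'k \<Rightarrow> 'n" and d where d: "adapted_chart X A V \<iota> d" "p \<in> fst d" using assms(2) unfolding closed_submanifold_def by blast
  interpret adapted X A V \<iota> d using X d VX by unfold_locales
  show "p \<in> \<Union> (fst ` AV)" using e_in d(2) \<open>p \<in> V\<close> unfolding assms(3) by (force simp: fst_e)
 qed
 have chV: "is_chart (subtopology X V) c" if c: "c \<in> AV" for c
 proof -
  obtain d and \<iota> :: "'k \<Rightarrow> 'n" where d: "adapted_chart X A V \<iota> d" "c = vchart V \<iota> d"
   using c unfolding assms(3) submanifold_atlas_def vchart_def prj_def by blast
  interpret adapted X A V \<iota> d using X d VX by unfold_locales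
  show ?thesis unfolding d(2) by (rule is_chart_e)
 qed
 have psh: "\<exists>r>0. ball (snd (vchart V \<iota> d) p) r \<subseteq> chart_image (vchart V \<iota> d) \<and>
    psh_coord (ball (snd (vchart V \<iota> d) p) r) (\<lambda>z. \<phi> (chart_inv (vchart V \<iota> d) z) + ereal (qf (s *\<^sub>R metr A \<omega> (vchart V \<iota> d) p) z))"
  if d: "adapted_chart X A V \<iota> d" and p: "p \<in> fst (vchart V \<iota> d)" for \<iota> :: "'k \<Rightarrow> 'n" and d p
 proof -
  interpret adapted X A V \<iota> d using X d VX by unfold_locales
  show ?thesis
   using psh_near_V[OF \<omega> covV[unfolded assms(3)] chV[unfolded assms(3)] assms(5)[unfolded assms(3)] cur[unfolded assms(3,4)] p st(1)] .
 qed
 have piV: "\<pi> x \<in> V" if "x \<in> U" for x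
  using assms(9) that openin_subset[OF assms(7)] VX unfolding holomorphic_retraction_def holomorphic_map_def continuous_map_def
  by (auto simp: Pi_iff)
 have piid: "\<pi> x = x" if "x \<in> V" for x using assms(9) that by (simp add: holomorphic_retraction_def)
 obtain B1 where B1: "\<And>x. x \<in> V \<Longrightarrow> \<phi> x \<le> ereal B1"
 proof -
  have "compact_space (subtopology X V)" using closedin_compact_space[OF cX clV] by (simp add: compact_space_subtopology)
  from quasi_psh_bounded_above[OF this chV _ assms(5)] covV VX that show thesis by (auto simp: Int_absorb1)
 qed

 \<comment> \<open>A finite cover by coordinate balls\<close>
 obtain d R G where D: "\<And>p. p \<in> topspace X \<Longrightarrow> datum TYPE('k) X A V (d p) (snd (d p) p) (R p) (G p) \<and> p \<in> fst (d p)"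
  using datum_exists[OF X assms(2)] by metis
 define z where "z p = snd (d p) p" for p
 define W where "W g = dball (d g) (z g) (R g)" for g
 define Wc where "Wc g = dcball (d g) (z g) (R g)" for g
 have data: "datum TYPE('k) X A V (d g) (z g) (R g) (G g)" "is_chart X (d g)" "R g > 0" if "g \<in> topspace X" for g
  using D[OF that] by (auto simp: z_def datum_def compatible_chart_def)
 \<comment> \<open>The half balls already cover, so every point lies well inside some ball, where
   the weight of that ball has hardly decayed.\<close>
 obtain I where I: "finite I" "I \<subseteq> topspace X" "topspace X \<subseteq> (\<Union>p\<in>I. dball (d p) (z p) (R p / 2))"
 proof -
  have "\<exists>W. openin X W \<and> p \<in> W \<and> W = dball (d p) (z p) (R p / 2)" if p: "p \<in> topspace X" for p
   using chart_open_preimage[OF data(2)[OF p] open_ball, of "z p" "R p / 2"] D[OF p] data(3)[OF p]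
   by (auto simp: dball_def z_def mem_ball)
  moreover have "compactin X (topspace X)" using cX by (simp add: compact_space_def)
  ultimately obtain P W where "finite P" "P \<subseteq> topspace X" "\<And>p. p \<in> P \<Longrightarrow> W p = dball (d p) (z p) (R p / 2)" "topspace X \<subseteq> (\<Union>p\<in>P. W p)"
   using compactin_finite_cover[of X "topspace X" "\<lambda>p W. W = dball (d p) (z p) (R p / 2)"] by metis
  then show thesis by (intro that) auto
 qed
 have dat: "datum TYPE('k) X A V (d g) (z g) (R g) (G g)" and chd: "is_chart X (d g)" and R0: "R g > 0" if "g \<in> I" for g
  using data I(2) that by auto
 have WWc: "W g \<subseteq> Wc g" for g by (auto simp: W_def Wc_def dball_def dcball_def)
 have oW: "openin X (W g)" if "g \<in> I" for g unfolding W_def dball_def by (rule chart_open_preimage[OF chd[OF that] open_ball])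
 have clW: "closedin X (Wc g)" if "g \<in> I" for g
  unfolding Wc_def using X by (intro compactin_imp_closedin datum_compactin[OF dat[OF that]]) (simp add: complex_manifold_def)
 have act: "\<exists>b\<in>I. p \<in> dball (d b) (z b) (R b / 2) \<and> p \<in> W b" if p: "p \<in> topspace X" for p
 proof -
  obtain b where b: "b \<in> I" "p \<in> dball (d b) (z b) (R b / 2)" using I(3) p by blast
  then show ?thesis using R0[OF b(1)] by (intro bexI[of _ b]) (auto simp: W_def dball_def)
 qed

 \<comment> \<open>The weights and the global maximum \<open>EE\<close>\<close>
 obtain Kd where Kd: "\<And>g b x. g \<in> I \<Longrightarrow> b \<in> I \<Longrightarrow> x \<in> Wc g \<Longrightarrow> x \<in> Wc b \<Longrightarrow> G g (snd (d g) x) \<le> Kd g b * G b (snd (d b) x)"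
  using datum_dominate[OF X cX VX dat dat] unfolding Wc_def by (metis IntI)
 define K where "K = 1 + (\<Sum>g\<in>I. \<Sum>b\<in>I. \<bar>Kd g b\<bar>)"
 have K1: "K \<ge> 1" unfolding K_def by (simp add: sum_nonneg)
 have KK: "Kd g b \<le> K" if "g \<in> I" "b \<in> I" for g b
 proof -
  have "\<bar>Kd g b\<bar> \<le> (\<Sum>b\<in>I. \<bar>Kd g b\<bar>)" using that I(1) by (intro member_le_sum) auto
  also have "\<dots> \<le> (\<Sum>g\<in>I. \<Sum>b\<in>I. \<bar>Kd g b\<bar>)" using that I(1) by (intro member_le_sum) (auto intro: sum_nonneg)
  finally show ?thesis by (simp add: K_def)
 qed
 txt \<open>The weight \<open>exp (- M |z|\<^sup>2 / R\<^sup>2)\<close> drops by a factor of at least \<open>K\<close> from the half ball to the boundary, so that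
  near a boundary point of a ball some other piece dominates.\<close>
 define M where "M = 2 * ln K + 2"
 have M: "M \<ge> 0" "K * exp (- (M/2)) \<le> 1"
 proof -
  show "M \<ge> 0" using K1 by (simp add: M_def)
  have "K * exp (- (M/2)) = K * (exp (- 1) / exp (ln K))" by (simp add: M_def add_divide_distrib flip: exp_diff)
  also have "\<dots> = exp (- 1)" using K1 by simp
  also have "\<dots> \<le> 1" using K1 by simp
  finally show "K * exp (- (M/2)) \<le> 1" .
 qed
 define m where "m g = M / (R g)\<^sup>2" for g
 have m0: "m g \<ge> 0" for g using M(1) by (simp add: m_def)
 define E where "E g x = peak (m g) (z g) (G g) (snd (d g) x)" for g x
 have E0: "0 \<le> E g x" if "g \<in> I" for g x unfolding E_def peak_def using datum_log_psh(2)[OF dat[OF that]] by simp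
 have oE: "openin X {x \<in> fst (d g). E g x < a}" "openin X {x \<in> fst (d g). a < E g x}" if "g \<in> I" for g a
 proof -
  have c: "continuous_on UNIV (peak (m g) (z g) (G g))"
   unfolding peak_def[abs_def] by (intro continuous_intros datum_log_psh(3)[OF dat[OF that]])
  have "open {y. peak (m g) (z g) (G g) y < a}" "open {y. a < peak (m g) (z g) (G g) y}"
   by (intro open_Collect_less c continuous_on_const)+
  from this[THEN chart_open_preimage[OF chd[OF that]]] show "openin X {x \<in> fst (d g). E g x < a}" "openin X {x \<in> fst (d g). a < E g x}"
   by (simp_all add: E_def)
 qed
 define a where "a p = {g\<in>I. p \<in> W g}" for p
 have a: "finite (a p)" "p \<in> topspace X \<Longrightarrow> a p \<noteq> {}" for p using I(1) act[of p] by (auto simp: a_def)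
 define EE where "EE x = Max ((\<lambda>g. E g x) ` a x)" for x
 have EE_ge: "E g x \<le> EE x" if "g \<in> I" "x \<in> W g" for g x
  unfolding EE_def using that a(1) by (intro Max_ge) (auto simp: a_def)
 have EE_in: "\<exists>g\<in>a x. EE x = E g x" if "x \<in> topspace X" for x
 proof -
  have "EE x \<in> (\<lambda>g. E g x) ` a x" unfolding EE_def using a(1) a(2)[OF that] by (intro Max_in) auto
  then show ?thesis by blast
 qed
 have loc: "\<exists>N. openin X N \<and> p \<in> N \<and> (\<forall>x\<in>N. a p \<subseteq> a x \<and> EE x = Max ((\<lambda>g. E g x) ` a p))" if p: "p \<in> topspace X" for p
  unfolding EE_def a_def
 proof (rule local_Max[OF I(1) oW clW WWc p])
  show "\<exists>b\<in>I. p \<in> W b" using act[OF p] by blast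
  fix g assume g: "g \<in> I" "p \<in> Wc g" "p \<notin> W g"
  obtain b where b: "b \<in> I" "p \<in> dball (d b) (z b) (R b / 2)" "p \<in> W b" using act[OF p] by blast
  let ?q = "\<lambda>g x. norm (snd (d g) x - z g)"
  \<comment> \<open>\<open>p\<close> lies on the boundary of the ball of \<open>g\<close>. Beyond
    7/8 of its radius the exponent of \<open>g\<close> is at least 49/64 M, hence at least 3/4 M,
    while in the half ball of \<open>b\<close> it is at most 1/4 M. The difference M/2 absorbs the
    factor \<open>K\<close>.\<close>
  let ?N = "{x \<in> fst (d g). snd (d g) x \<in> - cball (z g) (7/8 * R g)} \<inter> dball (d b) (z b) (R b / 2)"
  have "openin X ?N" unfolding dball_def by (intro openin_Int chart_open_preimage chd g(1) b(1)) auto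
  moreover have "p \<in> ?N" using g b R0[OF g(1)] by (auto simp: W_def Wc_def dball_def dcball_def)
  moreover have "E g x \<le> E b x" if x: "x \<in> ?N" "x \<in> W g" "x \<in> W b" for x
  proof -
   have Rg: "R g > 0" "R b > 0" using R0 g(1) b(1) by auto
   have "(7/8 * R g)\<^sup>2 \<le> (?q g x)\<^sup>2" using x(1) Rg by (intro power_mono) (auto simp: dist_norm norm_minus_commute)
   then have "m g * (7/8 * R g)\<^sup>2 \<le> m g * (?q g x)\<^sup>2" by (rule mult_left_mono[OF _ m0])
   moreover have "m g * (7/8 * R g)\<^sup>2 = 49/64 * M" using Rg by (simp add: m_def power_mult_distrib power2_eq_square)
   ultimately have 1: "exp (- (m g * (?q g x)\<^sup>2)) \<le> exp (- (3/4 * M))" using M(1) by simp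
   have "(?q b x)\<^sup>2 \<le> (R b / 2)\<^sup>2" using x(1) by (intro power_mono) (auto simp: dball_def dist_norm norm_minus_commute)
   then have "m b * (?q b x)\<^sup>2 \<le> m b * (R b / 2)\<^sup>2" by (rule mult_left_mono[OF _ m0])
   moreover have "m b * (R b / 2)\<^sup>2 = 1/4 * M" using Rg by (simp add: m_def power_divide)
   ultimately have 2: "exp (- (1/4 * M)) \<le> exp (- (m b * (?q b x)\<^sup>2))" by simp
   let ?Ng = "G g (snd (d g) x)" and ?Nb = "G b (snd (d b) x)"
   have N0: "0 \<le> ?Ng" "0 \<le> ?Nb" using datum_log_psh(2) dat g(1) b(1) by blast+
   have "?Ng \<le> Kd g b * ?Nb" using Kd[OF g(1) b(1)] x WWc by blast
   also have "\<dots> \<le> K * ?Nb" by (rule mult_right_mono[OF KK[OF g(1) b(1)] N0(2)])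
   finally have 3: "?Ng \<le> K * ?Nb" .
   have "E g x \<le> (K * ?Nb) * exp (- (3/4 * M))" unfolding E_def peak_def using 1 3 N0 K1 by (intro mult_mono) auto
   also have "\<dots> = ?Nb * exp (- (1/4 * M)) * (K * exp (- (M/2)))" by (simp add: exp_add[symmetric])
   also have "\<dots> \<le> ?Nb * exp (- (1/4 * M)) * 1" using M(2) N0 by (intro mult_left_mono) auto
   also have "\<dots> \<le> E b x" unfolding E_def peak_def using 2 N0(2) by (simp add: mult_left_mono)
   finally show ?thesis .
  qed
  ultimately show "\<exists>b\<in>I. p \<in> W b \<and> (\<exists>N. openin X N \<and> p \<in> N \<and> (\<forall>x\<in>N. x \<in> W g \<longrightarrow> x \<in> W b \<longrightarrow> E g x \<le> E b x))"
   using b(1,3) by blast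
 qed
 have EV: "EE x = 0 \<longleftrightarrow> x \<in> V" if x: "x \<in> topspace X" for x
 proof -
  have e: "E g x = 0 \<longleftrightarrow> x \<in> V" if "g \<in> I" "x \<in> W g" for g
  proof -
   have "x \<in> dcball (d g) (z g) (R g)" using that(2) WWc by (auto simp: Wc_def)
   from datum_zero[OF X VX dat[OF that(1)] this] show ?thesis by (simp add: E_def peak_def)
  qed
  obtain g where "g \<in> a x" "EE x = E g x" using EE_in[OF x] by blast
  then show ?thesis using e by (auto simp: a_def)
 qed
 have EE0: "0 \<le> EE x" if "x \<in> topspace X" for x using EE_in[OF that] E0 by (auto simp: a_def)

 \<comment> \<open>The two branches and the neighbourhood on which the first one is valid\<close>
 obtain \<delta>0 where \<delta>0: "\<And>g. g \<in> I \<Longrightarrow> \<delta>0 g > 0"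
  "\<And>g \<delta> B x. g \<in> I \<Longrightarrow> 0 < \<delta> \<Longrightarrow> \<delta> \<le> \<delta>0 g \<Longrightarrow> x \<in> W g \<Longrightarrow> upsh A \<omega> t (\<lambda>x. ereal \<delta> * eln (E g x) + ereal B) x"
 proof -
  have "\<exists>\<delta>0>0. \<forall>\<delta> B. 0 < \<delta> \<longrightarrow> \<delta> \<le> \<delta>0 \<longrightarrow> (\<forall>x\<in>W g. upsh A \<omega> t (\<lambda>x. ereal \<delta> * eln (E g x) + ereal B) x)" if "g \<in> I" for g
   unfolding W_def E_def by (rule upsh_eln[OF X \<omega> dat[OF that] m0 st(3)])
  then obtain \<delta>0 where "\<And>g. g \<in> I \<Longrightarrow> \<delta>0 g > 0 \<and> (\<forall>\<delta> B. 0 < \<delta> \<longrightarrow> \<delta> \<le> \<delta>0 g \<longrightarrow> (\<forall>x\<in>W g. upsh A \<omega> t (\<lambda>x. ereal \<delta> * eln (E g x) + ereal B) x))"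
   by metis
  then show thesis by (intro that[of \<delta>0]) blast+
 qed
 \<comment> \<open>One factor for all pieces; the inserted 1 keeps the set of the minimum
   nonempty.\<close>
 define \<delta> where "\<delta> = Min (insert 1 (\<delta>0 ` I))"
 have \<delta>: "\<delta> > 0" "\<And>g. g \<in> I \<Longrightarrow> \<delta> \<le> \<delta>0 g" using I(1) \<delta>0(1) by (auto simp: \<delta>_def)
 obtain Cg where Cg: "\<And>g. g \<in> I \<Longrightarrow> Cg g \<ge> 0"
  "\<And>g C' p. g \<in> I \<Longrightarrow> Cg g \<le> C' \<Longrightarrow> p \<in> V \<Longrightarrow> p \<in> Wc g \<Longrightarrow> \<exists>N. openin X N \<and> p \<in> N \<and> (\<forall>x\<in>N. upsh A \<omega> t (\<lambda>x. \<phi> (\<pi> x) + ereal (C' * E g x)) x)"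
 proof -
  have "\<exists>C\<ge>0. \<forall>C'\<ge>C. \<forall>p\<in>V \<inter> Wc g. \<exists>N. openin X N \<and> p \<in> N \<and> N \<subseteq> fst (d g) \<and> (\<forall>x\<in>N. upsh A \<omega> t (\<lambda>x. \<phi> (\<pi> x) + ereal (C' * E g x)) x)" if "g \<in> I" for g
   unfolding Wc_def E_def by (rule datum_retraction[OF X VX \<omega> assms(9,7,8) st(2) psh dat[OF that]])
  then obtain Cg where *: "\<And>g. g \<in> I \<Longrightarrow> Cg g \<ge> 0 \<and> (\<forall>C'\<ge>Cg g. \<forall>p\<in>V \<inter> Wc g. \<exists>N. openin X N \<and> p \<in> N \<and> N \<subseteq> fst (d g) \<and> (\<forall>x\<in>N. upsh A \<omega> t (\<lambda>x. \<phi> (\<pi> x) + ereal (C' * E g x)) x))"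
   by metis
  show thesis
  proof (rule that[of Cg])
   fix g C' p assume g: "g \<in> I" "Cg g \<le> C'" "p \<in> V" "p \<in> Wc g"
   then have "p \<in> V \<inter> Wc g" by blast
   from *[OF g(1), THEN conjunct2, rule_format, OF g(2) this]
   show "\<exists>N. openin X N \<and> p \<in> N \<and> (\<forall>x\<in>N. upsh A \<omega> t (\<lambda>x. \<phi> (\<pi> x) + ereal (C' * E g x)) x)" by (elim exE conjE) (intro exI conjI)
  qed (use * in blast)
 qed
 \<comment> \<open>A sum of nonnegative thresholds is at least each of them, and \<open>Cg\<close>
   allows every larger constant.\<close>
 define C where "C = (\<Sum>g\<in>I. Cg g)"
 have C: "0 \<le> C" "\<And>g. g \<in> I \<Longrightarrow> Cg g \<le> C" unfolding C_def using Cg(1) I(1) by (auto intro: sum_nonneg member_le_sum)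
 define Og where "Og g = \<Union> {N. openin X N \<and> (\<forall>x\<in>N. upsh A \<omega> t (\<lambda>x. \<phi> (\<pi> x) + ereal (C * E g x)) x)}" for g
 have Og: "openin X (Og g)" "\<And>x. x \<in> Og g \<Longrightarrow> upsh A \<omega> t (\<lambda>x. \<phi> (\<pi> x) + ereal (C * E g x)) x" for g
  unfolding Og_def by blast+
 \<comment> \<open>Every index that could be active here is a good one: the point is outside the
   closed ball of \<open>g\<close> or inside \<open>Og g\<close>. Using the closed balls makes this
   set open.\<close>
 define U' where "U' = U \<inter> ((\<Inter>g\<in>I. (topspace X - Wc g) \<union> Og g) \<inter> topspace X)"
 have oU': "openin X U'" unfolding U'_def
  using I(1) by (intro openin_Int assms(7) openin_INT openin_Un Og(1) openin_diff openin_topspace clW) auto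
 have VU': "V \<subseteq> U'"
 proof
  fix x assume x: "x \<in> V"
  have "x \<in> Og g" if "g \<in> I" "x \<in> Wc g" for g
   using Cg(2)[OF that(1) C(2)[OF that(1)] x that(2)] unfolding Og_def by blast
  then show "x \<in> U'" unfolding U'_def using x VX assms(8) by auto
 qed
 \<comment> \<open>Off \<open>U'\<close>, a compact set disjoint from \<open>V\<close>, each point
   has an active piece that is positive and continuous; it bounds \<open>EE\<close> from below
   nearby.\<close>
 obtain e1 where e1: "e1 > 0" "\<And>x. x \<in> topspace X \<Longrightarrow> EE x \<le> e1 \<Longrightarrow> x \<in> U'"
 proof -
  have "compactin X (topspace X - U')" using oU' by (intro closedin_compact_space[OF cX]) (simp add: closedin_diff)
  moreover have "\<exists>N. openin X N \<and> p \<in> N \<and> (\<exists>e>0. \<forall>x\<in>N. e < EE x)" if p: "p \<in> topspace X - U'" for p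
  proof -
   obtain g where g: "g \<in> a p" "EE p = E g p" using EE_in p by blast
   then have gI: "g \<in> I" "p \<in> W g" by (auto simp: a_def)
   have e: "E g p > 0" using EV[of p] EE0[of p] p VU' g(2) by auto
   let ?N = "{x \<in> fst (d g). E g p / 2 < E g x} \<inter> W g"
   have "openin X ?N" by (intro openin_Int oE(2) oW gI(1))
   moreover have "p \<in> ?N" using gI(2) e by (auto simp: W_def dball_def)
   moreover have "E g p / 2 < EE x" if "x \<in> ?N" for x using EE_ge[OF gI(1), of x] that by auto
   ultimately show ?thesis using e by (intro exI[of _ ?N] conjI exI[of _ "E g p / 2"]) auto
  qed
  ultimately obtain P :: "'a set" and N :: "'a \<Rightarrow> 'a set" where P: "finite P" "\<And>p. p \<in> P \<Longrightarrow> \<exists>e>0. \<forall>x\<in>N p. e < EE x" "topspace X - U' \<subseteq> (\<Union>p\<in>P. N p)"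
   by (rule compactin_finite_cover[of X "topspace X - U'" "\<lambda>p N. \<exists>e>0. \<forall>x\<in>N. e < EE x"]) blast+
  then obtain e where e: "\<And>p. p \<in> P \<Longrightarrow> e p > 0" "\<And>p x. p \<in> P \<Longrightarrow> x \<in> N p \<Longrightarrow> e p < EE x" by metis
  show thesis
  proof (rule that[of "Min (insert 1 (e ` P))"])
   show "Min (insert 1 (e ` P)) > 0" using P(1) e(1) by auto
   fix x assume x: "x \<in> topspace X" "EE x \<le> Min (insert 1 (e ` P))"
   show "x \<in> U'"
   proof (rule ccontr)
    assume "x \<notin> U'"
    then obtain p where p: "p \<in> P" "x \<in> N p" using P(3) x(1) by blast
    have "Min (insert 1 (e ` P)) \<le> e p" using P(1) p(1) by (intro Min_le) auto
    then show False using e(2)[OF p] x(2) by linarith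
   qed
  qed
 qed

 \<comment> \<open>The glued function\<close>
 define B where "B = B1 + C * e1 - \<delta> * ln (e1/2)"
 define L where "L r = ereal \<delta> * eln r + ereal B" for r
 have L_mono: "L r \<le> L r'" if "r \<le> r'" for r r'
  unfolding L_def using \<delta>(1) by (intro add_mono ereal_mult_left_mono eln_mono that) auto
 define \<Phi> where "\<Phi> x = (if EE x < e1 then max (\<phi> (\<pi> x) + ereal (C * EE x)) (L (EE x)) else L (EE x))" for x
 \<comment> \<open>\<open>B\<close> was chosen so that L (e1/2) = B1 + C e1, which bounds the first
   branch wherever \<open>EE x < e1\<close>.\<close>
 have \<Phi>_out: "\<Phi> x = L (EE x)" if x: "x \<in> topspace X" "e1/2 < EE x" for x
 proof (cases "EE x < e1")
  case True
  then have "x \<in> U" using e1(2)[OF x(1)] by (simp add: U'_def)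
  have "\<phi> (\<pi> x) + ereal (C * EE x) \<le> ereal B1 + ereal (C * e1)"
   using B1[OF piV[OF \<open>x \<in> U\<close>]] True C(1) by (intro add_mono) (auto intro: mult_left_mono)
  also have "\<dots> = L (e1/2)" using e1(1) by (simp add: L_def eln_def B_def)
  also have "\<dots> \<le> L (EE x)" using x(2) by (intro L_mono) simp
  finally show ?thesis by (simp add: \<Phi>_def max_absorb2)
 qed (simp add: \<Phi>_def)
 have upL: "upsh A \<omega> t (\<lambda>x. L (E g x)) p" if "g \<in> a p" for g p
  unfolding L_def using that \<delta> by (intro \<delta>0(2)) (auto simp: a_def)
 have up: "upsh A \<omega> t \<Phi> p" if p: "p \<in> topspace X" for p
 proof -
  obtain N where N: "openin X N" "p \<in> N" "\<And>x. x \<in> N \<Longrightarrow> a p \<subseteq> a x" "\<And>x. x \<in> N \<Longrightarrow> EE x = Max ((\<lambda>g. E g x) ` a p)"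
   using loc[OF p] by blast
  have NX: "N \<subseteq> topspace X" by (rule openin_subset[OF N(1)])
  note ap = a(1)[of p] a(2)[OF p]
  show ?thesis
  proof (cases "EE p < e1")
   case True
   \<comment> \<open>Increasing in \<open>r\<close>, hence it commutes with the maximum that defines
     \<open>EE\<close>.\<close>
   define f where "f x r = max (\<phi> (\<pi> x) + ereal (C * r)) (L r)" for x r
   have fm: "mono (f x)" for x
    unfolding f_def by (intro monoI max.mono L_mono add_mono order_refl) (auto intro: mult_left_mono[OF _ C(1)])
   have "p \<in> U'" using e1(2)[OF p] True by simp
   then have "upsh A \<omega> t (\<lambda>x. \<phi> (\<pi> x) + ereal (C * E g x)) p" if "g \<in> a p" for g
    using that WWc by (intro Og(2)) (auto simp: U'_def a_def)
   then have "upsh A \<omega> t (\<lambda>x. f x (E g x)) p" if "g \<in> a p" for g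
    unfolding f_def by (intro upsh_max upL that) (use that in blast)
   then have u: "upsh A \<omega> t (\<lambda>x. Max ((\<lambda>g. f x (E g x)) ` a p)) p" by (rule upsh_Max[OF ap])
   let ?N = "N \<inter> ((\<Inter>g\<in>a p. {x \<in> fst (d g). E g x < e1}) \<inter> topspace X)"
   have "E g p < e1" if "g \<in> a p" for g using True EE_ge[of g p] that by (auto simp: a_def)
   then have "p \<in> ?N" using N(2) p by (auto simp: a_def W_def dball_def)
   moreover have "openin X ?N" using ap by (intro openin_Int N(1) openin_INT oE(1)) (auto simp: a_def)
   ultimately show ?thesis
   proof (intro upsh_cong[OF X _ _ _ u])
    fix x assume x: "x \<in> ?N"
    have E: "EE x = Max ((\<lambda>g. E g x) ` a p)" by (rule N(4)) (use x in blast)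
    then have "EE x < e1" using x ap by auto
    then have "\<Phi> x = f x (Max ((\<lambda>g. E g x) ` a p))" using E by (simp add: \<Phi>_def f_def)
    also have "\<dots> = Max ((\<lambda>g. f x (E g x)) ` a p)"
     using mono_Max_commute[OF fm, where A="(\<lambda>g. E g x) ` a p"] ap by (simp add: image_image)
    finally show "Max ((\<lambda>g. f x (E g x)) ` a p) = \<Phi> x" ..
   qed
  next
   case False
   \<comment> \<open>\<open>EE p \<ge> e1\<close> keeps nearby points in the range
     \<open>EE x > e1/2\<close>, where \<Phi> is the second branch whether or not
     \<open>EE x < e1\<close>; so the jump in the definition of \<Phi> is harmless.\<close>
   obtain g where g: "g \<in> a p" "EE p = E g p" using EE_in[OF p] by blast
   then have gI: "g \<in> I" "p \<in> W g" by (auto simp: a_def)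
   have u: "upsh A \<omega> t (\<lambda>x. Max ((\<lambda>g. L (E g x)) ` a p)) p" by (rule upsh_Max[OF ap upL])
   let ?N = "N \<inter> ({x \<in> fst (d g). e1/2 < E g x} \<inter> W g)"
   have "openin X ?N" by (intro openin_Int N(1) oE(2) oW gI(1))
   moreover have "p \<in> ?N" using False N(2) g(2) gI e1(1) by (auto simp: W_def dball_def)
   ultimately show ?thesis
   proof (intro upsh_cong[OF X _ _ _ u])
    fix x assume x: "x \<in> ?N"
    then have "e1/2 < EE x" using EE_ge[OF gI(1), of x] by auto
    then have "\<Phi> x = L (EE x)" using x NX by (intro \<Phi>_out) auto
    also have "EE x = Max ((\<lambda>g. E g x) ` a p)" by (rule N(4)) (use x in blast)
    also have "L \<dots> = Max ((\<lambda>g. L (E g x)) ` a p)"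
     using mono_Max_commute[OF monoI[OF L_mono], where A="(\<lambda>g. E g x) ` a p"] ap by (simp add: image_image)
    finally show "Max ((\<lambda>g. L (E g x)) ` a p) = \<Phi> x" ..
   qed
  qed
 qed
 have \<Phi>V: "\<Phi> x = \<phi> x" if x: "x \<in> V" for x
 proof -
  have "EE x = 0" using EV x VX by blast
  moreover have "L 0 = -\<infinity>" using \<delta>(1) by (simp add: L_def eln_def)
  ultimately show ?thesis using e1(1) piid[OF x] by (simp add: \<Phi>_def max_absorb1)
 qed
 \<comment> \<open>Off \<open>V\<close> the second branch is finite. A component of \<open>X\<close>
   contained in \<open>V\<close>, possible when the dimensions agree, is also a component of
   \<open>V\<close>, and there \<Phi> = \<phi> is not identically -\<infinity>.\<close>
 have comp: "\<exists>x\<in>D. \<Phi> x \<noteq> -\<infinity>" if D: "D \<in> connected_components_of X" for D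
 proof (cases "D \<subseteq> V")
  case False
  have DX: "D \<subseteq> topspace X" by (rule connected_components_of_subset[OF D])
  then obtain x where x: "x \<in> D" "x \<in> topspace X" "x \<notin> V" using False by blast
  then have "EE x > 0" using EV EE0 by (force simp: less_le)
  then have "L (EE x) \<noteq> -\<infinity>" by (simp add: L_def eln_def)
  moreover have "L (EE x) \<le> \<Phi> x" by (simp add: \<Phi>_def)
  ultimately show ?thesis using x(1) by (intro bexI[of _ x]) auto
 next
  case True
  have cD: "connectedin X D" "D \<noteq> {}" by (rule connectedin_connected_components_of[OF D] nonempty_connected_components_of[OF D])+
  then obtain x where x: "x \<in> D" by blast
  let ?D = "connected_component_of_set (subtopology X V) x"
  have "connectedin (subtopology X V) D" using cD(1) True by (simp add: connectedin_subtopology)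
  then have "D \<subseteq> ?D" using x by (simp add: connected_component_of_maximal)
  have c': "?D \<in> connected_components_of (subtopology X V)"
   using x True VX unfolding connected_components_of_def by auto
  have "connectedin X ?D" using connectedin_connected_component_of[of "subtopology X V" x] by (simp add: connectedin_subtopology)
  moreover have "\<not> disjnt D ?D" using \<open>D \<subseteq> ?D\<close> x unfolding disjnt_def by blast
  ultimately have "?D \<subseteq> D" by (rule connected_components_of_maximal[OF D])
  obtain y where y: "y \<in> ?D" "\<phi> y \<noteq> -\<infinity>" using assms(5) c' unfolding quasi_psh_def by blast
  then show ?thesis using \<open>?D \<subseteq> D\<close> True \<Phi>V by (intro bexI[of _ y]) auto
 qed
 show ?thesis using upsh_final[OF X \<omega> less_imp_le[OF st(3)] st(4) up comp] \<Phi>V by blast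
qed

end
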